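(* Let $A<0$, $B,C,L>0$, $\lambda>0$, let $0<\rho<1$, $0<\varepsilon<\min\{1/2,\,1-\rho\}$, and let $g$ be an admissible boundary profile as in the context. Then there exists a critical point $(q_1^s,q_3^s)\in W^{1,2}(\Omega;\mathbb{R}^2)$ of the functional $$J_\lambda[q_1,q_3]=\int_\Omega\Big(|\nabla q_1|^2+3|\nabla q_3|^2+\frac{\lambda^2}{L}F(q_1,q_3)\Big)\,\mathrm{d}A$$ in the class of pairs $(q_1,q_3)\in W^{1,2}(\Omega;\mathbb{R}^2)$ satisfying the boundary conditions $q_1=q_{1,\mathrm b}$ and $q_3=q_{3,\mathrm b}$ on $\partial\Omega$, such that $q_1^s=0$ on $\Omega\cap\{x=0\}$ and on $\Omega\cap\{y=0\}$. Moreover, $$\mathbf{Q}_s=q_1^s\,(\mathbf{n}_1\otimes\mathbf{n}_1-\mathbf{n}_2\otimes\mathbf{n}_2)+q_3^s\,(2\hat{\mathbf z}\otimes\hat{\mathbf z}-\mathbf{n}_1\otimes\mathbf{n}_1-\mathbf{n}_2\otimes\mathbf{n}_2)$$ is a critical point of the Landau-de Gennes energy $I_\lambda$ in the admissible class $\mathscr{A}$.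
   Context: Domain. For $0<\rho<1$ and $0<\varepsilon<\min\{1/2,1-\rho\}$, $$\Omega=\{(x,y)\in\mathbb{R}^2: |x|<1-\varepsilon,\ |y|<1-\varepsilon,\ \rho<\max(|x+y|,|x-y|)<1\}.$$ Its boundary consists of the inner boundary $\Gamma_{\mathrm{in}}=\{\max(|x+y|,|x-y|)=\rho\}$ and the outer boundary $\Gamma_{\mathrm{out}}$. The latter is made of four long edges $C_1,\dots,C_4$, labeled counterclockwise, where $C_1=\{x+y=1,\ \varepsilon\le x\le 1-\varepsilon\}$ and $C_i$ lies in the $i$-th quadrant, and four short edges $S_1,\dots,S_4$, labeled counterclockwise: $S_1=\{(1-\varepsilon,y):|y|\le\varepsilon\}$, $S_2=\{(x,1-\varepsilon):|x|\le\varepsilon\}$, $S_3=\{(-(1-\varepsilon),y):|y|\le\varepsilon\}$, $S_4=\{(x,-(1-\varepsilon)):|x|\le\varepsilon\}$. Constants and vectors. $s_+=\dfrac{B+\sqrt{B^2+24|A|C}}{4C}$, $\mathbf n_1=\frac1{\sqrt2}(-1,1,0)$, $\mathbf n_2=\frac1{\sqrt2}(1,1,0)$, $\hat{\mathbf z}=(0,0,1)$. Boundary profile. $g:[-\varepsilon,\varepsilon]\to[-s_+/2,s_+/2]$ is of class $C^1$, odd, with $g(\varepsilon)=s_+/2$. Boundary data. $q_{1,\mathrm b}=0$ on $\Gamma_{\mathrm{in}}$, $q_{1,\mathrm b}=s_+/2$ on $C_1\cup C_3$, $q_{1,\mathrm b}=-s_+/2$ on $C_2\cup C_4$, $q_{1,\mathrm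 b}=g(y)$ on $S_1$, $q_{1,\mathrm b}=-g(y)$ on $S_3$, $q_{1,\mathrm b}=g(x)$ on $S_2$, $q_{1,\mathrm b}=-g(x)$ on $S_4$; and $q_{3,\mathrm b}=0$ on $\Gamma_{\mathrm{in}}$, $q_{3,\mathrm b}=-s_+/6$ on $\Gamma_{\mathrm{out}}$. Set $$\mathbf Q_{\mathrm b}=q_{1,\mathrm b}(\mathbf n_1\otimes\mathbf n_1-\mathbf n_2\otimes\mathbf n_2)+q_{3,\mathrm b}(2\hat{\mathbf z}\otimes\hat{\mathbf z}-\mathbf n_1\otimes\mathbf n_1-\mathbf n_2\otimes\mathbf n_2).$$ Potential. $$F(q_1,q_3)=A(q_1^2+3q_3^2)+2Bq_3(q_1^2-q_3^2)+C(q_1^2+3q_3^2)^2-F_{\min},\qquad F_{\min}=\tfrac{A s_+^2}{3}-\tfrac{2Bs_+^3}{27}+\tfrac{Cs_+^4}{9}.$$ Landau-de Gennes energy. $S_0$ is the space of real symmetric traceless $3\times3$ matrices, $|\mathbf Q|^2=\operatorname{tr}\mathbf Q^2$, $\mathscr A=\{\mathbf Q\in W^{1,2}(\Omega,S_0):\mathbf Q=\mathbf Q_{\mathrm b}\text{ on }\partial\Omega\}$, and $$I_\lambda[\mathbf Q]=\int_\Omega\Big(\tfrac12|\nabla\mathbf Q|^2+\tfrac{\lambda^2}{L}\big(\tfrac A2\operatorname{tr}\mathbf Q^2-\tfrac B3\operatorname{tr}\mathbf Q^3+\tfrac C4(\operatorname{tr}\mathbf Q^2)^2\big)\Big)\mathrm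 dA.$$ "Critical point" means a weak solution of the Euler-Lagrange equations (vanishing first variation for perturbations vanishing on $\partial\Omega$). Boundary values, and values on the axes, are in the sense of traces. The critical point $\mathbf Q_s$ is called a Well Order Reconstruction Solution (WORS). *)

theory Defs
  imports "HOL-Analysis.Analysis"
begin

type_synonym R2 = "real \<times> real"

section \<open>Sobolev functions on a plane domain\<close>

text \<open>Class \<open>C\<^sup>\<infinity>\<close> on the plane: \<open>D i j\<close> is the partial derivative of order \<open>i\<close> in the first and
  \<open>j\<close> in the second variable.\<close>

definition smooth :: "(R2 \<Rightarrow> real) \<Rightarrow> bool" where
  "smooth \<phi> \<longleftrightarrow> (\<exists>D :: nat \<Rightarrow> nat \<Rightarrow> R2 \<Rightarrow> real. D 0 0 = \<phi> \<and>
     (\<forall>i j p. (D i j has_derivative (\<lambda>h. fst h * D (Suc i) j p + snd h * D i (Suc j) p)) (at p)))"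

definition test_functions :: "R2 set \<Rightarrow> (R2 \<Rightarrow> real) set" where
  "test_functions \<Omega> = {\<phi>. smooth \<phi> \<and> compact (closure {p. \<phi> p \<noteq> 0}) \<and> closure {p. \<phi> p \<noteq> 0} \<subseteq> \<Omega>}"

definition L2 :: "'a measure \<Rightarrow> ('a \<Rightarrow> 'b::euclidean_space) \<Rightarrow> bool" where
  "L2 M u \<longleftrightarrow> u \<in> borel_measurable M \<and> integrable M (\<lambda>p. (norm (u p))\<^sup>2)"

definition has_weak_deriv ::
    "R2 set \<Rightarrow> R2 \<Rightarrow> (R2 \<Rightarrow> 'b::euclidean_space) \<Rightarrow> (R2 \<Rightarrow> 'b) \<Rightarrow> bool" where
  "has_weak_deriv \<Omega> e u v \<longleftrightarrow> (\<forall>\<phi>\<in>test_functions \<Omega>.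
     (LINT p|lebesgue_on \<Omega>. frechet_derivative \<phi> (at p) e *\<^sub>R u p)
       = - (LINT p|lebesgue_on \<Omega>. \<phi> p *\<^sub>R v p))"

definition W12 :: "R2 set \<Rightarrow> (R2 \<Rightarrow> 'b::euclidean_space) \<Rightarrow> bool" where
  "W12 \<Omega> u \<longleftrightarrow> L2 (lebesgue_on \<Omega>) u \<and>
     (\<forall>e\<in>{(1, 0), (0, 1)}. \<exists>v. L2 (lebesgue_on \<Omega>) v \<and> has_weak_deriv \<Omega> e u v)"

text \<open>A representative of the weak partial derivative in direction \<open>e\<close>, which for \<open>W12 \<Omega> u\<close> and \<open>\<Omega>\<close>
  open is unique up to null sets.\<close>

definition weak_deriv :: "R2 set \<Rightarrow> R2 \<Rightarrow> (R2 \<Rightarrow> 'b::euclidean_space) \<Rightarrow> R2 \<Rightarrow> 'b" where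
  "weak_deriv \<Omega> e u = (SOME v. L2 (lebesgue_on \<Omega>) v \<and> has_weak_deriv \<Omega> e u v)"

definition W12_norm :: "R2 set \<Rightarrow> (R2 \<Rightarrow> 'b::euclidean_space) \<Rightarrow> real" where
  "W12_norm \<Omega> u = sqrt (LINT p|lebesgue_on \<Omega>.
     (norm (u p))\<^sup>2 + (norm (weak_deriv \<Omega> (1, 0) u p))\<^sup>2 + (norm (weak_deriv \<Omega> (0, 1) u p))\<^sup>2)"

text \<open>
  Traces. On a bounded Lipschitz domain the trace operator is the unique continuous extension to
  \<open>W\<^sup>1\<^sup>,\<^sup>2\<close> of the restriction map on \<open>W\<^sup>1\<^sup>,\<^sup>2 \<inter> C(closure \<Omega>)\<close>. So \<open>u\<close> has trace \<open>h\<close> on \<open>S\<close> if some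
  functions in that space converge to \<open>u\<close> in \<open>W\<^sup>1\<^sup>,\<^sup>2\<close> and, restricted to \<open>S\<close>, converge to \<open>h\<close> in \<open>L\<^sup>2\<close>
  with respect to arc length. The definition is meant for sets \<open>S \<subseteq> closure \<Omega>\<close> made of finitely many
  straight edges, and the \<open>L\<^sup>2\<close> convergence is expressed on each nondegenerate segment contained
  in \<open>S\<close>: if the edges are closed, as for a polygonal boundary, this is \<open>L\<^sup>2\<close> convergence on \<open>S\<close>;
  if they are relatively open, as for a cut through \<open>\<Omega>\<close>, it is local \<open>L\<^sup>2\<close> convergence, which
  determines the trace almost everywhere just as well.
\<close>

definition has_trace ::
    "R2 set \<Rightarrow> (R2 \<Rightarrow> 'b::euclidean_space) \<Rightarrow> R2 set \<Rightarrow> (R2 \<Rightarrow> 'b) \<Rightarrow> bool" where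
  "has_trace \<Omega> u S h \<longleftrightarrow> W12 \<Omega> u \<and> (\<exists>v :: nat \<Rightarrow> R2 \<Rightarrow> 'b.
     (\<forall>n. W12 \<Omega> (v n) \<and> continuous_on (closure \<Omega>) (v n)) \<and>
     (\<lambda>n. W12_norm \<Omega> (\<lambda>p. v n p - u p)) \<longlonglongrightarrow> 0 \<and>
     (\<forall>a b. a \<noteq> b \<and> closed_segment a b \<subseteq> S \<longrightarrow>
        (\<forall>n. L2 (lebesgue_on {0..1}) (\<lambda>t. v n (linepath a b t) - h (linepath a b t))) \<and>
        (\<lambda>n. LINT t|lebesgue_on {0..1}. (norm (v n (linepath a b t) - h (linepath a b t)))\<^sup>2)
          \<longlonglongrightarrow> 0))"

section \<open>Energies and critical points\<close>

text \<open>\<open>W\<^sup>1\<^sup>,\<^sup>2\<close> functions with values in the linear space \<open>V\<close> and boundary values \<open>h\<close>.\<close>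

definition dirichlet_class ::
    "R2 set \<Rightarrow> 'b::euclidean_space set \<Rightarrow> (R2 \<Rightarrow> 'b) \<Rightarrow> (R2 \<Rightarrow> 'b) set" where
  "dirichlet_class \<Omega> V h =
     {u. W12 \<Omega> u \<and> (AE p in lebesgue_on \<Omega>. u p \<in> V) \<and> has_trace \<Omega> u (frontier \<Omega>) h}"

text \<open>An energy density \<open>f\<close> takes the value and the two partial derivatives of the unknown.\<close>

definition energy_integrand ::
    "R2 set \<Rightarrow> ('b \<Rightarrow> 'b \<Rightarrow> 'b \<Rightarrow> real) \<Rightarrow> (R2 \<Rightarrow> 'b::euclidean_space) \<Rightarrow> R2 \<Rightarrow> real" where
  "energy_integrand \<Omega> f u p = f (u p) (weak_deriv \<Omega> (1, 0) u p) (weak_deriv \<Omega> (0, 1) u p)"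

definition energy ::
    "R2 set \<Rightarrow> ('b \<Rightarrow> 'b \<Rightarrow> 'b \<Rightarrow> real) \<Rightarrow> (R2 \<Rightarrow> 'b::euclidean_space) \<Rightarrow> real" where
  "energy \<Omega> f u = (LINT p|lebesgue_on \<Omega>. energy_integrand \<Omega> f u p)"

text \<open>Vanishing first variation in all directions of zero trace. Integrability is required
  explicitly because the integral of a non-integrable function is 0 by convention.\<close>

definition critical_point ::
    "R2 set \<Rightarrow> 'b set \<Rightarrow> (R2 \<Rightarrow> 'b) \<Rightarrow> ('b \<Rightarrow> 'b \<Rightarrow> 'b \<Rightarrow> real)
       \<Rightarrow> (R2 \<Rightarrow> 'b::euclidean_space) \<Rightarrow> bool" where
  "critical_point \<Omega> V h f u \<longleftrightarrow> u \<in> dirichlet_class \<Omega> V h \<and>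
     (\<forall>\<phi> \<in> dirichlet_class \<Omega> V (\<lambda>_. 0).
        (\<forall>t. integrable (lebesgue_on \<Omega>) (energy_integrand \<Omega> f (\<lambda>p. u p + t *\<^sub>R \<phi> p))) \<and>
        ((\<lambda>t. energy \<Omega> f (\<lambda>p. u p + t *\<^sub>R \<phi> p)) has_real_derivative 0) (at 0))"

section \<open>The domain and its boundary\<close>

definition Omega :: "real \<Rightarrow> real \<Rightarrow> R2 set" where
  "Omega \<rho> \<epsilon> = {(x, y). \<bar>x\<bar> < 1 - \<epsilon> \<and> \<bar>y\<bar> < 1 - \<epsilon> \<and>
     \<rho> < max \<bar>x + y\<bar> \<bar>x - y\<bar> \<and> max \<bar>x + y\<bar> \<bar>x - y\<bar> < 1}"

definition Gamma_in :: "real \<Rightarrow> R2 set" where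
  "Gamma_in \<rho> = {(x, y). max \<bar>x + y\<bar> \<bar>x - y\<bar> = \<rho>}"

definition C1 :: "real \<Rightarrow> R2 set" where
  "C1 \<epsilon> = {(x, y). x + y = 1 \<and> \<epsilon> \<le> x \<and> x \<le> 1 - \<epsilon>}"
definition C2 :: "real \<Rightarrow> R2 set" where
  "C2 \<epsilon> = {(x, y). - x + y = 1 \<and> - (1 - \<epsilon>) \<le> x \<and> x \<le> - \<epsilon>}"
definition C3 :: "real \<Rightarrow> R2 set" where
  "C3 \<epsilon> = {(x, y). - x - y = 1 \<and> - (1 - \<epsilon>) \<le> x \<and> x \<le> - \<epsilon>}"
definition C4 :: "real \<Rightarrow> R2 set" where
  "C4 \<epsilon> = {(x, y). x - y = 1 \<and> \<epsilon> \<le> x \<and> x \<le> 1 - \<epsilon>}"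

definition S1 :: "real \<Rightarrow> R2 set" where
  "S1 \<epsilon> = {(x, y). x = 1 - \<epsilon> \<and> \<bar>y\<bar> \<le> \<epsilon>}"
definition S2 :: "real \<Rightarrow> R2 set" where
  "S2 \<epsilon> = {(x, y). y = 1 - \<epsilon> \<and> \<bar>x\<bar> \<le> \<epsilon>}"
definition S3 :: "real \<Rightarrow> R2 set" where
  "S3 \<epsilon> = {(x, y). x = - (1 - \<epsilon>) \<and> \<bar>y\<bar> \<le> \<epsilon>}"
definition S4 :: "real \<Rightarrow> R2 set" where
  "S4 \<epsilon> = {(x, y). y = - (1 - \<epsilon>) \<and> \<bar>x\<bar> \<le> \<epsilon>}"

definition Gamma_out :: "real \<Rightarrow> R2 set" where
  "Gamma_out \<epsilon> = C1 \<epsilon> \<union> C2 \<epsilon> \<union> C3 \<epsilon> \<union> C4 \<epsilon> \<union> S1 \<epsilon> \<union> S2 \<epsilon> \<union> S3 \<epsilon> \<union> S4 \<epsilon>"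

lemma max_abs_add_diff: "max \<bar>x + y\<bar> \<bar>x - y\<bar> = \<bar>x\<bar> + \<bar>y\<bar>" for x y :: real
  by linarith

lemma frontier_Omega:
  assumes "0 < \<rho>" "\<rho> < 1" "0 < \<epsilon>" "\<epsilon> < min (1 / 2) (1 - \<rho>)"
  shows "frontier (Omega \<rho> \<epsilon>) = Gamma_in \<rho> \<union> Gamma_out \<epsilon>"
proof -
  let ?O = "Omega \<rho> \<epsilon>"
  let ?K = "{p :: R2. \<bar>fst p\<bar> \<le> 1 - \<epsilon> \<and> \<bar>snd p\<bar> \<le> 1 - \<epsilon> \<and>
    \<rho> \<le> \<bar>fst p\<bar> + \<bar>snd p\<bar> \<and> \<bar>fst p\<bar> + \<bar>snd p\<bar> \<le> 1}"
  have O: "?O = {p. \<bar>fst p\<bar> < 1 - \<epsilon> \<and> \<bar>snd p\<bar> < 1 - \<epsilon> \<and>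
    \<rho> < \<bar>fst p\<bar> + \<bar>snd p\<bar> \<and> \<bar>fst p\<bar> + \<bar>snd p\<bar> < 1}"
    unfolding Omega_def max_abs_add_diff by auto
  have op: "open ?O"
    unfolding O by (intro open_Collect_conj open_Collect_less continuous_intros)
  have cl: "closed ?K"
    by (intro closed_Collect_conj closed_Collect_le continuous_intros)
  have G: "Gamma_in \<rho> \<union> Gamma_out \<epsilon> = ?K - ?O"
  proof (intro set_eqI)
    fix p :: R2
    obtain x y where p: "p = (x, y)" by (cases p)
    show "p \<in> Gamma_in \<rho> \<union> Gamma_out \<epsilon> \<longleftrightarrow> p \<in> ?K - ?O"
      using assms
      unfolding p O Gamma_in_def Gamma_out_def C1_def C2_def C3_def C4_def S1_def S2_def S3_def
        S4_def max_abs_add_diff by simp argo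
  qed
  have sub: "closure ?O \<subseteq> ?K"
    using cl by (intro closure_minimal) (auto simp: O)
  have lim: "((\<lambda>t. t *\<^sub>R p) \<longlongrightarrow> p) (at 1 within S)" for p :: R2 and S :: "real set"
    by (auto intro!: tendsto_eq_intros)
  have "p \<in> closure ?O" if "p \<in> ?K - ?O" for p
  proof (cases "\<bar>fst p\<bar> + \<bar>snd p\<bar> = \<rho>")
    case True
    have r: "\<bar>fst p\<bar> \<le> \<rho>" "\<bar>snd p\<bar> \<le> \<rho>" using True by auto
    have "eventually (\<lambda>t. t < (1 - \<epsilon>) / \<rho>) (at_right (1::real))"
      using assms by (intro order_tendstoD(2)[OF tendsto_ident_at]) (auto simp: field_simps)
    moreover have "eventually (\<lambda>t. t > 1) (at_right (1::real))"
      by (simp add: eventually_at_right_less)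
    ultimately have "eventually (\<lambda>t. t *\<^sub>R p \<in> ?O) (at_right (1::real))"
    proof eventually_elim
      case (elim t)
      have "t * \<rho> < 1 - \<epsilon>" using elim assms by (simp add: field_simps)
      moreover have "t * \<bar>fst p\<bar> \<le> t * \<rho>" "t * \<bar>snd p\<bar> \<le> t * \<rho>"
        using r elim by (auto intro!: mult_left_mono)
      moreover have "t * \<bar>fst p\<bar> + t * \<bar>snd p\<bar> = t * \<rho>"
        using True by (simp flip: distrib_left)
      moreover have "\<rho> < t * \<rho>" using elim assms by simp
      ultimately have "t * \<bar>fst p\<bar> < 1 - \<epsilon>" "t * \<bar>snd p\<bar> < 1 - \<epsilon>"
        "\<rho> < t * \<bar>fst p\<bar> + t * \<bar>snd p\<bar>" "t * \<bar>fst p\<bar> + t * \<bar>snd p\<bar> < 1"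
        using assms by linarith+
      then show ?case using elim by (simp add: O abs_mult)
    qed
    then show ?thesis
      by (intro Lim_in_closed_set[OF closed_closure _ _ lim])
        (auto elim!: eventually_mono intro: closure_subset[THEN subsetD])
  next
    case False
    have r: "\<bar>fst p\<bar> + \<bar>snd p\<bar> \<ge> 1 - \<epsilon>" using that False assms by (auto simp: O)
    have "eventually (\<lambda>t. t > \<rho> / (1 - \<epsilon>)) (at_left (1::real))"
      using assms by (intro order_tendstoD(1)[OF tendsto_ident_at]) (auto simp: field_simps)
    moreover have "eventually (\<lambda>t. t < 1) (at_left (1::real))"
      by (simp add: eventually_at_filter)
    moreover have "eventually (\<lambda>t. t > 0) (at_left (1::real))"
      by (intro order_tendstoD(1)[OF tendsto_ident_at]) auto
    ultimately have "eventually (\<lambda>t. t *\<^sub>R p \<in> ?O) (at_left (1::real))"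
    proof eventually_elim
      case (elim t)
      have "\<rho> < t * (1 - \<epsilon>)" using elim assms by (simp add: field_simps)
      also have "\<dots> \<le> t * (\<bar>fst p\<bar> + \<bar>snd p\<bar>)" using r elim by (intro mult_left_mono) auto
      finally have 1: "\<rho> < t * \<bar>fst p\<bar> + t * \<bar>snd p\<bar>" by (simp add: distrib_left)
      have *: "t * a < c" if "0 \<le> a" "a \<le> c" "0 < c" for a c
      proof -
        have "t * a \<le> t * c" using elim that by (intro mult_left_mono) auto
        also have "\<dots> < c" using elim that by simp
        finally show ?thesis .
      qed
      have "t * \<bar>fst p\<bar> < 1 - \<epsilon>" "t * \<bar>snd p\<bar> < 1 - \<epsilon>" "t * (\<bar>fst p\<bar> + \<bar>snd p\<bar>) < 1"
        using that assms by (auto intro!: *)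
      then show ?case using 1 elim by (simp add: O abs_mult distrib_left)
    qed
    then show ?thesis
      by (intro Lim_in_closed_set[OF closed_closure _ _ lim])
        (auto elim!: eventually_mono intro: closure_subset[THEN subsetD])
  qed
  then have "?K - ?O \<subseteq> closure ?O" by blast
  then show ?thesis
    using sub G closure_subset[of ?O] by (auto simp: frontier_def interior_open[OF op])
qed

section \<open>Boundary data\<close>

definition s_plus :: "real \<Rightarrow> real \<Rightarrow> real \<Rightarrow> real" where
  "s_plus A B C = (B + sqrt (B\<^sup>2 + 24 * \<bar>A\<bar> * C)) / (4 * C)"

definition boundary_profile :: "real \<Rightarrow> real \<Rightarrow> (real \<Rightarrow> real) \<Rightarrow> bool" where
  "boundary_profile s \<epsilon> g \<longleftrightarrow>
     g ` {-\<epsilon>..\<epsilon>} \<subseteq> {- s / 2..s / 2} \<and>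
     (\<exists>g'. continuous_on {-\<epsilon>..\<epsilon>} g' \<and>
        (\<forall>x\<in>{-\<epsilon>..\<epsilon>}. (g has_real_derivative g' x) (at x within {-\<epsilon>..\<epsilon>}))) \<and>
     (\<forall>x\<in>{-\<epsilon>..\<epsilon>}. g (- x) = - g x) \<and>
     g \<epsilon> = s / 2"

text \<open>The cases of the boundary data agree at the corners, since \<open>g (\<plusminus>\<epsilon>) = \<plusminus> s / 2\<close>; the values off
  the boundary are irrelevant.\<close>

definition q1b :: "real \<Rightarrow> real \<Rightarrow> real \<Rightarrow> (real \<Rightarrow> real) \<Rightarrow> R2 \<Rightarrow> real" where
  "q1b s \<rho> \<epsilon> g p =
     (if p \<in> Gamma_in \<rho> then 0
      else if p \<in> C1 \<epsilon> \<union> C3 \<epsilon> then s / 2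
      else if p \<in> C2 \<epsilon> \<union> C4 \<epsilon> then - s / 2
      else if p \<in> S1 \<epsilon> then g (snd p)
      else if p \<in> S3 \<epsilon> then - g (snd p)
      else if p \<in> S2 \<epsilon> then g (fst p)
      else if p \<in> S4 \<epsilon> then - g (fst p)
      else 0)"

definition q3b :: "real \<Rightarrow> real \<Rightarrow> real \<Rightarrow> R2 \<Rightarrow> real" where
  "q3b s \<rho> \<epsilon> p = (if p \<in> Gamma_in \<rho> then 0 else if p \<in> Gamma_out \<epsilon> then - s / 6 else 0)"

section \<open>The two functionals\<close>

definition tensor :: "real^3 \<Rightarrow> real^3 \<Rightarrow> real^3^3"  (infixl "\<otimes>\<^sub>t" 72) where
  "a \<otimes>\<^sub>t b = (\<chi> i j. a $ i * b $ j)"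

definition n1 :: "real^3" where "n1 = (1 / sqrt 2) *\<^sub>R vector [-1, 1, 0]"
definition n2 :: "real^3" where "n2 = (1 / sqrt 2) *\<^sub>R vector [1, 1, 0]"
definition zhat :: "real^3" where "zhat = vector [0, 0, 1]"

definition Q_of :: "real \<Rightarrow> real \<Rightarrow> real^3^3" where
  "Q_of q1 q3 = q1 *\<^sub>R (n1 \<otimes>\<^sub>t n1 - n2 \<otimes>\<^sub>t n2)
              + q3 *\<^sub>R (2 *\<^sub>R (zhat \<otimes>\<^sub>t zhat) - n1 \<otimes>\<^sub>t n1 - n2 \<otimes>\<^sub>t n2)"

definition S0 :: "(real^3^3) set" where
  "S0 = {Q. transpose Q = Q \<and> trace Q = 0}"

definition F_min :: "real \<Rightarrow> real \<Rightarrow> real \<Rightarrow> real" where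
  "F_min A B C = (let s = s_plus A B C in A * s\<^sup>2 / 3 - 2 * B * s^3 / 27 + C * s^4 / 9)"

definition F_pot :: "real \<Rightarrow> real \<Rightarrow> real \<Rightarrow> real \<Rightarrow> real \<Rightarrow> real" where
  "F_pot A B C q1 q3 = A * (q1\<^sup>2 + 3 * q3\<^sup>2) + 2 * B * q3 * (q1\<^sup>2 - q3\<^sup>2)
     + C * (q1\<^sup>2 + 3 * q3\<^sup>2)\<^sup>2 - F_min A B C"

definition J_density ::
    "real \<Rightarrow> real \<Rightarrow> real \<Rightarrow> real \<Rightarrow> real \<Rightarrow> real \<times> real \<Rightarrow> real \<times> real \<Rightarrow> real \<times> real \<Rightarrow> real" where
  "J_density A B C L lam q qx qy =
     ((fst qx)\<^sup>2 + (fst qy)\<^sup>2) + 3 * ((snd qx)\<^sup>2 + (snd qy)\<^sup>2)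
       + lam\<^sup>2 / L * F_pot A B C (fst q) (snd q)"

definition I_density ::
    "real \<Rightarrow> real \<Rightarrow> real \<Rightarrow> real \<Rightarrow> real \<Rightarrow> real^3^3 \<Rightarrow> real^3^3 \<Rightarrow> real^3^3 \<Rightarrow> real" where
  "I_density A B C L lam Q Qx Qy =
     1 / 2 * (trace (Qx ** Qx) + trace (Qy ** Qy))
       + lam\<^sup>2 / L * (A / 2 * trace (Q ** Q) - B / 3 * trace (Q ** Q ** Q)
                     + C / 4 * (trace (Q ** Q))\<^sup>2)"

end

theory Submission
  imports Defs "HOL-Complex_Analysis.Great_Picard"
begin

text \<open>
  Both reflections in the coordinate axes map \<open>\<Omega>\<close> to itself and change the sign of the boundary
  values of \<open>q\<^sub>1\<close> while preserving those of \<open>q\<^sub>3\<close>, and \<open>J\<close> is invariant under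
  \<open>(q\<^sub>1, q\<^sub>3) \<mapsto> (- q\<^sub>1, q\<^sub>3)\<close>. So one minimises \<open>J\<close> among the pairs with these symmetries. The first
  variation at the minimiser vanishes in symmetric directions, and averaging an arbitrary direction over
  the reflections (Palais' symmetric criticality) shows that it vanishes in all of them. The odd symmetry
  of \<open>q\<^sub>1\<close> forces its traces on the axes to be zero. Finally the first variation of the Landau-de Gennes
  energy at \<open>Q_of q\<^sub>1 q\<^sub>3\<close> in a direction \<open>\<phi>\<close> equals that of \<open>J\<close> in the direction of the projection of
  \<open>\<phi>\<close> to the range of \<open>Q_of\<close>: the remaining components of \<open>\<phi>\<close> are orthogonal to the gradient.

  No Sobolev space theory is presupposed. The \<open>L\<^sup>4\<close> embedding comes from absolute continuity on lines,
  since every point of \<open>\<Omega>\<close> lies on a horizontal and on a vertical segment in \<open>\<Omega>\<close> of length bounded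
  below, and compactness in \<open>L\<^sup>2\<close> from the Poincare inequality on small squares inside \<open>\<Omega>\<close>, where
  the \<open>L\<^sup>4\<close> bound controls the uncovered part of \<open>\<Omega>\<close> near the boundary. The potential is convex up to
  a quadratic term, so along a minimising sequence that converges in \<open>L\<^sup>2\<close> the gradients converge strongly
  as well, and this lets the boundary values pass to the limit.
\<close>

section \<open>Test functions of one variable\<close>

text \<open>The definition of a trace forces norm convergence: boundary values are given through
  approximants in \<open>W12_norm\<close>, so a merely weak limit would not visibly keep them. The
  minimising sequence is therefore made Cauchy in norm. The midpoint of two admissible pairs is
  admissible, the gradient part satisfies the parallelogram law, and the missing convexity of the
  potential costs only a multiple of the squared L2 distance, which compactness makes small. A
  second obstacle is that \<open>has_trace\<close> speaks of all segments in the boundary, while a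
  diagonal choice controls only finitely many conditions at each stage; estimating the integral over
  a segment by the integrals over the twelve boundary edges resolves this. \<open>weak_deriv\<close>
  is a Hilbert choice and not additive on the nose, so functions are carried together with explicit
  derivatives in the predicate \<open>sob\<close>. The quartic growth of both energies explains the
  exponent 4: it makes the energy finite along every line \<open>u + t \<phi>\<close>, where it is a
  polynomial of degree at most 4 in \<open>t\<close>.\<close>

definition smooth1 :: "(real \<Rightarrow> real) \<Rightarrow> bool" where
  "smooth1 f \<longleftrightarrow> (\<exists>D :: nat \<Rightarrow> real \<Rightarrow> real. D 0 = f \<and>
     (\<forall>i x. (D i has_real_derivative D (Suc i) x) (at x)))"

text \<open>Compact support in the open interval is expressed by two inner bounds. They may lie in
  the wrong order, and then \<open>f\<close> is zero; early members of \<open>bump_sequence\<close>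
  can be of this kind.\<close>

definition test1 :: "real \<Rightarrow> real \<Rightarrow> (real \<Rightarrow> real) \<Rightarrow> bool" where
  "test1 a b f \<longleftrightarrow> smooth1 f \<and> (\<exists>p q. a < p \<and> q < b \<and> (\<forall>x. f x \<noteq> 0 \<longrightarrow> p \<le> x \<and> x \<le> q))"

text \<open>The classical flat function exp(-1/x); \<open>k\<close> counts the powers of 1/x that
  differentiation brings out.\<close>

definition exp_inv :: "nat \<Rightarrow> real \<Rightarrow> real" where
  "exp_inv k x = (if x > 0 then exp (- (1 / x)) / x ^ k else 0)"

lemma exp_inv_tendsto_0: "(exp_inv k \<longlongrightarrow> 0) (at_right 0)"
proof -
  have "((\<lambda>y. y ^ k / exp y) \<longlongrightarrow> (0::real)) at_top"
    by (rule tendsto_power_div_exp_0)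
  then have "((\<lambda>x. inverse x ^ k / exp (inverse x)) \<longlongrightarrow> (0::real)) (at_right 0)"
    by (rule filterlim_compose[OF _ filterlim_inverse_at_top_right])
  then show ?thesis
  proof (rule Lim_transform_eventually)
    show "\<forall>\<^sub>F x in at_right 0. inverse x ^ k / exp (inverse x) = exp_inv k x"
      using eventually_at_right_less[of 0]
      by eventually_elim (simp add: exp_inv_def field_simps exp_minus)
  qed
qed

text \<open>The delicate point is 0: there the right difference quotient of \<open>exp_inv k\<close>
  is \<open>exp_inv (Suc k)\<close> itself, which tends to 0 by the preceding limit.\<close>

lemma exp_inv_deriv:
  "(exp_inv k has_real_derivative (exp_inv (k + 2) x - k * exp_inv (k + 1) x)) (at x)"
proof (cases "x > 0")
  case True
  define y where "y = inverse x"
  have y: "exp_inv n x = exp (- y) * y ^ n" for n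
    using True by (simp add: exp_inv_def y_def field_simps)
  have "((\<lambda>x. exp (- inverse x) * inverse x ^ k) has_real_derivative
      exp (- y) * y\<^sup>2 * y ^ k + exp (- y) * (real k * y ^ (k - 1) * (- y\<^sup>2))) (at x)"
    using True by (auto intro!: derivative_eq_intros simp: y_def power2_eq_square)
  also have "exp (- y) * y\<^sup>2 * y ^ k + exp (- y) * (real k * y ^ (k - 1) * (- y\<^sup>2))
      = exp_inv (k + 2) x - k * exp_inv (k + 1) x"
    unfolding y by (cases k) (simp_all add: power2_eq_square algebra_simps)
  also have "(\<lambda>x::real. exp (- inverse x) * inverse x ^ k) = (\<lambda>x. exp (- (1 / x)) / x ^ k)"
    by (simp add: divide_inverse power_inverse)
  finally have "((\<lambda>x. exp (- (1 / x)) / x ^ k) has_real_derivative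
      (exp_inv (k + 2) x - k * exp_inv (k + 1) x)) (at x)" .
  then show ?thesis
    by (rule has_field_derivative_transform_within_open[of _ _ _ "{0<..}"])
       (use True in \<open>auto simp: exp_inv_def\<close>)
next
  case False
  show ?thesis
  proof (cases "x < 0")
    case True
    have "((\<lambda>x. 0) has_real_derivative (exp_inv (k + 2) x - k * exp_inv (k + 1) x)) (at x)"
      using True by (auto simp: exp_inv_def)
    then show ?thesis
      by (rule has_field_derivative_transform_within_open[of _ _ _ "{..<0}"])
         (use True in \<open>auto simp: exp_inv_def\<close>)
  next
    case nx: False
    with False have x: "x = 0" by simp
    have "((\<lambda>y. (exp_inv k y - exp_inv k 0) / (y - 0)) \<longlongrightarrow> 0) (at 0)"
    proof (rule filterlim_split_at)
      show "((\<lambda>y. (exp_inv k y - exp_inv k 0) / (y - 0)) \<longlongrightarrow> 0) (at_left 0)"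
      proof (rule Lim_transform_eventually[OF tendsto_const])
        have "eventually (\<lambda>y. y < 0) (at_left (0::real))" by (simp add: eventually_at_filter)
        then show "\<forall>\<^sub>F y in at_left 0. 0 = (exp_inv k y - exp_inv k 0) / (y - 0)"
          by eventually_elim (auto simp: exp_inv_def)
      qed
      show "((\<lambda>y. (exp_inv k y - exp_inv k 0) / (y - 0)) \<longlongrightarrow> 0) (at_right 0)"
      proof (rule Lim_transform_eventually[OF exp_inv_tendsto_0[of "Suc k"]])
        show "\<forall>\<^sub>F y in at_right 0. exp_inv (Suc k) y = (exp_inv k y - exp_inv k 0) / (y - 0)"
          using eventually_at_right_less[of 0]
          by eventually_elim (auto simp: exp_inv_def)
      qed
    qed
    then show ?thesis
      unfolding x has_field_derivative_iff by (simp add: exp_inv_def)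
  qed
qed

text \<open>An algebra closed under differentiation: the derivative of \<open>exp_inv k\<close> is a linear combination of
  \<open>exp_inv (k + 2)\<close> and \<open>exp_inv (k + 1)\<close>.\<close>

inductive bump_alg :: "(real \<Rightarrow> real) \<Rightarrow> bool" where
  const: "bump_alg (\<lambda>_. c)"
| right: "bump_alg (\<lambda>x. exp_inv k (x - c))"
| left: "bump_alg (\<lambda>x. exp_inv k (c - x))"
| add: "bump_alg f \<Longrightarrow> bump_alg g \<Longrightarrow> bump_alg (\<lambda>x. f x + g x)"
| mult: "bump_alg f \<Longrightarrow> bump_alg g \<Longrightarrow> bump_alg (\<lambda>x. f x * g x)"

lemma bump_alg_deriv:
  "bump_alg f \<Longrightarrow> \<exists>f'. bump_alg f' \<and> (\<forall>x. (f has_real_derivative f' x) (at x))"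
proof (induction rule: bump_alg.induct)
  case (const c)
  show ?case by (rule exI[of _ "\<lambda>_. 0"]) (auto intro: bump_alg.const)
next
  case (right k c)
  have "((\<lambda>x. exp_inv k (x - c)) has_real_derivative
      exp_inv (k + 2) (x - c) + (- real k) * exp_inv (k + 1) (x - c)) (at x)" for x
    by (rule DERIV_chain2[where f = "exp_inv k" and g = "\<lambda>x. x - c" and Db = 1, OF exp_inv_deriv, THEN DERIV_cong])
       (auto intro!: derivative_eq_intros)
  moreover have "bump_alg (\<lambda>x. exp_inv (k + 2) (x - c) + (- real k) * exp_inv (k + 1) (x - c))"
    by (intro bump_alg.intros)
  ultimately show ?case by blast
next
  case (left k c)
  have "((\<lambda>x. exp_inv k (c - x)) has_real_derivative
      (-1) * exp_inv (k + 2) (c - x) + real k * exp_inv (k + 1) (c - x)) (at x)" for x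
    by (rule DERIV_chain2[where f = "exp_inv k" and g = "\<lambda>x. c - x" and Db = "- 1", OF exp_inv_deriv, THEN DERIV_cong])
       (auto intro!: derivative_eq_intros)
  moreover have "bump_alg (\<lambda>x. (-1) * exp_inv (k + 2) (c - x) + real k * exp_inv (k + 1) (c - x))"
    by (intro bump_alg.intros)
  ultimately show ?case by blast
next
  case (add f g)
  then obtain f' g' where "bump_alg f'" "\<forall>x. (f has_real_derivative f' x) (at x)"
    "bump_alg g'" "\<forall>x. (g has_real_derivative g' x) (at x)" by auto
  then show ?case by (intro exI[of _ "\<lambda>x. f' x + g' x"]) (auto intro: bump_alg.intros DERIV_add)
next
  case (mult f g)
  then obtain f' g' where fg: "bump_alg f'" "\<forall>x. (f has_real_derivative f' x) (at x)"
    "bump_alg g'" "\<forall>x. (g has_real_derivative g' x) (at x)" by auto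
  then have "((\<lambda>x. f x * g x) has_real_derivative f' x * g x + f x * g' x) (at x)" for x
    by (auto intro!: derivative_eq_intros)
  then show ?case using fg mult
    by (intro exI[of _ "\<lambda>x. f' x * g x + f x * g' x"]) (auto intro: bump_alg.intros)
qed

lemma bump_alg_smooth1:
  assumes "bump_alg f"
  shows "smooth1 f"
proof -
  obtain d where d: "\<And>f. bump_alg f \<Longrightarrow> bump_alg (d f) \<and> (\<forall>x. (f has_real_derivative d f x) (at x))"
    using bump_alg_deriv by metis
  have "bump_alg ((d ^^ n) f)" for n
    by (induction n) (use assms d in auto)
  then show ?thesis
    unfolding smooth1_def using d
    by (intro exI[of _ "\<lambda>n. (d ^^ n) f"]) auto
qed

lemma bump_alg_power: "bump_alg f \<Longrightarrow> bump_alg (\<lambda>x. f x ^ n)"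
  by (induction n) (auto intro: bump_alg.intros)

lemma exp_inv_0_bounds: "0 \<le> exp_inv 0 x" "exp_inv 0 x < 1" "x > 0 \<Longrightarrow> 0 < exp_inv 0 x"
  by (auto simp: exp_inv_def)

lemma exp_inv_0_mono: "x \<le> y \<Longrightarrow> exp_inv 0 x \<le> exp_inv 0 y"
  by (auto simp: exp_inv_def field_simps)

text \<open>The product \<open>h\<close> of two flat functions is positive exactly between p +
  1/(n+1) and q - 1/(n+1). The map 1 - (1 - h)^n fixes 0 and drives every value that stays above a
  positive constant to 1, and as a polynomial in \<open>h\<close> it remains in
  \<open>bump_alg\<close>. This approximates an indicator smoothly without integrating a
  bump.\<close>

lemma bump_sequence:
  obtains \<phi> :: "nat \<Rightarrow> real \<Rightarrow> real" where
    "\<And>n. test1 p q (\<phi> n)" "\<And>n x. 0 \<le> \<phi> n x" "\<And>n x. \<phi> n x \<le> 1"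
    "\<And>n x. x \<notin> {p<..<q} \<Longrightarrow> \<phi> n x = 0"
    "\<And>x. (\<lambda>n. \<phi> n x) \<longlonglongrightarrow> indicator {p<..<q} x"
proof -
  define h where "h n x = exp_inv 0 (x - (p + 1 / real (Suc n))) * exp_inv 0 ((q - 1 / real (Suc n)) - x)" for n x
  define \<phi> where "\<phi> n x = 1 + (-1) * (1 + (-1) * h n x) ^ n" for n x
  have h01: "0 \<le> h n x \<and> h n x \<le> 1" for n x
    unfolding h_def using exp_inv_0_bounds
    by (meson mult_le_one mult_nonneg_nonneg less_imp_le)
  have alg: "bump_alg (\<phi> n)" for n
    unfolding \<phi>_def h_def by (intro bump_alg.intros bump_alg_power)
  have supp: "h n x = 0" if "\<not> (p + 1 / real (Suc n) \<le> x \<and> x \<le> q - 1 / real (Suc n))" for n x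
    using that by (auto simp: h_def exp_inv_def)
  have s2: "p + 1 / real (Suc n) \<le> x \<and> x \<le> q - 1 / real (Suc n)" if "\<phi> n x \<noteq> 0" for n x
  proof (rule ccontr)
    assume "\<not> ?thesis"
    from supp[OF this] that show False by (simp add: \<phi>_def)
  qed
  show thesis
  proof (rule that)
    show "test1 p q (\<phi> n)" for n
      unfolding test1_def
    proof (intro conjI exI allI impI)
      show "smooth1 (\<phi> n)" using alg bump_alg_smooth1 by blast
      show "p < p + 1 / real (Suc n)" "q - 1 / real (Suc n) < q" by auto
    qed (use s2 in auto)
    show "0 \<le> \<phi> n x" for n x
      unfolding \<phi>_def using h01[of n x] power_le_one[of "1 - h n x" n] by simp
    show "\<phi> n x \<le> 1" for n x
      unfolding \<phi>_def using h01[of n x] by simp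
    show out: "\<phi> n x = 0" if "x \<notin> {p<..<q}" for n x
    proof (rule ccontr)
      assume "\<phi> n x \<noteq> 0"
      from s2[OF this] that have "p + 1 / real (Suc n) \<le> x" "x \<le> q - 1 / real (Suc n)" "\<not> (p < x \<and> x < q)"
        by auto
      moreover have "1 / real (Suc n) > 0" by simp
      ultimately show False by linarith
    qed
    show "(\<lambda>n. \<phi> n x) \<longlonglongrightarrow> indicator {p<..<q} x" for x
    proof (cases "x \<in> {p<..<q}")
      case True
      \<comment> \<open>Half the distance of \<open>x\<close> to the nearer end: once 1/(n+1) <
        \<delta>, both factors of \<open>h n x\<close> are at least
        \<open>exp_inv 0 \<delta>\<close>.\<close>
      define \<delta> where "\<delta> = min (x - p) (q - x) / 2"
      have \<delta>: "\<delta> > 0" using True by (auto simp: \<delta>_def)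
      define c where "c = exp_inv 0 \<delta> * exp_inv 0 \<delta>"
      have c: "0 < c" using exp_inv_0_bounds(3)[OF \<delta>] by (simp add: c_def)
      obtain N where N: "1 / real (Suc N) < \<delta>" using \<delta> nat_approx_posE by blast
      have hc: "h n x \<ge> c" if "n \<ge> N" for n
      proof -
        have "1 / real (Suc n) \<le> 1 / real (Suc N)" using that by (simp add: frac_le)
        then have "1 / real (Suc n) < \<delta>" using N by simp
        then have "\<delta> \<le> x - (p + 1 / real (Suc n))" "\<delta> \<le> (q - 1 / real (Suc n)) - x"
        proof -
          have "\<delta> \<le> (x - p) / 2" "\<delta> \<le> (q - x) / 2" by (auto simp: \<delta>_def)
          with \<open>1 / real (Suc n) < \<delta>\<close> show "\<delta> \<le> x - (p + 1 / real (Suc n))"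
            "\<delta> \<le> (q - 1 / real (Suc n)) - x" by argo+
        qed
        then show ?thesis unfolding c_def h_def
          using exp_inv_0_bounds by (intro mult_mono exp_inv_0_mono) auto
      qed
      have c1: "c \<le> 1" using hc[of N] h01[of N x] by auto
      have "(\<lambda>n. (1 - h n x) ^ n) \<longlonglongrightarrow> 0"
      proof (rule tendsto_sandwich[of "\<lambda>_. 0" _ _ "\<lambda>n. (1 - c) ^ n"])
        show "\<forall>\<^sub>F n in sequentially. 0 \<le> (1 - h n x) ^ n" using h01 by auto
        show "\<forall>\<^sub>F n in sequentially. (1 - h n x) ^ n \<le> (1 - c) ^ n"
          using eventually_ge_at_top[of N]
          by eventually_elim (use hc h01 in \<open>auto intro!: power_mono\<close>)
        show "(\<lambda>n. (1 - c) ^ n) \<longlonglongrightarrow> 0" using c c1 by (intro LIMSEQ_realpow_zero) auto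
      qed auto
      then have "(\<lambda>n. 1 - (1 - h n x) ^ n) \<longlonglongrightarrow> 1 - 0" by (intro tendsto_intros)
      then show ?thesis using True by (simp add: \<phi>_def)
    next
      case False
      then show ?thesis using out[OF False] by simp
    qed
  qed
qed

section \<open>Basic facts about test functions on an interval\<close>

lemma smooth1_continuous: "smooth1 f \<Longrightarrow> isCont f x"
  unfolding smooth1_def by (metis DERIV_isCont)

lemma test1_smooth1: "test1 a b f \<Longrightarrow> smooth1 f"
  by (simp add: test1_def)

lemma test1_measurable [measurable (raw)]: "test1 a b f \<Longrightarrow> f \<in> borel_measurable borel"
  by (intro borel_measurable_continuous_onI continuous_at_imp_continuous_on)
     (auto intro: smooth1_continuous test1_smooth1)

lemma test1_bounded:
  assumes "test1 a b f"
  obtains M where "\<And>x. \<bar>f x\<bar> \<le> M" "M \<ge> 0"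
proof -
  obtain p q where pq: "\<And>x. f x \<noteq> 0 \<Longrightarrow> p \<le> x \<and> x \<le> q" using assms by (auto simp: test1_def)
  have "continuous_on {p..q} f"
    using assms by (intro continuous_at_imp_continuous_on) (auto intro: smooth1_continuous test1_smooth1)
  then have "compact (f ` {p..q})" by (intro compact_continuous_image) auto
  then obtain B where B: "\<And>y. y \<in> f ` {p..q} \<Longrightarrow> norm y \<le> B"
    using compact_imp_bounded bounded_iff by metis
  show ?thesis
  proof (rule that[of "max 0 B"])
    show "\<bar>f x\<bar> \<le> max 0 B" for x
      using pq[of x] B[of "f x"] by (cases "f x = 0") (auto simp: le_max_iff_disj)
  qed auto
qed

lemma test1_integrable:
  assumes "test1 a b f"
  shows "integrable lborel f"
proof -
  obtain p q where pq: "\<And>x. f x \<noteq> 0 \<Longrightarrow> p \<le> x \<and> x \<le> q" using assms by (auto simp: test1_def)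
  have "set_integrable lborel {p..q} f"
    unfolding set_integrable_def
    using assms by (intro borel_integrable_compact continuous_at_imp_continuous_on)
      (auto intro: smooth1_continuous test1_smooth1)
  moreover have "(\<lambda>x. indicator {p..q} x *\<^sub>R f x) = f"
    using pq by (fastforce simp: indicator_def)
  ultimately show ?thesis by (simp add: set_integrable_def)
qed

lemma test1_outside: "test1 a b f \<Longrightarrow> x \<notin> {a<..<b} \<Longrightarrow> f x = 0"
  unfolding test1_def by fastforce

lemma smooth1_lincomb:
  assumes "smooth1 f" "smooth1 g"
  shows "smooth1 (\<lambda>x. f x - c * g x)"
proof -
  obtain D E where "D 0 = f" "\<forall>i x. (D i has_real_derivative D (Suc i) x) (at x)"
    "E 0 = g" "\<forall>i x. (E i has_real_derivative E (Suc i) x) (at x)"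
    using assms unfolding smooth1_def by blast
  then show ?thesis unfolding smooth1_def
    by (intro exI[of _ "\<lambda>i x. D i x - c * E i x"]) (auto intro!: derivative_eq_intros)
qed

lemma test1_lincomb:
  assumes "test1 a b f" "test1 a b g"
  shows "test1 a b (\<lambda>x. f x - c * g x)"
proof -
  obtain p q p' q' where pq: "a < p" "q < b" "\<And>x. f x \<noteq> 0 \<Longrightarrow> p \<le> x \<and> x \<le> q"
    "a < p'" "q' < b" "\<And>x. g x \<noteq> 0 \<Longrightarrow> p' \<le> x \<and> x \<le> q'"
    using assms by (auto simp: test1_def)
  have "min p p' \<le> x \<and> x \<le> max q q'" if "f x - c * g x \<noteq> 0" for x
  proof -
    from that have "f x \<noteq> 0 \<or> g x \<noteq> 0" by auto
    then show ?thesis using pq(3)[of x] pq(6)[of x] by linarith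
  qed
  moreover have "a < min p p'" "max q q' < b" using pq by auto
  moreover have "smooth1 (\<lambda>x. f x - c * g x)"
    using assms by (intro smooth1_lincomb) (auto simp: test1_def)
  ultimately show ?thesis unfolding test1_def by blast
qed

lemma test1_deriv:
  assumes "test1 a b f"
  obtains f' where "test1 a b f'" "\<And>x. (f has_real_derivative f' x) (at x)"
proof -
  obtain D where D: "D 0 = f" "\<And>i x. (D i has_real_derivative D (Suc i) x) (at x)"
    using assms unfolding test1_def smooth1_def by blast
  obtain p q where pq: "a < p" "q < b" "\<And>x. f x \<noteq> 0 \<Longrightarrow> p \<le> x \<and> x \<le> q"
    using assms by (auto simp: test1_def)
  have "D 1 x = 0" if "\<not> (p \<le> x \<and> x \<le> q)" for x
  proof -
    have "(f has_real_derivative D 1 x) (at x)"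
      using D(2)[of 0 x] by (simp add: D(1))
    then have "((\<lambda>_. 0) has_real_derivative D 1 x) (at x)"
      by (rule has_field_derivative_transform_within_open[of _ _ _ "- {p..q}"])
         (use that pq in auto)
    then show ?thesis by (metis DERIV_const DERIV_unique)
  qed
  moreover have "smooth1 (D 1)"
    unfolding smooth1_def using D(2) by (intro exI[of _ "\<lambda>i. D (Suc i)"]) auto
  ultimately have "test1 a b (D 1)"
    unfolding test1_def using pq by blast
  then show ?thesis using that[of "D 1"] D by (metis One_nat_def)
qed

text \<open>Starting the primitive at the left end \<open>p\<close> of the support makes it vanish
  to the left; to the right it equals the whole integral of \<open>f\<close>, which is 0. So mean
  zero is what makes a test function the derivative of another one.\<close>

lemma test1_antiderivative:
  assumes f: "test1 a b f" and 0: "(LINT x|lborel. f x) = 0"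
  obtains F where "test1 a b F" "\<And>x. (F has_real_derivative f x) (at x)"
proof -
  have cont: "isCont f x" for x using f by (auto intro: smooth1_continuous test1_smooth1)
  obtain p q where pq: "a < p" "q < b" "\<And>x. f x \<noteq> 0 \<Longrightarrow> p \<le> x \<and> x \<le> q"
    using f by (auto simp: test1_def)
  have "\<exists>G. \<forall>x::real. - \<infinity> < ereal x \<longrightarrow> ereal x < \<infinity> \<longrightarrow> (G has_vector_derivative f x) (at x)"
    by (rule einterval_antiderivative) (use cont in auto)
  then obtain G where G: "\<And>x. (G has_real_derivative f x) (at x)"
    by (auto simp: has_real_derivative_iff_has_vector_derivative)
  define F where "F x = G x - G p" for x
  have F: "(F has_real_derivative f x) (at x)" for x
    unfolding F_def using G by (auto intro!: derivative_eq_intros)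
  have left: "F x = 0" if "x < p" for x
  proof -
    have "F x = F p"
    proof (rule DERIV_isconst_end[OF that, symmetric])
      show "continuous_on {x..p} F"
        using F by (meson DERIV_isCont continuous_at_imp_continuous_on)
      show "(F has_real_derivative 0) (at y)" if "x < y" "y < p" for y
        using F[of y] pq(3)[of y] that by (cases "f y = 0") auto
    qed
    then show ?thesis by (simp add: F_def)
  qed
  have right: "F x = 0" if "x > q" for x
  proof -
    \<comment> \<open>\<open>l\<close> lies to the left of the support, so the interval from
      \<open>l\<close> to \<open>x\<close> contains the support and the integral over it is the full
      one.\<close>
    define l where "l = min (p - 1) x"
    have "l \<le> x" by (simp add: l_def)
    have "F x - F l = (LINT y|lborel. f y * indicator {l..x} y)"
      using integral_FTC_Icc_real[OF \<open>l \<le> x\<close>, of F f] F cont by auto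
    also have "(\<lambda>y. f y * indicator {l..x} y) = f"
      using pq(3) that by (fastforce simp: indicator_def l_def)
    finally have "F x = F l" using 0 by simp
    then show ?thesis using left[of l] by (auto simp: l_def)
  qed
  have "smooth1 F"
  proof -
    obtain D where "D 0 = f" "\<And>i x. (D i has_real_derivative D (Suc i) x) (at x)"
      using f unfolding test1_def smooth1_def by blast
    then show ?thesis unfolding smooth1_def
      by (intro exI[of _ "\<lambda>i. case i of 0 \<Rightarrow> F | Suc j \<Rightarrow> D j"]) (use F in \<open>auto split: nat.splits\<close>)
  qed
  then have "test1 a b F"
    unfolding test1_def using pq left right by (meson not_le)
  then show thesis using that F by blast
qed

lemma compactI_sub:
  fixes K S :: "'a :: t2_space set"
  assumes "compact K" "closed S" "S \<subseteq> K"
  shows "compact S"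
  using compact_Int_closed[OF assms(1,2)] assms(3) by (simp add: Int_absorb1)

lemma test1_product_test_function:
  assumes f: "test1 a b f" and g: "test1 c d g" and sub: "{a<..<b} \<times> {c<..<d} \<subseteq> \<Omega>"
  shows "(\<lambda>p. f (fst p) * g (snd p)) \<in> test_functions \<Omega>"
proof -
  obtain D where D: "D 0 = f" "\<And>i x. (D i has_real_derivative D (Suc i) x) (at x)"
    using f unfolding test1_def smooth1_def by blast
  obtain E where E: "E 0 = g" "\<And>i x. (E i has_real_derivative E (Suc i) x) (at x)"
    using g unfolding test1_def smooth1_def by blast
  have "smooth (\<lambda>p. f (fst p) * g (snd p))"
    unfolding smooth_def
  proof (intro exI[of _ "\<lambda>i j p. D i (fst p) * E j (snd p)"] conjI allI)
    show "(\<lambda>p. D 0 (fst p) * E 0 (snd p)) = (\<lambda>p. f (fst p) * g (snd p))"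
      using D E by simp
    fix i j and p :: R2
    have "((\<lambda>p. D i (fst p)) has_derivative (\<lambda>h. D (Suc i) (fst p) * fst h)) (at p)"
      by (rule has_derivative_compose[OF _ D(2)[unfolded has_field_derivative_def]])
         (auto intro!: derivative_eq_intros)
    moreover have "((\<lambda>p. E j (snd p)) has_derivative (\<lambda>h. E (Suc j) (snd p) * snd h)) (at p)"
      by (rule has_derivative_compose[OF _ E(2)[unfolded has_field_derivative_def]])
         (auto intro!: derivative_eq_intros)
    ultimately show "((\<lambda>p. D i (fst p) * E j (snd p)) has_derivative
       (\<lambda>h. fst h * (D (Suc i) (fst p) * E j (snd p)) + snd h * (D i (fst p) * E (Suc j) (snd p)))) (at p)"
      by (rule has_derivative_eq_rhs[OF has_derivative_mult]) (auto simp: algebra_simps)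
  qed
  moreover obtain p q where pq: "a < p" "q < b" "\<And>x. f x \<noteq> 0 \<Longrightarrow> p \<le> x \<and> x \<le> q"
    using f by (auto simp: test1_def)
  obtain r s where rs: "c < r" "s < d" "\<And>x. g x \<noteq> 0 \<Longrightarrow> r \<le> x \<and> x \<le> s"
    using g by (auto simp: test1_def)
  have sub': "closure {z :: R2. f (fst z) * g (snd z) \<noteq> 0} \<subseteq> {p..q} \<times> {r..s}"
    by (rule closure_minimal) (use pq rs in \<open>auto intro: closed_Times\<close>)
  moreover have "compact (closure {z :: R2. f (fst z) * g (snd z) \<noteq> 0})"
    by (rule compactI_sub[OF compact_Times[OF compact_Icc compact_Icc] closed_closure sub'])
  moreover have "{p..q} \<times> {r..s} \<subseteq> \<Omega>" using sub pq rs by fastforce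
  ultimately show ?thesis
    unfolding test_functions_def by simp
qed

lemma test1_product_frechet:
  assumes f: "\<And>x. (f has_real_derivative f' x) (at x)" and g: "\<And>x. (g has_real_derivative g' x) (at x)"
  shows "frechet_derivative (\<lambda>p. f (fst p) * g (snd p)) (at p) (1, 0) = f' (fst p) * g (snd p)"
    and "frechet_derivative (\<lambda>p. f (fst p) * g (snd p)) (at p) (0, 1) = f (fst p) * g' (snd p)"
proof -
  have "((\<lambda>p. f (fst p)) has_derivative (\<lambda>h. f' (fst p) * fst h)) (at p)"
    by (rule has_derivative_compose[OF _ f[unfolded has_field_derivative_def]])
       (auto intro!: derivative_eq_intros)
  moreover have "((\<lambda>p. g (snd p)) has_derivative (\<lambda>h. g' (snd p) * snd h)) (at p)"
    by (rule has_derivative_compose[OF _ g[unfolded has_field_derivative_def]])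
       (auto intro!: derivative_eq_intros)
  ultimately have "((\<lambda>p. f (fst p) * g (snd p)) has_derivative
       (\<lambda>h. fst h * (f' (fst p) * g (snd p)) + snd h * (f (fst p) * g' (snd p)))) (at p)"
    by (intro has_derivative_eq_rhs[OF has_derivative_mult]) (auto simp: algebra_simps)
  then have fr: "frechet_derivative (\<lambda>p. f (fst p) * g (snd p)) (at p) =
       (\<lambda>h. fst h * (f' (fst p) * g (snd p)) + snd h * (f (fst p) * g' (snd p)))"
    by (rule frechet_derivative_at[symmetric])
  show "frechet_derivative (\<lambda>p. f (fst p) * g (snd p)) (at p) (1, 0) = f' (fst p) * g (snd p)"
    "frechet_derivative (\<lambda>p. f (fst p) * g (snd p)) (at p) (0, 1) = f (fst p) * g' (snd p)"
    unfolding fr by simp_all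
qed

section \<open>The fundamental lemma and uniqueness of weak derivatives\<close>

lemma measurable_comp_fst [measurable (raw)]:
    "f \<in> borel_measurable borel \<Longrightarrow> (\<lambda>p::R2. f (fst p)) \<in> borel_measurable borel"
  and measurable_comp_snd [measurable (raw)]:
    "f \<in> borel_measurable borel \<Longrightarrow> (\<lambda>p::R2. f (snd p)) \<in> borel_measurable borel"
  for f :: "real \<Rightarrow> 'b::topological_space"
  by (rule measurable_compose[rotated], assumption, intro borel_measurable_continuous_onI continuous_intros)+

text \<open>Products of bumps converge boundedly to indicators of boxes, so \<open>w\<close> has
  integral 0 over every box. Boxes form a generator closed under intersection, and induction over
  the sigma-algebra extends this to all Borel sets, which forces \<open>w\<close> to vanish almost
  everywhere.\<close>

lemma fundamental_lemma_box:
  fixes w :: "R2 \<Rightarrow> real"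
  assumes w: "integrable lborel w" and out: "\<And>p. p \<notin> {a<..<b} \<times> {c<..<d} \<Longrightarrow> w p = 0"
    and 0: "\<And>\<phi> \<beta>. test1 a b \<phi> \<Longrightarrow> test1 c d \<beta> \<Longrightarrow> (LINT p|lborel. \<phi> (fst p) * \<beta> (snd p) * w p) = 0"
  shows "AE p in lborel. w p = 0"
proof (rule sigma_finite_measure.density_zero[OF sigma_finite_lborel w])
  have [measurable]: "w \<in> borel_measurable borel" using w by simp
  have si: "set_integrable lborel X w" if "X \<in> sets borel" for X
    unfolding set_integrable_def by (rule integrable_mult_indicator) (use that w in auto)
  have box: "(LINT p:box u v|lborel. w p) = 0" for u v :: R2
  proof -
    \<comment> \<open>The box is clipped to the rectangle in which the test functions have to live;
      \<open>w\<close> vanishes outside it, so nothing is lost.\<close>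
    define P Q where "P = max (fst u) a" and "Q = min (fst v) b"
    define R S where "R = max (snd u) c" and "S = min (snd v) d"
    obtain \<phi> where \<phi>: "\<And>n. test1 P Q (\<phi> n)" "\<And>n x. 0 \<le> \<phi> n x" "\<And>n x. \<phi> n x \<le> 1"
      "\<And>x. (\<lambda>n. \<phi> n x) \<longlonglongrightarrow> indicator {P<..<Q} x"
      by (rule bump_sequence[of P Q]) blast
    obtain \<beta> where \<beta>: "\<And>n. test1 R S (\<beta> n)" "\<And>n x. 0 \<le> \<beta> n x" "\<And>n x. \<beta> n x \<le> 1"
      "\<And>x. (\<lambda>n. \<beta> n x) \<longlonglongrightarrow> indicator {R<..<S} x"
      by (rule bump_sequence[of R S]) blast
    note [measurable] = test1_measurable[OF \<phi>(1)] test1_measurable[OF \<beta>(1)]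
    have "(\<lambda>n. LINT p|lborel. \<phi> n (fst p) * \<beta> n (snd p) * w p) \<longlonglongrightarrow>
      (LINT p|lborel. indicator {P<..<Q} (fst p) * indicator {R<..<S} (snd p) * w p)"
    proof (rule integral_dominated_convergence[where w = "\<lambda>p. \<bar>w p\<bar>"])
      show "AE p in lborel. (\<lambda>n. \<phi> n (fst p) * \<beta> n (snd p) * w p) \<longlonglongrightarrow>
        indicator {P<..<Q} (fst p) * indicator {R<..<S} (snd p) * w p"
        by (intro AE_I2 tendsto_intros \<phi> \<beta>)
      have "\<bar>\<phi> n x\<bar> * \<bar>\<beta> n y\<bar> \<le> 1" for n x y
        using \<phi>(2,3)[of n x] \<beta>(2,3)[of n y] by (simp add: mult_le_one)
      then show "AE p in lborel. norm (\<phi> n (fst p) * \<beta> n (snd p) * w p) \<le> \<bar>w p\<bar>" for n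
        by (intro AE_I2) (simp add: abs_mult mult_left_le_one_le)
    qed (use w in \<open>auto\<close>)
    moreover have "test1 a b (\<phi> n)" "test1 c d (\<beta> n)" for n
      using \<phi>(1)[of n] \<beta>(1)[of n] unfolding test1_def P_def Q_def R_def S_def
      by (meson max_less_iff_conj min_less_iff_conj)+
    ultimately have "(LINT p|lborel. indicator {P<..<Q} (fst p) * indicator {R<..<S} (snd p) * w p) = 0"
      using 0 by (simp add: LIMSEQ_const_iff)
    also have "(\<lambda>p. indicator {P<..<Q} (fst p) * indicator {R<..<S} (snd p) * w p) =
      (\<lambda>p. indicator (box u v) p *\<^sub>R w p)"
    proof
      fix p
      show "indicator {P<..<Q} (fst p) * indicator {R<..<S} (snd p) * w p = indicator (box u v) p *\<^sub>R w p"
        using out[of p] by (cases p) (auto simp: box_prod indicator_def P_def Q_def R_def S_def)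
    qed
    finally show ?thesis by (simp add: set_lebesgue_integral_def)
  qed
  \<comment> \<open>The complement case of the induction below subtracts from the integral over the
    whole plane, so this has to be 0 as well.\<close>
  have whole: "(LINT p|lborel. w p) = 0"
  proof -
    have "(LINT p|lborel. w p) = (LINT p:box (a, c) (b, d)|lborel. w p)"
      unfolding set_lebesgue_integral_def
      by (rule arg_cong[where f = "integral\<^sup>L lborel"])
         (use out in \<open>fastforce simp: box_prod indicator_def\<close>)
    then show ?thesis using box by simp
  qed
  fix A :: "R2 set" assume "A \<in> sets lborel"
  then have A: "A \<in> sigma_sets UNIV (range (\<lambda>(a, b). box a b))"
    by (simp add: borel_eq_box)
  have sb: "X \<in> sets borel" if "X \<in> sigma_sets UNIV (range (\<lambda>(a, b). box a b :: R2 set))" for X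
    using that by (simp add: borel_eq_box)
  have "Int_stable (range (\<lambda>(a, b). box a b :: R2 set))"
    by (auto simp: Int_stable_def box_Int_box)
  moreover have "range (\<lambda>(a, b). box a b :: R2 set) \<subseteq> Pow UNIV" by auto
  moreover note A
  ultimately show "(LINT p:A|lborel. w p) = 0"
  proof (induction rule: sigma_sets_induct_disjoint)
    case (basic A)
    then show ?case using box by auto
  next
    case empty
    then show ?case by (simp add: set_lebesgue_integral_def)
  next
    case (compl A)
    then have [measurable]: "A \<in> sets borel" using sb by blast
    have "(LINT p|lborel. w p) = (LINT p:A|lborel. w p) + (LINT p:UNIV - A|lborel. w p)"
      using set_integral_Un[of A "UNIV - A" lborel w] si by (simp add: set_integral_space[OF w, simplified] Un_absorb2)
    then show ?case using whole compl by simp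
  next
    case (union A)
    have "A i \<in> sets borel" for i using union(2) sb by blast
    then show ?case
      using union by (subst lebesgue_integral_countable_add) (auto simp: disjoint_family_on_def intro!: si)
  qed
qed

lemma test_function_continuous_bounded:
  assumes "\<phi> \<in> test_functions \<Omega>"
  shows "continuous_on UNIV \<phi>" "\<exists>M\<ge>0. \<forall>p. \<bar>\<phi> p\<bar> \<le> M"
    "continuous_on UNIV (\<lambda>p. frechet_derivative \<phi> (at p) e)"
    "\<exists>M\<ge>0. \<forall>p. \<bar>frechet_derivative \<phi> (at p) e\<bar> \<le> M"
    "linear (frechet_derivative \<phi> (at p))" "\<phi> differentiable (at p)"
    "p \<notin> \<Omega> \<Longrightarrow> \<phi> p = 0" "p \<notin> \<Omega> \<Longrightarrow> frechet_derivative \<phi> (at p) e = 0"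
proof -
  obtain D where D: "D 0 0 = \<phi>"
    "\<And>i j p. (D i j has_derivative (\<lambda>h. fst h * D (Suc i) j p + snd h * D i (Suc j) p)) (at p)"
    using assms unfolding test_functions_def smooth_def by auto
  let ?K = "closure {p. \<phi> p \<noteq> 0}"
  have K: "compact ?K" "?K \<subseteq> \<Omega>" using assms by (auto simp: test_functions_def)
  have cont: "continuous_on UNIV (D i j)" for i j
    using D(2) by (meson continuous_at_imp_continuous_on has_derivative_continuous)
  have bounded: "\<exists>M\<ge>0. \<forall>p. \<bar>f p\<bar> \<le> M" if f: "continuous_on UNIV f" "\<And>p. p \<notin> ?K \<Longrightarrow> f p = 0" for f :: "R2 \<Rightarrow> real"
  proof -
    have "compact (f ` ?K)" using K continuous_on_subset[OF f(1)] by (intro compact_continuous_image) auto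
    then obtain B where B: "\<And>y. y \<in> f ` ?K \<Longrightarrow> norm y \<le> B"
      using compact_imp_bounded bounded_iff by metis
    have "\<bar>f p\<bar> \<le> max 0 B" for p
      using f(2)[of p] B[of "f p"] by (cases "p \<in> ?K") (auto simp: le_max_iff_disj)
    then show ?thesis by (intro exI[of _ "max 0 B"]) auto
  qed
  have fr: "frechet_derivative \<phi> (at p) = (\<lambda>h. fst h * D 1 0 p + snd h * D 0 1 p)" for p
    using frechet_derivative_at[OF D(2)[of 0 0 p]] D(1) by simp
  have fr0: "frechet_derivative \<phi> (at p) e = 0" if "p \<notin> ?K" for p e
  proof -
    have "(\<phi> has_derivative (\<lambda>_. 0)) (at p)"
    proof (rule has_derivative_transform_within_open[of "\<lambda>_. 0" _ p UNIV "- ?K"])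
      show "0 = \<phi> x" if "x \<in> - ?K" for x
        using that closure_subset[of "{p. \<phi> p \<noteq> 0}"] by auto
    qed (use that in auto)
    from frechet_derivative_at[OF this] show ?thesis by metis
  qed
  show "continuous_on UNIV \<phi>" using cont[of 0 0] D(1) by simp
  moreover have "\<phi> p = 0" if "p \<notin> ?K" for p using that closure_subset[of "{p. \<phi> p \<noteq> 0}"] by auto
  ultimately show "\<exists>M\<ge>0. \<forall>p. \<bar>\<phi> p\<bar> \<le> M" by (intro bounded)
  show *: "continuous_on UNIV (\<lambda>p. frechet_derivative \<phi> (at p) e)"
    unfolding fr by (intro continuous_intros cont)
  show "\<exists>M\<ge>0. \<forall>p. \<bar>frechet_derivative \<phi> (at p) e\<bar> \<le> M"
    by (intro bounded * fr0)
  show "\<phi> differentiable (at p)" using D(2)[of 0 0 p] D(1) unfolding differentiable_def by auto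
  then show "linear (frechet_derivative \<phi> (at p))" by (rule linear_frechet_derivative)
  show "p \<notin> \<Omega> \<Longrightarrow> \<phi> p = 0" using K closure_subset[of "{p. \<phi> p \<noteq> 0}"] by auto
  show "p \<notin> \<Omega> \<Longrightarrow> frechet_derivative \<phi> (at p) e = 0" using K fr0[of p e] by blast
qed

section \<open>From Lebesgue measure on the domain to Borel functions on the plane\<close>

lemma AE_lebesgue_on_iff:
  "open \<Omega> \<Longrightarrow> (AE p in lebesgue_on \<Omega>. P p) \<longleftrightarrow> (AE p in lborel. p \<in> \<Omega> \<longrightarrow> P p)"
  by (subst AE_restrict_space_iff) (auto simp: AE_completion_iff)

lemma borel_measurable_lebesgue_on_AE:
  fixes f g :: "R2 \<Rightarrow> 'b::euclidean_space"
  assumes "open \<Omega>" "f \<in> borel_measurable (lebesgue_on \<Omega>)" "AE p in lebesgue_on \<Omega>. f p = g p"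
  shows "g \<in> borel_measurable (lebesgue_on \<Omega>)"
proof -
  have "(\<lambda>p. if p \<in> \<Omega> then f p else 0) \<in> borel_measurable lebesgue"
    using assms by (simp add: borel_measurable_if)
  moreover have "AE p in lebesgue. (if p \<in> \<Omega> then f p else 0) = (if p \<in> \<Omega> then g p else 0)"
    using assms(3) unfolding AE_lebesgue_on_iff[OF assms(1)] AE_completion_iff by eventually_elim auto
  ultimately have "(\<lambda>p. if p \<in> \<Omega> then g p else 0) \<in> borel_measurable lebesgue"
    by (rule borel_measurable_AE)
  then show ?thesis using assms by (simp add: borel_measurable_if)
qed

text \<open>Weak derivatives are defined with Lebesgue measure on \<Omega>, while Fubini is applied
  to Borel functions on the plane. Extension by 0 passes from one setting to the other.\<close>

lemma lebesgue_on_integral_lborel: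
  fixes f g :: "R2 \<Rightarrow> 'b::euclidean_space"
  assumes "open \<Omega>" and [measurable]: "g \<in> borel_measurable borel" and "\<And>p. p \<notin> \<Omega> \<Longrightarrow> g p = 0"
    and eq: "AE p in lebesgue_on \<Omega>. f p = g p"
  shows "integrable (lebesgue_on \<Omega>) f \<longleftrightarrow> integrable lborel g"
    and "integral\<^sup>L (lebesgue_on \<Omega>) f = integral\<^sup>L lborel g"
proof -
  have g: "g = (\<lambda>p. if p \<in> \<Omega> then g p else 0)" using assms by auto
  have \<Omega>: "\<Omega> \<in> sets lebesgue" using assms by auto
  have gm: "g \<in> borel_measurable (lebesgue_on \<Omega>)"
    by (intro measurable_restrict_space1 measurable_completion) simp
  have fm: "f \<in> borel_measurable (lebesgue_on \<Omega>)"
    by (rule borel_measurable_lebesgue_on_AE[OF assms(1) gm]) (use eq in auto)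
  have "integrable (lebesgue_on \<Omega>) f \<longleftrightarrow> integrable (lebesgue_on \<Omega>) g"
    by (rule integrable_cong_AE[OF fm gm eq])
  also have "\<dots> \<longleftrightarrow> integrable lebesgue g"
    using Lebesgue_Measure.integrable_restrict_UNIV[OF \<Omega>, of g] g by simp
  finally show "integrable (lebesgue_on \<Omega>) f \<longleftrightarrow> integrable lborel g"
    by (simp add: integrable_completion)
  have "integral\<^sup>L (lebesgue_on \<Omega>) f = integral\<^sup>L (lebesgue_on \<Omega>) g"
    by (rule integral_cong_AE[OF fm gm eq])
  also have "\<dots> = integral\<^sup>L lebesgue g"
    using Lebesgue_Measure.integral_restrict_UNIV[OF \<Omega>, of g] g by simp
  finally show "integral\<^sup>L (lebesgue_on \<Omega>) f = integral\<^sup>L lborel g"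
    by (simp add: integral_completion)
qed

lemma borel_representative:
  fixes f :: "R2 \<Rightarrow> real"
  assumes "open \<Omega>" and f: "f \<in> borel_measurable (lebesgue_on \<Omega>)"
  obtains g where "g \<in> borel_measurable borel" "\<And>p. p \<notin> \<Omega> \<Longrightarrow> g p = 0"
    "AE p in lebesgue_on \<Omega>. f p = g p"
proof -
  have "(\<lambda>p. if p \<in> \<Omega> then f p else 0) \<in> borel_measurable lebesgue"
    using assms by (simp add: borel_measurable_if)
  then obtain g where g[measurable]: "g \<in> borel_measurable lborel"
    and eq: "AE p in lborel. (if p \<in> \<Omega> then f p else 0) = g p"
    using completion_ex_borel_measurable_real by blast
  have [measurable]: "\<Omega> \<in> sets borel" using assms by auto
  show ?thesis
  proof (rule that[of "\<lambda>p. indicator \<Omega> p * g p"])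
    show "AE p in lebesgue_on \<Omega>. f p = indicator \<Omega> p * g p"
      using eq unfolding AE_lebesgue_on_iff[OF assms(1)] by eventually_elim auto
  qed auto
qed

lemma integrable_bounded_mult:
  fixes f :: "'a \<Rightarrow> 'b::{banach, second_countable_topology}"
  assumes "g \<in> borel_measurable M" "\<And>p. \<bar>g p\<bar> \<le> K" "integrable M f"
  shows "integrable M (\<lambda>p. g p *\<^sub>R f p)"
proof (rule Bochner_Integration.integrable_bound)
  show "integrable M (\<lambda>p. K * norm (f p))" using assms(3) by auto
  show "(\<lambda>p. g p *\<^sub>R f p) \<in> borel_measurable M" using assms by auto
  show "AE p in M. norm (g p *\<^sub>R f p) \<le> norm (K * norm (f p))"
    using order_trans[OF abs_ge_zero assms(2)] assms(2)
    by (auto simp: abs_mult intro!: mult_right_mono AE_I2)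
qed

lemma continuous_lebesgue_on_measurable:
  fixes f :: "'a::euclidean_space \<Rightarrow> 'b::euclidean_space"
  shows "continuous_on UNIV f \<Longrightarrow> f \<in> borel_measurable (lebesgue_on \<Omega>)"
  by (intro measurable_restrict_space1 measurable_completion) (simp add: borel_measurable_continuous_onI)

lemma test_function_integrable:
  fixes f :: "R2 \<Rightarrow> 'b::euclidean_space"
  assumes "\<phi> \<in> test_functions \<Omega>" "integrable (lebesgue_on \<Omega>') f"
  shows "integrable (lebesgue_on \<Omega>') (\<lambda>p. \<phi> p *\<^sub>R f p)"
    "integrable (lebesgue_on \<Omega>') (\<lambda>p. frechet_derivative \<phi> (at p) e *\<^sub>R f p)"
proof -
  obtain M where "\<And>p. \<bar>\<phi> p\<bar> \<le> M" using test_function_continuous_bounded(2)[OF assms(1)] by blast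
  then show "integrable (lebesgue_on \<Omega>') (\<lambda>p. \<phi> p *\<^sub>R f p)"
    by (rule integrable_bounded_mult[OF continuous_lebesgue_on_measurable[OF
      test_function_continuous_bounded(1)[OF assms(1)]] _ assms(2)])
  obtain M where "\<And>p. \<bar>frechet_derivative \<phi> (at p) e\<bar> \<le> M"
    using test_function_continuous_bounded(4)[OF assms(1)] by blast
  then show "integrable (lebesgue_on \<Omega>') (\<lambda>p. frechet_derivative \<phi> (at p) e *\<^sub>R f p)"
    by (rule integrable_bounded_mult[OF continuous_lebesgue_on_measurable[OF
      test_function_continuous_bounded(3)[OF assms(1)]] _ assms(2)])
qed

text \<open>A countable cover of the open set by boxes reduces the claim to the product test
  functions of \<open>fundamental_lemma_box\<close>; countability keeps the union of the exceptional
  sets null.\<close>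

lemma fundamental_lemma:
  fixes f :: "R2 \<Rightarrow> real"
  assumes "open \<Omega>" and f: "integrable (lebesgue_on \<Omega>) f"
    and 0: "\<And>\<phi>. \<phi> \<in> test_functions \<Omega> \<Longrightarrow> (LINT p|lebesgue_on \<Omega>. \<phi> p * f p) = 0"
  shows "AE p in lebesgue_on \<Omega>. f p = 0"
proof -
  have [measurable]: "\<Omega> \<in> sets borel" using assms by auto
  obtain g where g[measurable]: "g \<in> borel_measurable borel" and g0: "\<And>p. p \<notin> \<Omega> \<Longrightarrow> g p = 0"
    and eq: "AE p in lebesgue_on \<Omega>. f p = g p"
    using borel_representative[OF assms(1) borel_measurable_integrable[OF f]] by metis
  have gi: "integrable lborel g"
    using lebesgue_on_integral_lborel(1)[OF assms(1) g g0 eq] f by simp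
  obtain \<D> where D: "countable \<D>" "\<D> \<subseteq> Pow \<Omega>" "\<And>X. X \<in> \<D> \<Longrightarrow> \<exists>a b. X = box a b" "\<Union> \<D> = \<Omega>"
    using open_countable_Union_open_box[OF assms(1)] by metis
  have "AE p in lborel. p \<in> X \<longrightarrow> g p = 0" if X: "X \<in> \<D>" for X
  proof -
    obtain a b where ab: "X = box a b" using D X by blast
    then have X': "X = {fst a<..<fst b} \<times> {snd a<..<snd b}" by (simp add: box_prod)
    have "AE p in lborel. indicator X p * g p = 0"
    proof (rule fundamental_lemma_box[of _ "fst a" "fst b" "snd a" "snd b"])
      show "integrable lborel (\<lambda>p. indicator X p * g p)"
        using integrable_mult_indicator[OF _ gi, of X] ab by simp
      fix \<phi> \<beta> assume t: "test1 (fst a) (fst b) \<phi>" "test1 (snd a) (snd b) \<beta>"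
      have tf: "(\<lambda>p. \<phi> (fst p) * \<beta> (snd p)) \<in> test_functions \<Omega>"
        using test1_product_test_function[OF t] X X' D by auto
      note [measurable] = test1_measurable[OF t(1)] test1_measurable[OF t(2)]
      have "(LINT p|lborel. \<phi> (fst p) * \<beta> (snd p) * (indicator X p * g p)) =
        (LINT p|lborel. \<phi> (fst p) * \<beta> (snd p) * g p)"
        by (rule arg_cong[where f = "integral\<^sup>L lborel"])
           (use test1_outside[OF t(1)] test1_outside[OF t(2)] in \<open>fastforce simp: X' indicator_def\<close>)
      also have "\<dots> = (LINT p|lebesgue_on \<Omega>. \<phi> (fst p) * \<beta> (snd p) * f p)"
        by (rule lebesgue_on_integral_lborel(2)[OF assms(1), symmetric])
           (use eq g0 in \<open>auto elim!: eventually_mono\<close>)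
      also have "\<dots> = 0" using 0[OF tf] .
      finally show "(LINT p|lborel. \<phi> (fst p) * \<beta> (snd p) * (indicator X p * g p)) = 0" .
    qed (auto simp: X')
    then show ?thesis by eventually_elim auto
  qed
  then have "AE p in lborel. \<forall>X\<in>\<D>. p \<in> X \<longrightarrow> g p = 0"
    unfolding AE_ball_countable[OF D(1)] by blast
  then have "AE p in lborel. g p = 0" by eventually_elim (use g0 D in blast)
  with eq show ?thesis
    unfolding AE_lebesgue_on_iff[OF assms(1)] by eventually_elim auto
qed

lemma L2_integrable:
  fixes u :: "'a \<Rightarrow> 'b::euclidean_space"
  assumes "finite_measure M" "L2 M u"
  shows "integrable M u"
proof (rule Bochner_Integration.integrable_bound)
  interpret finite_measure M by fact
  show "integrable M (\<lambda>p. 1 + (norm (u p))\<^sup>2)" using assms by (auto simp: L2_def)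
  show "u \<in> borel_measurable M" using assms by (auto simp: L2_def)
  have "x \<le> 1 + x\<^sup>2" for x :: real using zero_le_power2[of "x - 1 / 2"] by (simp add: power2_eq_square algebra_simps) 
  then show "AE p in M. norm (u p) \<le> norm (1 + (norm (u p))\<^sup>2)" by (auto intro!: AE_I2)
qed

text \<open>Tested coordinate by coordinate with the fundamental lemma. This is why the Hilbert
  choice in \<open>weak_deriv\<close> does no harm.\<close>

lemma weak_deriv_unique:
  fixes u v v' :: "R2 \<Rightarrow> 'b::euclidean_space"
  assumes "open \<Omega>" and v: "integrable (lebesgue_on \<Omega>) v" "integrable (lebesgue_on \<Omega>) v'"
    and w: "has_weak_deriv \<Omega> e u v" "has_weak_deriv \<Omega> e u v'"
  shows "AE p in lebesgue_on \<Omega>. v p = v' p"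
proof -
  have "AE p in lebesgue_on \<Omega>. (v p - v' p) \<bullet> i = 0" if i: "i \<in> Basis" for i
  proof (rule fundamental_lemma[OF assms(1)])
    show "integrable (lebesgue_on \<Omega>) (\<lambda>p. (v p - v' p) \<bullet> i)" using v by auto
    fix \<phi> assume \<phi>: "\<phi> \<in> test_functions \<Omega>"
    have int: "integrable (lebesgue_on \<Omega>) (\<lambda>p. \<phi> p *\<^sub>R v p)" "integrable (lebesgue_on \<Omega>) (\<lambda>p. \<phi> p *\<^sub>R v' p)"
      using test_function_integrable[OF \<phi>] v by auto
    have "(LINT p|lebesgue_on \<Omega>. \<phi> p * ((v p - v' p) \<bullet> i)) = (LINT p|lebesgue_on \<Omega>. (\<phi> p *\<^sub>R v p - \<phi> p *\<^sub>R v' p) \<bullet> i)"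
      by (simp add: inner_diff_left algebra_simps)
    also have "\<dots> = ((LINT p|lebesgue_on \<Omega>. \<phi> p *\<^sub>R v p) - (LINT p|lebesgue_on \<Omega>. \<phi> p *\<^sub>R v' p)) \<bullet> i"
      using int by (subst integral_inner_left) auto
    also have "(LINT p|lebesgue_on \<Omega>. \<phi> p *\<^sub>R v p) = (LINT p|lebesgue_on \<Omega>. \<phi> p *\<^sub>R v' p)"
      using w[unfolded has_weak_deriv_def, THEN bspec, OF \<phi>] by simp
    also have "((LINT p|lebesgue_on \<Omega>. \<phi> p *\<^sub>R v' p) - (LINT p|lebesgue_on \<Omega>. \<phi> p *\<^sub>R v' p)) \<bullet> i = 0"
      by simp
    finally show "(LINT p|lebesgue_on \<Omega>. \<phi> p * ((v p - v' p) \<bullet> i)) = 0" .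
  qed
  then have "AE p in lebesgue_on \<Omega>. \<forall>i\<in>Basis. (v p - v' p) \<bullet> i = 0"
    by (intro AE_finite_allI) auto
  then show ?thesis by eventually_elim (simp add: euclidean_all_zero_iff)
qed

section \<open>Absolute continuity on lines\<close>

lemma integrable_lborel_snd:
  fixes f :: "R2 \<Rightarrow> real"
  assumes "integrable lborel f"
  shows "integral\<^sup>L lborel f = (LINT y|lborel. LINT x|lborel. f (x, y))"
    "AE y in lborel. integrable lborel (\<lambda>x. f (x, y))"
    "integrable lborel (\<lambda>y. LINT x|lborel. f (x, y))"
  using lborel_pair.integral_snd[of "\<lambda>x y. f (x, y)"] lborel_pair.AE_integrable_snd[of "\<lambda>x y. f (x, y)"]
    lborel_pair.integrable_snd[of "\<lambda>x y. f (x, y)"] assms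
  by (simp_all add: lborel_prod)

lemma integrable_lborel_prod:
  fixes f g :: "real \<Rightarrow> real"
  assumes f: "integrable lborel f" and g: "integrable lborel g"
  shows "integrable lborel (\<lambda>p::R2. f (fst p) * g (snd p))"
    "(LINT p|(lborel::R2 measure). f (fst p) * g (snd p)) = (LINT x|lborel. f x) * (LINT y|lborel. g y)"
proof -
  have [measurable]: "f \<in> borel_measurable borel" "g \<in> borel_measurable borel" using f g by auto
  have "integrable (lborel \<Otimes>\<^sub>M lborel) (\<lambda>p::R2. f (fst p) * g (snd p))"
  proof (rule lborel_pair.Fubini_integrable)
    show "integrable lborel (\<lambda>x. LINT y|lborel. norm (f (fst (x, y)) * g (snd (x, y))))"
      using f by (simp add: abs_mult)
  qed (use g in auto)
  then show *: "integrable lborel (\<lambda>p::R2. f (fst p) * g (snd p))" by (simp add: lborel_prod)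
  show "(LINT p|(lborel::R2 measure). f (fst p) * g (snd p)) = (LINT x|lborel. f x) * (LINT y|lborel. g y)"
    by (subst integrable_lborel_snd(1)[OF *]) simp
qed

lemma AE_lborel_snd:
  assumes "AE y in lborel. P y"
  shows "AE p in (lborel :: R2 measure). P (snd p)"
proof -
  obtain N where N: "N \<in> null_sets lborel" "{y. \<not> P y} \<subseteq> N"
    using assms by (auto simp: eventually_ae_filter)
  have "UNIV \<times> N \<in> null_sets (lborel \<Otimes>\<^sub>M lborel :: R2 measure)"
    using N(1) by (auto simp: null_sets_def lborel.emeasure_pair_measure_Times)
  then have "UNIV \<times> N \<in> null_sets (lborel :: R2 measure)" by (simp add: lborel_prod)
  then show ?thesis
    by (rule AE_I') (use N(2) in auto)
qed

text \<open>The primitive of \<open>h\<close> need not be differentiable everywhere, so the formula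
  is obtained from Fubini on the triangle a < t < x: for fixed \<open>t\<close> > a, the integral of
  \<open>\<psi>\<close> over x > t is minus \<open>\<Phi> t\<close>.\<close>

lemma integration_by_parts_primitive:
  fixes h :: "real \<Rightarrow> real"
  assumes h: "integrable lborel h" and \<Phi>: "test1 a b \<Phi>" and \<psi>: "test1 a b \<psi>"
    and deriv: "\<And>x. (\<Phi> has_real_derivative \<psi> x) (at x)"
  shows "(LINT x|lborel. \<psi> x * (LINT t|lborel. indicator {a<..<x} t * h t)) = - (LINT t|lborel. \<Phi> t * h t)"
proof -
  have [measurable]: "h \<in> borel_measurable borel" using h by auto
  note [measurable] = test1_measurable[OF \<Phi>] test1_measurable[OF \<psi>]
  \<comment> \<open>The product of \<open>\<psi>\<close> at x and \<open>h\<close> at t, restricted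
    to the triangle; the condition t < x is expressed through the difference of the coordinates,
    which keeps measurability visible.\<close>
  define f where "f p = \<psi> (fst p) * (indicator {a<..} (snd p) * indicator {0<..} (fst p - snd p) * h (snd p))" for p :: R2
  have "integrable lborel f"
  proof (rule Bochner_Integration.integrable_bound[OF integrable_lborel_prod(1)[OF test1_integrable[OF \<psi>] h]])
    show "f \<in> borel_measurable lborel" unfolding f_def lborel_prod[symmetric] by measurable
    show "AE p in lborel. norm (f p) \<le> norm (\<psi> (fst p) * h (snd p))"
      by (auto simp: f_def abs_mult indicator_def)
  qed
  then have f: "integrable (lborel \<Otimes>\<^sub>M lborel) (case_prod (\<lambda>x y. f (x, y)))" by (simp add: lborel_prod)
  have "(LINT x|lborel. \<psi> x * (LINT t|lborel. indicator {a<..<x} t * h t)) = (LINT x|lborel. LINT t|lborel. f (x, t))"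
  proof (rule Bochner_Integration.integral_cong[OF refl])
    fix x
    have "(LINT t|lborel. f (x, t)) = (LINT t|lborel. \<psi> x * (indicator {a<..<x} t * h t))"
      unfolding f_def by (rule Bochner_Integration.integral_cong) (auto simp: indicator_def)
    then show "\<psi> x * (LINT t|lborel. indicator {a<..<x} t * h t) = (LINT t|lborel. f (x, t))" by simp
  qed
  also have "\<dots> = (LINT t|lborel. LINT x|lborel. f (x, t))"
    using lborel_pair.Fubini_integral[OF f] by simp
  also have "\<dots> = (LINT t|lborel. - (\<Phi> t * h t))"
  proof (rule Bochner_Integration.integral_cong[OF refl])
    fix t
    show "(LINT x|lborel. f (x, t)) = - (\<Phi> t * h t)"
    proof (cases "a < t")
      case False
      then have "\<Phi> t = 0" using test1_outside[OF \<Phi>, of t] by auto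
      then show ?thesis using False by (simp add: f_def)
    next
      case True
      \<comment> \<open>\<open>M\<close> lies to the right of the supports, so the integral up to
        \<open>M\<close> is the whole one and \<open>\<Phi> M\<close> is 0.\<close>
      define M where "M = max t b"
      have "(LINT x|lborel. f (x, t)) = (LINT x|lborel. h t * (\<psi> x * indicator {t..M} x))"
      proof (rule integral_cong_AE)
        show "AE x in lborel. f (x, t) = h t * (\<psi> x * indicator {t..M} x)"
          using AE_lborel_singleton[of t]
        proof eventually_elim
          case (elim x)
          then show ?case using True test1_outside[OF \<psi>, of x]
            by (cases "x \<le> M") (auto simp: f_def indicator_def M_def)
        qed
      qed (auto simp: f_def)
      also have "\<dots> = h t * (\<Phi> M - \<Phi> t)"
        using deriv smooth1_continuous[OF test1_smooth1[OF \<psi>]]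
        by (subst integral_mult_right_zero, subst integral_FTC_Icc_real[of t M \<Phi>]) (auto simp: M_def)
      also have "\<Phi> M = 0" using test1_outside[OF \<Phi>, of M] by (auto simp: M_def)
      finally show ?thesis by simp
    qed
  qed
  finally show ?thesis by simp
qed

text \<open>Let \<open>V\<close> be the primitive of \<open>v\<close> in the first variable. By
  \<open>H\<close> and integration by parts, u - V is orthogonal to every product of
  \<open>\<psi>\<close> in x and \<open>\<beta>\<close> in y with \<open>\<psi>\<close> of mean
  zero, hence depends on y alone; that function is \<open>k\<close>. The rest of \<open>u\<close> is
  \<open>V\<close>, which is bounded by the integral of the modulus of \<open>v\<close> along the
  slice.\<close>

lemma oscillation_on_box:
  fixes u v :: "R2 \<Rightarrow> real"
  assumes u: "integrable lborel u" and v: "integrable lborel v" and "a < b"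
    and H: "\<And>\<Phi> \<psi> \<beta>. test1 a b \<Phi> \<Longrightarrow> test1 c d \<beta> \<Longrightarrow> (\<And>x. (\<Phi> has_real_derivative \<psi> x) (at x)) \<Longrightarrow>
      (LINT p|lborel. \<psi> (fst p) * \<beta> (snd p) * u p) = - (LINT p|lborel. \<Phi> (fst p) * \<beta> (snd p) * v p)"
  obtains k where "integrable lborel k"
    "AE p in lborel. p \<in> {a<..<b} \<times> {c<..<d} \<longrightarrow>
      \<bar>u p - k (snd p)\<bar> \<le> (LINT t|lborel. indicator {a<..<b} t * \<bar>v (t, snd p)\<bar>)"
proof -
  have [measurable]: "u \<in> borel_measurable borel" "v \<in> borel_measurable borel"
    using u v by auto
  have [measurable]: "v \<in> borel_measurable (borel \<Otimes>\<^sub>M borel)" by (simp add: borel_prod)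
  define I where "I y = (LINT t|lborel. indicator {a<..<b} t * \<bar>v (t, y)\<bar>)" for y
  define V where "V p = (LINT t|lborel. indicator {a<..<fst p} t * v (t, snd p))" for p :: R2
  define B where "B = {a<..<b} \<times> {c<..<d}"
  have B[measurable]: "B \<in> sets borel" unfolding B_def by (intro borel_open open_Times) auto
  have AEv: "AE y in lborel. integrable lborel (\<lambda>t. v (t, y))" by (rule integrable_lborel_snd(2)[OF v])
  have "integrable lborel (\<lambda>p. indicator {a<..<b} (fst p) * \<bar>v p\<bar>)"
    by (rule Bochner_Integration.integrable_bound[OF v]) (auto simp: indicator_def)
  from integrable_lborel_snd(3)[OF this] have I: "integrable lborel I"
    by (simp add: I_def[abs_def])
  then have [measurable]: "I \<in> borel_measurable borel" by auto
  have V[measurable]: "V \<in> borel_measurable borel"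
  proof -
    have "(\<lambda>p. LINT t|lborel. (if a < t \<and> t < fst p then 1 else 0) * v (t, snd p)) \<in> borel_measurable (borel \<Otimes>\<^sub>M borel)"
      by measurable
    also have "(\<lambda>p. LINT t|lborel. (if a < t \<and> t < fst p then 1 else 0) * v (t, snd p)) = V"
      unfolding V_def by (intro ext Bochner_Integration.integral_cong) (auto simp: indicator_def)
    finally show ?thesis by (simp add: borel_prod)
  qed
  have VI: "AE p in lborel. p \<in> B \<longrightarrow> \<bar>V p\<bar> \<le> I (snd p)"
    using AE_lborel_snd[OF AEv]
  proof eventually_elim
    case (elim p)
    have int: "integrable lborel (\<lambda>t. indicator {a<..<b} t * \<bar>v (t, snd p)\<bar>)"
      by (rule Bochner_Integration.integrable_bound[OF elim]) (auto simp: indicator_def)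
    show ?case
    proof
      assume "p \<in> B"
      then have "fst p < b" by (auto simp: B_def)
      have "\<bar>V p\<bar> \<le> (LINT t|lborel. norm (indicator {a<..<fst p} t * v (t, snd p)))"
        using integral_norm_bound[of lborel "\<lambda>t. indicator {a<..<fst p} t * v (t, snd p)"]
        by (simp add: V_def)
      also have "\<dots> \<le> I (snd p)"
        unfolding I_def by (rule integral_mono_AE'[OF int]) (use \<open>fst p < b\<close> in \<open>auto simp: indicator_def abs_mult\<close>)
      finally show "\<bar>V p\<bar> \<le> I (snd p)" .
    qed
  qed
  define w where "w p = indicator B p * (u p - V p)" for p
  have cut: "integrable lborel (\<lambda>p. indicator B p * f (snd p))" if f: "integrable lborel f" for f :: "real \<Rightarrow> real"
  proof (rule Bochner_Integration.integrable_bound)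
    show "integrable lborel (\<lambda>p. indicator {a<..<b} (fst p) * f (snd p))"
      by (rule integrable_lborel_prod) (use f \<open>a < b\<close> in \<open>auto intro!: integrable_real_indicator\<close>)
    have "f \<in> borel_measurable borel" using f by auto
    note [measurable] = measurable_comp_snd[OF this]
    show "(\<lambda>p. indicator B p * f (snd p)) \<in> borel_measurable lborel" by measurable
  qed (auto simp: B_def indicator_def)
  have wV: "integrable lborel (\<lambda>p. indicator B p * V p)"
  proof (rule Bochner_Integration.integrable_bound[OF cut[OF I]])
    show "AE p in lborel. norm (indicator B p * V p) \<le> norm (indicator B p * I (snd p))"
      using VI by eventually_elim (auto simp: indicator_def)
  qed simp
  have wu: "integrable lborel (\<lambda>p. indicator B p * u p)"
    by (rule Bochner_Integration.integrable_bound[OF u]) (auto simp: indicator_def)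
  have w: "integrable lborel w"
    unfolding w_def using wu wV by (simp add: right_diff_distrib)
  then have [measurable]: "w \<in> borel_measurable borel" by auto
  have tint: "integrable lborel (\<lambda>p. \<phi> (fst p) * \<beta> (snd p) * f p)"
    if t: "test1 a b \<phi>" "test1 c d \<beta>" "integrable lborel f" for \<phi> \<beta> and f :: "R2 \<Rightarrow> real"
  proof -
    obtain M N where M: "\<And>x. \<bar>\<phi> x\<bar> \<le> M" "0 \<le> M" "\<And>x. \<bar>\<beta> x\<bar> \<le> N" "0 \<le> N"
      using test1_bounded[OF t(1)] test1_bounded[OF t(2)] by metis
    note [measurable] = test1_measurable[OF t(1)] test1_measurable[OF t(2)]
    have "integrable lborel (\<lambda>p. (\<phi> (fst p) * \<beta> (snd p)) *\<^sub>R f p)"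
      by (rule integrable_bounded_mult[of _ _ "M * N"]) (use M t(3) in \<open>auto simp: abs_mult intro!: mult_mono\<close>)
    then show ?thesis by simp
  qed
  have inB: "\<phi> (fst p) * \<beta> (snd p) * (indicator B p * f) = \<phi> (fst p) * \<beta> (snd p) * f"
    if "test1 a b \<phi>" "test1 c d \<beta>" for \<phi> \<beta> p and f :: real
    using test1_outside[OF that(1), of "fst p"] test1_outside[OF that(2), of "snd p"]
    by (cases p) (auto simp: B_def indicator_def)
  have w0: "(LINT p|lborel. \<psi> (fst p) * \<beta> (snd p) * w p) = 0"
    if \<psi>: "test1 a b \<psi>" and \<beta>: "test1 c d \<beta>" and \<psi>0: "(LINT x|lborel. \<psi> x) = 0" for \<psi> \<beta>
  proof -
    obtain \<Phi> where \<Phi>: "test1 a b \<Phi>" "\<And>x. (\<Phi> has_real_derivative \<psi> x) (at x)"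
      using test1_antiderivative[OF \<psi> \<psi>0] by blast
    note [measurable] = test1_measurable[OF \<psi>] test1_measurable[OF \<beta>] test1_measurable[OF \<Phi>(1)]
    have "(LINT p|lborel. \<psi> (fst p) * \<beta> (snd p) * w p) =
      (LINT p|lborel. \<psi> (fst p) * \<beta> (snd p) * (indicator B p * u p)) -
      (LINT p|lborel. \<psi> (fst p) * \<beta> (snd p) * (indicator B p * V p))"
      using Bochner_Integration.integral_diff[OF tint[OF \<psi> \<beta> wu] tint[OF \<psi> \<beta> wV]]
      by (simp add: w_def algebra_simps)
    also have "(LINT p|lborel. \<psi> (fst p) * \<beta> (snd p) * (indicator B p * u p)) =
      - (LINT p|lborel. \<Phi> (fst p) * \<beta> (snd p) * v p)"
      using H[OF \<Phi>(1) \<beta> \<Phi>(2)] by (simp add: inB[OF \<psi> \<beta>])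
    also have "(LINT p|lborel. \<psi> (fst p) * \<beta> (snd p) * (indicator B p * V p)) =
       (LINT y|lborel. LINT x|lborel. \<psi> x * \<beta> y * V (x, y))"
      using integrable_lborel_snd(1)[OF tint[OF \<psi> \<beta> wV]]
        inB[OF \<psi> \<beta>, of "(x, y)" for x y, simplified fst_conv snd_conv] by (simp only: fst_conv snd_conv)
    also have "\<dots> = (LINT y|lborel. LINT x|lborel. - (\<Phi> x * \<beta> y * v (x, y)))"
    proof (rule integral_cong_AE)
      show "AE y in lborel. (LINT x|lborel. \<psi> x * \<beta> y * V (x, y)) = (LINT x|lborel. - (\<Phi> x * \<beta> y * v (x, y)))"
        using AEv
      proof eventually_elim
        case (elim y)
        have "(LINT x|lborel. \<psi> x * \<beta> y * V (x, y)) = (LINT x|lborel. \<beta> y * (\<psi> x * V (x, y)))"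
          by (simp add: algebra_simps)
        also have "\<dots> = \<beta> y * (- (LINT t|lborel. \<Phi> t * v (t, y)))"
          using integration_by_parts_primitive[OF elim \<Phi>(1) \<psi> \<Phi>(2)] by (simp add: V_def)
        also have "\<dots> = (LINT t|lborel. - \<beta> y * (\<Phi> t * v (t, y)))"
          by simp
        finally show ?case by (simp add: algebra_simps)
      qed
      have [measurable]: "V \<in> borel_measurable (borel \<Otimes>\<^sub>M borel)" by (simp add: borel_prod)
      show "(\<lambda>y. LINT x|lborel. \<psi> x * \<beta> y * V (x, y)) \<in> borel_measurable lborel"
        "(\<lambda>y. LINT x|lborel. - (\<Phi> x * \<beta> y * v (x, y))) \<in> borel_measurable lborel"
        by measurable
    qed
    also have "\<dots> = - (LINT p|lborel. \<Phi> (fst p) * \<beta> (snd p) * v p)"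
      using integrable_lborel_snd(1)[OF tint[OF \<Phi>(1) \<beta> v]] by simp
    finally show ?thesis by simp
  qed
  \<comment> \<open>One fixed test function with nonzero integral. Subtracting a multiple of it
    turns any \<open>\<phi>\<close> into a test function of mean zero, to which \<open>w0\<close>
    applies.\<close>
  obtain \<alpha> where \<alpha>: "test1 a b \<alpha>" "(LINT x|lborel. \<alpha> x) \<noteq> 0"
  proof -
    obtain \<phi> where \<phi>: "\<And>n. test1 a b (\<phi> n)" "\<And>n x. 0 \<le> \<phi> n x" "\<And>n x. \<phi> n x \<le> 1"
      "\<And>n x. x \<notin> {a<..<b} \<Longrightarrow> \<phi> n x = 0" "\<And>x. (\<lambda>n. \<phi> n x) \<longlonglongrightarrow> indicator {a<..<b} x"
      by (rule bump_sequence[of a b]) blast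
    have "(\<lambda>n. LINT x|lborel. \<phi> n x) \<longlonglongrightarrow> (LINT x|lborel. indicator {a<..<b} x)"
    proof (rule integral_dominated_convergence[where w = "indicator {a<..<b}"])
      show "AE x in lborel. norm (\<phi> n x) \<le> indicator {a<..<b} x" for n
        using \<phi>(2-4) by (auto simp: indicator_def)
    qed (use \<phi>(1,5) test1_measurable \<open>a < b\<close> in \<open>auto intro!: integrable_real_indicator\<close>)
    moreover have "(LINT x|lborel. indicator {a<..<b} x) = b - a" using \<open>a < b\<close> by simp
    ultimately have "\<exists>n. (LINT x|lborel. \<phi> n x) \<noteq> 0"
      using \<open>a < b\<close> by (rule_tac ccontr) (simp add: LIMSEQ_const_iff)
    then show ?thesis using that \<phi>(1) by blast
  qed
  define A where "A = (LINT x|lborel. \<alpha> x)"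
  \<comment> \<open>The weighted mean of \<open>w\<close> along the slice; for a function
    independent of x it recovers the value.\<close>
  define k where "k y = (LINT x|lborel. \<alpha> x * w (x, y)) / A" for y
  note [measurable] = test1_measurable[OF \<alpha>(1)]
  have \<alpha>w: "integrable lborel (\<lambda>p. \<alpha> (fst p) * w p)"
  proof -
    obtain M where "\<And>x. \<bar>\<alpha> x\<bar> \<le> M" using test1_bounded[OF \<alpha>(1)] by metis
    then have "integrable lborel (\<lambda>p. \<alpha> (fst p) *\<^sub>R w p)"
      by (intro integrable_bounded_mult[of _ _ M] w) auto
    then show ?thesis by simp
  qed
  have k: "integrable lborel k"
    unfolding k_def using integrable_lborel_snd(3)[OF \<alpha>w] by simp
  have wk: "integrable lborel (\<lambda>p. indicator B p * k (snd p))" by (rule cut[OF k])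
  have "AE p in lborel. w p - indicator B p * k (snd p) = 0"
  proof (rule fundamental_lemma_box[where a = a and b = b and c = c and d = d])
    show "integrable lborel (\<lambda>p. w p - indicator B p * k (snd p))" using w wk by auto
    show "w p - indicator B p * k (snd p) = 0" if "p \<notin> {a<..<b} \<times> {c<..<d}" for p
      using that by (auto simp: w_def B_def)
    fix \<phi> \<beta> assume \<phi>: "test1 a b \<phi>" and \<beta>: "test1 c d \<beta>"
    note [measurable] = test1_measurable[OF \<phi>] test1_measurable[OF \<beta>]
    define r where "r = (LINT x|lborel. \<phi> x) / A"
    have "(LINT p|lborel. (\<phi> (fst p) - r * \<alpha> (fst p)) * \<beta> (snd p) * w p) = 0"
      by (rule w0[OF test1_lincomb[OF \<phi> \<alpha>(1)] \<beta>])
         (use \<alpha>(2) test1_integrable[OF \<phi>] test1_integrable[OF \<alpha>(1)] in \<open>simp add: r_def A_def\<close>)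
    then have 1: "(LINT p|lborel. \<phi> (fst p) * \<beta> (snd p) * w p) =
        r * (LINT p|lborel. \<alpha> (fst p) * \<beta> (snd p) * w p)"
      using tint[OF \<phi> \<beta> w] tint[OF \<alpha>(1) \<beta> w] by (simp add: left_diff_distrib mult.assoc)
    have "integrable lborel (\<lambda>y. \<beta> y * k y)"
    proof -
      obtain M where "\<And>x. \<bar>\<beta> x\<bar> \<le> M" using test1_bounded[OF \<beta>] by metis
      then have "integrable lborel (\<lambda>y. \<beta> y *\<^sub>R k y)" by (intro integrable_bounded_mult[of _ _ M] k) auto
      then show ?thesis by simp
    qed
    from integrable_lborel_prod(2)[OF test1_integrable[OF \<phi>] this]
    have "(LINT p|lborel. \<phi> (fst p) * \<beta> (snd p) * (indicator B p * k (snd p))) =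
      (LINT x|lborel. \<phi> x) * (LINT y|lborel. \<beta> y * k y)"
      unfolding inB[OF \<phi> \<beta>] by (simp add: mult.assoc)
    also have "\<dots> = r * (LINT y|lborel. A * (\<beta> y * k y))"
      using \<alpha>(2) by (simp add: r_def A_def)
    also have "(\<lambda>y. A * (\<beta> y * k y)) = (\<lambda>y. LINT x|lborel. \<alpha> x * \<beta> y * w (x, y))"
    proof
      fix y
      have "A * (\<beta> y * k y) = (LINT x|lborel. \<beta> y * (\<alpha> x * w (x, y)))"
        using \<alpha>(2) by (simp add: k_def A_def)
      then show "A * (\<beta> y * k y) = (LINT x|lborel. \<alpha> x * \<beta> y * w (x, y))"
        by (simp add: algebra_simps)
    qed
    also have "(LINT y|lborel. LINT x|lborel. \<alpha> x * \<beta> y * w (x, y)) =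
       (LINT p|lborel. \<alpha> (fst p) * \<beta> (snd p) * w p)"
      using integrable_lborel_snd(1)[OF tint[OF \<alpha>(1) \<beta> w]] by simp
    finally have "(LINT p|lborel. \<phi> (fst p) * \<beta> (snd p) * (indicator B p * k (snd p))) =
       (LINT p|lborel. \<phi> (fst p) * \<beta> (snd p) * w p)" using 1 by simp
    then show "(LINT p|lborel. \<phi> (fst p) * \<beta> (snd p) * (w p - indicator B p * k (snd p))) = 0"
      using tint[OF \<phi> \<beta> w] tint[OF \<phi> \<beta> wk] by (simp add: right_diff_distrib)
  qed
  then have "AE p in lborel. p \<in> {a<..<b} \<times> {c<..<d} \<longrightarrow> \<bar>u p - k (snd p)\<bar> \<le> I (snd p)"
    using VI
  proof eventually_elim
    case (elim p)
    show ?case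
    proof
      assume "p \<in> {a<..<b} \<times> {c<..<d}"
      then have "p \<in> B" by (simp add: B_def)
      with elim have "u p - k (snd p) = V p" by (simp add: w_def)
      with elim \<open>p \<in> B\<close> show "\<bar>u p - k (snd p)\<bar> \<le> I (snd p)" by simp
    qed
  qed
  then show ?thesis using that[OF k] by (simp add: I_def)
qed

section \<open>Sobolev and Poincare inequalities\<close>

text \<open>The polynomial t^2 P - 2 t R + Q is the integral of a square, hence nonnegative for all
  t; its value at t = R / P gives the inequality.\<close>

lemma integral_Cauchy_Schwarz:
  fixes f g :: "'a \<Rightarrow> real"
  assumes [measurable]: "f \<in> borel_measurable M" "g \<in> borel_measurable M"
    and f: "integrable M (\<lambda>x. (f x)\<^sup>2)" and g: "integrable M (\<lambda>x. (g x)\<^sup>2)"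
  shows "integrable M (\<lambda>x. f x * g x)"
    and "(LINT x|M. f x * g x)\<^sup>2 \<le> (LINT x|M. (f x)\<^sup>2) * (LINT x|M. (g x)\<^sup>2)"
proof -
  have le: "\<bar>x * y\<bar> \<le> x\<^sup>2 + y\<^sup>2" for x y :: real
  proof -
    have "2 * (\<bar>x\<bar> * \<bar>y\<bar>) \<le> x\<^sup>2 + y\<^sup>2" "0 \<le> \<bar>x\<bar> * \<bar>y\<bar>"
      using zero_le_power2[of "\<bar>x\<bar> - \<bar>y\<bar>"] by (simp_all add: power2_diff)
    then show ?thesis unfolding abs_mult by linarith
  qed
  show fg: "integrable M (\<lambda>x. f x * g x)"
    by (rule Bochner_Integration.integrable_bound[OF Bochner_Integration.integrable_add[OF f g]]) (use le in auto)
  define P Q R where "P = (LINT x|M. (f x)\<^sup>2)" and "Q = (LINT x|M. (g x)\<^sup>2)" and "R = (LINT x|M. f x * g x)"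
  have pos: "0 \<le> t\<^sup>2 * P - 2 * t * R + Q" for t
  proof -
    have "0 \<le> (LINT x|M. (t * f x - g x)\<^sup>2)" by simp
    also have "\<dots> = (LINT x|M. t\<^sup>2 * (f x)\<^sup>2 - 2 * t * (f x * g x) + (g x)\<^sup>2)"
      by (rule Bochner_Integration.integral_cong) (auto simp: power2_eq_square algebra_simps)
    also have "\<dots> = t\<^sup>2 * P - 2 * t * R + Q"
      unfolding P_def Q_def R_def using f g fg by simp
    finally show ?thesis .
  qed
  have "P \<ge> 0" by (simp add: P_def)
  have "R\<^sup>2 \<le> P * Q"
  proof (cases "P = 0")
    case True
    have "R = 0"
    proof (rule ccontr)
      assume "R \<noteq> 0"
      \<comment> \<open>For P = 0 the polynomial is linear, and at this point its value is
        -1.\<close>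
      then show False using pos[of "(Q + 1) / (2 * R)"] True by simp
    qed
    then show ?thesis using True by simp
  next
    case False
    then have "P > 0" using \<open>P \<ge> 0\<close> by simp
    then show ?thesis using pos[of "R / P"] by (simp add: field_simps power2_eq_square)
  qed
  then show "(LINT x|M. f x * g x)\<^sup>2 \<le> (LINT x|M. (f x)\<^sup>2) * (LINT x|M. (g x)\<^sup>2)"
    by (simp add: P_def Q_def R_def)
qed

lemma Cauchy_Schwarz_interval:
  fixes f :: "real \<Rightarrow> real"
  assumes [measurable]: "f \<in> borel_measurable borel" and f: "integrable lborel (\<lambda>x. (f x)\<^sup>2)" and "a \<le> b"
  shows "integrable lborel (\<lambda>x. indicator {a<..<b} x * \<bar>f x\<bar>)"
    and "(LINT x|lborel. indicator {a<..<b} x * \<bar>f x\<bar>)\<^sup>2 \<le> (b - a) * (LINT x|lborel. indicator {a<..<b} x * (f x)\<^sup>2)"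
proof -
  define J :: "real \<Rightarrow> real" where "J = indicator {a<..<b}"
  have J2: "(J x)\<^sup>2 = J x" "J x * (J x * y) = J x * y" for x y by (auto simp: J_def indicator_def)
  have J: "integrable lborel J" "(LINT x|lborel. J x) = b - a" using assms(3) by (auto simp: J_def intro!: integrable_real_indicator)
  have [measurable]: "J \<in> borel_measurable borel" by (simp add: J_def)
  have "integrable lborel (\<lambda>x. (J x * \<bar>f x\<bar>)\<^sup>2)"
    by (rule Bochner_Integration.integrable_bound[OF f]) (auto simp: J_def indicator_def)
  then have *: "integrable lborel (\<lambda>x. J x * (J x * \<bar>f x\<bar>))"
    "(LINT x|lborel. J x * (J x * \<bar>f x\<bar>))\<^sup>2 \<le> (LINT x|lborel. (J x)\<^sup>2) * (LINT x|lborel. (J x * \<bar>f x\<bar>)\<^sup>2)"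
    using J(1) by (intro integral_Cauchy_Schwarz; simp add: J2)+
  show "integrable lborel (\<lambda>x. indicator {a<..<b} x * \<bar>f x\<bar>)"
    using *(1) by (simp add: J2 J_def[symmetric])
  show "(LINT x|lborel. indicator {a<..<b} x * \<bar>f x\<bar>)\<^sup>2 \<le> (b - a) * (LINT x|lborel. indicator {a<..<b} x * (f x)\<^sup>2)"
    using *(2) by (simp add: J2 J(2) J_def[symmetric] power_mult_distrib)
qed

section \<open>Exchanging the two coordinates\<close>

lemma lborel_swap:
  shows "distr lborel borel prod.swap = (lborel :: R2 measure)"
proof -
  have "(lborel :: R2 measure) = distr (lborel \<Otimes>\<^sub>M lborel) (lborel \<Otimes>\<^sub>M lborel) (\<lambda>(x, y). (y, x))"
    using lborel_pair.distr_pair_swap by (simp add: lborel_prod)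
  also have "\<dots> = distr lborel borel prod.swap"
    unfolding lborel_prod by (rule distr_cong) auto
  finally show ?thesis ..
qed

lemma swap_measurable [measurable]: "prod.swap \<in> borel_measurable (borel :: R2 measure)"
  by (intro borel_measurable_continuous_onI continuous_on_swap)

lemma integral_lborel_swap:
  fixes f :: "R2 \<Rightarrow> real"
  assumes [measurable]: "f \<in> borel_measurable borel"
  shows "integrable lborel (\<lambda>p. f (prod.swap p)) \<longleftrightarrow> integrable lborel f"
    "(LINT p|lborel. f (prod.swap p)) = (LINT p|lborel. f p)"
  using integrable_distr_eq[of prod.swap "lborel :: R2 measure" borel f] integral_distr[of prod.swap "lborel :: R2 measure" borel f]
  by (simp_all add: lborel_swap)

lemma AE_lborel_swap:
  assumes "AE p in (lborel :: R2 measure). P p"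
  shows "AE p in (lborel :: R2 measure). P (prod.swap p)"
proof -
  have "AE p in distr lborel borel (prod.swap :: R2 \<Rightarrow> R2). P p" using assms unfolding lborel_swap .
  then obtain N where N: "N \<in> null_sets (distr lborel borel (prod.swap :: R2 \<Rightarrow> R2))" "{p. \<not> P p} \<subseteq> N"
    by (auto simp: eventually_ae_filter)
  then have "prod.swap -` N \<in> null_sets (lborel :: R2 measure)"
    using measurable_sets[OF swap_measurable, of N] by (auto simp: null_sets_def emeasure_distr)
  then show ?thesis by (rule AE_I') (use N(2) in auto)
qed

lemma AE_lborel_slices:
  assumes "AE p in (lborel :: R2 measure). P p"
  shows "AE y in lborel. AE x in lborel. P (x, y)"
proof -
  have "AE p in (lborel \<Otimes>\<^sub>M lborel :: R2 measure). P (prod.swap p)"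
    using AE_lborel_swap[OF assms] unfolding lborel_prod .
  from lborel_pair.AE_pair[OF this] show ?thesis by simp
qed

section \<open>Bounds along slices and the L4 embedding\<close>

text \<open>\<open>U\<close> and \<open>V\<close> are defined on the whole plane, \<open>U\<close> extended by 0, and \<open>V\<close> is the weak derivative of \<open>U\<close>
  in the first variable on \<open>\<Omega>\<close>, tested on products only. The second variable is treated by swapping.\<close>

definition weak_x :: "R2 set \<Rightarrow> (R2 \<Rightarrow> real) \<Rightarrow> (R2 \<Rightarrow> real) \<Rightarrow> bool" where
  "weak_x \<Omega> U V \<longleftrightarrow> U \<in> borel_measurable borel \<and> V \<in> borel_measurable borel \<and>
     (\<forall>p. p \<notin> \<Omega> \<longrightarrow> U p = 0) \<and>
     integrable lborel U \<and> integrable lborel V \<and>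
     integrable lborel (\<lambda>p. (U p)\<^sup>2) \<and> integrable lborel (\<lambda>p. (V p)\<^sup>2) \<and>
     (\<forall>a b c d \<Phi> \<psi> \<beta>. {a<..<b} \<times> {c<..<d} \<subseteq> \<Omega> \<longrightarrow> test1 a b \<Phi> \<longrightarrow> test1 c d \<beta> \<longrightarrow>
        (\<forall>x. (\<Phi> has_real_derivative \<psi> x) (at x)) \<longrightarrow>
        (LINT p|lborel. \<psi> (fst p) * \<beta> (snd p) * U p) = - (LINT p|lborel. \<Phi> (fst p) * \<beta> (snd p) * V p))"

lemma weak_x_oscillation:
  assumes "weak_x \<Omega> U V" and "{a<..<b} \<times> {c<..<d} \<subseteq> \<Omega>" and "a < b"
  obtains k where "integrable lborel k"
    "AE y in lborel. y \<in> {c<..<d} \<longrightarrow> (AE x in lborel. x \<in> {a<..<b} \<longrightarrow>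
      \<bar>U (x, y) - k y\<bar> \<le> (LINT t|lborel. indicator {a<..<b} t * \<bar>V (t, y)\<bar>))"
proof -
  have UV: "integrable lborel U" "integrable lborel V"
    and H: "\<And>\<Phi> \<psi> \<beta>. test1 a b \<Phi> \<Longrightarrow> test1 c d \<beta> \<Longrightarrow> (\<And>x. (\<Phi> has_real_derivative \<psi> x) (at x)) \<Longrightarrow>
      (LINT p|lborel. \<psi> (fst p) * \<beta> (snd p) * U p) = - (LINT p|lborel. \<Phi> (fst p) * \<beta> (snd p) * V p)"
    using assms unfolding weak_x_def by blast+
  obtain k where k: "integrable lborel k" "AE p in lborel. p \<in> {a<..<b} \<times> {c<..<d} \<longrightarrow>
      \<bar>U p - k (snd p)\<bar> \<le> (LINT t|lborel. indicator {a<..<b} t * \<bar>V (t, snd p)\<bar>)"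
    by (rule oscillation_on_box[OF UV \<open>a < b\<close> H]) blast+
  from AE_lborel_slices[OF k(2)] have "AE y in lborel. y \<in> {c<..<d} \<longrightarrow> (AE x in lborel. x \<in> {a<..<b} \<longrightarrow>
      \<bar>U (x, y) - k y\<bar> \<le> (LINT t|lborel. indicator {a<..<b} t * \<bar>V (t, y)\<bar>))"
    by eventually_elim (auto elim: eventually_mono)
  then show ?thesis using that[OF k(1)] by blast
qed

lemma integrable_lborel_slices:
  fixes V :: "R2 \<Rightarrow> real"
  assumes [measurable]: "V \<in> borel_measurable borel" and "integrable lborel (\<lambda>p. (V p)\<^sup>2)"
  shows "AE y in lborel. (\<lambda>x. V (x, y)) \<in> borel_measurable borel \<and> integrable lborel (\<lambda>x. (V (x, y))\<^sup>2)"
proof -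
  have [measurable]: "V \<in> borel_measurable (borel \<Otimes>\<^sub>M borel)" by (simp add: borel_prod)
  show ?thesis using integrable_lborel_snd(2)[OF assms(2)] by eventually_elim auto
qed

text \<open>The one-dimensional Sobolev bound on a slice. The oscillation satisfies I^2 \<le> m SV;
  averaging k^2 \<le> 2 U^2 + 2 I^2 over (a, b) gives k^2 \<le> 2 SU / l + 2 I^2; then U^2 \<le> 2
  k^2 + 2 I^2 produces the constants 4 / l and 6 m. The integrals on the right run over the whole
  line, so the bound is the same for all rectangles that meet the slice.\<close>

lemma weak_x_sup_bound:
  assumes w: "weak_x \<Omega> U V" and sub: "{a<..<b} \<times> {c<..<d} \<subseteq> \<Omega>" and l: "0 < l" "l \<le> b - a" "b - a \<le> m"
  shows "AE y in lborel. y \<in> {c<..<d} \<longrightarrow> (AE x in lborel. x \<in> {a<..<b} \<longrightarrow>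
     (U (x, y))\<^sup>2 \<le> (LINT t|lborel. 4 / l * (U (t, y))\<^sup>2 + 6 * m * (V (t, y))\<^sup>2))"
proof -
  have ab: "a < b" using l by simp
  have UV: "U \<in> borel_measurable borel" "integrable lborel (\<lambda>p. (U p)\<^sup>2)"
    "V \<in> borel_measurable borel" "integrable lborel (\<lambda>p. (V p)\<^sup>2)"
    using w unfolding weak_x_def by auto
  obtain k where k: "AE y in lborel. y \<in> {c<..<d} \<longrightarrow> (AE x in lborel. x \<in> {a<..<b} \<longrightarrow>
      \<bar>U (x, y) - k y\<bar> \<le> (LINT t|lborel. indicator {a<..<b} t * \<bar>V (t, y)\<bar>))"
    by (rule weak_x_oscillation[OF w sub ab]) blast
  show ?thesis
    using k integrable_lborel_slices[OF UV(1,2)] integrable_lborel_slices[OF UV(3,4)]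
  proof eventually_elim
    case (elim y)
    define I where "I = (LINT t|lborel. indicator {a<..<b} t * \<bar>V (t, y)\<bar>)"
    define J :: "real \<Rightarrow> real" where "J = indicator {a<..<b}"
    define SU where "SU = (LINT t|lborel. (U (t, y))\<^sup>2)"
    define SV where "SV = (LINT t|lborel. (V (t, y))\<^sup>2)"
    have [measurable]: "(\<lambda>x. U (x, y)) \<in> borel_measurable borel" "(\<lambda>x. V (x, y)) \<in> borel_measurable borel"
      using elim by auto
    have [measurable]: "J \<in> borel_measurable borel" by (simp add: J_def)
    have J: "integrable lborel J" "(LINT x|lborel. J x) = b - a"
      using ab by (auto simp: J_def intro!: integrable_real_indicator)
    have JU: "integrable lborel (\<lambda>t. J t * (U (t, y))\<^sup>2)"
      by (rule Bochner_Integration.integrable_bound[of _ "\<lambda>x. (U (x, y))\<^sup>2"]) (use elim in \<open>auto simp: J_def indicator_def\<close>)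
    have JV: "integrable lborel (\<lambda>t. J t * (V (t, y))\<^sup>2)"
      by (rule Bochner_Integration.integrable_bound[of _ "\<lambda>x. (V (x, y))\<^sup>2"]) (use elim in \<open>auto simp: J_def indicator_def\<close>)
    have "I\<^sup>2 \<le> (b - a) * (LINT t|lborel. J t * (V (t, y))\<^sup>2)"
      unfolding I_def J_def by (rule Cauchy_Schwarz_interval) (use elim ab in auto)
    also have "\<dots> \<le> (b - a) * SV"
      unfolding SV_def using elim ab JV by (intro mult_left_mono integral_mono) (auto simp: J_def indicator_def)
    finally have I2: "I\<^sup>2 \<le> (b - a) * SV" .
    show ?case
    proof
      assume "y \<in> {c<..<d}"
      with elim have osc: "AE x in lborel. x \<in> {a<..<b} \<longrightarrow> \<bar>U (x, y) - k y\<bar> \<le> I" by (simp add: I_def)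
      have sq: "r\<^sup>2 \<le> 2 * s\<^sup>2 + 2 * I\<^sup>2" if "\<bar>r - s\<bar> \<le> I" for r s :: real
      proof -
        have "(r - s)\<^sup>2 \<le> I\<^sup>2" using that by (metis abs_ge_zero order_trans power2_abs power_mono)
        moreover have "r\<^sup>2 \<le> 2 * s\<^sup>2 + 2 * (r - s)\<^sup>2"
          using zero_le_power2[of "r - 2 * s"] by (simp add: power2_eq_square algebra_simps)
        ultimately show ?thesis by linarith
      qed
      have "(LINT x|lborel. J x * (k y)\<^sup>2) \<le> (LINT x|lborel. 2 * (J x * (U (x, y))\<^sup>2) + J x * (2 * I\<^sup>2))"
      proof (rule integral_mono_AE)
        show "AE x in lborel. J x * (k y)\<^sup>2 \<le> 2 * (J x * (U (x, y))\<^sup>2) + J x * (2 * I\<^sup>2)"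
          using osc by eventually_elim (use sq in \<open>auto simp: J_def indicator_def abs_minus_commute\<close>)
      qed (use J JU in auto)
      also have "\<dots> = 2 * (LINT x|lborel. J x * (U (x, y))\<^sup>2) + (b - a) * (2 * I\<^sup>2)"
        using J JU by simp
      also have "(LINT x|lborel. J x * (U (x, y))\<^sup>2) \<le> SU"
        unfolding SU_def using elim JU by (intro integral_mono) (auto simp: J_def indicator_def)
      finally have "(b - a) * (k y)\<^sup>2 \<le> 2 * SU + (b - a) * (2 * I\<^sup>2)" using J by simp
      then have "(k y)\<^sup>2 \<le> (2 * SU + (b - a) * (2 * I\<^sup>2)) / (b - a)" using ab by (simp add: field_simps)
      also have "\<dots> = 2 * SU / (b - a) + 2 * I\<^sup>2" using ab by (simp add: field_simps)
      also have "2 * SU / (b - a) \<le> 2 * SU / l"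
        using l ab by (intro divide_left_mono) (auto simp: SU_def)
      finally have ky: "(k y)\<^sup>2 \<le> 2 * SU / l + 2 * I\<^sup>2" by simp
      have "I\<^sup>2 \<le> m * SV" using I2 l(3) mult_right_mono[of "b - a" m SV] by (simp add: SV_def)
      moreover have "(LINT t|lborel. 4 / l * (U (t, y))\<^sup>2 + 6 * m * (V (t, y))\<^sup>2) = 4 / l * SU + 6 * m * SV"
        unfolding SU_def SV_def using elim by simp
      ultimately have "2 * (k y)\<^sup>2 + 2 * I\<^sup>2 \<le> (LINT t|lborel. 4 / l * (U (t, y))\<^sup>2 + 6 * m * (V (t, y))\<^sup>2)"
        using ky by simp
      with osc show "AE x in lborel. x \<in> {a<..<b} \<longrightarrow>
         (U (x, y))\<^sup>2 \<le> (LINT t|lborel. 4 / l * (U (t, y))\<^sup>2 + 6 * m * (V (t, y))\<^sup>2)"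
        by (auto elim!: eventually_mono intro: order_trans[OF sq])
    qed
  qed
qed

lemma AE_lborel_slicesI:
  assumes [measurable]: "Measurable.pred borel (P :: R2 \<Rightarrow> bool)"
    and "AE y in lborel. AE x in lborel. P (x, y)"
  shows "AE p in (lborel :: R2 measure). P p"
proof -
  have 1: "{p \<in> space (lborel \<Otimes>\<^sub>M lborel). P (prod.swap p)} \<in> sets (lborel \<Otimes>\<^sub>M lborel)"
    unfolding lborel_prod by measurable
  have "AE p in lborel \<Otimes>\<^sub>M lborel. P (prod.swap p)"
    by (rule lborel_pair.AE_pair_measure[OF 1]) (use assms(2) in auto)
  then have "AE p in (lborel :: R2 measure). P (prod.swap p)" unfolding lborel_prod .
  from AE_lborel_swap[OF this] show ?thesis by simp
qed

text \<open>Only the horizontal side is controlled. The vertical one may be as thin as the point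
  demands, so that points close to a slanted boundary edge qualify.\<close>

definition wide :: "R2 set \<Rightarrow> real \<Rightarrow> real \<Rightarrow> bool" where
  "wide \<Omega> l m \<longleftrightarrow> (\<forall>p\<in>\<Omega>. \<exists>a b c d. p \<in> {a<..<b} \<times> {c<..<d} \<and> {a<..<b} \<times> {c<..<d} \<subseteq> \<Omega> \<and>
     l \<le> b - a \<and> b - a \<le> m)"

text \<open>The rectangles provided by \<open>wide\<close> are uncountably many; Lindelof leaves
  countably many with the same union, so the exceptional null sets can be united. The absolute value
  makes the bound trivially true off \<Omega>, where \<open>U\<close> is 0.\<close>

lemma weak_x_sup_bound_wide:
  assumes w: "weak_x \<Omega> U V" and wide: "wide \<Omega> l m" and l: "0 < l"
  defines "K \<equiv> \<lambda>y. LINT t|lborel. 4 / l * (U (t, y))\<^sup>2 + 6 * m * (V (t, y))\<^sup>2"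
  shows "integrable lborel K" "AE p in lborel. (U p)\<^sup>2 \<le> \<bar>K (snd p)\<bar>"
proof -
  have U[measurable]: "U \<in> borel_measurable borel" "\<And>p. p \<notin> \<Omega> \<Longrightarrow> U p = 0" and
    UV: "integrable lborel (\<lambda>p. 4 / l * (U p)\<^sup>2 + 6 * m * (V p)\<^sup>2)"
    using w unfolding weak_x_def by auto
  show K: "integrable lborel K" unfolding K_def using integrable_lborel_snd(3)[OF UV] .
  then have [measurable]: "K \<in> borel_measurable borel" by auto
  define \<F> where "\<F> = {R. \<exists>a b c d. R = {a<..<b} \<times> {c<..<d} \<and> R \<subseteq> \<Omega> \<and> l \<le> b - a \<and> b - a \<le> m}"
  have op: "open R" if "R \<in> \<F>" for R using that by (auto simp: \<F>_def intro: open_Times)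
  obtain \<F>' where F': "\<F>' \<subseteq> \<F>" "countable \<F>'" "\<Union> \<F>' = \<Union> \<F>" using Lindelof[of \<F>] op by metis
  have "AE p in lborel. p \<in> R \<longrightarrow> (U p)\<^sup>2 \<le> K (snd p)" if "R \<in> \<F>'" for R
  proof -
    obtain a b c d where R: "R = {a<..<b} \<times> {c<..<d}" "R \<subseteq> \<Omega>" "l \<le> b - a" "b - a \<le> m"
    proof -
      have "R \<in> \<F>" using \<open>R \<in> \<F>'\<close> F'(1) by blast
      then show thesis using that unfolding \<F>_def by blast
    qed
    have [measurable]: "R \<in> sets borel" using op that F' by (intro borel_open) auto
    show ?thesis
    proof (rule AE_lborel_slicesI)
      show "AE y in lborel. AE x in lborel. (x, y) \<in> R \<longrightarrow> (U (x, y))\<^sup>2 \<le> K (snd (x, y))"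
        using weak_x_sup_bound[OF w _ l R(3,4), of c d] R(2) unfolding R(1) K_def
        by (auto elim!: eventually_mono)
    qed measurable
  qed
  then have "AE p in lborel. \<forall>R\<in>\<F>'. p \<in> R \<longrightarrow> (U p)\<^sup>2 \<le> K (snd p)"
    unfolding AE_ball_countable[OF F'(2)] by blast
  then show "AE p in lborel. (U p)\<^sup>2 \<le> \<bar>K (snd p)\<bar>"
  proof eventually_elim
    case (elim p)
    show ?case
    proof (cases "p \<in> \<Omega>")
      case True
      then obtain a b c d where "p \<in> {a<..<b} \<times> {c<..<d}" "{a<..<b} \<times> {c<..<d} \<subseteq> \<Omega>" "l \<le> b - a" "b - a \<le> m"
        using bspec[OF wide[unfolded wide_def] True] by (elim exE conjE) (rule that)
      from this(2-4) have "{a<..<b} \<times> {c<..<d} \<in> \<F>" unfolding \<F>_def by blast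
      then have "p \<in> \<Union> \<F>" using \<open>p \<in> {a<..<b} \<times> {c<..<d}\<close> by blast
      then have "p \<in> \<Union> \<F>'" using F' by simp
      then show ?thesis using elim by force
    qed (simp add: U)
  qed
qed

text \<open>Gagliardo's argument: U^2 is bounded by an integrable function of y and, after swapping,
  by an integrable function of x, hence U^4 by the product of the two.\<close>

lemma L4_embedding:
  assumes x: "weak_x \<Omega> U V" and y: "weak_x (prod.swap ` \<Omega>) (\<lambda>p. U (prod.swap p)) W"
    and wide: "wide \<Omega> l m" "wide (prod.swap ` \<Omega>) l m" and l: "0 < l"
  shows "integrable lborel (\<lambda>p. (U p) ^ 4)"
proof -
  have [measurable]: "U \<in> borel_measurable borel" using x by (simp add: weak_x_def)
  obtain K where K: "integrable lborel K" "AE p in lborel. (U p)\<^sup>2 \<le> \<bar>K (snd p)\<bar>"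
    using weak_x_sup_bound_wide[OF x wide(1) l] by blast
  obtain L where L: "integrable lborel L" "AE p in lborel. (U (prod.swap p))\<^sup>2 \<le> \<bar>L (snd p)\<bar>"
    using weak_x_sup_bound_wide[OF y wide(2) l] by blast
  have L': "AE p in lborel. (U p)\<^sup>2 \<le> \<bar>L (fst p)\<bar>" using AE_lborel_swap[OF L(2)] by simp
  show ?thesis
  proof (rule Bochner_Integration.integrable_bound[OF integrable_lborel_prod(1)[OF L(1) K(1)]])
    show "AE p in lborel. norm ((U p) ^ 4) \<le> norm (L (fst p) * K (snd p))"
      using K(2) L'
    proof eventually_elim
      case (elim p)
      have "(U p) ^ 4 = (U p)\<^sup>2 * (U p)\<^sup>2" by (simp add: power2_eq_square power4_eq_xxxx)
      also have "\<dots> \<le> \<bar>L (fst p)\<bar> * \<bar>K (snd p)\<bar>" using elim by (intro mult_mono) auto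
      finally show ?case by (simp add: abs_mult)
    qed
  qed simp
qed

text \<open>On horizontal slices \<open>U\<close> stays within A(y) of k(y), on vertical ones within
  B(x) of l(x). Averaging over x puts k(y) within A(y) + m of a constant \<open>e\<close>, so
  \<open>U\<close> is within 2 A(y) + m of \<open>e\<close>. Squaring, integrating and
  Cauchy-Schwarz give the gradient term, and passing from \<open>e\<close> to the mean of
  \<open>U\<close> only lowers the square deviation.\<close>

lemma Poincare_square:
  assumes x: "weak_x \<Omega> U V" and y: "weak_x (prod.swap ` \<Omega>) (\<lambda>p. U (prod.swap p)) (\<lambda>p. W (prod.swap p))"
    and h: "0 < h" and sub: "{a<..<a + h} \<times> {c<..<c + h} \<subseteq> \<Omega>"
  defines "Q \<equiv> indicator ({a<..<a + h} \<times> {c<..<c + h}) :: R2 \<Rightarrow> real"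
  shows "(LINT p|lborel. Q p * (U p)\<^sup>2) \<le>
    (LINT p|lborel. Q p * U p)\<^sup>2 / h\<^sup>2 + 8 * h\<^sup>2 * (LINT p|lborel. Q p * ((V p)\<^sup>2 + (W p)\<^sup>2))"
proof -
  define I J :: "real \<Rightarrow> real" where "I = indicator {a<..<a + h}" and "J = indicator {c<..<c + h}"
  have Q: "Q p = I (fst p) * J (snd p)" for p
    by (cases p) (auto simp: Q_def I_def J_def indicator_def)
  have [measurable]: "I \<in> borel_measurable borel" "J \<in> borel_measurable borel" by (auto simp: I_def J_def)
  have Q_meas[measurable]: "Q \<in> borel_measurable borel" unfolding Q by (intro borel_measurable_times measurable_comp_fst measurable_comp_snd) auto
  have I: "integrable lborel I" "(LINT x|lborel. I x) = h" and J: "integrable lborel J" "(LINT x|lborel. J x) = h"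
    using h by (auto simp: I_def J_def intro!: integrable_real_indicator)
  have Qi: "integrable lborel Q" "(LINT p|lborel. Q p) = h\<^sup>2"
    unfolding Q using integrable_lborel_prod[OF I(1) J(1)] I J by (auto simp: power2_eq_square)
  have IJ01: "0 \<le> I t" "I t \<le> 1" "0 \<le> J t" "J t \<le> 1" "(I t)\<^sup>2 = I t" for t by (auto simp: I_def J_def indicator_def)
  have Q01: "0 \<le> Q p" "\<bar>Q p\<bar> \<le> 1" "(Q p)\<^sup>2 = Q p" for p by (auto simp: Q_def indicator_def)
  have Qint: "integrable lborel (\<lambda>p. Q p * f p)" if "integrable lborel f" for f
    using integrable_bounded_mult[of Q lborel 1 f] Q01(2) that by simp
  have U[measurable]: "U \<in> borel_measurable borel" and V[measurable]: "V \<in> borel_measurable borel"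
    and U1: "integrable lborel U" and V1: "integrable lborel V"
    and U2: "integrable lborel (\<lambda>p. (U p)\<^sup>2)" and V2: "integrable lborel (\<lambda>p. (V p)\<^sup>2)"
    using x by (auto simp: weak_x_def)
  have W'[measurable]: "(\<lambda>p. W (prod.swap p)) \<in> borel_measurable borel"
    and W'1: "integrable lborel (\<lambda>p. W (prod.swap p))"
    and W'2: "integrable lborel (\<lambda>p. (W (prod.swap p))\<^sup>2)"
    using y by (auto simp: weak_x_def)
  have W[measurable]: "W \<in> borel_measurable borel"
    using measurable_compose[OF swap_measurable W'] by simp
  have W2: "integrable lborel (\<lambda>p. (W p)\<^sup>2)"
    using W'2 integral_lborel_swap(1)[of "\<lambda>p. (W p)\<^sup>2"] by simp
  have W1: "integrable lborel W"
    using W'1 integral_lborel_swap(1)[of "\<lambda>p. W p"] by simp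
  define A where "A y = (LINT t|lborel. I t * \<bar>V (t, y)\<bar>)" for y
  define B where "B x = (LINT t|lborel. J t * \<bar>W (x, t)\<bar>)" for x
  define G where "G y = (LINT t|lborel. I t * (V (t, y))\<^sup>2)" for y
  define H where "H x = (LINT t|lborel. J t * (W (x, t))\<^sup>2)" for x
  obtain k where k: "integrable lborel k" "AE y in lborel. y \<in> {c<..<c + h} \<longrightarrow>
     (AE x in lborel. x \<in> {a<..<a + h} \<longrightarrow> \<bar>U (x, y) - k y\<bar> \<le> A y)"
    unfolding A_def I_def by (rule weak_x_oscillation[OF x sub]) (use h in \<open>simp, blast\<close>)
  have sub': "{c<..<c + h} \<times> {a<..<a + h} \<subseteq> prod.swap ` \<Omega>" using sub by force
  obtain l where l: "integrable lborel l" "AE x in lborel. x \<in> {a<..<a + h} \<longrightarrow>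
     (AE y in lborel. y \<in> {c<..<c + h} \<longrightarrow> \<bar>U (x, y) - l x\<bar> \<le> B x)"
    unfolding B_def J_def
    by (rule weak_x_oscillation[OF y sub', unfolded swap_simp]) (use h in \<open>simp, blast\<close>)
  have IV: "integrable lborel (\<lambda>p. I (fst p) * (V p)\<^sup>2)"
    by (rule Bochner_Integration.integrable_bound[OF V2]) (use IJ01 in \<open>auto simp: abs_mult mult_left_le_one_le\<close>)
  have JW: "integrable lborel (\<lambda>p. J (fst p) * (W (prod.swap p))\<^sup>2)"
    by (rule Bochner_Integration.integrable_bound[OF W'2]) (use IJ01 in \<open>auto simp: abs_mult mult_left_le_one_le\<close>)
  have JW1: "integrable lborel (\<lambda>p. J (fst p) * \<bar>W (prod.swap p)\<bar>)"
    by (rule Bochner_Integration.integrable_bound[OF W'1]) (use IJ01 in \<open>auto simp: abs_mult mult_left_le_one_le\<close>)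
  have G: "integrable lborel G" unfolding G_def using integrable_lborel_snd(3)[OF IV] by simp
  have H: "integrable lborel H" unfolding H_def using integrable_lborel_snd(3)[OF JW] by simp
  have B: "integrable lborel B" unfolding B_def using integrable_lborel_snd(3)[OF JW1] by simp
  have [measurable]: "G \<in> borel_measurable borel" "H \<in> borel_measurable borel" "B \<in> borel_measurable borel"
    using G H B by auto
  have GV: "(LINT y|lborel. J y * G y) = (LINT p|lborel. Q p * (V p)\<^sup>2)"
  proof -
    have "(LINT x|lborel. Q (x, y) * (V (x, y))\<^sup>2) = (LINT x|lborel. J y * (I x * (V (x, y))\<^sup>2))" for y
      by (rule Bochner_Integration.integral_cong) (simp_all add: Q)
    then show ?thesis
      unfolding G_def by (subst integrable_lborel_snd(1)[OF Qint[OF V2]]) simp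
  qed
  have HW: "(LINT x|lborel. I x * H x) = (LINT p|lborel. Q p * (W p)\<^sup>2)"
  proof -
    have "(LINT p|lborel. Q p * (W p)\<^sup>2) = (LINT p|lborel. Q (prod.swap p) * (W (prod.swap p))\<^sup>2)"
      by (rule integral_lborel_swap(2)[symmetric]) measurable
    also have "\<dots> = (LINT x|lborel. I x * H x)"
    proof -
      have "integrable lborel (\<lambda>p. Q (prod.swap p) * (W (prod.swap p))\<^sup>2)"
        using integral_lborel_swap(1)[of "\<lambda>p. Q p * (W p)\<^sup>2"] Qint[OF W2] by simp
      from integrable_lborel_snd(1)[OF this] show ?thesis unfolding H_def by (simp add: Q mult_ac)
    qed
    finally show ?thesis ..
  qed
  have A2: "AE y in lborel. (A y)\<^sup>2 \<le> h * G y"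
    using integrable_lborel_slices[OF V V2]
  proof eventually_elim
    case (elim y)
    then show ?case
      using Cauchy_Schwarz_interval(2)[of "\<lambda>x. V (x, y)" a "a + h"] h by (auto simp: A_def G_def I_def)
  qed
  have B2: "AE x in lborel. (B x)\<^sup>2 \<le> h * H x"
    using integrable_lborel_slices[OF W' W'2]
  proof eventually_elim
    case (elim y)
    then show ?case
      using Cauchy_Schwarz_interval(2)[of "\<lambda>x. W (y, x)" c "c + h"] h by (auto simp: B_def H_def J_def)
  qed
  have Iint: "integrable lborel (\<lambda>p. I p * f p)" if "integrable lborel f" for f
    using integrable_bounded_mult[of I lborel 1 f] IJ01 that by simp
  have Jint: "integrable lborel (\<lambda>p. J p * f p)" if "integrable lborel f" for f
    using integrable_bounded_mult[of J lborel 1 f] IJ01 that by simp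
  \<comment> \<open>\<open>e\<close> and \<open>m\<close> are the means of \<open>l\<close> and
    \<open>B\<close> over the horizontal side of the square.\<close>
  define e where "e = (LINT x|lborel. I x * l x) / h"
  define m where "m = (LINT x|lborel. I x * B x) / h"
  have m2: "m\<^sup>2 \<le> (LINT p|lborel. Q p * (W p)\<^sup>2)"
  proof -
    have IB2: "integrable lborel (\<lambda>x. I x * (B x)\<^sup>2)"
      by (rule Bochner_Integration.integrable_bound[OF Iint[OF integrable_mult_right[OF H, of h]]])
         (use B2 IJ01 in \<open>auto elim!: eventually_mono simp: abs_mult intro!: mult_left_mono order_trans[OF _ abs_ge_self[of "h * _", unfolded abs_mult]]\<close>)
    have "(LINT x|lborel. I x * (I x * B x))\<^sup>2 \<le> (LINT x|lborel. (I x)\<^sup>2) * (LINT x|lborel. (I x * B x)\<^sup>2)"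
      using IB2 I by (intro integral_Cauchy_Schwarz(2)) (auto simp: power_mult_distrib IJ01)
    moreover have "I x * (I x * B x) = I x * B x" for x using IJ01(5)[of x] by (simp add: power2_eq_square flip: mult.assoc)
    ultimately have "(LINT x|lborel. I x * B x)\<^sup>2 \<le> h * (LINT x|lborel. I x * (B x)\<^sup>2)"
      using I by (simp add: power_mult_distrib IJ01)
    also have "(LINT x|lborel. I x * (B x)\<^sup>2) \<le> (LINT x|lborel. I x * (h * H x))"
      by (rule integral_mono_AE[OF IB2 Iint]) (use H B2 IJ01 in \<open>auto elim!: eventually_mono intro!: mult_left_mono\<close>)
    also have "\<dots> = h * (LINT x|lborel. I x * H x)" by (simp add: mult.left_commute)
    finally show ?thesis using h HW by (simp add: m_def power_divide field_simps power2_eq_square)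
  qed
  have kB: "AE y in lborel. y \<in> {c<..<c + h} \<longrightarrow> \<bar>k y - e\<bar> \<le> A y + m"
  proof -
    \<comment> \<open>The bound for \<open>l\<close> is known for almost every x and then almost
      every y. As a measurable condition on the plane it can be read in the opposite order, which
      averaging over x at fixed y requires.\<close>
    define E where "E p \<longleftrightarrow> (p \<in> {a<..<a + h} \<times> {c<..<c + h} \<longrightarrow> \<bar>U p - l (fst p)\<bar> \<le> B (fst p))" for p
    have "AE p in lborel. E (prod.swap p)"
    proof (rule AE_lborel_slicesI)
      have [measurable]: "l \<in> borel_measurable borel" using l by auto
      have "(\<lambda>p. U p - l (fst p)) \<in> borel_measurable borel" "(\<lambda>p. B (fst p)) \<in> borel_measurable (borel :: R2 measure)"
        by (intro borel_measurable_diff measurable_comp_fst; simp)+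
      note [measurable] = this
      have [measurable]: "{a<..<a + h} \<times> {c<..<c + h} \<in> sets borel" by (intro borel_open open_Times) auto
      have "Measurable.pred borel E" unfolding E_def by measurable
      then show "Measurable.pred borel (\<lambda>p. E (prod.swap p))" by measurable
      show "AE x in lborel. AE y in lborel. E (prod.swap (y, x))"
        using l(2) by (auto simp: E_def elim!: eventually_mono)
    qed
    from AE_lborel_swap[OF this] have "AE p in lborel. E p" by simp
    from AE_lborel_slices[OF this] have "AE y in lborel. AE x in lborel. E (x, y)" .
    with k(2) show ?thesis
    proof eventually_elim
      case (elim y)
      show ?case
      proof
        assume y: "y \<in> {c<..<c + h}"
        with elim(1) have "AE x in lborel. x \<in> {a<..<a + h} \<longrightarrow> \<bar>U (x, y) - k y\<bar> \<le> A y" by blast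
        with elim(2) have ae: "AE x in lborel. \<bar>I x * k y - I x * l x\<bar> \<le> I x * A y + I x * B x"
          by eventually_elim (use y in \<open>auto simp: E_def I_def indicator_def\<close>)
        have int: "integrable lborel (\<lambda>x. I x * k y)" "integrable lborel (\<lambda>x. I x * l x)"
          "integrable lborel (\<lambda>x. I x * A y)" "integrable lborel (\<lambda>x. I x * B x)"
          using I Iint[OF l(1)] Iint[OF B] by auto
        have "\<bar>LINT x|lborel. I x * k y - I x * l x\<bar> \<le> (LINT x|lborel. I x * A y + I x * B x)"
          using ae int by (intro order_trans[OF integral_abs_bound] integral_mono_AE) auto
        then have "\<bar>h * k y - (LINT x|lborel. I x * l x)\<bar> \<le> h * A y + (LINT x|lborel. I x * B x)"
          using int I by simp
        then have "\<bar>h * (k y - e)\<bar> \<le> h * (A y + m)" using h by (simp add: e_def m_def right_diff_distrib distrib_left)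
        then show "\<bar>k y - e\<bar> \<le> A y + m" using h by (simp add: abs_mult)
      qed
    qed
  qed
  have UA: "AE p in lborel. Q p * (U p - e)\<^sup>2 \<le> 8 * h * (Q p * G (snd p)) + Q p * (2 * m\<^sup>2)"
  proof (rule AE_lborel_slicesI)
    have "(\<lambda>p. G (snd p)) \<in> borel_measurable (borel :: R2 measure)" by (rule measurable_comp_snd) simp
    note [measurable] = this
    show "Measurable.pred borel (\<lambda>p. Q p * (U p - e)\<^sup>2 \<le> 8 * h * (Q p * G (snd p)) + Q p * (2 * m\<^sup>2))"
      by measurable
    show "AE y in lborel. AE x in lborel. Q (x, y) * (U (x, y) - e)\<^sup>2 \<le> 8 * h * (Q (x, y) * G (snd (x, y))) + Q (x, y) * (2 * m\<^sup>2)"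
      using kB k(2) A2
    proof eventually_elim
      case (elim y)
      show ?case
      proof (cases "y \<in> {c<..<c + h}")
        case True
        with elim have ky: "\<bar>k y - e\<bar> \<le> A y + m" and ae: "AE x in lborel. x \<in> {a<..<a + h} \<longrightarrow> \<bar>U (x, y) - k y\<bar> \<le> A y" by auto
        show ?thesis using ae
        proof eventually_elim
          case (elim x)
          show ?case
          proof (cases "x \<in> {a<..<a + h}")
            case True
            then have "\<bar>U (x, y) - e\<bar> \<le> 2 * A y + m" using elim ky by auto
            then have "(U (x, y) - e)\<^sup>2 \<le> (2 * A y + m)\<^sup>2"
              by (metis abs_ge_zero order_trans power2_abs power_mono)
            also have "\<dots> \<le> 8 * (A y)\<^sup>2 + 2 * m\<^sup>2"
              using zero_le_power2[of "2 * A y - m"] by (simp add: power2_eq_square algebra_simps)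
            also have "\<dots> \<le> 8 * h * G y + 2 * m\<^sup>2" using \<open>(A y)\<^sup>2 \<le> h * G y\<close> by simp
            finally show ?thesis using Q01(1)[of "(x, y)"]
              mult_left_mono[of "(U (x, y) - e)\<^sup>2" "8 * h * G y + 2 * m\<^sup>2" "Q (x, y)"] by (simp add: algebra_simps)
          qed (simp add: Q I_def)
        qed
      qed (simp add: Q J_def)
    qed
  qed
  have QG: "integrable lborel (\<lambda>p. Q p * G (snd p))" "(LINT p|lborel. Q p * G (snd p)) = h * (LINT y|lborel. J y * G y)"
    using integrable_lborel_prod[OF I(1) Jint[OF G]] I(2) by (simp_all add: Q mult.assoc)
  have QU: "integrable lborel (\<lambda>p. Q p * U p)" "integrable lborel (\<lambda>p. Q p * (U p)\<^sup>2)"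
    using Qint U1 U2 by auto
  have exp: "Q p * (U p - e)\<^sup>2 = Q p * (U p)\<^sup>2 - 2 * e * (Q p * U p) + e\<^sup>2 * Q p" for p
    by (simp add: power2_eq_square algebra_simps)
  have "(LINT p|lborel. Q p * (U p - e)\<^sup>2) = (LINT p|lborel. Q p * (U p)\<^sup>2) - 2 * e * (LINT p|lborel. Q p * U p) + e\<^sup>2 * h\<^sup>2"
    unfolding exp using QU Qi by simp
  \<comment> \<open>A complete square: among all constants the mean of \<open>U\<close> gives the
    least square deviation, so \<open>e\<close> may be replaced by it.\<close>
  moreover have "(LINT p|lborel. Q p * U p)\<^sup>2 / h\<^sup>2 - 2 * e * (LINT p|lborel. Q p * U p) + e\<^sup>2 * h\<^sup>2 \<ge> 0"
    using zero_le_power2[of "(LINT p|lborel. Q p * U p) / h - e * h"] h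
    by (simp add: power2_eq_square algebra_simps)
  moreover have "(LINT p|lborel. Q p * (U p - e)\<^sup>2) \<le> (LINT p|lborel. 8 * h * (Q p * G (snd p)) + Q p * (2 * m\<^sup>2))"
    by (rule integral_mono_AE[OF _ _ UA]) (use QG QU Qi in \<open>auto simp: exp\<close>)
  moreover have "\<dots> = 8 * h\<^sup>2 * (LINT p|lborel. Q p * (V p)\<^sup>2) + h\<^sup>2 * (2 * m\<^sup>2)"
    using QG Qi GV by (simp add: power2_eq_square)
  moreover have "h\<^sup>2 * (2 * m\<^sup>2) \<le> h\<^sup>2 * (8 * (LINT p|lborel. Q p * (W p)\<^sup>2))"
  proof (rule mult_left_mono)
    have "0 \<le> (LINT p|lborel. Q p * (W p)\<^sup>2)" using Q01 by (intro integral_nonneg_AE) auto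
    then show "2 * m\<^sup>2 \<le> 8 * (LINT p|lborel. Q p * (W p)\<^sup>2)" using m2 by linarith
  qed simp
  moreover have "(LINT p|lborel. Q p * ((V p)\<^sup>2 + (W p)\<^sup>2)) = (LINT p|lborel. Q p * (V p)\<^sup>2) + (LINT p|lborel. Q p * (W p)\<^sup>2)"
    using Qint[OF V2] Qint[OF W2] by (simp add: distrib_left)
  ultimately show ?thesis by (simp add: distrib_left mult.assoc)
qed


section \<open>Dyadic squares inside a bounded open set\<close>

definition grid_square :: "nat \<Rightarrow> int \<times> int \<Rightarrow> R2 set" where
  "grid_square n q = {real_of_int (fst q) / 2 ^ n<..<real_of_int (fst q) / 2 ^ n + 1 / 2 ^ n} \<times>
     {real_of_int (snd q) / 2 ^ n<..<real_of_int (snd q) / 2 ^ n + 1 / 2 ^ n}"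

definition inner_squares :: "R2 set \<Rightarrow> nat \<Rightarrow> (int \<times> int) set" where
  "inner_squares \<Omega> n = {q. grid_square n q \<subseteq> \<Omega>}"

lemma grid_square_mem_iff:
  "p \<in> grid_square n q \<longleftrightarrow>
     real_of_int (fst q) < 2 ^ n * fst p \<and> 2 ^ n * fst p < real_of_int (fst q) + 1 \<and>
     real_of_int (snd q) < 2 ^ n * snd p \<and> 2 ^ n * snd p < real_of_int (snd q) + 1"
  by (cases p) (auto simp: grid_square_def field_simps)

lemma grid_square_measurable [measurable]: "grid_square n q \<in> sets borel"
  unfolding grid_square_def by (intro borel_open open_Times) auto

lemma finite_inner_squares:
  assumes "bounded \<Omega>"
  shows "finite (inner_squares \<Omega> n)"
proof -
  obtain R where R: "\<And>p. p \<in> \<Omega> \<Longrightarrow> norm p \<le> R" using assms bounded_iff by blast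
  define N where "N = \<lceil>2 ^ n * R\<rceil> + 1"
  have "inner_squares \<Omega> n \<subseteq> {-N..N} \<times> {-N..N}"
  proof
    fix q assume "q \<in> inner_squares \<Omega> n"
    \<comment> \<open>The centre of the square; the bound on its norm bounds the indices.\<close>
    moreover define p where "p = ((real_of_int (fst q) + 1/2) / 2 ^ n, (real_of_int (snd q) + 1/2) / 2 ^ n)"
    have "p \<in> grid_square n q" by (simp add: grid_square_mem_iff p_def)
    ultimately have "norm p \<le> R" using R[of p] by (auto simp: inner_squares_def)
    then have "\<bar>fst p\<bar> \<le> R" "\<bar>snd p\<bar> \<le> R"
      using norm_fst_le[of "fst p" "snd p"] norm_snd_le[of "snd p" "fst p"] by auto
    then have "\<bar>real_of_int (fst q) + 1/2\<bar> \<le> 2 ^ n * R" "\<bar>real_of_int (snd q) + 1/2\<bar> \<le> 2 ^ n * R"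
      by (simp_all add: p_def field_simps)
    then have "\<bar>real_of_int (fst q)\<bar> \<le> N" "\<bar>real_of_int (snd q)\<bar> \<le> N"
      using le_of_int_ceiling[of "2 ^ n * R"] unfolding N_def by linarith+
    then show "q \<in> {-N..N} \<times> {-N..N}" by (cases q) auto
  qed
  then show ?thesis by (rule finite_subset) auto
qed

lemma grid_square_disjoint:
  assumes "p \<in> grid_square n q" "p \<in> grid_square n q'"
  shows "q = q'"
proof -
  have "fst q = fst q'" "snd q = snd q'" using assms unfolding grid_square_mem_iff by linarith+
  then show ?thesis by (simp add: prod_eq_iff)
qed

text \<open>The indicator of the part of \<Omega> outside the inner squares. The form as a
  difference lets an integral over \<Omega> split linearly into the squares and the remainder; that
  the values are only 0 and 1 follows from disjointness of the open squares.\<close>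

definition uncovered :: "R2 set \<Rightarrow> nat \<Rightarrow> R2 \<Rightarrow> real" where
  "uncovered \<Omega> n p = indicator \<Omega> p - (\<Sum>q\<in>inner_squares \<Omega> n. indicator (grid_square n q) p)"

lemma uncovered_cases:
  assumes "bounded \<Omega>"
  shows "uncovered \<Omega> n p = (if p \<in> \<Omega> \<and> (\<forall>q\<in>inner_squares \<Omega> n. p \<notin> grid_square n q) then 1 else 0)"
proof (cases "\<exists>q\<in>inner_squares \<Omega> n. p \<in> grid_square n q")
  case True
  then obtain q where q: "q \<in> inner_squares \<Omega> n" "p \<in> grid_square n q" by blast
  have "(\<Sum>q\<in>inner_squares \<Omega> n. indicator (grid_square n q) p :: real) = (\<Sum>q'\<in>inner_squares \<Omega> n. if q' = q then 1 else 0)"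
  proof (rule sum.cong[OF refl])
    fix q'
    show "indicator (grid_square n q') p = (if q' = q then 1 else 0 :: real)"
    proof (cases "p \<in> grid_square n q'")
      case True
      then show ?thesis using grid_square_disjoint[OF True q(2)] by simp
    next
      case False
      then show ?thesis using q(2) by (cases "q' = q") simp_all
    qed
  qed
  also have "\<dots> = 1" using q finite_inner_squares[OF assms] by simp
  finally have "uncovered \<Omega> n p = indicator \<Omega> p - 1" by (simp add: uncovered_def)
  moreover have "p \<in> \<Omega>" using q by (auto simp: inner_squares_def)
  ultimately show ?thesis using True by simp
next
  case False
  then show ?thesis by (auto simp: uncovered_def indicator_def)
qed

text \<open>Off the countably many grid lines, a point whose ball of radius r lies in \<Omega>
  belongs to an inner square as soon as 2 / 2^n < r. Dominated convergence does the rest.\<close>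

lemma uncovered_integral_tendsto:
  assumes "open \<Omega>" "bounded \<Omega>"
  shows "integrable lborel (uncovered \<Omega> n)" "(\<lambda>n. LINT p|lborel. uncovered \<Omega> n p) \<longlonglongrightarrow> 0"
proof -
  have [measurable]: "\<Omega> \<in> sets borel" using assms by auto
  have fin: "emeasure lborel \<Omega> < \<infinity>" using emeasure_bounded_finite[OF assms(2)] by simp
  have \<Omega>: "integrable lborel (indicator \<Omega> :: R2 \<Rightarrow> real)" using fin by (auto intro: integrable_real_indicator)
  have meas: "uncovered \<Omega> n \<in> borel_measurable lborel" for n unfolding uncovered_def by measurable
  have bd: "norm (uncovered \<Omega> n p) \<le> indicator \<Omega> p" for n p
    using uncovered_cases[OF assms(2), of n p] by (auto simp: indicator_def)
  show "integrable lborel (uncovered \<Omega> n)"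
    by (rule Bochner_Integration.integrable_bound[OF \<Omega> meas]) (use bd in \<open>auto intro!: AE_I2 order_trans[OF bd]\<close>)
  have "AE x in lborel. \<forall>n::nat. \<forall>i::int. 2 ^ n * x \<noteq> real_of_int i"
    unfolding AE_all_countable
  proof (intro allI)
    fix n :: nat and i :: int
    show "AE x in lborel. 2 ^ n * x \<noteq> real_of_int i"
      using AE_lborel_singleton[of "real_of_int i / 2 ^ n"] by eventually_elim (auto simp: field_simps)
  qed
  from AE_lborel_snd[OF this] have 1: "AE p in (lborel :: R2 measure). \<forall>n::nat. \<forall>i::int. 2 ^ n * snd p \<noteq> real_of_int i" .
  from AE_lborel_swap[OF this] have 2: "AE p in (lborel :: R2 measure). \<forall>n::nat. \<forall>i::int. 2 ^ n * fst p \<noteq> real_of_int i" by simp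
  have "AE p in lborel. (\<lambda>n. uncovered \<Omega> n p) \<longlonglongrightarrow> 0"
    using 1 2
  proof eventually_elim
    case (elim p)
    show ?case
    proof (cases "p \<in> \<Omega>")
      case False
      then show ?thesis by (simp add: uncovered_cases[OF assms(2)])
    next
      case True
      then obtain r where r: "r > 0" "ball p r \<subseteq> \<Omega>" using assms(1) openE by blast
      have "(\<lambda>n. (1/2) ^ n) \<longlonglongrightarrow> (0::real)" by (rule LIMSEQ_realpow_zero) auto
      from order_tendstoD(2)[OF this, of "r / 2"] r have "\<forall>\<^sub>F n in sequentially. (1/2) ^ n < r / 2" by simp
      then have "\<forall>\<^sub>F n in sequentially. uncovered \<Omega> n p = 0"
      proof eventually_elim
        case (elim n)
        define q where "q = (\<lfloor>2 ^ n * fst p\<rfloor>, \<lfloor>2 ^ n * snd p\<rfloor>)"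
        have "real_of_int \<lfloor>2 ^ n * fst p\<rfloor> \<noteq> 2 ^ n * fst p" "real_of_int \<lfloor>2 ^ n * snd p\<rfloor> \<noteq> 2 ^ n * snd p"
          using \<open>\<forall>n i. 2 ^ n * fst p \<noteq> real_of_int i\<close> \<open>\<forall>n i. 2 ^ n * snd p \<noteq> real_of_int i\<close> by metis+
        then have pq: "p \<in> grid_square n q"
          unfolding grid_square_mem_iff q_def fst_conv snd_conv by linarith
        have "grid_square n q \<subseteq> ball p r"
        proof
          fix z assume z: "z \<in> grid_square n q"
          then have "\<bar>2 ^ n * fst z - 2 ^ n * fst p\<bar> < 1" "\<bar>2 ^ n * snd z - 2 ^ n * snd p\<bar> < 1"
            using pq unfolding grid_square_mem_iff by linarith+
          then have "2 ^ n * \<bar>fst z - fst p\<bar> < 1" "2 ^ n * \<bar>snd z - snd p\<bar> < 1"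
            by (simp_all flip: right_diff_distrib add: abs_mult)
          then have "\<bar>fst z - fst p\<bar> < (1/2) ^ n" "\<bar>snd z - snd p\<bar> < (1/2) ^ n"
            by (simp_all add: field_simps)
          then have "\<bar>fst (p - z)\<bar> + \<bar>snd (p - z)\<bar> < r" using elim by (simp add: abs_minus_commute)
          then show "z \<in> ball p r"
            using norm_Pair_le[of "fst (p - z)" "snd (p - z)"] unfolding prod.collapse by (simp add: dist_norm)
        qed
        then have "q \<in> inner_squares \<Omega> n" using r by (auto simp: inner_squares_def)
        then show ?case using pq by (auto simp: uncovered_cases[OF assms(2)])
      qed
      then show ?thesis by (rule tendsto_eventually)
    qed
  qed
  then have "(\<lambda>n. LINT p|lborel. uncovered \<Omega> n p) \<longlonglongrightarrow> (LINT p|(lborel :: R2 measure). 0)"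
    by (intro integral_dominated_convergence[OF _ meas \<Omega>]) (use bd in auto)
  then show "(\<lambda>n. LINT p|lborel. uncovered \<Omega> n p) \<longlonglongrightarrow> 0" by simp
qed

text \<open>Poincare on each inner square of side h = 1 / 2^n, where 1 / h^2 = 4^n and 8 h^2 = 8 /
  4^n; on the uncovered part, Cauchy-Schwarz against U^4. For families with bounded gradients in L2
  and bounded L4 norms the last two terms are uniformly small for large \<open>n\<close>, and the
  first involves finitely many numbers: compactness rests on this.\<close>

lemma L2_square_estimate:
  assumes \<Omega>: "open \<Omega>" "bounded \<Omega>"
    and x: "weak_x \<Omega> U V" and y: "weak_x (prod.swap ` \<Omega>) (\<lambda>p. U (prod.swap p)) (\<lambda>p. W (prod.swap p))"
    and U4: "integrable lborel (\<lambda>p. (U p) ^ 4)"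
  shows "(LINT p|lborel. (U p)\<^sup>2) \<le>
    (\<Sum>q\<in>inner_squares \<Omega> n. 4 ^ n * (LINT p|lborel. indicator (grid_square n q) p * U p)\<^sup>2)
    + 8 / 4 ^ n * (LINT p|lborel. (V p)\<^sup>2 + (W p)\<^sup>2)
    + sqrt (LINT p|lborel. uncovered \<Omega> n p) * sqrt (LINT p|lborel. (U p) ^ 4)"
proof -
  define S where "S = inner_squares \<Omega> n"
  define Q :: "int \<times> int \<Rightarrow> R2 \<Rightarrow> real" where "Q q = indicator (grid_square n q)" for q
  have [measurable]: "Q q \<in> borel_measurable borel" for q by (simp add: Q_def)
  have S: "finite S" unfolding S_def by (rule finite_inner_squares[OF \<Omega>(2)])
  have U0: "\<And>p. p \<notin> \<Omega> \<Longrightarrow> U p = 0" and [measurable]: "U \<in> borel_measurable borel"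
    and U2: "integrable lborel (\<lambda>p. (U p)\<^sup>2)" and V2: "integrable lborel (\<lambda>p. (V p)\<^sup>2)"
    using x by (auto simp: weak_x_def)
  have W'2: "integrable lborel (\<lambda>p. (W (prod.swap p))\<^sup>2)" and W': "(\<lambda>p. W (prod.swap p)) \<in> borel_measurable borel"
    using y by (auto simp: weak_x_def)
  have [measurable]: "W \<in> borel_measurable borel" using measurable_compose[OF swap_measurable W'] by simp
  have W2: "integrable lborel (\<lambda>p. (W p)\<^sup>2)"
    using W'2 integral_lborel_swap(1)[of "\<lambda>p. (W p)\<^sup>2"] by simp
  have Qint: "integrable lborel (\<lambda>p. Q q p * f p)" if "integrable lborel f" for f q
    using integrable_bounded_mult[of "Q q" lborel 1 f] that by (auto simp: Q_def indicator_def)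
  define s where "s = uncovered \<Omega> n"
  have s: "integrable lborel s" unfolding s_def by (rule uncovered_integral_tendsto(1)[OF \<Omega>])
  have s01: "(s p)\<^sup>2 = s p" "0 \<le> s p" "s p \<le> 1" for p unfolding s_def by (auto simp: uncovered_cases[OF \<Omega>(2)])
  have [measurable]: "s \<in> borel_measurable borel" using s by auto
  have sU: "integrable lborel (\<lambda>p. s p * (U p)\<^sup>2)"
    using integrable_bounded_mult[of s lborel 1, OF _ _ U2] s01 by simp
  have "(\<Sum>q\<in>S. LINT p|lborel. Q q p * ((V p)\<^sup>2 + (W p)\<^sup>2)) = (LINT p|lborel. (\<Sum>q\<in>S. Q q p * ((V p)\<^sup>2 + (W p)\<^sup>2)))"
    using Qint[OF Bochner_Integration.integrable_add[OF V2 W2]] by simp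
  also have "\<dots> \<le> (LINT p|lborel. (V p)\<^sup>2 + (W p)\<^sup>2)"
  proof (rule integral_mono)
    fix p
    have "(\<Sum>q\<in>S. Q q p) \<le> 1"
    proof -
      have "(\<Sum>q\<in>S. Q q p) \<le> indicator \<Omega> p"
        using s01(2)[of p] by (simp add: s_def uncovered_def S_def Q_def)
      also have "\<dots> \<le> 1" by (simp add: indicator_def)
      finally show ?thesis .
    qed
    then show "(\<Sum>q\<in>S. Q q p * ((V p)\<^sup>2 + (W p)\<^sup>2)) \<le> (V p)\<^sup>2 + (W p)\<^sup>2"
      by (simp flip: sum_distrib_right add: mult_left_le_one_le Q_def sum_nonneg)
  qed (use Qint[OF Bochner_Integration.integrable_add[OF V2 W2]] V2 W2 in auto)
  finally have T: "8 / 4 ^ n * (\<Sum>q\<in>S. LINT p|lborel. Q q p * ((V p)\<^sup>2 + (W p)\<^sup>2)) \<le>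
      8 / 4 ^ n * (LINT p|lborel. (V p)\<^sup>2 + (W p)\<^sup>2)"
    by (intro mult_left_mono) auto
  have "(U p)\<^sup>2 = (\<Sum>q\<in>S. Q q p * (U p)\<^sup>2) + s p * (U p)\<^sup>2" for p
    using U0[of p] by (cases "p \<in> \<Omega>")
      (simp_all add: s_def uncovered_def S_def Q_def left_diff_distrib flip: sum_distrib_right)
  then have "(LINT p|lborel. (U p)\<^sup>2) = (LINT p|lborel. (\<Sum>q\<in>S. Q q p * (U p)\<^sup>2) + s p * (U p)\<^sup>2)" by simp
  also have "\<dots> = (\<Sum>q\<in>S. LINT p|lborel. Q q p * (U p)\<^sup>2) + (LINT p|lborel. s p * (U p)\<^sup>2)"
    using sU Qint[OF U2] by simp
  also have "(\<Sum>q\<in>S. LINT p|lborel. Q q p * (U p)\<^sup>2) \<le>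
     (\<Sum>q\<in>S. 4 ^ n * (LINT p|lborel. Q q p * U p)\<^sup>2 + 8 / 4 ^ n * (LINT p|lborel. Q q p * ((V p)\<^sup>2 + (W p)\<^sup>2)))"
  proof (rule sum_mono)
    fix q assume "q \<in> S"
    then have sub: "grid_square n q \<subseteq> \<Omega>" by (simp add: S_def inner_squares_def)
    have p4: "(1 / 2 ^ n :: real)\<^sup>2 = 1 / 4 ^ n"
      by (simp add: power2_eq_square power_mult_distrib[symmetric])
    show "(LINT p|lborel. Q q p * (U p)\<^sup>2) \<le> 4 ^ n * (LINT p|lborel. Q q p * U p)\<^sup>2 + 8 / 4 ^ n * (LINT p|lborel. Q q p * ((V p)\<^sup>2 + (W p)\<^sup>2))"
      using Poincare_square[OF x y, of "1 / 2 ^ n" "fst q / 2 ^ n" "snd q / 2 ^ n"] sub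
      unfolding Q_def grid_square_def p4 by (simp add: mult.commute)
  qed
  also have "\<dots> = (\<Sum>q\<in>S. 4 ^ n * (LINT p|lborel. Q q p * U p)\<^sup>2) + 8 / 4 ^ n * (\<Sum>q\<in>S. LINT p|lborel. Q q p * ((V p)\<^sup>2 + (W p)\<^sup>2))"
    by (simp add: sum.distrib sum_distrib_left)
  also note T
  also have "(LINT p|lborel. s p * (U p)\<^sup>2) \<le> sqrt (LINT p|lborel. s p) * sqrt (LINT p|lborel. (U p) ^ 4)"
  proof -
    have "(LINT p|lborel. s p * (U p)\<^sup>2)\<^sup>2 \<le> (LINT p|lborel. (s p)\<^sup>2) * (LINT p|lborel. ((U p)\<^sup>2)\<^sup>2)"
      by (rule integral_Cauchy_Schwarz(2)) (use s U4 in \<open>simp_all add: s01\<close>)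
    then have "(LINT p|lborel. s p * (U p)\<^sup>2)\<^sup>2 \<le> (LINT p|lborel. s p) * (LINT p|lborel. (U p) ^ 4)"
      by (simp add: s01)
    then show ?thesis unfolding real_sqrt_mult[symmetric] by (rule real_le_rsqrt)
  qed
  finally show ?thesis by (simp add: S_def Q_def s_def)
qed

section \<open>Calculus of Sobolev functions\<close>

text \<open>The derivatives are arguments, because those picked by \<open>weak_deriv\<close> obey
  the rules of calculus only almost everywhere. With explicit derivatives sums, linear images and
  reflections are plain identities, and \<open>sob_weak_deriv\<close> returns to the chosen
  representatives.\<close>

definition sob ::
    "R2 set \<Rightarrow> (R2 \<Rightarrow> 'b::euclidean_space) \<Rightarrow> (R2 \<Rightarrow> 'b) \<Rightarrow> (R2 \<Rightarrow> 'b) \<Rightarrow> bool" where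
  "sob \<Omega> u v w \<longleftrightarrow> L2 (lebesgue_on \<Omega>) u \<and> L2 (lebesgue_on \<Omega>) v \<and> L2 (lebesgue_on \<Omega>) w \<and>
     has_weak_deriv \<Omega> (1, 0) u v \<and> has_weak_deriv \<Omega> (0, 1) u w"

lemma finite_measure_lebesgue_on_open: "open \<Omega> \<Longrightarrow> bounded \<Omega> \<Longrightarrow> finite_measure (lebesgue_on (\<Omega> :: R2 set))"
  by (intro finite_measure_lebesgue_on lmeasurable_open)

lemma norm_add_sq: "(norm (x + y))\<^sup>2 \<le> 2 * (norm x)\<^sup>2 + 2 * (norm y)\<^sup>2"
  for x y :: "'a::real_normed_vector"
proof -
  have "(norm (x + y))\<^sup>2 \<le> (norm x + norm y)\<^sup>2" by (intro power_mono norm_triangle_ineq) auto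
  also have "\<dots> \<le> 2 * (norm x)\<^sup>2 + 2 * (norm y)\<^sup>2"
    using zero_le_power2[of "norm x - norm y"] by (simp add: power2_eq_square algebra_simps)
  finally show ?thesis .
qed

lemma L2_add: 
  assumes "L2 M u" "L2 M v"
  shows "L2 M (\<lambda>p. u p + v p)"
  unfolding L2_def
proof
  have [measurable]: "u \<in> borel_measurable M" "v \<in> borel_measurable M" using assms by (auto simp: L2_def)
  show "(\<lambda>p. u p + v p) \<in> borel_measurable M" by measurable
  show "integrable M (\<lambda>p. (norm (u p + v p))\<^sup>2)"
  proof (rule Bochner_Integration.integrable_bound)
    show "integrable M (\<lambda>p. 2 * (norm (u p))\<^sup>2 + 2 * (norm (v p))\<^sup>2)" using assms by (auto simp: L2_def)
    show "AE p in M. norm ((norm (u p + v p))\<^sup>2) \<le> norm (2 * (norm (u p))\<^sup>2 + 2 * (norm (v p))\<^sup>2)"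
      using norm_add_sq by (intro AE_I2) (simp add: order_trans[OF _ abs_ge_self])
  qed measurable
qed

lemma L2_bounded_linear:
  fixes u :: "'a \<Rightarrow> 'b::euclidean_space" and f :: "'b \<Rightarrow> 'c::euclidean_space"
  assumes "bounded_linear f" "L2 M u"
  shows "L2 M (\<lambda>p. f (u p))"
  unfolding L2_def
proof
  interpret f: bounded_linear f by fact
  have [measurable]: "u \<in> borel_measurable M" using assms by (auto simp: L2_def)
  show fm[measurable]: "(\<lambda>p. f (u p)) \<in> borel_measurable M"
    by (rule measurable_compose[OF _ borel_measurable_continuous_onI[OF f.continuous_on[OF continuous_on_id]]]) simp
  obtain K where K: "\<And>x. norm (f x) \<le> norm x * K" using f.bounded by blast
  show "integrable M (\<lambda>p. (norm (f (u p)))\<^sup>2)"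
  proof (rule Bochner_Integration.integrable_bound)
    show "integrable M (\<lambda>p. K\<^sup>2 * (norm (u p))\<^sup>2)" using assms by (auto simp: L2_def)
    show "AE p in M. norm ((norm (f (u p)))\<^sup>2) \<le> norm (K\<^sup>2 * (norm (u p))\<^sup>2)"
      using power_mono[OF K norm_ge_zero, of _ 2] by (intro AE_I2) (simp add: power_mult_distrib mult.commute)
  qed measurable
qed

lemma L2_scaleR: "L2 M u \<Longrightarrow> L2 M (\<lambda>p. c *\<^sub>R u p)"
  by (rule L2_bounded_linear[OF bounded_linear_scaleR_right])

lemma L2_diff: "L2 M u \<Longrightarrow> L2 M v \<Longrightarrow> L2 M (\<lambda>p. u p - v p)"
  using L2_add[of M u "\<lambda>p. (-1) *\<^sub>R v p"] L2_scaleR[of M v "-1"] by simp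

lemma has_weak_deriv_add:
  fixes u v u' v' :: "R2 \<Rightarrow> 'b::euclidean_space"
  assumes "has_weak_deriv \<Omega> e u v" "has_weak_deriv \<Omega> e u' v'"
    and "integrable (lebesgue_on \<Omega>) u" "integrable (lebesgue_on \<Omega>) v"
      "integrable (lebesgue_on \<Omega>) u'" "integrable (lebesgue_on \<Omega>) v'"
  shows "has_weak_deriv \<Omega> e (\<lambda>p. u p + u' p) (\<lambda>p. v p + v' p)"
  unfolding has_weak_deriv_def
proof
  fix \<phi> assume \<phi>: "\<phi> \<in> test_functions \<Omega>"
  show "(LINT p|lebesgue_on \<Omega>. frechet_derivative \<phi> (at p) e *\<^sub>R (u p + u' p)) =
    - (LINT p|lebesgue_on \<Omega>. \<phi> p *\<^sub>R (v p + v' p))"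
    using assms(1,2) \<phi> test_function_integrable(2)[OF \<phi> assms(3), of e] test_function_integrable(1)[OF \<phi> assms(4)]
      test_function_integrable(2)[OF \<phi> assms(5), of e] test_function_integrable(1)[OF \<phi> assms(6)]
    by (simp add: has_weak_deriv_def scaleR_add_right)
qed

lemma has_weak_deriv_bounded_linear:
  fixes u v :: "R2 \<Rightarrow> 'b::euclidean_space" and f :: "'b \<Rightarrow> 'c::euclidean_space"
  assumes "bounded_linear f" "has_weak_deriv \<Omega> e u v"
    and "integrable (lebesgue_on \<Omega>) u" "integrable (lebesgue_on \<Omega>) v"
  shows "has_weak_deriv \<Omega> e (\<lambda>p. f (u p)) (\<lambda>p. f (v p))"
  unfolding has_weak_deriv_def
proof
  interpret f: bounded_linear f by fact
  fix \<phi> assume \<phi>: "\<phi> \<in> test_functions \<Omega>"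
  have "(LINT p|lebesgue_on \<Omega>. frechet_derivative \<phi> (at p) e *\<^sub>R f (u p)) =
      f (LINT p|lebesgue_on \<Omega>. frechet_derivative \<phi> (at p) e *\<^sub>R u p)"
    using integral_bounded_linear[OF assms(1) test_function_integrable(2)[OF \<phi> assms(3)]] by (simp add: f.scaleR)
  also have "\<dots> = f (- (LINT p|lebesgue_on \<Omega>. \<phi> p *\<^sub>R v p))"
    using assms(2) \<phi> by (simp add: has_weak_deriv_def)
  also have "\<dots> = - (LINT p|lebesgue_on \<Omega>. \<phi> p *\<^sub>R f (v p))"
    using integral_bounded_linear[OF assms(1) test_function_integrable(1)[OF \<phi> assms(4)]] by (simp add: f.scaleR linear_neg[OF f.linear])
  finally show "(LINT p|lebesgue_on \<Omega>. frechet_derivative \<phi> (at p) e *\<^sub>R f (u p)) =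
    - (LINT p|lebesgue_on \<Omega>. \<phi> p *\<^sub>R f (v p))" .
qed

section \<open>Rules and estimates on a bounded open set\<close>

locale bounded_domain =
  fixes \<Omega> :: "R2 set"
  assumes open_\<Omega>: "open \<Omega>" and bounded_\<Omega>: "bounded \<Omega>"
begin

abbreviation "M\<Omega> \<equiv> lebesgue_on \<Omega>"

sublocale finite_measure M\<Omega>
  by (rule finite_measure_lebesgue_on_open[OF open_\<Omega> bounded_\<Omega>])

lemma L2_imp_integrable: "L2 M\<Omega> (u :: R2 \<Rightarrow> 'b::euclidean_space) \<Longrightarrow> integrable M\<Omega> u"
  by (rule L2_integrable[OF finite_measure_axioms])

lemma sob_add:
  fixes u v w :: "R2 \<Rightarrow> 'b::euclidean_space"
  shows "sob \<Omega> u v w \<Longrightarrow> sob \<Omega> u' v' w' \<Longrightarrow> sob \<Omega> (\<lambda>p. u p + u' p) (\<lambda>p. v p + v' p) (\<lambda>p. w p + w' p)"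
  unfolding sob_def by (auto intro: L2_add has_weak_deriv_add L2_imp_integrable)

lemma sob_bounded_linear:
  fixes u v w :: "R2 \<Rightarrow> 'b::euclidean_space" and f :: "'b \<Rightarrow> 'c::euclidean_space"
  shows "bounded_linear f \<Longrightarrow> sob \<Omega> u v w \<Longrightarrow> sob \<Omega> (\<lambda>p. f (u p)) (\<lambda>p. f (v p)) (\<lambda>p. f (w p))"
  unfolding sob_def by (auto intro: L2_bounded_linear has_weak_deriv_bounded_linear L2_imp_integrable)

lemma sob_scaleR:
  fixes u v w :: "R2 \<Rightarrow> 'b::euclidean_space"
  shows "sob \<Omega> u v w \<Longrightarrow> sob \<Omega> (\<lambda>p. c *\<^sub>R u p) (\<lambda>p. c *\<^sub>R v p) (\<lambda>p. c *\<^sub>R w p)"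
  by (rule sob_bounded_linear[OF bounded_linear_scaleR_right])

lemma sob_diff:
  fixes u v w :: "R2 \<Rightarrow> 'b::euclidean_space"
  assumes "sob \<Omega> u v w" "sob \<Omega> u' v' w'"
  shows "sob \<Omega> (\<lambda>p. u p - u' p) (\<lambda>p. v p - v' p) (\<lambda>p. w p - w' p)"
  using sob_add[OF assms(1) sob_scaleR[OF assms(2), of "-1"]] by simp

lemma W12_sob:
  assumes "W12 \<Omega> (u :: R2 \<Rightarrow> 'b::euclidean_space)"
  shows "sob \<Omega> u (weak_deriv \<Omega> (1, 0) u) (weak_deriv \<Omega> (0, 1) u)"
  using assms someI_ex[of "\<lambda>v. L2 M\<Omega> v \<and> has_weak_deriv \<Omega> (1, 0) u v"]
    someI_ex[of "\<lambda>v. L2 M\<Omega> v \<and> has_weak_deriv \<Omega> (0, 1) u v"]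
  unfolding W12_def sob_def weak_deriv_def by blast

lemma sob_W12: "sob \<Omega> u v w \<Longrightarrow> W12 \<Omega> (u :: R2 \<Rightarrow> 'b::euclidean_space)"
  unfolding W12_def sob_def by auto

lemma sob_unique:
  fixes u v w :: "R2 \<Rightarrow> 'b::euclidean_space"
  assumes "sob \<Omega> u v w" "sob \<Omega> u v' w'"
  shows "AE p in M\<Omega>. v p = v' p" "AE p in M\<Omega>. w p = w' p"
  using assms unfolding sob_def
  by (auto intro!: weak_deriv_unique[OF open_\<Omega>] L2_imp_integrable)

lemma sob_weak_deriv:
  fixes u v w :: "R2 \<Rightarrow> 'b::euclidean_space"
  assumes "sob \<Omega> u v w"
  shows "AE p in M\<Omega>. weak_deriv \<Omega> (1, 0) u p = v p \<and> weak_deriv \<Omega> (0, 1) u p = w p"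
  using sob_unique[OF W12_sob[OF sob_W12[OF assms]] assms] by eventually_elim auto

lemma sob_cong:
  fixes u v w :: "R2 \<Rightarrow> 'b::euclidean_space"
  assumes s: "sob \<Omega> u v w" and "AE p in M\<Omega>. u p = u' p" "AE p in M\<Omega>. v p = v' p" "AE p in M\<Omega>. w p = w' p"
  shows "sob \<Omega> u' v' w'"
proof -
  have L: "L2 M\<Omega> f'" if "L2 M\<Omega> f" "AE p in M\<Omega>. f p = f' p" for f f' :: "R2 \<Rightarrow> 'b"
  proof -
    have m: "f' \<in> borel_measurable M\<Omega>"
      using that borel_measurable_lebesgue_on_AE[OF open_\<Omega>] by (auto simp: L2_def)
    have "integrable M\<Omega> (\<lambda>p. (norm (f' p))\<^sup>2)"
      using that m by (subst integrable_cong_AE[of _ M\<Omega> "\<lambda>p. (norm (f p))\<^sup>2"]) (auto simp: L2_def elim!: eventually_mono)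
    with m show ?thesis by (simp add: L2_def)
  qed
  have H: "has_weak_deriv \<Omega> e f' g'" if "has_weak_deriv \<Omega> e f g" "AE p in M\<Omega>. f p = f' p" "AE p in M\<Omega>. g p = g' p"
    "L2 M\<Omega> f" "L2 M\<Omega> g" for e and f f' g g' :: "R2 \<Rightarrow> 'b"
    unfolding has_weak_deriv_def
  proof
    fix \<phi> assume \<phi>: "\<phi> \<in> test_functions \<Omega>"
    note int = L2_imp_integrable[OF that(4)] L2_imp_integrable[OF that(5)]
      L2_imp_integrable[OF L[OF that(4,2)]] L2_imp_integrable[OF L[OF that(5,3)]]
    have "(LINT p|M\<Omega>. frechet_derivative \<phi> (at p) e *\<^sub>R f p) = (LINT p|M\<Omega>. frechet_derivative \<phi> (at p) e *\<^sub>R f' p)"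
      by (rule integral_cong_AE[OF borel_measurable_integrable[OF test_function_integrable(2)[OF \<phi> int(1)]]
          borel_measurable_integrable[OF test_function_integrable(2)[OF \<phi> int(3)]]])
        (use that(2) in \<open>auto elim!: eventually_mono\<close>)
    moreover have "(LINT p|M\<Omega>. \<phi> p *\<^sub>R g p) = (LINT p|M\<Omega>. \<phi> p *\<^sub>R g' p)"
      by (rule integral_cong_AE[OF borel_measurable_integrable[OF test_function_integrable(1)[OF \<phi> int(2)]]
          borel_measurable_integrable[OF test_function_integrable(1)[OF \<phi> int(4)]]])
        (use that(3) in \<open>auto elim!: eventually_mono\<close>)
    ultimately show "(LINT p|M\<Omega>. frechet_derivative \<phi> (at p) e *\<^sub>R f' p) = - (LINT p|M\<Omega>. \<phi> p *\<^sub>R g' p)"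
      using that(1) \<phi> by (simp add: has_weak_deriv_def)
  qed
  have *: "L2 M\<Omega> u" "L2 M\<Omega> v" "L2 M\<Omega> w" "has_weak_deriv \<Omega> (1, 0) u v" "has_weak_deriv \<Omega> (0, 1) u w"
    using s by (simp_all add: sob_def)
  show ?thesis
    unfolding sob_def
    by (intro conjI L[OF *(1) assms(2)] L[OF *(2) assms(3)] L[OF *(3) assms(4)]
      H[OF *(4) assms(2,3) *(1,2)] H[OF *(5) assms(2,4) *(1,3)])
qed

definition sob_sq :: "(R2 \<Rightarrow> 'b::euclidean_space) \<Rightarrow> (R2 \<Rightarrow> 'b) \<Rightarrow> (R2 \<Rightarrow> 'b) \<Rightarrow> real" where
  "sob_sq u v w = (LINT p|M\<Omega>. (norm (u p))\<^sup>2 + (norm (v p))\<^sup>2 + (norm (w p))\<^sup>2)"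

lemma W12_norm_sob:
  fixes u v w :: "R2 \<Rightarrow> 'b::euclidean_space"
  assumes "sob \<Omega> u v w"
  shows "W12_norm \<Omega> u = sqrt (sob_sq u v w)"
proof -
  have "(LINT p|M\<Omega>. (norm (u p))\<^sup>2 + (norm (weak_deriv \<Omega> (1, 0) u p))\<^sup>2 + (norm (weak_deriv \<Omega> (0, 1) u p))\<^sup>2) =
     sob_sq u v w"
    unfolding sob_sq_def
  proof (rule integral_cong_AE)
    show "AE p in M\<Omega>. (norm (u p))\<^sup>2 + (norm (weak_deriv \<Omega> (1, 0) u p))\<^sup>2 + (norm (weak_deriv \<Omega> (0, 1) u p))\<^sup>2 =
        (norm (u p))\<^sup>2 + (norm (v p))\<^sup>2 + (norm (w p))\<^sup>2"
      using sob_weak_deriv[OF assms] by eventually_elim auto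
  qed (use W12_sob[OF sob_W12[OF assms]] assms in \<open>auto simp: sob_def L2_def\<close>)
  then show ?thesis by (simp add: W12_norm_def)
qed

text \<open>Borel representatives that vanish off \<Omega> make the Fubini arguments available. The
  derivative in y becomes one in the first variable when function, derivative and domain are swapped
  together.\<close>

lemma sob_weak_x:
  fixes u v w :: "R2 \<Rightarrow> real"
  assumes s: "sob \<Omega> u v w"
  obtains U V W where "weak_x \<Omega> U V" "weak_x (prod.swap ` \<Omega>) (\<lambda>p. U (prod.swap p)) (\<lambda>p. W (prod.swap p))"
    "AE p in M\<Omega>. u p = U p" "AE p in M\<Omega>. v p = V p" "AE p in M\<Omega>. w p = W p"
    "U \<in> borel_measurable borel" "V \<in> borel_measurable borel" "W \<in> borel_measurable borel"
    "\<And>p. p \<notin> \<Omega> \<Longrightarrow> U p = 0 \<and> V p = 0 \<and> W p = 0"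
proof -
  have L: "L2 M\<Omega> u" "L2 M\<Omega> v" "L2 M\<Omega> w" and D: "has_weak_deriv \<Omega> (1, 0) u v" "has_weak_deriv \<Omega> (0, 1) u w"
    using s by (auto simp: sob_def)
  obtain U where U[measurable]: "U \<in> borel_measurable borel" and U0: "\<And>p. p \<notin> \<Omega> \<Longrightarrow> U p = 0" and Ueq: "AE p in M\<Omega>. u p = U p"
    using borel_representative[OF open_\<Omega>, of u] L(1) unfolding L2_def by metis
  obtain V where V[measurable]: "V \<in> borel_measurable borel" and V0: "\<And>p. p \<notin> \<Omega> \<Longrightarrow> V p = 0" and Veq: "AE p in M\<Omega>. v p = V p"
    using borel_representative[OF open_\<Omega>, of v] L(2) unfolding L2_def by metis
  obtain W where W[measurable]: "W \<in> borel_measurable borel" and W0: "\<And>p. p \<notin> \<Omega> \<Longrightarrow> W p = 0" and Weq: "AE p in M\<Omega>. w p = W p"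
    using borel_representative[OF open_\<Omega>, of w] L(3) unfolding L2_def by metis
  have int: "integrable lborel F \<and> integrable lborel (\<lambda>p. (F p)\<^sup>2)"
    if "F \<in> borel_measurable borel" "\<And>p. p \<notin> \<Omega> \<Longrightarrow> F p = 0" "AE p in M\<Omega>. f p = F p" "L2 M\<Omega> f" for f F :: "R2 \<Rightarrow> real"
  proof
    show "integrable lborel F"
      using lebesgue_on_integral_lborel(1)[OF open_\<Omega> that(1-3)] L2_imp_integrable[OF that(4)] by simp
    have "AE p in M\<Omega>. (norm (f p))\<^sup>2 = (F p)\<^sup>2" using that(3) by eventually_elim auto
    then show "integrable lborel (\<lambda>p. (F p)\<^sup>2)"
      using lebesgue_on_integral_lborel(1)[OF open_\<Omega>, of "\<lambda>p. (F p)\<^sup>2" "\<lambda>p. (norm (f p))\<^sup>2"] that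
      by (simp add: L2_def)
  qed
  have tr: "(LINT p|lborel. \<phi> p * F p) = (LINT p|M\<Omega>. \<phi> p * f p)"
    if "F \<in> borel_measurable borel" "\<And>p. p \<notin> \<Omega> \<Longrightarrow> F p = 0" "AE p in M\<Omega>. f p = F p" "\<phi> \<in> borel_measurable borel" for f F \<phi> :: "R2 \<Rightarrow> real"
    by (rule lebesgue_on_integral_lborel(2)[OF open_\<Omega>, symmetric]) (use that in \<open>auto elim!: eventually_mono\<close>)
  have meas: "(\<lambda>p::R2. f (fst p) * g (snd p)) \<in> borel_measurable borel"
    if "f \<in> borel_measurable borel" "g \<in> borel_measurable borel" for f g :: "real \<Rightarrow> real"
    by (intro borel_measurable_times measurable_comp_fst measurable_comp_snd that)
  have wx: "weak_x \<Omega> U V"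
    unfolding weak_x_def
  proof (intro conjI allI impI)
    fix a b c d \<Phi> \<psi> \<beta>
    assume sub: "{a<..<b} \<times> {c<..<d} \<subseteq> \<Omega>" and t: "test1 a b \<Phi>" "test1 c d \<beta>"
      and d: "\<forall>x. (\<Phi> has_real_derivative \<psi> x) (at x)"
    \<comment> \<open>\<open>weak_x\<close> admits any \<open>\<psi>\<close> that is the derivative
      of \<open>\<Phi>\<close>; uniqueness of derivatives identifies it with a test function, which
      is measurable.\<close>
    obtain \<Phi>' where \<Phi>': "test1 a b \<Phi>'" "\<And>x. (\<Phi> has_real_derivative \<Phi>' x) (at x)" using test1_deriv[OF t(1)] by blast
    have "\<Phi>' = \<psi>" using d \<Phi>'(2) DERIV_unique by blast
    with \<Phi>' have \<psi>: "test1 a b \<psi>" by simp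
    obtain \<beta>' where \<beta>': "\<And>x. (\<beta> has_real_derivative \<beta>' x) (at x)" using test1_deriv[OF t(2)] by blast
    have tf: "(\<lambda>p. \<Phi> (fst p) * \<beta> (snd p)) \<in> test_functions \<Omega>" by (rule test1_product_test_function[OF t sub])
    show "(LINT p|lborel. \<psi> (fst p) * \<beta> (snd p) * U p) = - (LINT p|lborel. \<Phi> (fst p) * \<beta> (snd p) * V p)"
      using D(1)[unfolded has_weak_deriv_def, THEN bspec, OF tf]
      using d by (simp add: test1_product_frechet(1)[OF _ \<beta>', of \<Phi> \<psi>] meas
        tr[OF U U0 Ueq] tr[OF V V0 Veq] test1_measurable[OF t(1)] test1_measurable[OF t(2)] test1_measurable[OF \<psi>])
  qed (use int[OF U U0 Ueq L(1)] int[OF V V0 Veq L(2)] U0 in auto)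
  have wy: "weak_x (prod.swap ` \<Omega>) (\<lambda>p. U (prod.swap p)) (\<lambda>p. W (prod.swap p))"
    unfolding weak_x_def
  proof (intro conjI allI impI)
    fix a b c d \<Phi> \<psi> \<beta>
    assume sub: "{a<..<b} \<times> {c<..<d} \<subseteq> prod.swap ` \<Omega>" and t: "test1 a b \<Phi>" "test1 c d \<beta>"
      and d: "\<forall>x. (\<Phi> has_real_derivative \<psi> x) (at x)"
    obtain \<Phi>' where \<Phi>': "test1 a b \<Phi>'" "\<And>x. (\<Phi> has_real_derivative \<Phi>' x) (at x)" using test1_deriv[OF t(1)] by blast
    have "\<Phi>' = \<psi>" using d \<Phi>'(2) DERIV_unique by blast
    with \<Phi>' have \<psi>: "test1 a b \<psi>" by simp
    obtain \<beta>' where \<beta>': "\<And>x. (\<beta> has_real_derivative \<beta>' x) (at x)" using test1_deriv[OF t(2)] by blast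
    have "{c<..<d} \<times> {a<..<b} \<subseteq> \<Omega>" using sub by force
    then have tf: "(\<lambda>p. \<beta> (fst p) * \<Phi> (snd p)) \<in> test_functions \<Omega>" by (rule test1_product_test_function[OF t(2,1)])
    note tm = test1_measurable[OF t(1)] test1_measurable[OF t(2)] test1_measurable[OF \<psi>]
    have "(LINT p|lborel. \<beta> (fst p) * \<psi> (snd p) * U p) = - (LINT p|lborel. \<beta> (fst p) * \<Phi> (snd p) * W p)"
      using D(2)[unfolded has_weak_deriv_def, THEN bspec, OF tf]
      using d by (simp add: test1_product_frechet(2)[OF \<beta>', of \<Phi> \<psi>] meas tr[OF U U0 Ueq] tr[OF W W0 Weq] tm)
    then show "(LINT p|lborel. \<psi> (fst p) * \<beta> (snd p) * U (prod.swap p)) = - (LINT p|lborel. \<Phi> (fst p) * \<beta> (snd p) * W (prod.swap p))"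
      using integral_lborel_swap(2)[OF borel_measurable_times[OF meas[OF tm(2,3)] U]]
        integral_lborel_swap(2)[OF borel_measurable_times[OF meas[OF tm(2,1)] W]]
      by (simp add: mult.commute[of "\<psi> _"] mult.commute[of "\<Phi> _"])
  next
    fix p :: R2 assume "p \<notin> prod.swap ` \<Omega>"
    then have "prod.swap p \<notin> \<Omega>" by (metis image_eqI swap_swap)
    then show "U (prod.swap p) = 0" by (rule U0)
  qed (use int[OF U U0 Ueq L(1)] int[OF W W0 Weq L(3)] integral_lborel_swap(1)[of U] integral_lborel_swap(1)[of W]
      integral_lborel_swap(1)[of "\<lambda>p. (U p)\<^sup>2"] integral_lborel_swap(1)[of "\<lambda>p. (W p)\<^sup>2"] in auto)
  show ?thesis by (rule that[OF wx wy Ueq Veq Weq U V W]) (use U0 V0 W0 in auto)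
qed

lemma sob_L4:
  fixes u v w :: "R2 \<Rightarrow> real"
  assumes "sob \<Omega> u v w" and "wide \<Omega> l m" "wide (prod.swap ` \<Omega>) l m" "0 < l"
  shows "integrable M\<Omega> (\<lambda>p. (u p) ^ 4)"
proof -
  obtain U V W where U: "weak_x \<Omega> U V" "weak_x (prod.swap ` \<Omega>) (\<lambda>p. U (prod.swap p)) (\<lambda>p. W (prod.swap p))"
    "AE p in M\<Omega>. u p = U p" "U \<in> borel_measurable borel" "\<And>p. p \<notin> \<Omega> \<Longrightarrow> U p = 0 \<and> V p = 0 \<and> W p = 0"
    by (rule sob_weak_x[OF assms(1)]) blast
  have "integrable lborel (\<lambda>p. (U p) ^ 4)" by (rule L4_embedding[OF U(1,2) assms(2-)])
  moreover have "AE p in M\<Omega>. (u p) ^ 4 = (U p) ^ 4" using U(3) by eventually_elim auto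
  ultimately show ?thesis
    using lebesgue_on_integral_lborel(1)[OF open_\<Omega>, of "\<lambda>p. (U p) ^ 4" "\<lambda>p. (u p) ^ 4"] U(4,5) by simp
qed

lemma sob_square_estimate:
  fixes u v w :: "R2 \<Rightarrow> real"
  assumes s: "sob \<Omega> u v w" and u4: "integrable M\<Omega> (\<lambda>p. (u p) ^ 4)"
  shows "(LINT p|M\<Omega>. (u p)\<^sup>2) \<le>
    (\<Sum>q\<in>inner_squares \<Omega> n. 4 ^ n * (LINT p|M\<Omega>. indicator (grid_square n q) p * u p)\<^sup>2)
    + 8 / 4 ^ n * (LINT p|M\<Omega>. (v p)\<^sup>2 + (w p)\<^sup>2)
    + sqrt (LINT p|lborel. uncovered \<Omega> n p) * sqrt (LINT p|M\<Omega>. (u p) ^ 4)"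
proof -
  obtain U V W where U: "weak_x \<Omega> U V" "weak_x (prod.swap ` \<Omega>) (\<lambda>p. U (prod.swap p)) (\<lambda>p. W (prod.swap p))"
    and eq: "AE p in M\<Omega>. u p = U p" "AE p in M\<Omega>. v p = V p" "AE p in M\<Omega>. w p = W p"
    and [measurable]: "U \<in> borel_measurable borel" "V \<in> borel_measurable borel" "W \<in> borel_measurable borel"
    and 0: "\<And>p. p \<notin> \<Omega> \<Longrightarrow> U p = 0 \<and> V p = 0 \<and> W p = 0"
    by (rule sob_weak_x[OF s]) blast
  note tr = lebesgue_on_integral_lborel[OF open_\<Omega>]
  have 4: "integrable M\<Omega> (\<lambda>p. (u p) ^ 4) \<longleftrightarrow> integrable lborel (\<lambda>p. (U p) ^ 4)"
    "(LINT p|M\<Omega>. (u p) ^ 4) = (LINT p|lborel. (U p) ^ 4)"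
    using eq(1) 0 by (intro tr; auto elim!: eventually_mono)+
  have 2: "(LINT p|M\<Omega>. (u p)\<^sup>2) = (LINT p|lborel. (U p)\<^sup>2)"
    using eq(1) 0 by (intro tr; auto elim!: eventually_mono)
  have vw: "(LINT p|M\<Omega>. (v p)\<^sup>2 + (w p)\<^sup>2) = (LINT p|lborel. (V p)\<^sup>2 + (W p)\<^sup>2)"
  proof (rule tr(2))
    show "AE p in M\<Omega>. (v p)\<^sup>2 + (w p)\<^sup>2 = (V p)\<^sup>2 + (W p)\<^sup>2" using eq(2,3) by eventually_elim auto
  qed (use 0 in auto)
  have 1: "(LINT p|M\<Omega>. indicator (grid_square n q) p * u p) = (LINT p|lborel. indicator (grid_square n q) p * U p)" for q
    using eq(1) 0 by (intro tr; auto elim!: eventually_mono)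
  show ?thesis
    unfolding 4(2) 2 vw 1 by (rule L2_square_estimate[OF open_\<Omega> bounded_\<Omega> U]) (use u4 4(1) in simp)
qed

text \<open>The integrals over all dyadic squares of all scales are countably many bounded
  sequences, so one subsequence makes all of them converge. In the square estimate for the
  difference of two members the scale is fixed first, such that gradient term and uncovered part
  stay below e / 2 for all members; the remaining sum is finite and tends to 0.\<close>

lemma Rellich:
  fixes u v w :: "nat \<Rightarrow> R2 \<Rightarrow> real"
  assumes s: "\<And>n. sob \<Omega> (u n) (v n) (w n)" and u4: "\<And>n. integrable M\<Omega> (\<lambda>p. (u n p) ^ 4)"
    and b2: "\<And>n. (LINT p|M\<Omega>. (u n p)\<^sup>2) \<le> K"
    and bv: "\<And>n. (LINT p|M\<Omega>. (v n p)\<^sup>2 + (w n p)\<^sup>2) \<le> K" and b4: "\<And>n. (LINT p|M\<Omega>. (u n p) ^ 4) \<le> K"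
  obtains r :: "nat \<Rightarrow> nat" where "strict_mono r"
    "\<And>e. e > 0 \<Longrightarrow> \<exists>N. \<forall>i\<ge>N. \<forall>j\<ge>N. (LINT p|M\<Omega>. (u (r i) p - u (r j) p)\<^sup>2) < e"
proof -
  define a where "a k x = (LINT p|M\<Omega>. indicator (grid_square (fst x) (snd x)) p * u k p)" for k and x :: "nat \<times> int \<times> int"
  have ui: "integrable M\<Omega> (u k)" for k using s[of k] L2_imp_integrable by (auto simp: sob_def)
  have u2i: "integrable M\<Omega> (\<lambda>p. (u k p)\<^sup>2)" for k using s[of k] by (auto simp: sob_def L2_def)
  have gm: "(indicator (grid_square n q) :: R2 \<Rightarrow> real) \<in> borel_measurable M\<Omega>" for n q
    by (intro measurable_restrict_space1 measurable_completion) simp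
  have gi: "integrable M\<Omega> (\<lambda>p. indicator (grid_square n q) p * u k p)" for n q k
    using integrable_bounded_mult[OF gm _ ui, of n q 1] by (simp add: indicator_def)
  have "norm (a k x) \<le> measure M\<Omega> (space M\<Omega>) + K" for k x
  proof -
    have "norm (a k x) \<le> (LINT p|M\<Omega>. norm (indicator (grid_square (fst x) (snd x)) p * u k p))"
      unfolding a_def by (rule integral_norm_bound)
    also have "\<dots> \<le> (LINT p|M\<Omega>. 1 + (u k p)\<^sup>2)"
    proof (rule integral_mono)
      fix p
      have "\<bar>u k p\<bar> \<le> 1 + (u k p)\<^sup>2" using zero_le_power2[of "\<bar>u k p\<bar> - 1 / 2"] by (simp add: power2_diff power_divide)
      then show "norm (indicator (grid_square (fst x) (snd x)) p * u k p) \<le> 1 + (u k p)\<^sup>2"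
        by (auto simp: indicator_def)
    qed (use gi u2i in auto)
    also have "\<dots> \<le> measure M\<Omega> (space M\<Omega>) + K" using u2i b2 by simp
    finally show ?thesis .
  qed
  then obtain r :: "nat \<Rightarrow> nat" where r: "strict_mono r" "\<And>x. \<exists>l. (\<lambda>n. a (r n) x) \<longlonglongrightarrow> l"
    using function_convergent_subsequence[of "UNIV :: (nat \<times> int \<times> int) set" a] by (metis UNIV_I countableI_type)
  define A where "A n i j = (\<Sum>q\<in>inner_squares \<Omega> n. 4 ^ n * (a (r i) (n, q) - a (r j) (n, q))\<^sup>2)" for n i j
  have K: "K \<ge> 0" using b2[of 0] by (rule order_trans[rotated]) simp
  have est: "(LINT p|M\<Omega>. (u (r i) p - u (r j) p)\<^sup>2) \<le> A n i j + 8 / 4 ^ n * (4 * K) + sqrt (LINT p|lborel. uncovered \<Omega> n p) * sqrt (16 * K)" for n i j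
  proof -
    have 4: "(x - y) ^ 4 \<le> 8 * x ^ 4 + 8 * y ^ 4" for x y :: real
    proof -
      have "(x - y)\<^sup>2 \<le> 2 * x\<^sup>2 + 2 * y\<^sup>2" using zero_le_power2[of "x + y"] by (simp add: power2_eq_square algebra_simps)
      then have "((x - y)\<^sup>2)\<^sup>2 \<le> (2 * x\<^sup>2 + 2 * y\<^sup>2)\<^sup>2" by (intro power_mono) auto
      also have "\<dots> \<le> 8 * (x\<^sup>2)\<^sup>2 + 8 * (y\<^sup>2)\<^sup>2" using zero_le_power2[of "x\<^sup>2 - y\<^sup>2"] by (simp add: power2_eq_square algebra_simps)
      finally show ?thesis by simp
    qed
    have [measurable]: "u k \<in> borel_measurable M\<Omega>" for k using ui by auto
    have i4: "integrable M\<Omega> (\<lambda>p. (u (r i) p - u (r j) p) ^ 4)"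
      by (rule Bochner_Integration.integrable_bound[of _ "\<lambda>p. 8 * (u (r i) p) ^ 4 + 8 * (u (r j) p) ^ 4"])
         (use u4 4 in \<open>auto intro!: AE_I2\<close>)
    have "(LINT p|M\<Omega>. (u (r i) p - u (r j) p) ^ 4) \<le> (LINT p|M\<Omega>. 8 * (u (r i) p) ^ 4 + 8 * (u (r j) p) ^ 4)"
      by (rule integral_mono[OF i4]) (use u4 4 in auto)
    also have "\<dots> \<le> 16 * K" using u4 b4[of "r i"] b4[of "r j"] by simp
    finally have I4: "(LINT p|M\<Omega>. (u (r i) p - u (r j) p) ^ 4) \<le> 16 * K" .
    have vi: "integrable M\<Omega> (\<lambda>p. (v k p)\<^sup>2)" "integrable M\<Omega> (\<lambda>p. (w k p)\<^sup>2)" for k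
      using s[of k] by (auto simp: sob_def L2_def)
    have sd: "sob \<Omega> (\<lambda>p. u (r i) p - u (r j) p) (\<lambda>p. v (r i) p - v (r j) p) (\<lambda>p. w (r i) p - w (r j) p)"
      by (intro sob_diff s)
    then have vdi: "integrable M\<Omega> (\<lambda>p. (v (r i) p - v (r j) p)\<^sup>2)" "integrable M\<Omega> (\<lambda>p. (w (r i) p - w (r j) p)\<^sup>2)"
      by (auto simp: sob_def L2_def)
    have 2: "(x - y)\<^sup>2 \<le> 2 * x\<^sup>2 + 2 * y\<^sup>2" for x y :: real
      using zero_le_power2[of "x + y"] by (simp add: power2_eq_square algebra_simps)
    have "(LINT p|M\<Omega>. (v (r i) p - v (r j) p)\<^sup>2 + (w (r i) p - w (r j) p)\<^sup>2) \<le>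
      (LINT p|M\<Omega>. 2 * ((v (r i) p)\<^sup>2 + (w (r i) p)\<^sup>2) + 2 * ((v (r j) p)\<^sup>2 + (w (r j) p)\<^sup>2))"
    proof (rule integral_mono)
      fix p
      show "(v (r i) p - v (r j) p)\<^sup>2 + (w (r i) p - w (r j) p)\<^sup>2 \<le> 2 * ((v (r i) p)\<^sup>2 + (w (r i) p)\<^sup>2) + 2 * ((v (r j) p)\<^sup>2 + (w (r j) p)\<^sup>2)"
        using 2[of "v (r i) p" "v (r j) p"] 2[of "w (r i) p" "w (r j) p"] by simp
    qed (use vi vdi in auto)
    also have "\<dots> = 2 * (LINT p|M\<Omega>. (v (r i) p)\<^sup>2 + (w (r i) p)\<^sup>2) + 2 * (LINT p|M\<Omega>. (v (r j) p)\<^sup>2 + (w (r j) p)\<^sup>2)"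
      using vi by simp
    also have "\<dots> \<le> 4 * K" using bv[of "r i"] bv[of "r j"] by simp
    finally have I2: "(LINT p|M\<Omega>. (v (r i) p - v (r j) p)\<^sup>2 + (w (r i) p - w (r j) p)\<^sup>2) \<le> 4 * K" .
    have aa: "(LINT p|M\<Omega>. indicator (grid_square n q) p * (u (r i) p - u (r j) p)) = a (r i) (n, q) - a (r j) (n, q)" for q
      unfolding a_def using gi by (simp add: right_diff_distrib)
    have "(LINT p|lborel. uncovered \<Omega> n p) \<ge> 0"
      by (intro integral_nonneg_AE AE_I2) (simp add: uncovered_cases[OF bounded_\<Omega>])
    then have "sqrt (LINT p|lborel. uncovered \<Omega> n p) * sqrt (LINT p|M\<Omega>. (u (r i) p - u (r j) p) ^ 4) \<le>
       sqrt (LINT p|lborel. uncovered \<Omega> n p) * sqrt (16 * K)"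
      using I4 by (intro mult_left_mono) auto
    moreover have "8 / 4 ^ n * (LINT p|M\<Omega>. (v (r i) p - v (r j) p)\<^sup>2 + (w (r i) p - w (r j) p)\<^sup>2) \<le> 8 / 4 ^ n * (4 * K)"
      using I2 by (intro mult_left_mono) auto
    ultimately show ?thesis
      using sob_square_estimate[OF sd i4, of n] unfolding A_def aa by linarith
  qed
  show ?thesis
  proof (rule that[OF r(1)])
    fix e :: real assume e: "e > 0"
    have "(\<lambda>n. 8 / 4 ^ n * (4 * K) + sqrt (LINT p|lborel. uncovered \<Omega> n p) * sqrt (16 * K)) \<longlonglongrightarrow> 0 * (4 * K) + sqrt 0 * sqrt (16 * K)"
    proof (intro tendsto_intros uncovered_integral_tendsto(2)[OF open_\<Omega> bounded_\<Omega>])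
      have "(\<lambda>n. 8 * (1 / 4) ^ n) \<longlonglongrightarrow> 8 * (0::real)" by (intro tendsto_intros LIMSEQ_realpow_zero) auto
      then show "(\<lambda>n. 8 / 4 ^ n :: real) \<longlonglongrightarrow> 0" by (simp add: power_one_over)
    qed
    then have "\<forall>\<^sub>F n in sequentially. 8 / 4 ^ n * (4 * K) + sqrt (LINT p|lborel. uncovered \<Omega> n p) * sqrt (16 * K) < e / 2"
      using e by (intro order_tendstoD(2)) auto
    then obtain n where n: "8 / 4 ^ n * (4 * K) + sqrt (LINT p|lborel. uncovered \<Omega> n p) * sqrt (16 * K) < e / 2"
      by (auto simp: eventually_sequentially)
    have "\<forall>q. \<exists>l. (\<lambda>i. a (r i) (n, q)) \<longlonglongrightarrow> l" using r(2) by blast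
    from choice[OF this] obtain l where l: "\<And>q. (\<lambda>i. a (r i) (n, q)) \<longlonglongrightarrow> l q" by blast
    define B where "B i = (\<Sum>q\<in>inner_squares \<Omega> n. 4 ^ n * (a (r i) (n, q) - l q)\<^sup>2)" for i
    have "B \<longlonglongrightarrow> (\<Sum>q\<in>inner_squares \<Omega> n. 4 ^ n * (l q - l q)\<^sup>2)"
      unfolding B_def by (intro tendsto_intros l)
    \<comment> \<open>The fraction e / 8 because \<open>A n i j\<close> is at most 2 B i + 2 B j,
      which has to stay below e / 2.\<close>
    then have "\<forall>\<^sub>F i in sequentially. B i < e / 8" using e by (intro order_tendstoD(2)) auto
    then obtain N where N: "\<And>i. i \<ge> N \<Longrightarrow> B i < e / 8" by (auto simp: eventually_sequentially)
    have AB: "A n i j \<le> 2 * B i + 2 * B j" for i j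
    proof -
      have "4 ^ n * (a (r i) (n, q) - a (r j) (n, q))\<^sup>2 \<le> 2 * (4 ^ n * (a (r i) (n, q) - l q)\<^sup>2) + 2 * (4 ^ n * (a (r j) (n, q) - l q)\<^sup>2)" for q
      proof -
        have "(x - y)\<^sup>2 \<le> 2 * (x - z)\<^sup>2 + 2 * (y - z)\<^sup>2" for x y z :: real
          using zero_le_power2[of "x + y - 2 * z"] by (simp add: power2_eq_square algebra_simps)
        from mult_left_mono[OF this, of "4 ^ n"] show ?thesis by (simp add: distrib_left mult.left_commute)
      qed
      then have "A n i j \<le> (\<Sum>q\<in>inner_squares \<Omega> n. 2 * (4 ^ n * (a (r i) (n, q) - l q)\<^sup>2) + 2 * (4 ^ n * (a (r j) (n, q) - l q)\<^sup>2))"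
        unfolding A_def by (intro sum_mono)
      then show ?thesis by (simp add: B_def sum.distrib sum_distrib_left)
    qed
    then have "(LINT p|M\<Omega>. (u (r i) p - u (r j) p)\<^sup>2) < e" if "i \<ge> N" "j \<ge> N" for i j
    proof -
      have "A n i j \<le> 2 * B i + 2 * B j" by (rule AB)
      moreover have "(LINT p|M\<Omega>. (u (r i) p - u (r j) p)\<^sup>2) < A n i j + e / 2"
        by (rule le_less_trans[OF est[of i j n]]) (use n in \<open>simp only: add.assoc add_strict_left_mono\<close>)
      moreover have "B i < e / 8" "B j < e / 8" using N that by blast+
      ultimately show ?thesis by argo
    qed
    then show "\<exists>N. \<forall>i\<ge>N. \<forall>j\<ge>N. (LINT p|M\<Omega>. (u (r i) p - u (r j) p)\<^sup>2) < e" by blast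
  qed
qed

end

section \<open>Completeness\<close>

text \<open>Fatou's lemma with integrability of the limit as a conclusion. It serves both the
  completeness of L2 and the lower semicontinuity of the energy.\<close>

lemma nn_integral_Fatou_bound:
  fixes f :: "nat \<Rightarrow> 'a \<Rightarrow> real"
  assumes [measurable]: "\<And>n. f n \<in> borel_measurable M" "g \<in> borel_measurable M"
    and nn: "\<And>n x. 0 \<le> f n x" and int: "\<And>n. integrable M (f n)"
    and lim: "AE x in M. (\<lambda>n. f n x) \<longlonglongrightarrow> g x"
    and le: "\<forall>\<^sub>F n in sequentially. (LINT x|M. f n x) \<le> e"
  shows "integrable M g" "(LINT x|M. g x) \<le> e"
proof -
  have e: "0 \<le> e"
  proof -
    obtain n where "(LINT x|M. f n x) \<le> e" using le by (auto simp: eventually_sequentially)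
    moreover have "0 \<le> (LINT x|M. f n x)" using nn by simp
    ultimately show ?thesis by linarith
  qed
  have g0: "AE x in M. 0 \<le> g x"
    using lim by eventually_elim (use nn in \<open>auto intro: LIMSEQ_le_const\<close>)
  have "(\<integral>\<^sup>+x. ennreal (g x) \<partial>M) = (\<integral>\<^sup>+x. liminf (\<lambda>n. ennreal (f n x)) \<partial>M)"
    by (rule nn_integral_cong_AE, use lim in eventually_elim) (intro lim_imp_Liminf[symmetric] tendsto_ennrealI; simp)
  also have "\<dots> \<le> liminf (\<lambda>n. \<integral>\<^sup>+x. ennreal (f n x) \<partial>M)"
    by (rule nn_integral_liminf) measurable
  also have "\<dots> \<le> ennreal e"
    by (rule Liminf_le, simp, use le in eventually_elim)
       (use nn int in \<open>simp add: nn_integral_eq_integral ennreal_leI\<close>)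
  finally have *: "(\<integral>\<^sup>+x. ennreal (g x) \<partial>M) \<le> ennreal e" .
  show "integrable M g"
    by (rule integrableI_nonneg[OF _ g0]) (use le_less_trans[OF *] in auto)
  show "(LINT x|M. g x) \<le> e"
    using * e g0 by (subst integral_eq_nn_integral) (auto intro: enn2real_leI)
qed

lemma (in finite_measure) integral_norm_le_L2:
  fixes f :: "'a \<Rightarrow> 'b::euclidean_space"
  assumes "L2 M f"
  shows "(LINT x|M. norm (f x)) \<le> sqrt (measure M (space M) * (LINT x|M. (norm (f x))\<^sup>2))"
proof (rule real_le_rsqrt)
  show "(LINT x|M. norm (f x))\<^sup>2 \<le> measure M (space M) * (LINT x|M. (norm (f x))\<^sup>2)"
    using integral_Cauchy_Schwarz(2)[of "\<lambda>_. 1" M "\<lambda>x. norm (f x)"] assms by (auto simp: L2_def)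
qed

text \<open>Over a finite measure, Cauchy in L2 implies Cauchy in L1, so a subsequence converges
  almost everywhere. Fatou applied to u n - u (r i) as i tends to infinity turns the Cauchy
  condition into convergence of the whole sequence to that limit.\<close>

lemma (in finite_measure) L2_complete:
  fixes u :: "nat \<Rightarrow> 'a \<Rightarrow> 'b::euclidean_space"
  assumes L2: "\<And>n. L2 M (u n)"
    and Cauchy: "\<And>e. e > 0 \<Longrightarrow> \<exists>N. \<forall>i\<ge>N. \<forall>j\<ge>N. (LINT x|M. (norm (u i x - u j x))\<^sup>2) < e"
  obtains f where "L2 M f" "(\<lambda>n. LINT x|M. (norm (u n x - f x))\<^sup>2) \<longlonglongrightarrow> 0"
proof -
  have m[measurable]: "u n \<in> borel_measurable M" for n using L2[of n] by (auto simp: L2_def)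
  have "\<exists>N. \<forall>i\<ge>N. \<forall>j\<ge>N. (LINT x|M. norm (u i x - u j x)) < e" if e: "e > 0" for e
  proof -
    \<comment> \<open>The summand 1 keeps the divisor positive when the space has measure 0.\<close>
    define m where "m = measure M (space M) + 1"
    have m: "m > 0" by (simp add: m_def add_nonneg_pos)
    obtain N where N: "\<And>i j. i \<ge> N \<Longrightarrow> j \<ge> N \<Longrightarrow> (LINT x|M. (norm (u i x - u j x))\<^sup>2) < e\<^sup>2 / m"
      using Cauchy[of "e\<^sup>2 / m"] e m by auto
    have "(LINT x|M. norm (u i x - u j x)) < e" if "i \<ge> N" "j \<ge> N" for i j
    proof -
      have "(LINT x|M. norm (u i x - u j x)) \<le> sqrt (measure M (space M) * (LINT x|M. (norm (u i x - u j x))\<^sup>2))"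
        by (rule integral_norm_le_L2[OF L2_diff[OF L2 L2]])
      also have "\<dots> \<le> sqrt (m * (LINT x|M. (norm (u i x - u j x))\<^sup>2))"
        by (intro real_sqrt_le_mono mult_right_mono) (auto simp: m_def)
      also have "\<dots> < sqrt (m * (e\<^sup>2 / m))"
        using N[OF that] m by (intro real_sqrt_less_mono mult_strict_left_mono) auto
      also have "\<dots> = e" using m e by simp
      finally show ?thesis .
    qed
    then show ?thesis by blast
  qed
  then obtain r :: "nat \<Rightarrow> nat" where r: "strict_mono r" "AE x in M. Cauchy (\<lambda>i. u (r i) x)"
    using cauchy_L1_AE_cauchy_subseq[of M u] L2_integrable[OF finite_measure_axioms L2] by blast
  define f where "f x = lim (\<lambda>i. u (r i) x)" for x
  have [measurable]: "f \<in> borel_measurable M" unfolding f_def by measurable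
  have lim: "AE x in M. (\<lambda>i. u (r i) x) \<longlonglongrightarrow> f x"
    using r(2) by eventually_elim (simp add: f_def Cauchy_convergent convergent_LIMSEQ_iff[symmetric])
  have bound: "\<exists>N. \<forall>n\<ge>N. integrable M (\<lambda>x. (norm (u n x - f x))\<^sup>2) \<and> (LINT x|M. (norm (u n x - f x))\<^sup>2) \<le> e" if "e > 0" for e
  proof -
    obtain N where N: "\<And>i j. i \<ge> N \<Longrightarrow> j \<ge> N \<Longrightarrow> (LINT x|M. (norm (u i x - u j x))\<^sup>2) < e"
      using Cauchy[OF \<open>e > 0\<close>] by auto
    have "integrable M (\<lambda>x. (norm (u n x - f x))\<^sup>2) \<and> (LINT x|M. (norm (u n x - f x))\<^sup>2) \<le> e" if "n \<ge> N" for n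
    proof -
      have 1: "integrable M (\<lambda>x. (norm (u n x - u (r i) x))\<^sup>2)" for i
        using L2_diff[OF L2 L2] by (simp add: L2_def)
      have 2: "AE x in M. (\<lambda>i. (norm (u n x - u (r i) x))\<^sup>2) \<longlonglongrightarrow> (norm (u n x - f x))\<^sup>2"
        using lim by eventually_elim (intro tendsto_intros)
      have 3: "\<forall>\<^sub>F i in sequentially. (LINT x|M. (norm (u n x - u (r i) x))\<^sup>2) \<le> e"
        using eventually_ge_at_top[of N]
        by eventually_elim (rule less_imp_le[OF N[OF that order_trans[OF _ seq_suble[OF r(1)]]]])
      have [measurable]: "(\<lambda>x. (norm (u n x - u (r i) x))\<^sup>2) \<in> borel_measurable M"
        "(\<lambda>x. (norm (u n x - f x))\<^sup>2) \<in> borel_measurable M" for i by measurable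
      show ?thesis
        by (intro conjI nn_integral_Fatou_bound[OF _ _ _ 1 2 3]) auto
    qed
    then show ?thesis by blast
  qed
  show ?thesis
  proof (rule that[of f])
    show "(\<lambda>n. LINT x|M. (norm (u n x - f x))\<^sup>2) \<longlonglongrightarrow> 0"
    proof (rule LIMSEQ_I)
      fix e :: real assume "e > 0"
      then obtain N where "\<forall>n\<ge>N. (LINT x|M. (norm (u n x - f x))\<^sup>2) \<le> e / 2" using bound[of "e / 2"] by auto
      then show "\<exists>N. \<forall>n\<ge>N. norm ((LINT x|M. (norm (u n x - f x))\<^sup>2) - 0) < e"
        using \<open>e > 0\<close> by (intro exI[of _ N]) auto
    qed
    obtain N where "integrable M (\<lambda>x. (norm (u N x - f x))\<^sup>2)" using bound[of 1] by auto
    then have "L2 M (\<lambda>x. u N x - f x)" by (simp add: L2_def)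
    from L2_diff[OF L2[of N] this] show "L2 M f" by simp
  qed
qed

lemma (in finite_measure) L2_tendsto_integral:
  fixes u :: "nat \<Rightarrow> 'a \<Rightarrow> 'b::euclidean_space"
  assumes L2: "\<And>n. L2 M (u n)" "L2 M f" and lim: "(\<lambda>n. LINT x|M. (norm (u n x - f x))\<^sup>2) \<longlonglongrightarrow> 0"
    and g: "g \<in> borel_measurable M" "\<And>x. \<bar>g x\<bar> \<le> K"
  shows "(\<lambda>n. LINT x|M. g x *\<^sub>R u n x) \<longlonglongrightarrow> (LINT x|M. g x *\<^sub>R f x)"
proof -
  note int = integrable_bounded_mult[OF g L2_integrable[OF finite_measure_axioms L2(1)]]
    integrable_bounded_mult[OF g L2_integrable[OF finite_measure_axioms L2(2)]]
  have "norm ((LINT x|M. g x *\<^sub>R u n x) - (LINT x|M. g x *\<^sub>R f x)) \<le>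
     K * sqrt (measure M (space M) * (LINT x|M. (norm (u n x - f x))\<^sup>2))" for n
  proof -
    have L: "L2 M (\<lambda>x. u n x - f x)" by (rule L2_diff[OF L2])
    then have i: "integrable M (\<lambda>x. u n x - f x)" by (rule L2_integrable[OF finite_measure_axioms])
    have "norm ((LINT x|M. g x *\<^sub>R u n x) - (LINT x|M. g x *\<^sub>R f x)) = norm (LINT x|M. g x *\<^sub>R (u n x - f x))"
      using int by (simp add: scaleR_diff_right)
    also have "\<dots> \<le> (LINT x|M. norm (g x *\<^sub>R (u n x - f x)))" by (rule integral_norm_bound)
    also have "\<dots> \<le> (LINT x|M. K * norm (u n x - f x))"
      by (rule integral_mono) (use integrable_norm[OF integrable_bounded_mult[OF g i]] i g(2) in \<open>auto intro!: mult_right_mono\<close>)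
    also have "\<dots> = K * (LINT x|M. norm (u n x - f x))" using i by simp
    also have "\<dots> \<le> K * sqrt (measure M (space M) * (LINT x|M. (norm (u n x - f x))\<^sup>2))"
      using order_trans[OF abs_ge_zero g(2)] by (intro mult_left_mono integral_norm_le_L2[OF L]) auto
    finally show ?thesis .
  qed
  then have bound: "\<forall>\<^sub>F n in sequentially. norm ((LINT x|M. g x *\<^sub>R u n x) - (LINT x|M. g x *\<^sub>R f x)) \<le>
     K * sqrt (measure M (space M) * (LINT x|M. (norm (u n x - f x))\<^sup>2))" by (intro always_eventually allI)
  have "(\<lambda>n. K * sqrt (measure M (space M) * (LINT x|M. (norm (u n x - f x))\<^sup>2))) \<longlonglongrightarrow> K * sqrt (measure M (space M) * 0)"
    by (intro tendsto_intros lim)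
  then have "(\<lambda>n. K * sqrt (measure M (space M) * (LINT x|M. (norm (u n x - f x))\<^sup>2))) \<longlonglongrightarrow> 0" by simp
  from Lim_null_comparison[OF bound this] show ?thesis by (rule LIM_zero_cancel)
qed

context bounded_domain
begin

lemma has_weak_deriv_limit:
  fixes u v :: "nat \<Rightarrow> R2 \<Rightarrow> 'b::euclidean_space"
  assumes "\<And>n. L2 M\<Omega> (u n)" "\<And>n. L2 M\<Omega> (v n)" "L2 M\<Omega> f" "L2 M\<Omega> g"
    "(\<lambda>n. LINT x|M\<Omega>. (norm (u n x - f x))\<^sup>2) \<longlonglongrightarrow> 0" "(\<lambda>n. LINT x|M\<Omega>. (norm (v n x - g x))\<^sup>2) \<longlonglongrightarrow> 0"
    "\<And>n. has_weak_deriv \<Omega> e (u n) (v n)"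
  shows "has_weak_deriv \<Omega> e f g"
  unfolding has_weak_deriv_def
proof
  fix \<phi> assume \<phi>: "\<phi> \<in> test_functions \<Omega>"
  obtain K1 where K1: "\<And>p. \<bar>\<phi> p\<bar> \<le> K1" using test_function_continuous_bounded(2)[OF \<phi>] by blast
  obtain K2 where K2: "\<And>p. \<bar>frechet_derivative \<phi> (at p) e\<bar> \<le> K2" using test_function_continuous_bounded(4)[OF \<phi>] by blast
  have 1: "(\<lambda>n. LINT p|M\<Omega>. frechet_derivative \<phi> (at p) e *\<^sub>R u n p) \<longlonglongrightarrow> (LINT p|M\<Omega>. frechet_derivative \<phi> (at p) e *\<^sub>R f p)"
    by (rule L2_tendsto_integral[OF assms(1,3,5) _ K2])
       (rule continuous_lebesgue_on_measurable[OF test_function_continuous_bounded(3)[OF \<phi>]])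
  have 2: "(\<lambda>n. - (LINT p|M\<Omega>. \<phi> p *\<^sub>R v n p)) \<longlonglongrightarrow> - (LINT p|M\<Omega>. \<phi> p *\<^sub>R g p)"
    by (intro tendsto_minus L2_tendsto_integral[OF assms(2,4,6) _ K1])
       (rule continuous_lebesgue_on_measurable[OF test_function_continuous_bounded(1)[OF \<phi>]])
  have eq: "(LINT p|M\<Omega>. frechet_derivative \<phi> (at p) e *\<^sub>R u n p) = - (LINT p|M\<Omega>. \<phi> p *\<^sub>R v n p)" for n
    using assms(7)[of n] \<phi> by (simp add: has_weak_deriv_def)
  show "(LINT p|M\<Omega>. frechet_derivative \<phi> (at p) e *\<^sub>R f p) = - (LINT p|M\<Omega>. \<phi> p *\<^sub>R g p)"
    by (rule LIMSEQ_unique[OF 1[unfolded eq] 2])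
qed

lemma sob_sq_split:
  assumes "sob \<Omega> u v w"
  shows "sob_sq u v w = (LINT p|M\<Omega>. (norm (u p))\<^sup>2) + (LINT p|M\<Omega>. (norm (v p))\<^sup>2) + (LINT p|M\<Omega>. (norm (w p))\<^sup>2)"
  using assms unfolding sob_def L2_def sob_sq_def by simp

lemma sob_complete:
  fixes u v w :: "nat \<Rightarrow> R2 \<Rightarrow> 'b::euclidean_space"
  assumes s: "\<And>n. sob \<Omega> (u n) (v n) (w n)"
    and C: "\<And>e. e > 0 \<Longrightarrow> \<exists>N. \<forall>i\<ge>N. \<forall>j\<ge>N.
      sob_sq (\<lambda>p. u i p - u j p) (\<lambda>p. v i p - v j p) (\<lambda>p. w i p - w j p) < e"
  obtains u' v' w' where "sob \<Omega> u' v' w'"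
    "(\<lambda>n. LINT p|M\<Omega>. (norm (u n p - u' p))\<^sup>2) \<longlonglongrightarrow> 0"
    "(\<lambda>n. LINT p|M\<Omega>. (norm (v n p - v' p))\<^sup>2) \<longlonglongrightarrow> 0"
    "(\<lambda>n. LINT p|M\<Omega>. (norm (w n p - w' p))\<^sup>2) \<longlonglongrightarrow> 0"
proof -
  have L: "L2 M\<Omega> (u n)" "L2 M\<Omega> (v n)" "L2 M\<Omega> (w n)" for n using s[of n] by (auto simp: sob_def)
  have le: "(LINT p|M\<Omega>. (norm (u i p - u j p))\<^sup>2) \<le> sob_sq (\<lambda>p. u i p - u j p) (\<lambda>p. v i p - v j p) (\<lambda>p. w i p - w j p)"
    "(LINT p|M\<Omega>. (norm (v i p - v j p))\<^sup>2) \<le> sob_sq (\<lambda>p. u i p - u j p) (\<lambda>p. v i p - v j p) (\<lambda>p. w i p - w j p)"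
    "(LINT p|M\<Omega>. (norm (w i p - w j p))\<^sup>2) \<le> sob_sq (\<lambda>p. u i p - u j p) (\<lambda>p. v i p - v j p) (\<lambda>p. w i p - w j p)" for i j
    unfolding sob_sq_split[OF sob_diff[OF s s]] by simp_all
  obtain u' where u': "L2 M\<Omega> u'" "(\<lambda>n. LINT p|M\<Omega>. (norm (u n p - u' p))\<^sup>2) \<longlonglongrightarrow> 0"
    by (rule L2_complete[of u]) (use L(1) in blast, use C le(1) in \<open>meson le_less_trans\<close>, blast)
  obtain v' where v': "L2 M\<Omega> v'" "(\<lambda>n. LINT p|M\<Omega>. (norm (v n p - v' p))\<^sup>2) \<longlonglongrightarrow> 0"
    by (rule L2_complete[of v]) (use L(2) in blast, use C le(2) in \<open>meson le_less_trans\<close>, blast)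
  obtain w' where w': "L2 M\<Omega> w'" "(\<lambda>n. LINT p|M\<Omega>. (norm (w n p - w' p))\<^sup>2) \<longlonglongrightarrow> 0"
    by (rule L2_complete[of w]) (use L(3) in blast, use C le(3) in \<open>meson le_less_trans\<close>, blast)
  have D: "has_weak_deriv \<Omega> (1, 0) (u n) (v n)" "has_weak_deriv \<Omega> (0, 1) (u n) (w n)" for n
    using s[of n] by (simp_all add: sob_def)
  have "sob \<Omega> u' v' w'"
    unfolding sob_def
    using u'(1) v'(1) w'(1) has_weak_deriv_limit[OF L(1,2) u'(1) v'(1) u'(2) v'(2) D(1)]
      has_weak_deriv_limit[OF L(1,3) u'(1) w'(1) u'(2) w'(2) D(2)] by blast
  then show ?thesis by (rule that[OF _ u'(2) v'(2) w'(2)])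
qed

end

section \<open>Traces\<close>

text \<open>Two common points, with parameters t1, t2 on one segment and s1, s2 on the other, put
  both segments on one line; the affine map taking t1, t2 to s1, s2 is the change of
  parameter.\<close>

lemma segment_reparametrisation:
  fixes a b c d :: R2
  assumes "a \<noteq> b" "c \<noteq> d"
  shows "(\<exists>t0. \<forall>t. linepath a b t \<in> closed_segment c d \<longrightarrow> t = t0) \<or>
    (\<exists>\<alpha> \<beta>. \<alpha> \<noteq> 0 \<and> (\<forall>t. linepath a b t = linepath c d (\<beta> + \<alpha> * t)) \<and>
       (\<forall>t. linepath a b t \<in> closed_segment c d \<longrightarrow> \<beta> + \<alpha> * t \<in> {0..1}))"
proof (cases "\<exists>t0. \<forall>t. linepath a b t \<in> closed_segment c d \<longrightarrow> t = t0")
  case False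
  have lp: "linepath x y t = x + t *\<^sub>R (y - x)" for x y :: R2 and t
    by (simp add: linepath_def algebra_simps)
  have inj: "s = s'" if "linepath c d s = linepath c d s'" for s s'
    using that \<open>c \<noteq> d\<close> by (simp add: lp)
  from False obtain t1 t2 where t: "linepath a b t1 \<in> closed_segment c d" "linepath a b t2 \<in> closed_segment c d" "t1 \<noteq> t2"
    by blast
  then obtain s1 s2 where s: "linepath a b t1 = linepath c d s1" "linepath a b t2 = linepath c d s2"
    by (metis imageE linepath_image_01)
  define \<alpha> where "\<alpha> = (s2 - s1) / (t2 - t1)"
  define \<beta> where "\<beta> = s1 - \<alpha> * t1"
  have "(t2 - t1) *\<^sub>R (b - a) = (s2 - s1) *\<^sub>R (d - c)"
  proof -
    have "(t2 - t1) *\<^sub>R (b - a) = linepath a b t2 - linepath a b t1" by (simp add: lp algebra_simps)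
    also have "\<dots> = (s2 - s1) *\<^sub>R (d - c)" unfolding s by (simp add: lp algebra_simps)
    finally show ?thesis .
  qed
  then have "(1 / (t2 - t1)) *\<^sub>R ((t2 - t1) *\<^sub>R (b - a)) = (1 / (t2 - t1)) *\<^sub>R ((s2 - s1) *\<^sub>R (d - c))" by simp
  then have ba: "b - a = \<alpha> *\<^sub>R (d - c)" using t(3) by (simp add: \<alpha>_def)
  then have "\<alpha> \<noteq> 0" using \<open>a \<noteq> b\<close> by auto
  have eq: "linepath a b t = linepath c d (\<beta> + \<alpha> * t)" for t
  proof -
    have "linepath a b t = linepath a b t1 + (t - t1) *\<^sub>R (b - a)" by (simp add: lp algebra_simps)
    also have "\<dots> = linepath c d (\<beta> + \<alpha> * t)" unfolding s ba by (simp add: lp \<beta>_def algebra_simps)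
    finally show ?thesis .
  qed
  have "\<beta> + \<alpha> * t \<in> {0..1}" if "linepath a b t \<in> closed_segment c d" for t
  proof -
    obtain s where "s \<in> {0..1}" "linepath a b t = linepath c d s" using \<open>linepath a b t \<in> closed_segment c d\<close> by (metis imageE linepath_image_01)
    then show ?thesis using eq[of t] inj by metis
  qed
  then show ?thesis using eq \<open>\<alpha> \<noteq> 0\<close> by blast
qed blast

text \<open>The segment meets each edge in at most one point, a null set, or runs along its line
  with an affine change of parameter and Jacobian 1 / |\<alpha>|. The constant is chosen before
  \<open>f\<close>; this reduces convergence along every segment of the boundary to convergence on
  finitely many edges.\<close>

lemma segment_integral_bound:
  fixes a b :: R2
  assumes E: "finite E" "\<And>c d. (c, d) \<in> E \<Longrightarrow> c \<noteq> d" and "a \<noteq> b"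
    and sub: "closed_segment a b \<subseteq> (\<Union>(c, d)\<in>E. closed_segment c d)"
  obtains K :: real where "K \<ge> 0" "\<And>f :: R2 \<Rightarrow> real. (\<And>p. 0 \<le> f p) \<Longrightarrow> integrable (lebesgue_on {0..1}) (\<lambda>t. f (linepath a b t)) \<Longrightarrow>
    (\<And>c d. (c, d) \<in> E \<Longrightarrow> integrable (lebesgue_on {0..1}) (\<lambda>t. f (linepath c d t))) \<Longrightarrow>
    (LINT t|lebesgue_on {0..1}. f (linepath a b t)) \<le> K * (\<Sum>(c, d)\<in>E. LINT t|lebesgue_on {0..1}. f (linepath c d t :: R2))"
proof -
  define I where "I q = {t. linepath a b t \<in> closed_segment (fst q) (snd q)}" for q :: "R2 \<times> R2"
  have Icl: "closed (I q)" for q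
    unfolding I_def using closed_vimage[of "closed_segment (fst q) (snd q)" "linepath a b"]
    by (simp add: vimage_def continuous_on_linepath)
  \<comment> \<open>The left side is a nonnegative integral, so the piece of the segment inside one
    edge can be treated without first proving its integrability.\<close>
  define good where "good q k \<longleftrightarrow> k \<ge> 0 \<and> (\<forall>f. (\<forall>p::R2. 0 \<le> f p) \<longrightarrow> integrable (lebesgue_on {0..1}) (\<lambda>t. f (linepath (fst q) (snd q) t)) \<longrightarrow>
     (\<integral>\<^sup>+t. indicator (I q) t * ennreal (f (linepath a b t)) \<partial>lebesgue) \<le>
       ennreal (k * (LINT t|lebesgue_on {0..1}. f (linepath (fst q) (snd q) t))))" for q and k :: real
  have "\<exists>k. good q k" if q: "q \<in> E" for q
  proof -
    obtain c d where cd: "q = (c, d)" "c \<noteq> d" using E(2) q by (cases q) auto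
    consider t0 where "\<And>t. t \<in> I q \<Longrightarrow> t = t0" |
      \<alpha> \<beta> where "\<alpha> \<noteq> 0" "\<And>t. linepath a b t = linepath c d (\<beta> + \<alpha> * t)" "\<And>t. t \<in> I q \<Longrightarrow> \<beta> + \<alpha> * t \<in> {0..1}"
      using segment_reparametrisation[OF \<open>a \<noteq> b\<close> cd(2)] unfolding I_def cd(1) by auto
    then show ?thesis
    proof cases
      case 1
      have "good q 0"
        unfolding good_def
      proof (intro conjI allI impI)
        fix f :: "R2 \<Rightarrow> real"
        have "(\<integral>\<^sup>+t. indicator (I q) t * ennreal (f (linepath a b t)) \<partial>lebesgue) = (\<integral>\<^sup>+(t::real). 0 \<partial>lebesgue)"
        proof (rule nn_integral_cong_AE)
          have "AE t in lebesgue. t \<noteq> t0" using AE_lborel_singleton[of t0] by (simp add: AE_completion_iff)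
          then show "AE t in lebesgue. indicator (I q) t * ennreal (f (linepath a b t)) = 0"
            by eventually_elim (use 1 in \<open>auto simp: indicator_def\<close>)
        qed
        then show "(\<integral>\<^sup>+t. indicator (I q) t * ennreal (f (linepath a b t)) \<partial>lebesgue) \<le>
          ennreal (0 * (LINT t|lebesgue_on {0..1}. f (linepath (fst q) (snd q) t)))" by simp
      qed simp
      then show ?thesis ..
    next
      case 2
      have "good q (1 / \<bar>\<alpha>\<bar>)"
        unfolding good_def
      proof (intro conjI allI impI)
        fix f :: "R2 \<Rightarrow> real"
        assume f0: "\<forall>p. 0 \<le> f p" and "integrable (lebesgue_on {0..1}) (\<lambda>t. f (linepath (fst q) (snd q) t))"
        then have int: "integrable (lebesgue_on {0..1}) (\<lambda>t. f (linepath c d t))" by (simp add: cd)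
        define F where "F s = (if s \<in> {0..1} then f (linepath c d s) else 0)" for s
        have F: "integrable lebesgue F" "(LINT s|lebesgue. F s) = (LINT t|lebesgue_on {0..1}. f (linepath c d t))"
          unfolding F_def using int by (simp_all add: Lebesgue_Measure.integrable_restrict_UNIV Lebesgue_Measure.integral_restrict_UNIV del: atLeastAtMost_iff)
        have [measurable]: "F \<in> borel_measurable lebesgue" using F by auto
        have F0: "0 \<le> F s" for s using spec[OF f0, of "linepath c d s"] by (simp add: F_def)
        have "ennreal \<bar>\<alpha>\<bar> * (\<integral>\<^sup>+t. indicator (I q) t * ennreal (f (linepath a b t)) \<partial>lebesgue) \<le>
          ennreal \<bar>\<alpha>\<bar> * (\<integral>\<^sup>+t. ennreal (F (\<beta> + \<alpha> * t)) \<partial>lebesgue)"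
        proof (intro mult_left_mono nn_integral_mono)
          fix t
          show "indicator (I q) t * ennreal (f (linepath a b t)) \<le> ennreal (F (\<beta> + \<alpha> * t))"
            using 2(3)[of t] f0 by (cases "t \<in> I q") (simp_all add: F_def 2(2) del: atLeastAtMost_iff)
        qed simp
        also have "\<dots> = (\<integral>\<^sup>+s. ennreal (F s) \<partial>lebesgue)"
          using nn_integral_real_affine_lebesgue[OF _ 2(1), of "\<lambda>s. ennreal (F s)" \<beta>] by simp
        also have "\<dots> = ennreal (LINT s|lebesgue. F s)"
          using F0 by (intro nn_integral_eq_integral F) auto
        finally have le: "ennreal \<bar>\<alpha>\<bar> * (\<integral>\<^sup>+t. indicator (I q) t * ennreal (f (linepath a b t)) \<partial>lebesgue) \<le> ennreal (LINT s|lebesgue. F s)" .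
        have "(\<integral>\<^sup>+t. indicator (I q) t * ennreal (f (linepath a b t)) \<partial>lebesgue) =
           ennreal (1 / \<bar>\<alpha>\<bar>) * (ennreal \<bar>\<alpha>\<bar> * (\<integral>\<^sup>+t. indicator (I q) t * ennreal (f (linepath a b t)) \<partial>lebesgue))"
          using 2(1) by (simp flip: ennreal_mult mult.assoc)
        also have "\<dots> \<le> ennreal (1 / \<bar>\<alpha>\<bar>) * ennreal (LINT s|lebesgue. F s)"
          by (intro mult_left_mono le) simp
        also have "\<dots> = ennreal (1 / \<bar>\<alpha>\<bar> * (LINT s|lebesgue. F s))"
          using F0 by (simp flip: ennreal_mult)
        finally show "(\<integral>\<^sup>+t. indicator (I q) t * ennreal (f (linepath a b t)) \<partial>lebesgue) \<le>
          ennreal (1 / \<bar>\<alpha>\<bar> * (LINT t|lebesgue_on {0..1}. f (linepath (fst q) (snd q) t)))"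
          by (simp add: F(2) cd)
      qed simp
      then show ?thesis ..
    qed
  qed
  then obtain k where k: "\<And>q. q \<in> E \<Longrightarrow> good q (k q)" by metis
  have k0: "k q \<ge> 0" if "q \<in> E" for q using k[OF that] by (simp add: good_def)
  show thesis
  proof (rule that[of "\<Sum>q\<in>E. k q"])
    show "0 \<le> sum k E" using k0 by (intro sum_nonneg) auto
    fix f :: "R2 \<Rightarrow> real"
    assume f0: "\<And>p. 0 \<le> f p" and fab: "integrable (lebesgue_on {0..1}) (\<lambda>t. f (linepath a b t))"
      and fcd: "\<And>c d. (c, d) \<in> E \<Longrightarrow> integrable (lebesgue_on {0..1}) (\<lambda>t. f (linepath c d t))"
    define T where "T q = (LINT t|lebesgue_on {0..1}. f (linepath (fst q) (snd q) t))" for q :: "R2 \<times> R2"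
    have T0: "T q \<ge> 0" for q using f0 by (simp add: T_def)
    define F where "F t = (if t \<in> {0..1} then f (linepath a b t) else 0)" for t
    have F: "integrable lebesgue F" "(LINT s|lebesgue. F s) = (LINT t|lebesgue_on {0..1}. f (linepath a b t))"
      unfolding F_def using fab by (simp_all add: Lebesgue_Measure.integrable_restrict_UNIV Lebesgue_Measure.integral_restrict_UNIV del: atLeastAtMost_iff)
    have [measurable]: "F \<in> borel_measurable lebesgue" using F by auto
    have [measurable]: "I q \<in> sets lebesgue" for q using Icl by auto
    have F0: "0 \<le> F s" for s using f0[of "linepath a b s"] by (simp add: F_def)
    have "ennreal (LINT s|lebesgue. F s) = (\<integral>\<^sup>+t. ennreal (F t) \<partial>lebesgue)"
      using F0 by (intro nn_integral_eq_integral[symmetric] F) auto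
    also have "\<dots> \<le> (\<integral>\<^sup>+t. (\<Sum>q\<in>E. indicator (I q) t * ennreal (F t)) \<partial>lebesgue)"
    proof (rule nn_integral_mono)
      fix t
      show "ennreal (F t) \<le> (\<Sum>q\<in>E. indicator (I q) t * ennreal (F t))"
      proof (cases "t \<in> {0..1}")
        case True
        then have "linepath a b t \<in> closed_segment a b" by (metis imageI linepath_image_01)
        then obtain q where q: "q \<in> E" "t \<in> I q" using sub by (auto simp: I_def)
        have "indicator (I q) t * ennreal (F t) \<le> (\<Sum>q\<in>E. indicator (I q) t * ennreal (F t))"
          by (rule member_le_sum) (use q E in auto)
        then show ?thesis using q by simp
      next
        case False
        then have "F t = 0" unfolding F_def by (rule if_not_P)
        then show ?thesis by simp
      qed
    qed
    also have "\<dots> = (\<Sum>q\<in>E. \<integral>\<^sup>+t. indicator (I q) t * ennreal (F t) \<partial>lebesgue)"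
      by (rule nn_integral_sum) measurable
    also have "\<dots> \<le> (\<Sum>q\<in>E. \<integral>\<^sup>+t. indicator (I q) t * ennreal (f (linepath a b t)) \<partial>lebesgue)"
      using f0 by (intro sum_mono nn_integral_mono mult_left_mono) (auto simp: F_def)
    also have "\<dots> \<le> (\<Sum>q\<in>E. ennreal (k q * T q))"
    proof (rule sum_mono)
      fix q assume q: "q \<in> E"
      then have "integrable (lebesgue_on {0..1}) (\<lambda>t. f (linepath (fst q) (snd q) t))" using fcd[of "fst q" "snd q"] by simp
      then show "(\<integral>\<^sup>+t. indicator (I q) t * ennreal (f (linepath a b t)) \<partial>lebesgue) \<le> ennreal (k q * T q)"
        using k[OF q] f0 unfolding good_def T_def by blast
    qed
    also have "\<dots> = ennreal (\<Sum>q\<in>E. k q * T q)"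
      using k0 T0 by (intro sum_ennreal) auto
    finally have "(LINT s|lebesgue. F s) \<le> (\<Sum>q\<in>E. k q * T q)"
      using k0 T0 by (simp add: ennreal_le_iff sum_nonneg)
    also have "\<dots> \<le> (\<Sum>q\<in>E. sum k E * T q)"
      using k0 T0 E(1) by (intro sum_mono mult_right_mono member_le_sum) auto
    also have "\<dots> = sum k E * (\<Sum>(c, d)\<in>E. LINT t|lebesgue_on {0..1}. f (linepath c d t))"
      by (simp add: sum_distrib_left T_def split_beta)
    finally show "(LINT t|lebesgue_on {0..1}. f (linepath a b t)) \<le>
      sum k E * (\<Sum>(c, d)\<in>E. LINT t|lebesgue_on {0..1}. f (linepath c d t))"
      by (simp add: F(2))
  qed
qed

section \<open>Rules for norms and traces\<close>

context bounded_domain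
begin

lemma W12_norm_sq:
  fixes u v w :: "R2 \<Rightarrow> 'b::euclidean_space"
  assumes "sob \<Omega> u v w"
  shows "(W12_norm \<Omega> u)\<^sup>2 = (LINT p|M\<Omega>. (norm (u p))\<^sup>2) + (LINT p|M\<Omega>. (norm (v p))\<^sup>2) + (LINT p|M\<Omega>. (norm (w p))\<^sup>2)"
proof -
  have "0 \<le> sob_sq u v w" unfolding sob_sq_def by simp
  then show ?thesis by (simp add: W12_norm_sob[OF assms] sob_sq_split[OF assms, symmetric])
qed

lemma W12_add:
  fixes u u' :: "R2 \<Rightarrow> 'b::euclidean_space"
  assumes "W12 \<Omega> u" "W12 \<Omega> u'"
  shows "W12 \<Omega> (\<lambda>p. u p + u' p)"
  by (rule sob_W12[OF sob_add[OF W12_sob[OF assms(1)] W12_sob[OF assms(2)]]])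

lemma W12_bounded_linear:
  fixes u :: "R2 \<Rightarrow> 'b::euclidean_space" and f :: "'b \<Rightarrow> 'c::euclidean_space"
  assumes "bounded_linear f" "W12 \<Omega> u"
  shows "W12 \<Omega> (\<lambda>p. f (u p))"
  by (rule sob_W12[OF sob_bounded_linear[OF assms(1) W12_sob[OF assms(2)]]])

lemma W12_diff:
  fixes u u' :: "R2 \<Rightarrow> 'b::euclidean_space"
  assumes "W12 \<Omega> u" "W12 \<Omega> u'"
  shows "W12 \<Omega> (\<lambda>p. u p - u' p)"
  by (rule sob_W12[OF sob_diff[OF W12_sob[OF assms(1)] W12_sob[OF assms(2)]]])

lemma integral_norm_add_sq:
  fixes f g :: "'a \<Rightarrow> 'b::euclidean_space"
  assumes "L2 N f" "L2 N g"
  shows "(LINT p|N. (norm (f p + g p))\<^sup>2) \<le> 2 * (LINT p|N. (norm (f p))\<^sup>2) + 2 * (LINT p|N. (norm (g p))\<^sup>2)"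
proof -
  have "(LINT p|N. (norm (f p + g p))\<^sup>2) \<le> (LINT p|N. 2 * (norm (f p))\<^sup>2 + 2 * (norm (g p))\<^sup>2)"
    by (rule integral_mono) (use L2_add[OF assms] assms norm_add_sq in \<open>auto simp: L2_def\<close>)
  then show ?thesis using assms by (simp add: L2_def)
qed

lemma integral_norm_bounded_linear_sq:
  fixes f :: "'a \<Rightarrow> 'b::euclidean_space" and T :: "'b \<Rightarrow> 'c::euclidean_space"
  assumes T: "bounded_linear T" "\<And>x. norm (T x) \<le> norm x * K" and "L2 N f"
  shows "(LINT p|N. (norm (T (f p)))\<^sup>2) \<le> K\<^sup>2 * (LINT p|N. (norm (f p))\<^sup>2)"
proof -
  have "(norm (T x))\<^sup>2 \<le> K\<^sup>2 * (norm x)\<^sup>2" for x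
    using power_mono[OF T(2) norm_ge_zero, of x 2] by (simp add: power_mult_distrib mult.commute)
  then have "(LINT p|N. (norm (T (f p)))\<^sup>2) \<le> (LINT p|N. K\<^sup>2 * (norm (f p))\<^sup>2)"
    by (intro integral_mono) (use L2_bounded_linear[OF T(1) assms(3)] assms(3) in \<open>auto simp: L2_def\<close>)
  then show ?thesis by simp
qed

text \<open>The triangle inequality in squared form follows from the pointwise bound
  \<open>norm_add_sq\<close> applied to the function and both derivatives; it suffices for sequences
  that tend to 0.\<close>

lemma W12_norm_add:
  fixes u u' :: "R2 \<Rightarrow> 'b::euclidean_space"
  assumes "W12 \<Omega> u" "W12 \<Omega> u'"
  shows "(W12_norm \<Omega> (\<lambda>p. u p + u' p))\<^sup>2 \<le> 2 * (W12_norm \<Omega> u)\<^sup>2 + 2 * (W12_norm \<Omega> u')\<^sup>2"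
proof -
  note s = W12_sob[OF assms(1)] W12_sob[OF assms(2)]
  have L: "L2 M\<Omega> u" "L2 M\<Omega> (weak_deriv \<Omega> (1, 0) u)" "L2 M\<Omega> (weak_deriv \<Omega> (0, 1) u)"
    "L2 M\<Omega> u'" "L2 M\<Omega> (weak_deriv \<Omega> (1, 0) u')" "L2 M\<Omega> (weak_deriv \<Omega> (0, 1) u')"
    using s by (auto simp: sob_def)
  have sum3: "x1 + x2 + x3 \<le> 2 * (y1 + y2 + y3) + 2 * (z1 + z2 + z3)"
    if "x1 \<le> 2 * y1 + 2 * z1" "x2 \<le> 2 * y2 + 2 * z2" "x3 \<le> 2 * y3 + 2 * z3" for x1 x2 x3 y1 y2 y3 z1 z2 z3 :: real
    using that by simp
  show ?thesis
    unfolding W12_norm_sq[OF s(1)] W12_norm_sq[OF s(2)] W12_norm_sq[OF sob_add[OF s]]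
    by (rule sum3[OF integral_norm_add_sq[OF L(1,4)] integral_norm_add_sq[OF L(2,5)] integral_norm_add_sq[OF L(3,6)]])
qed

lemma W12_norm_bounded_linear:
  fixes u :: "R2 \<Rightarrow> 'b::euclidean_space" and T :: "'b \<Rightarrow> 'c::euclidean_space"
  assumes T: "bounded_linear T" "\<And>x. norm (T x) \<le> norm x * K" and "W12 \<Omega> u"
  shows "(W12_norm \<Omega> (\<lambda>p. T (u p)))\<^sup>2 \<le> K\<^sup>2 * (W12_norm \<Omega> u)\<^sup>2"
proof -
  note s = W12_sob[OF assms(3)]
  have L: "L2 M\<Omega> u" "L2 M\<Omega> (weak_deriv \<Omega> (1, 0) u)" "L2 M\<Omega> (weak_deriv \<Omega> (0, 1) u)"
    using s by (auto simp: sob_def)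
  show ?thesis
    unfolding W12_norm_sq[OF s] W12_norm_sq[OF sob_bounded_linear[OF T(1) s]]
    using integral_norm_bounded_linear_sq[OF T L(1)] integral_norm_bounded_linear_sq[OF T L(2)]
      integral_norm_bounded_linear_sq[OF T L(3)] by (simp add: distrib_left)
qed

lemma tendsto_zero_square_iff: "(\<lambda>n. (f n)\<^sup>2) \<longlonglongrightarrow> 0 \<longleftrightarrow> f \<longlonglongrightarrow> (0::real)"
proof
  assume "(\<lambda>n. (f n)\<^sup>2) \<longlonglongrightarrow> 0"
  then have "(\<lambda>n. sqrt ((f n)\<^sup>2)) \<longlonglongrightarrow> sqrt 0" by (intro tendsto_intros)
  then show "f \<longlonglongrightarrow> 0" by (simp add: tendsto_rabs_zero_iff)
next
  assume "f \<longlonglongrightarrow> 0"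
  then have "(\<lambda>n. (f n)\<^sup>2) \<longlonglongrightarrow> 0\<^sup>2" by (intro tendsto_intros)
  then show "(\<lambda>n. (f n)\<^sup>2) \<longlonglongrightarrow> 0" by simp
qed

lemma tendsto_zero_le:
  assumes "f \<longlonglongrightarrow> (0::real)" "g \<longlonglongrightarrow> 0" "\<And>n. 0 \<le> h n" "\<And>n. h n \<le> a * f n + b * g n"
  shows "h \<longlonglongrightarrow> 0"
proof (rule tendsto_sandwich[of "\<lambda>_. 0"])
  have "(\<lambda>n. a * f n + b * g n) \<longlonglongrightarrow> a * 0 + b * 0" by (intro tendsto_intros assms)
  then show "(\<lambda>n. a * f n + b * g n) \<longlonglongrightarrow> 0" by simp
qed (use assms in auto)

lemma has_trace_add:
  fixes u u' :: "R2 \<Rightarrow> 'b::euclidean_space"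
  assumes "has_trace \<Omega> u S h" "has_trace \<Omega> u' S h'"
  shows "has_trace \<Omega> (\<lambda>p. u p + u' p) S (\<lambda>p. h p + h' p)"
proof -
  obtain v where W: "W12 \<Omega> u" and v: "\<And>n. W12 \<Omega> (v n)" "\<And>n. continuous_on (closure \<Omega>) (v n)"
    "(\<lambda>n. W12_norm \<Omega> (\<lambda>p. v n p - u p)) \<longlonglongrightarrow> 0"
    "\<And>a b n. a \<noteq> b \<Longrightarrow> closed_segment a b \<subseteq> S \<Longrightarrow> L2 (lebesgue_on {0..1}) (\<lambda>t. v n (linepath a b t) - h (linepath a b t))"
    "\<And>a b. a \<noteq> b \<Longrightarrow> closed_segment a b \<subseteq> S \<Longrightarrow>
      (\<lambda>n. LINT t|lebesgue_on {0..1}. (norm (v n (linepath a b t) - h (linepath a b t)))\<^sup>2) \<longlonglongrightarrow> 0"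
    using assms(1) unfolding has_trace_def by blast
  obtain v' where W': "W12 \<Omega> u'" and v': "\<And>n. W12 \<Omega> (v' n)" "\<And>n. continuous_on (closure \<Omega>) (v' n)"
    "(\<lambda>n. W12_norm \<Omega> (\<lambda>p. v' n p - u' p)) \<longlonglongrightarrow> 0"
    "\<And>a b n. a \<noteq> b \<Longrightarrow> closed_segment a b \<subseteq> S \<Longrightarrow> L2 (lebesgue_on {0..1}) (\<lambda>t. v' n (linepath a b t) - h' (linepath a b t))"
    "\<And>a b. a \<noteq> b \<Longrightarrow> closed_segment a b \<subseteq> S \<Longrightarrow>
      (\<lambda>n. LINT t|lebesgue_on {0..1}. (norm (v' n (linepath a b t) - h' (linepath a b t)))\<^sup>2) \<longlonglongrightarrow> 0"
    using assms(2) unfolding has_trace_def by blast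
  have eq: "v n p + v' n p - (w + w') = (v n p - w) + (v' n p - w')" for n p w w' by simp
  show ?thesis
    unfolding has_trace_def
  proof (intro conjI exI[of _ "\<lambda>n p. v n p + v' n p"] allI impI)
    show "(\<lambda>n. W12_norm \<Omega> (\<lambda>p. (v n p + v' n p) - (u p + u' p))) \<longlonglongrightarrow> 0"
      unfolding eq
      by (rule iffD1[OF tendsto_zero_square_iff], rule tendsto_zero_le[OF
          iffD2[OF tendsto_zero_square_iff v(3)] iffD2[OF tendsto_zero_square_iff v'(3)] _ W12_norm_add])
        (auto intro: W12_diff v v' W W')
    fix a b :: R2 assume ab: "a \<noteq> b \<and> closed_segment a b \<subseteq> S"
    show "L2 (lebesgue_on {0..1}) (\<lambda>t. v n (linepath a b t) + v' n (linepath a b t) - (h (linepath a b t) + h' (linepath a b t)))" for n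
      unfolding eq by (intro L2_add v(4) v'(4)) (use ab in auto)
    show "(\<lambda>n. LINT t|lebesgue_on {0..1}. (norm (v n (linepath a b t) + v' n (linepath a b t) - (h (linepath a b t) + h' (linepath a b t))))\<^sup>2) \<longlonglongrightarrow> 0"
      unfolding eq
      by (rule tendsto_zero_le[OF v(5) v'(5) _ integral_norm_add_sq]) (use ab v(4) v'(4) in auto)
  qed (auto intro: W12_add W W' v v' continuous_intros)
qed

lemma has_trace_bounded_linear:
  fixes u :: "R2 \<Rightarrow> 'b::euclidean_space" and T :: "'b \<Rightarrow> 'c::euclidean_space"
  assumes T: "bounded_linear T" and "has_trace \<Omega> u S h"
  shows "has_trace \<Omega> (\<lambda>p. T (u p)) S (\<lambda>p. T (h p))"
proof -
  interpret T: bounded_linear T by fact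
  obtain K where K: "\<And>x. norm (T x) \<le> norm x * K" using T.bounded by blast
  obtain v where W: "W12 \<Omega> u" and v: "\<And>n. W12 \<Omega> (v n)" "\<And>n. continuous_on (closure \<Omega>) (v n)"
    "(\<lambda>n. W12_norm \<Omega> (\<lambda>p. v n p - u p)) \<longlonglongrightarrow> 0"
    "\<And>a b n. a \<noteq> b \<Longrightarrow> closed_segment a b \<subseteq> S \<Longrightarrow> L2 (lebesgue_on {0..1}) (\<lambda>t. v n (linepath a b t) - h (linepath a b t))"
    "\<And>a b. a \<noteq> b \<Longrightarrow> closed_segment a b \<subseteq> S \<Longrightarrow>
      (\<lambda>n. LINT t|lebesgue_on {0..1}. (norm (v n (linepath a b t) - h (linepath a b t)))\<^sup>2) \<longlonglongrightarrow> 0"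
    using assms(2) unfolding has_trace_def by blast
  \<comment> \<open>\<open>tendsto_zero_le\<close> expects two null sequences; here the second one
    is constantly 0 and gets the coefficient 0.\<close>
  have z: "(\<lambda>n. 0::real) \<longlonglongrightarrow> 0" by simp
  have bd: "x \<le> K\<^sup>2 * y + 0 * 0" if "x \<le> K\<^sup>2 * y" for x y :: real using that by simp
  show ?thesis
    unfolding has_trace_def
  proof (intro conjI exI[of _ "\<lambda>n p. T (v n p)"] allI impI)
    show "(\<lambda>n. W12_norm \<Omega> (\<lambda>p. T (v n p) - T (u p))) \<longlonglongrightarrow> 0"
      unfolding T.diff[symmetric]
      by (rule iffD1[OF tendsto_zero_square_iff], rule tendsto_zero_le[OF
          iffD2[OF tendsto_zero_square_iff v(3)] z _ bd[OF W12_norm_bounded_linear[OF T K]]])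
         (auto intro: W12_diff v W)
    fix a b :: R2 assume ab: "a \<noteq> b \<and> closed_segment a b \<subseteq> S"
    show "L2 (lebesgue_on {0..1}) (\<lambda>t. T (v n (linepath a b t)) - T (h (linepath a b t)))" for n
      unfolding T.diff[symmetric] by (intro L2_bounded_linear[OF T] v(4)) (use ab in auto)
    show "(\<lambda>n. LINT t|lebesgue_on {0..1}. (norm (T (v n (linepath a b t)) - T (h (linepath a b t))))\<^sup>2) \<longlonglongrightarrow> 0"
      unfolding T.diff[symmetric]
      by (rule tendsto_zero_le[OF v(5) z _ bd[OF integral_norm_bounded_linear_sq[OF T K]]]) (use ab v(4) in auto)
  qed (auto intro: W12_bounded_linear T W v T.continuous_on)
qed

lemma has_trace_scaleR:
  fixes u :: "R2 \<Rightarrow> 'b::euclidean_space"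
  shows "has_trace \<Omega> u S h \<Longrightarrow> has_trace \<Omega> (\<lambda>p. c *\<^sub>R u p) S (\<lambda>p. c *\<^sub>R h p)"
  by (rule has_trace_bounded_linear[OF bounded_linear_scaleR_right])

text \<open>For each k an approximant of \<open>u k\<close> is chosen within 1/(k+1), both in norm
  and in the integrals over the finitely many edges in \<open>E\<close>. These approximants converge
  to \<open>u'\<close>, and \<open>segment_integral_bound\<close> carries the estimate from the
  edges to an arbitrary segment in \<open>S\<close>.\<close>

lemma has_trace_limit:
  fixes u :: "nat \<Rightarrow> R2 \<Rightarrow> 'b::euclidean_space"
  assumes E: "finite E" "\<And>c d. (c, d) \<in> E \<Longrightarrow> c \<noteq> d" and S: "S = (\<Union>(c, d)\<in>E. closed_segment c d)"
    and tr: "\<And>k. has_trace \<Omega> (u k) S h" and W: "W12 \<Omega> u'"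
    and lim: "(\<lambda>k. W12_norm \<Omega> (\<lambda>p. u k p - u' p)) \<longlonglongrightarrow> 0"
  shows "has_trace \<Omega> u' S h"
proof -
  define D where "D v c d = (LINT t|lebesgue_on {0..1}. (norm (v (linepath c d t) - h (linepath c d t)))\<^sup>2)" for v and c d :: R2
  have D0: "0 \<le> D v c d" for v c d by (simp add: D_def)
  have Esub: "closed_segment c d \<subseteq> S" if "(c, d) \<in> E" for c d using that S by auto
  have "\<exists>v. W12 \<Omega> v \<and> continuous_on (closure \<Omega>) v \<and> W12_norm \<Omega> (\<lambda>p. v p - u k p) < 1 / Suc k \<and>
     (\<forall>a b. a \<noteq> b \<longrightarrow> closed_segment a b \<subseteq> S \<longrightarrow> L2 (lebesgue_on {0..1}) (\<lambda>t. v (linepath a b t) - h (linepath a b t))) \<and>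
     (\<forall>(c, d)\<in>E. D v c d < 1 / Suc k)" for k
  proof -
    obtain v where v: "\<And>n. W12 \<Omega> (v n)" "\<And>n. continuous_on (closure \<Omega>) (v n)"
      "(\<lambda>n. W12_norm \<Omega> (\<lambda>p. v n p - u k p)) \<longlonglongrightarrow> 0"
      "\<And>a b n. a \<noteq> b \<Longrightarrow> closed_segment a b \<subseteq> S \<Longrightarrow> L2 (lebesgue_on {0..1}) (\<lambda>t. v n (linepath a b t) - h (linepath a b t))"
      "\<And>a b. a \<noteq> b \<Longrightarrow> closed_segment a b \<subseteq> S \<Longrightarrow> (\<lambda>n. D (v n) a b) \<longlonglongrightarrow> 0"
      using tr[of k] unfolding has_trace_def D_def by blast
    have "\<forall>\<^sub>F n in sequentially. W12_norm \<Omega> (\<lambda>p. v n p - u k p) < 1 / Suc k"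
      by (rule order_tendstoD(2)[OF v(3)]) simp
    moreover have "\<forall>\<^sub>F n in sequentially. \<forall>(c, d)\<in>E. D (v n) c d < 1 / Suc k"
    proof -
      have "\<forall>\<^sub>F n in sequentially. D (v n) (fst q) (snd q) < 1 / Suc k" if q: "q \<in> E" for q
        by (rule order_tendstoD(2)[OF v(5)]) (use q E(2)[of "fst q" "snd q"] Esub[of "fst q" "snd q"] in auto)
      then show ?thesis using E(1) by (auto simp: eventually_ball_finite_distrib split_beta)
    qed
    ultimately have "\<forall>\<^sub>F n in sequentially. W12_norm \<Omega> (\<lambda>p. v n p - u k p) < 1 / Suc k \<and> (\<forall>(c, d)\<in>E. D (v n) c d < 1 / Suc k)"
      by eventually_elim blast
    then obtain n where "W12_norm \<Omega> (\<lambda>p. v n p - u k p) < 1 / Suc k \<and> (\<forall>(c, d)\<in>E. D (v n) c d < 1 / Suc k)"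
      by (auto simp: eventually_sequentially)
    then show ?thesis using v(1,2,4) by (intro exI[of _ "v n"]) blast
  qed
  from choice[OF allI[OF this]] obtain v where v0: "\<forall>k. W12 \<Omega> (v k) \<and> continuous_on (closure \<Omega>) (v k) \<and>
     W12_norm \<Omega> (\<lambda>p. v k p - u k p) < 1 / Suc k \<and>
     (\<forall>a b. a \<noteq> b \<longrightarrow> closed_segment a b \<subseteq> S \<longrightarrow> L2 (lebesgue_on {0..1}) (\<lambda>t. v k (linepath a b t) - h (linepath a b t))) \<and>
     (\<forall>(c, d)\<in>E. D (v k) c d < 1 / Suc k)" by (rule exE)
  have v: "W12 \<Omega> (v k)" "continuous_on (closure \<Omega>) (v k)"
    "W12_norm \<Omega> (\<lambda>p. v k p - u k p) < 1 / Suc k"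
    "a \<noteq> b \<Longrightarrow> closed_segment a b \<subseteq> S \<Longrightarrow> L2 (lebesgue_on {0..1}) (\<lambda>t. v k (linepath a b t) - h (linepath a b t))"
    "(c, d) \<in> E \<Longrightarrow> D (v k) c d < 1 / Suc k" for k a b c d
    using spec[OF v0, of k] by fast+
  have inv: "(\<lambda>k. 1 / Suc k) \<longlonglongrightarrow> (0::real)" using LIMSEQ_inverse_real_of_nat by (simp add: inverse_eq_divide)
  have Wu: "W12 \<Omega> (u k)" for k using tr[of k] by (simp add: has_trace_def)
  have n0: "0 \<le> W12_norm \<Omega> f" for f :: "R2 \<Rightarrow> 'b" by (simp add: W12_norm_def)
  show ?thesis
    unfolding has_trace_def
  proof (intro conjI exI[of _ v] allI impI)
    have "(\<lambda>k. W12_norm \<Omega> (\<lambda>p. v k p - u k p)) \<longlonglongrightarrow> 0"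
      by (rule tendsto_sandwich[OF always_eventually[OF allI[OF n0]]
            always_eventually[OF allI[OF less_imp_le[OF v(3)]]] tendsto_const inv])
    then have 1: "(\<lambda>k. (W12_norm \<Omega> (\<lambda>p. v k p - u k p))\<^sup>2) \<longlonglongrightarrow> 0" by (simp add: tendsto_zero_square_iff)
    have 2: "(\<lambda>k. (W12_norm \<Omega> (\<lambda>p. u k p - u' p))\<^sup>2) \<longlonglongrightarrow> 0" using lim by (simp add: tendsto_zero_square_iff)
    have "(\<lambda>k. (W12_norm \<Omega> (\<lambda>p. (v k p - u k p) + (u k p - u' p)))\<^sup>2) \<longlonglongrightarrow> 0"
      by (rule tendsto_zero_le[OF 1 2 _ W12_norm_add]) (auto intro: W12_diff v W Wu)
    then show "(\<lambda>k. W12_norm \<Omega> (\<lambda>p. v k p - u' p)) \<longlonglongrightarrow> 0" by (simp add: tendsto_zero_square_iff)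
    fix a b :: R2 assume ab: "a \<noteq> b \<and> closed_segment a b \<subseteq> S"
    then show "L2 (lebesgue_on {0..1}) (\<lambda>t. v n (linepath a b t) - h (linepath a b t))" for n using v(4) by blast
    obtain K :: real where K: "K \<ge> 0" "\<And>f :: R2 \<Rightarrow> real. (\<And>p. 0 \<le> f p) \<Longrightarrow> integrable (lebesgue_on {0..1}) (\<lambda>t. f (linepath a b t)) \<Longrightarrow>
      (\<And>c d. (c, d) \<in> E \<Longrightarrow> integrable (lebesgue_on {0..1}) (\<lambda>t. f (linepath c d t))) \<Longrightarrow>
      (LINT t|lebesgue_on {0..1}. f (linepath a b t)) \<le> K * (\<Sum>(c, d)\<in>E. LINT t|lebesgue_on {0..1}. f (linepath c d t :: R2))"
      using segment_integral_bound[OF E, of a b] ab S by blast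
    have le: "D (v k) a b \<le> K * (card E * (1 / Suc k))" for k
    proof -
      have int: "integrable (lebesgue_on {0..1}) (\<lambda>t. (norm (v k (linepath c d t) - h (linepath c d t)))\<^sup>2)"
        if "c \<noteq> d" "closed_segment c d \<subseteq> S" for c d
        using v(4)[OF that] by (simp add: L2_def)
      have "D (v k) a b \<le> K * (\<Sum>(c, d)\<in>E. D (v k) c d)"
        using K(2)[of "\<lambda>p. (norm (v k p - h p))\<^sup>2", OF _ int int] ab E(2) Esub unfolding D_def by simp
      also have "(\<Sum>(c, d)\<in>E. D (v k) c d) \<le> (\<Sum>q\<in>E. 1 / Suc k)"
        by (rule sum_mono) (use v(5) in \<open>auto intro: less_imp_le\<close>)
      finally show ?thesis using K(1) by (simp add: mult_left_mono)
    qed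
    have "(\<lambda>k. K * (card E * (1 / Suc k))) \<longlonglongrightarrow> K * (real (card E) * 0)" by (intro tendsto_intros inv)
    then have "(\<lambda>k. K * (card E * (1 / Suc k))) \<longlonglongrightarrow> 0" by simp
    then have "(\<lambda>k. D (v k) a b) \<longlonglongrightarrow> 0"
      by (rule tendsto_sandwich[OF always_eventually[OF allI[OF D0]] always_eventually[OF allI[OF le]] tendsto_const])
    then show "(\<lambda>n. LINT t|lebesgue_on {0..1}. (norm (v n (linepath a b t) - h (linepath a b t)))\<^sup>2) \<longlonglongrightarrow> 0"
      by (simp add: D_def)
  qed (use W v in auto)
qed

end

section \<open>Reflections\<close>

definition refl :: "real \<Rightarrow> real \<Rightarrow> R2 \<Rightarrow> R2" where
  "refl c1 c2 p = (c1 * fst p, c2 * snd p)"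

locale reflection = bounded_domain +
  fixes c1 c2 :: real
  assumes c: "c1 * c1 = 1" "c2 * c2 = 1" and sym: "\<And>p. refl c1 c2 p \<in> \<Omega> \<longleftrightarrow> p \<in> \<Omega>"
begin

abbreviation "R \<equiv> refl c1 c2"

lemma R_R [simp]: "R (R p) = p"
  using c by (simp add: refl_def flip: mult.assoc)

lemma R_linear: "bounded_linear R"
  unfolding refl_def
  by (intro bounded_linear_Pair bounded_linear_mult_right[THEN bounded_linear_compose] bounded_linear_fst bounded_linear_snd)

lemma R_continuous: "continuous_on S R"
  by (intro bounded_linear.continuous_on[OF R_linear] continuous_on_id)

text \<open>Both coordinates are multiplied by factors of modulus 1, so the determinant in the
  affine change of variables is 1 in modulus.\<close>

lemma R_lebesgue: "R \<in> lebesgue \<rightarrow>\<^sub>M lebesgue" "distr lebesgue lebesgue R = lebesgue"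
proof -
  define k where "k j = (if j = (1, 0) then c1 else c2)" for j :: R2
  have B: "(Basis :: R2 set) = {(1, 0), (0, 1)}" by (auto simp: Basis_prod_def)
  have R: "R = (\<lambda>x. 0 + (\<Sum>j\<in>Basis. (k j * (x \<bullet> j)) *\<^sub>R j))"
    unfolding B by (auto simp: refl_def k_def)
  have "c1 \<noteq> 0" "c2 \<noteq> 0" using c by auto
  then have k: "\<And>j. j \<in> Basis \<Longrightarrow> k j \<noteq> 0" by (simp add: k_def)
  have abs: "\<bar>c1\<bar> = 1" "\<bar>c2\<bar> = 1" using c by (metis abs_mult_self_eq abs_1 abs_square_eq_1 power2_eq_square)+
  have p: "(\<Prod>j\<in>(Basis :: R2 set). \<bar>k j\<bar>) = 1" unfolding B by (simp add: k_def abs)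
  show "R \<in> lebesgue \<rightarrow>\<^sub>M lebesgue" unfolding R by (rule lebesgue_affine_measurable[OF k])
  show "distr lebesgue lebesgue R = lebesgue"
    using lebesgue_affine_euclidean[of k 0, OF k] unfolding R[symmetric] p by (simp add: density_1)
qed

lemma integral_R:
  fixes f :: "R2 \<Rightarrow> 'b::euclidean_space"
  assumes f: "f \<in> borel_measurable M\<Omega>"
  shows "(\<lambda>p. f (R p)) \<in> borel_measurable M\<Omega>"
    "integrable M\<Omega> (\<lambda>p. f (R p)) \<longleftrightarrow> integrable M\<Omega> f"
    "(LINT p|M\<Omega>. f (R p)) = (LINT p|M\<Omega>. f p)"
proof -
  have \<Omega>: "\<Omega> \<in> sets lebesgue" using open_\<Omega> by auto
  define g where "g p = (if p \<in> \<Omega> then f p else 0)" for p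
  have g: "g \<in> borel_measurable lebesgue" unfolding g_def using f \<Omega> by (simp add: borel_measurable_if)
  have gR: "g (R p) = (if p \<in> \<Omega> then f (R p) else 0)" for p by (simp add: g_def sym)
  have "(\<lambda>p. g (R p)) \<in> borel_measurable lebesgue" by (rule measurable_compose[OF R_lebesgue(1) g])
  then show "(\<lambda>p. f (R p)) \<in> borel_measurable M\<Omega>" unfolding gR using \<Omega> by (simp add: borel_measurable_if)
  have "integrable M\<Omega> (\<lambda>p. f (R p)) \<longleftrightarrow> integrable lebesgue (\<lambda>p. g (R p))"
    unfolding gR by (rule Lebesgue_Measure.integrable_restrict_UNIV[OF \<Omega>, symmetric])
  also have "\<dots> \<longleftrightarrow> integrable lebesgue g"
    using integrable_distr_eq[OF R_lebesgue(1) g] by (simp add: R_lebesgue(2))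
  also have "\<dots> \<longleftrightarrow> integrable M\<Omega> f" unfolding g_def by (rule Lebesgue_Measure.integrable_restrict_UNIV[OF \<Omega>])
  finally show "integrable M\<Omega> (\<lambda>p. f (R p)) \<longleftrightarrow> integrable M\<Omega> f" .
  have "(LINT p|M\<Omega>. f (R p)) = (LINT p|lebesgue. g (R p))"
    unfolding gR by (rule Lebesgue_Measure.integral_restrict_UNIV[OF \<Omega>, symmetric])
  also have "\<dots> = (LINT p|lebesgue. g p)"
    using integral_distr[OF R_lebesgue(1) g] by (simp add: R_lebesgue(2))
  also have "\<dots> = (LINT p|M\<Omega>. f p)" unfolding g_def by (rule Lebesgue_Measure.integral_restrict_UNIV[OF \<Omega>])
  finally show "(LINT p|M\<Omega>. f (R p)) = (LINT p|M\<Omega>. f p)" .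
qed

lemma AE_R:
  assumes "AE p in M\<Omega>. P p"
  shows "AE p in M\<Omega>. P (R p)"
proof -
  have \<Omega>: "\<Omega> \<inter> space lebesgue \<in> sets lebesgue" using open_\<Omega> by auto
  have "AE p in lebesgue. p \<in> \<Omega> \<longrightarrow> P p" using assms by (simp add: AE_restrict_space_iff[OF \<Omega>])
  then have "AE p in distr lebesgue lebesgue R. p \<in> \<Omega> \<longrightarrow> P p" unfolding R_lebesgue(2) .
  then have "AE p in lebesgue. R p \<in> \<Omega> \<longrightarrow> P (R p)" by (rule AE_distrD[OF R_lebesgue(1)])
  then show ?thesis by (simp add: AE_restrict_space_iff[OF \<Omega>] sym)
qed

lemma L2_R: "L2 M\<Omega> (u :: R2 \<Rightarrow> 'b::euclidean_space) \<Longrightarrow> L2 M\<Omega> (\<lambda>p. u (R p))"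
  unfolding L2_def using integral_R(1)[of u] integral_R(2)[of "\<lambda>p. (norm (u p))\<^sup>2"] by auto

lemma test_functions_R:
  assumes "\<phi> \<in> test_functions \<Omega>"
  shows "(\<lambda>p. \<phi> (R p)) \<in> test_functions \<Omega>"
proof -
  obtain D where D: "D 0 0 = \<phi>"
    "\<And>i j p. (D i j has_derivative (\<lambda>h. fst h * D (Suc i) j p + snd h * D i (Suc j) p)) (at p)"
    using assms unfolding test_functions_def smooth_def by auto
  have "smooth (\<lambda>p. \<phi> (R p))"
    unfolding smooth_def
  proof (intro exI[of _ "\<lambda>i j p. c1 ^ i * c2 ^ j * D i j (R p)"] conjI allI)
    show "(\<lambda>p. c1 ^ 0 * c2 ^ 0 * D 0 0 (R p)) = (\<lambda>p. \<phi> (R p))" using D by simp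
    fix i j p
    have "((\<lambda>p. D i j (R p)) has_derivative (\<lambda>h. fst (R h) * D (Suc i) j (R p) + snd (R h) * D i (Suc j) (R p))) (at p)"
      by (rule has_derivative_compose[OF bounded_linear_imp_has_derivative[OF R_linear] D(2)])
    from has_derivative_mult_right[OF this, of "c1 ^ i * c2 ^ j"]
    show "((\<lambda>p. c1 ^ i * c2 ^ j * D i j (R p)) has_derivative
      (\<lambda>h. fst h * (c1 ^ Suc i * c2 ^ j * D (Suc i) j (R p)) + snd h * (c1 ^ i * c2 ^ Suc j * D i (Suc j) (R p)))) (at p)"
      by (rule has_derivative_eq_rhs) (simp add: refl_def algebra_simps fun_eq_iff)
  qed
  moreover
  let ?K = "closure {p. \<phi> p \<noteq> 0}"
  have K: "compact ?K" "?K \<subseteq> \<Omega>" using assms by (auto simp: test_functions_def)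
  have cK: "compact (R ` ?K)" by (rule compact_continuous_image[OF R_continuous K(1)])
  have "{p. \<phi> (R p) \<noteq> 0} \<subseteq> R ` ?K"
  proof
    fix p assume "p \<in> {p. \<phi> (R p) \<noteq> 0}"
    then have "R p \<in> ?K" using closure_subset[of "{p. \<phi> p \<noteq> 0}"] by auto
    then have "R (R p) \<in> R ` ?K" by (rule imageI)
    then show "p \<in> R ` ?K" by simp
  qed
  then have sub: "closure {p. \<phi> (R p) \<noteq> 0} \<subseteq> R ` ?K"
    by (rule closure_minimal) (rule compact_imp_closed[OF cK])
  moreover have "compact (closure {p. \<phi> (R p) \<noteq> 0})" by (rule compactI_sub[OF cK closed_closure sub])
  moreover have "R ` ?K \<subseteq> \<Omega>" using K(2) sym by blast
  ultimately show ?thesis unfolding test_functions_def by simp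
qed

text \<open>The reflection is moved from \<open>u\<close> onto the test function. The chain rule
  yields a factor \<open>k\<close> there, and k * k = 1 carries it over to the derivative.\<close>

lemma has_weak_deriv_R:
  fixes u v :: "R2 \<Rightarrow> 'b::euclidean_space"
  assumes w: "has_weak_deriv \<Omega> e u v" and e: "R e = k *\<^sub>R e" "k * k = 1" and L: "L2 M\<Omega> u" "L2 M\<Omega> v"
  shows "has_weak_deriv \<Omega> e (\<lambda>p. u (R p)) (\<lambda>p. k *\<^sub>R v (R p))"
  unfolding has_weak_deriv_def
proof
  fix \<phi> assume \<phi>: "\<phi> \<in> test_functions \<Omega>"
  have fr: "frechet_derivative (\<lambda>p. \<phi> (R p)) (at p) e = k * frechet_derivative \<phi> (at (R p)) e" for p
  proof -
    have "(\<phi> has_derivative frechet_derivative \<phi> (at (R p))) (at (R p))"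
      using test_function_continuous_bounded(6)[OF \<phi>] frechet_derivative_works by blast
    from has_derivative_compose[OF bounded_linear_imp_has_derivative[OF R_linear] this]
    have "frechet_derivative (\<lambda>p. \<phi> (R p)) (at p) = (\<lambda>h. frechet_derivative \<phi> (at (R p)) (R h))"
      by (rule frechet_derivative_at[symmetric])
    then show ?thesis using linear_scale[OF test_function_continuous_bounded(5)[OF \<phi>]] e(1) by simp
  qed
  have m: "(\<lambda>p. frechet_derivative \<phi> (at p) e *\<^sub>R u (R p)) \<in> borel_measurable M\<Omega>"
    "(\<lambda>p. \<phi> p *\<^sub>R v (R p)) \<in> borel_measurable M\<Omega>"
    using test_function_integrable(2)[OF \<phi> L2_imp_integrable[OF L2_R[OF L(1)]]]
      test_function_integrable(1)[OF \<phi> L2_imp_integrable[OF L2_R[OF L(2)]]] by auto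
  have "(LINT p|M\<Omega>. frechet_derivative \<phi> (at p) e *\<^sub>R u (R p)) = (LINT p|M\<Omega>. frechet_derivative \<phi> (at (R p)) e *\<^sub>R u p)"
    using integral_R(3)[OF m(1)] by simp
  also have "\<dots> = (LINT p|M\<Omega>. k *\<^sub>R (frechet_derivative (\<lambda>p. \<phi> (R p)) (at p) e *\<^sub>R u p))"
    unfolding fr using e(2) by (simp flip: mult.assoc)
  also have "\<dots> = k *\<^sub>R (LINT p|M\<Omega>. frechet_derivative (\<lambda>p. \<phi> (R p)) (at p) e *\<^sub>R u p)"
    by (rule integral_scaleR_right)
  also have "(LINT p|M\<Omega>. frechet_derivative (\<lambda>p. \<phi> (R p)) (at p) e *\<^sub>R u p) = - (LINT p|M\<Omega>. \<phi> (R p) *\<^sub>R v p)"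
    using w test_functions_R[OF \<phi>] by (simp add: has_weak_deriv_def)
  also have "(LINT p|M\<Omega>. \<phi> (R p) *\<^sub>R v p) = (LINT p|M\<Omega>. \<phi> p *\<^sub>R v (R p))"
    using integral_R(3)[OF m(2)] by simp
  also have "k *\<^sub>R - (LINT p|M\<Omega>. \<phi> p *\<^sub>R v (R p)) = - (LINT p|M\<Omega>. k *\<^sub>R (\<phi> p *\<^sub>R v (R p)))"
    by (subst integral_scaleR_right) simp
  finally show "(LINT p|M\<Omega>. frechet_derivative \<phi> (at p) e *\<^sub>R u (R p)) = - (LINT p|M\<Omega>. \<phi> p *\<^sub>R k *\<^sub>R v (R p))"
    by (simp add: mult.commute)
qed

lemma sob_R:
  fixes u v w :: "R2 \<Rightarrow> 'b::euclidean_space"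
  assumes "sob \<Omega> u v w"
  shows "sob \<Omega> (\<lambda>p. u (R p)) (\<lambda>p. c1 *\<^sub>R v (R p)) (\<lambda>p. c2 *\<^sub>R w (R p))"
proof -
  have "R (1, 0) = c1 *\<^sub>R (1, 0)" "R (0, 1) = c2 *\<^sub>R (0, 1)" by (auto simp: refl_def)
  then show ?thesis
    using assms c unfolding sob_def by (auto intro!: L2_R L2_scaleR has_weak_deriv_R)
qed

lemma W12_norm_R:
  fixes u :: "R2 \<Rightarrow> 'b::euclidean_space"
  assumes "W12 \<Omega> u"
  shows "W12_norm \<Omega> (\<lambda>p. u (R p)) = W12_norm \<Omega> u"
proof -
  note s = W12_sob[OF assms]
  have abs: "\<bar>c1\<bar> = 1" "\<bar>c2\<bar> = 1" using c by (metis abs_mult_self_eq abs_1 abs_square_eq_1 power2_eq_square)+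
  have i: "(LINT p|M\<Omega>. (norm (f (R p)))\<^sup>2) = (LINT p|M\<Omega>. (norm (f p))\<^sup>2)" if "L2 M\<Omega> f" for f :: "R2 \<Rightarrow> 'b"
    by (rule integral_R(3)[of "\<lambda>p. (norm (f p))\<^sup>2"]) (use that in \<open>auto simp: L2_def\<close>)
  have "(W12_norm \<Omega> (\<lambda>p. u (R p)))\<^sup>2 = (W12_norm \<Omega> u)\<^sup>2"
    unfolding W12_norm_sq[OF s] W12_norm_sq[OF sob_R[OF s]] using s by (simp add: abs i sob_def)
  then show ?thesis by (simp add: W12_norm_def)
qed

lemma R_closure: "R p \<in> closure \<Omega> \<longleftrightarrow> p \<in> closure \<Omega>"
proof -
  have "R q \<in> closure \<Omega>" if "q \<in> closure \<Omega>" for q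
  proof -
    have "R ` closure \<Omega> \<subseteq> closure (R ` \<Omega>)" by (rule closure_bounded_linear_image_subset[OF R_linear])
    moreover have "R ` \<Omega> \<subseteq> \<Omega>" using sym by blast
    ultimately show ?thesis using that closure_mono by blast
  qed
  then show ?thesis by (metis R_R)
qed

lemma has_trace_R:
  fixes u :: "R2 \<Rightarrow> 'b::euclidean_space"
  assumes "has_trace \<Omega> u S h" and S: "\<And>p. R p \<in> S \<longleftrightarrow> p \<in> S"
  shows "has_trace \<Omega> (\<lambda>p. u (R p)) S (\<lambda>p. h (R p))"
proof -
  obtain v where W: "W12 \<Omega> u" and v: "\<And>n. W12 \<Omega> (v n)" "\<And>n. continuous_on (closure \<Omega>) (v n)"
    "(\<lambda>n. W12_norm \<Omega> (\<lambda>p. v n p - u p)) \<longlonglongrightarrow> 0"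
    "\<And>a b n. a \<noteq> b \<Longrightarrow> closed_segment a b \<subseteq> S \<Longrightarrow> L2 (lebesgue_on {0..1}) (\<lambda>t. v n (linepath a b t) - h (linepath a b t))"
    "\<And>a b. a \<noteq> b \<Longrightarrow> closed_segment a b \<subseteq> S \<Longrightarrow>
      (\<lambda>n. LINT t|lebesgue_on {0..1}. (norm (v n (linepath a b t) - h (linepath a b t)))\<^sup>2) \<longlonglongrightarrow> 0"
    using assms(1) unfolding has_trace_def by blast
  have WR: "W12 \<Omega> (\<lambda>p. f (R p))" if "W12 \<Omega> f" for f :: "R2 \<Rightarrow> 'b"
    by (rule sob_W12[OF sob_R[OF W12_sob[OF that]]])
  have lp: "R (linepath a b t) = linepath (R a) (R b) t" for a b t
    by (simp add: refl_def linepath_def algebra_simps)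
  have seg: "R a \<noteq> R b" "closed_segment (R a) (R b) \<subseteq> S" if "a \<noteq> b \<and> closed_segment a b \<subseteq> S" for a b
  proof -
    show "R a \<noteq> R b" using that by (metis R_R)
    show "closed_segment (R a) (R b) \<subseteq> S"
    proof
      fix q assume "q \<in> closed_segment (R a) (R b)"
      then obtain t where t: "t \<in> {0..1}" "q = R (linepath a b t)"
        unfolding linepath_image_01[symmetric] lp[symmetric] by (rule imageE)
      then have "linepath a b t \<in> S" using that linepath_image_01[of a b] by blast
      then show "q \<in> S" using S t(2) by simp
    qed
  qed
  show ?thesis
    unfolding has_trace_def
  proof (intro conjI exI[of _ "\<lambda>n p. v n (R p)"] allI impI)
    have "W12_norm \<Omega> (\<lambda>p. v n (R p) - u (R p)) = W12_norm \<Omega> (\<lambda>p. v n p - u p)" for n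
      using W12_norm_R[OF W12_diff[OF v(1) W], of n] by simp
    then show "(\<lambda>n. W12_norm \<Omega> (\<lambda>p. v n (R p) - u (R p))) \<longlonglongrightarrow> 0" using v(3) by simp
    show "continuous_on (closure \<Omega>) (\<lambda>p. v n (R p))" for n
      by (rule continuous_on_compose2[OF v(2) R_continuous]) (auto simp: R_closure)
    fix a b :: R2 assume ab: "a \<noteq> b \<and> closed_segment a b \<subseteq> S"
    show "L2 (lebesgue_on {0..1}) (\<lambda>t. v n (R (linepath a b t)) - h (R (linepath a b t)))" for n
      unfolding lp by (rule v(4)[OF seg[OF ab]])
    show "(\<lambda>n. LINT t|lebesgue_on {0..1}. (norm (v n (R (linepath a b t)) - h (R (linepath a b t))))\<^sup>2) \<longlonglongrightarrow> 0"
      unfolding lp by (rule v(5)[OF seg[OF ab]])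
  qed (auto intro: WR v W)
qed

end

section \<open>Piecewise differentiable functions\<close>

text \<open>Fubini, and on each row the fundamental theorem of calculus from -r to r, where
  \<open>P\<close> vanishes. Each row may contain finitely many points without derivative, which
  accommodates the kinks of the boundary lift.\<close>

lemma integral_derivative_compact_support:
  fixes P f :: "R2 \<Rightarrow> real"
  assumes P: "continuous_on UNIV P" and f: "integrable lborel f"
    and out: "\<And>p. \<bar>fst p\<bar> \<ge> r \<Longrightarrow> P p = 0 \<and> f p = 0" and "r > 0"
    and fin: "\<And>y. finite (F y)"
    and d: "\<And>x y. x \<notin> F y \<Longrightarrow> ((\<lambda>x. P (x, y)) has_real_derivative f (x, y)) (at x)"
  shows "(LINT p|lborel. f p) = 0"
proof -
  have "(LINT p|lborel. f p) = (LINT y|lborel. LINT x|lborel. f (x, y))" by (rule integrable_lborel_snd(1)[OF f])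
  also have "\<dots> = (LINT y|(lborel :: real measure). 0)"
  proof (rule integral_cong_AE)
    show "AE y in lborel. (LINT x|lborel. f (x, y)) = 0"
      using integrable_lborel_snd(2)[OF f]
    proof eventually_elim
      case (elim y)
      have "((\<lambda>x. f (x, y)) has_integral (P (r, y) - P (-r, y))) {-r..r}"
      proof (rule fundamental_theorem_of_calculus_interior_strong[OF fin[of y]])
        show "continuous_on {-r..r} (\<lambda>x. P (x, y))"
          by (rule continuous_on_compose2[OF P]) (auto intro!: continuous_intros)
      qed (use d \<open>r > 0\<close> in \<open>auto simp: has_real_derivative_iff_has_vector_derivative\<close>)
      then have "((\<lambda>x. f (x, y)) has_integral 0) {-r..r}" using out[of "(r, y)"] out[of "(-r, y)"] by simp
      then have "((\<lambda>x. f (x, y)) has_integral 0) UNIV"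
        by (rule has_integral_on_superset) (use out in auto)
      then show ?case using has_integral_integral_lborel[OF elim] has_integral_unique by blast
    qed
  qed (use integrable_lborel_snd(3)[OF f] in auto)
  finally show ?thesis by simp
qed

lemma test_function_partial:
  assumes "\<phi> \<in> test_functions \<Omega>"
  shows "((\<lambda>x. \<phi> (x, y)) has_real_derivative frechet_derivative \<phi> (at (x, y)) (1, 0)) (at x)"
    "((\<lambda>y. \<phi> (x, y)) has_real_derivative frechet_derivative \<phi> (at (x, y)) (0, 1)) (at y)"
proof -
  let ?D = "frechet_derivative \<phi> (at (x, y))"
  have D: "(\<phi> has_derivative ?D) (at (x, y))"
    using test_function_continuous_bounded(6)[OF assms] frechet_derivative_works by blast
  note lin = linear_scale[OF test_function_continuous_bounded(5)[OF assms]]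
  have "((\<lambda>x. (x, y)) has_derivative (\<lambda>h. (h, 0))) (at x)" by (auto intro!: derivative_eq_intros)
  from has_derivative_compose[OF this D] have "((\<lambda>x. \<phi> (x, y)) has_derivative (\<lambda>h. ?D (h, 0))) (at x)" .
  moreover have "(\<lambda>h. ?D (h, 0)) = (*) (?D (1, 0))" 
  proof
    fix h
    have "?D (h, 0) = ?D (h *\<^sub>R (1, 0))" by simp
    also have "\<dots> = h *\<^sub>R ?D (1, 0)" by (rule lin)
    finally show "?D (h, 0) = ?D (1, 0) * h" by (simp only: real_scaleR_def mult.commute)
  qed
  ultimately show "((\<lambda>x. \<phi> (x, y)) has_real_derivative ?D (1, 0)) (at x)"
    unfolding has_field_derivative_def by simp
  have "((\<lambda>y. (x, y)) has_derivative (\<lambda>h. (0, h))) (at y)" by (auto intro!: derivative_eq_intros)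
  from has_derivative_compose[OF this D] have "((\<lambda>y. \<phi> (x, y)) has_derivative (\<lambda>h. ?D (0, h))) (at y)" .
  moreover have "(\<lambda>h. ?D (0, h)) = (*) (?D (0, 1))" 
  proof
    fix h
    have "?D (0, h) = ?D (h *\<^sub>R (0, 1))" by simp
    also have "\<dots> = h *\<^sub>R ?D (0, 1)" by (rule lin)
    finally show "?D (0, h) = ?D (0, 1) * h" by (simp only: real_scaleR_def mult.commute)
  qed
  ultimately show "((\<lambda>y. \<phi> (x, y)) has_real_derivative ?D (0, 1)) (at y)"
    unfolding has_field_derivative_def by simp
qed

context bounded_domain
begin

text \<open>The preceding lemma applied to the product of a test function and \<open>G\<close>. The
  one family \<open>F\<close> lists the exceptional x in row y as well as the exceptional y in
  column x, which fits functions whose kinks are symmetric under exchange of the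
  coordinates.\<close>

lemma sob_piecewise_differentiable:
  fixes G Gx Gy :: "R2 \<Rightarrow> real"
  assumes G: "continuous_on UNIV G" and [measurable]: "Gx \<in> borel_measurable borel" "Gy \<in> borel_measurable borel"
    and K: "\<And>p. \<bar>Gx p\<bar> \<le> K" "\<And>p. \<bar>Gy p\<bar> \<le> K"
    and fin: "\<And>y. finite (F y)"
    and dx: "\<And>x y. x \<notin> F y \<Longrightarrow> ((\<lambda>x. G (x, y)) has_real_derivative Gx (x, y)) (at x)"
    and dy: "\<And>x y. y \<notin> F x \<Longrightarrow> ((\<lambda>y. G (x, y)) has_real_derivative Gy (x, y)) (at y)"
  shows "sob \<Omega> G Gx Gy"
proof -
  have [measurable]: "G \<in> borel_measurable borel" by (rule borel_measurable_continuous_onI[OF G])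
  obtain r0 where r0: "\<And>p. p \<in> \<Omega> \<Longrightarrow> norm p \<le> r0" using bounded_\<Omega> bounded_iff by blast
  define r where "r = max r0 0 + 1"
  have r: "r > 0" "p \<notin> \<Omega>" if "\<bar>fst p\<bar> \<ge> r \<or> \<bar>snd p\<bar> \<ge> r" for p :: R2
  proof -
    show "r > 0" by (simp add: r_def)
    show "p \<notin> \<Omega>"
      using r0[of p] norm_fst_le[of "fst p" "snd p"] norm_snd_le[of "snd p" "fst p"] that by (auto simp: r_def)
  qed
  have r_pos: "r > 0" by (simp add: r_def)
  obtain KG where KG: "\<And>p. p \<in> closure \<Omega> \<Longrightarrow> norm (G p) \<le> KG"
  proof -
    have "compact (G ` closure \<Omega>)"
      using bounded_\<Omega> by (intro compact_continuous_image continuous_on_subset[OF G]) (auto simp: compact_closure)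
    then obtain B where "\<And>y. y \<in> G ` closure \<Omega> \<Longrightarrow> norm y \<le> B" using compact_imp_bounded bounded_iff by metis
    then show ?thesis by (intro that[of B]) blast
  qed
  have meas: "f \<in> borel_measurable M\<Omega>" if "f \<in> borel_measurable borel" for f :: "R2 \<Rightarrow> real"
    using that by (intro measurable_restrict_space1 measurable_completion) simp
  have L2: "L2 M\<Omega> f" if "f \<in> borel_measurable borel" "\<And>p. p \<in> \<Omega> \<Longrightarrow> \<bar>f p\<bar> \<le> B" for f :: "R2 \<Rightarrow> real" and B
    unfolding L2_def
  proof
    show "f \<in> borel_measurable M\<Omega>" by (rule meas[OF that(1)])
    then show "integrable M\<Omega> (\<lambda>p. (norm (f p))\<^sup>2)"
      using power_mono[OF that(2) abs_ge_zero, of _ 2]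
      by (intro integrable_const_bound[of _ "B\<^sup>2"]) (auto intro!: AE_I2)
  qed
  have LG: "L2 M\<Omega> G" by (rule L2[of _ KG]) (use KG closure_subset in \<open>auto simp: subset_iff\<close>)
  have LGx: "L2 M\<Omega> Gx" "L2 M\<Omega> Gy" by (rule L2[of _ K]; use K in simp)+
  have int: "integrable lborel (\<lambda>p. f p * h p)" "(LINT p|lborel. f p * h p) = (LINT p|M\<Omega>. f p * h p)"
    if t: "continuous_on UNIV f" "\<exists>M\<ge>0. \<forall>p. \<bar>f p\<bar> \<le> M" "\<And>p. p \<notin> \<Omega> \<Longrightarrow> f p = 0" "h \<in> borel_measurable borel" "L2 M\<Omega> h" for f h :: "R2 \<Rightarrow> real"
  proof -
    have [measurable]: "f \<in> borel_measurable borel" by (rule borel_measurable_continuous_onI[OF t(1)])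
    obtain B where "\<And>p. \<bar>f p\<bar> \<le> B" using t(2) by blast
    from integrable_bounded_mult[OF meas this L2_imp_integrable[OF t(5)]]
    have i: "integrable M\<Omega> (\<lambda>p. f p * h p)" by simp
    show "integrable lborel (\<lambda>p. f p * h p)" "(LINT p|lborel. f p * h p) = (LINT p|M\<Omega>. f p * h p)"
      using lebesgue_on_integral_lborel[OF open_\<Omega>, of "\<lambda>p. f p * h p" "\<lambda>p. f p * h p"] t(3,4) i by auto
  qed
  have x: "has_weak_deriv \<Omega> (1, 0) G Gx"
    unfolding has_weak_deriv_def
  proof
    fix \<phi> assume \<phi>: "\<phi> \<in> test_functions \<Omega>"
    note tf = test_function_continuous_bounded[OF \<phi>]
    let ?D = "\<lambda>p. frechet_derivative \<phi> (at p) (1, 0)"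
    note i1 = int[OF tf(3) tf(4) tf(8), of G "(1, 0)"] and i2 = int[OF tf(1) tf(2) tf(7), of Gx]
    have "(LINT p|lborel. ?D p * G p + \<phi> p * Gx p) = 0"
    proof (rule integral_derivative_compact_support[where P = "\<lambda>p. \<phi> p * G p" and r = r and F = F])
      show "((\<lambda>x. \<phi> (x, y) * G (x, y)) has_real_derivative ?D (x, y) * G (x, y) + \<phi> (x, y) * Gx (x, y)) (at x)"
        if "x \<notin> F y" for x y
        by (rule DERIV_cong[OF DERIV_mult[OF test_function_partial(1)[OF \<phi>] dx[OF that]]]) simp
    qed (use i1 i2 LG LGx r tf(7,8) r_pos fin in \<open>auto intro!: continuous_intros tf(1) G\<close>)
    then show "(LINT p|M\<Omega>. ?D p *\<^sub>R G p) = - (LINT p|M\<Omega>. \<phi> p *\<^sub>R Gx p)"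
      using i1 i2 LG LGx by simp
  qed
  have y: "has_weak_deriv \<Omega> (0, 1) G Gy"
    unfolding has_weak_deriv_def
  proof
    fix \<phi> assume \<phi>: "\<phi> \<in> test_functions \<Omega>"
    note tf = test_function_continuous_bounded[OF \<phi>]
    let ?D = "\<lambda>p. frechet_derivative \<phi> (at p) (0, 1)"
    note i1 = int[OF tf(3) tf(4) tf(8), of G "(0, 1)"] and i2 = int[OF tf(1) tf(2) tf(7), of Gy]
    define f where "f p = ?D p * G p + \<phi> p * Gy p" for p
    have f: "integrable lborel f" unfolding f_def using i1 i2 LG LGx by simp
    have sw: "continuous_on UNIV (\<lambda>p. h (prod.swap p))" if "continuous_on UNIV h" for h :: "R2 \<Rightarrow> real"
      by (rule continuous_on_compose2[OF that continuous_on_swap]) auto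
    have "(LINT p|lborel. f (prod.swap p)) = 0"
    proof (rule integral_derivative_compact_support[where P = "\<lambda>p. \<phi> (prod.swap p) * G (prod.swap p)" and r = r and F = F])
      show "((\<lambda>x. \<phi> (prod.swap (x, y)) * G (prod.swap (x, y))) has_real_derivative f (prod.swap (x, y))) (at x)"
        if "x \<notin> F y" for x y
        unfolding f_def swap_simp
        by (rule DERIV_cong[OF DERIV_mult[OF test_function_partial(2)[OF \<phi>] dy[OF that]]]) simp
      show "integrable lborel (\<lambda>p. f (prod.swap p))"
        using f integral_lborel_swap(1)[of f] by auto
      show "\<phi> (prod.swap p) * G (prod.swap p) = 0 \<and> f (prod.swap p) = 0" if "r \<le> \<bar>fst p\<bar>" for p
        using r(2)[of "prod.swap p"] that tf(7,8) by (simp add: f_def)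
    qed (use r_pos fin in \<open>auto intro!: continuous_intros sw tf(1) G\<close>)
    then have "(LINT p|lborel. f p) = 0" using integral_lborel_swap(2)[of f] f by auto
    then show "(LINT p|M\<Omega>. ?D p *\<^sub>R G p) = - (LINT p|M\<Omega>. \<phi> p *\<^sub>R Gy p)"
      using i1 i2 LG LGx by (simp add: f_def)
  qed
  show ?thesis unfolding sob_def using LG LGx x y by blast
qed

lemma sob_Pair:
  fixes u v w u' v' w' :: "R2 \<Rightarrow> real"
  assumes "sob \<Omega> u v w" "sob \<Omega> u' v' w'"
  shows "sob \<Omega> (\<lambda>p. (u p, u' p)) (\<lambda>p. (v p, v' p)) (\<lambda>p. (w p, w' p))"
proof -
  have 1: "bounded_linear (\<lambda>x::real. (x, 0::real))" "bounded_linear (\<lambda>x::real. (0::real, x))"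
    by (intro bounded_linear_Pair bounded_linear_ident bounded_linear_zero)+
  from sob_add[OF sob_bounded_linear[OF 1(1) assms(1)] sob_bounded_linear[OF 1(2) assms(2)]]
  show ?thesis by simp
qed

lemma has_trace_eq:
  fixes u h :: "R2 \<Rightarrow> 'b::euclidean_space"
  assumes "sob \<Omega> u v w" "continuous_on (closure \<Omega>) u" "\<And>p. p \<in> S \<Longrightarrow> u p = h p"
  shows "has_trace \<Omega> u S h"
  unfolding has_trace_def
proof (intro conjI exI[of _ "\<lambda>_. u"] allI impI)
  have "sob \<Omega> (\<lambda>p. u p - u p) (\<lambda>p. v p - v p) (\<lambda>p. w p - w p)" by (rule sob_diff[OF assms(1) assms(1)])
  then have "(W12_norm \<Omega> (\<lambda>p. u p - u p))\<^sup>2 = 0" by (subst W12_norm_sq) auto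
  then show "(\<lambda>n. W12_norm \<Omega> (\<lambda>p. u p - u p)) \<longlonglongrightarrow> 0" by simp
  fix a b :: R2 assume ab: "a \<noteq> b \<and> closed_segment a b \<subseteq> S"
  then have 0: "u (linepath a b t) - h (linepath a b t) = 0" if "t \<in> {0..1}" for t
  proof -
    have "linepath a b t \<in> closed_segment a b" using that linepath_image_01[of a b] by blast
    then show ?thesis using ab assms(3)[of "linepath a b t"] by auto
  qed
  \<comment> \<open>Nothing is assumed about the regularity of \<open>h\<close>; measurability along
    the segment comes from the difference being identically 0 there.\<close>
  have m: "(\<lambda>t. u (linepath a b t) - h (linepath a b t)) \<in> borel_measurable (lebesgue_on {0..1})"
    by (subst measurable_cong[of _ _ "\<lambda>_. 0"]) (use 0 in auto)
  have i: "integrable (lebesgue_on {0..1}) (\<lambda>t. (norm (u (linepath a b t) - h (linepath a b t)))\<^sup>2)"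
    by (subst Bochner_Integration.integrable_cong[OF refl, of _ _ "\<lambda>_. 0"]) (use 0 in auto)
  show "L2 (lebesgue_on {0..1}) (\<lambda>t. u (linepath a b t) - h (linepath a b t))"
    unfolding L2_def using m i by simp
  have "(LINT t|lebesgue_on {0..1}. (norm (u (linepath a b t) - h (linepath a b t)))\<^sup>2) = (LINT t|lebesgue_on {0..1::real}. 0)"
    by (rule Bochner_Integration.integral_cong) (use 0 in auto)
  then show "(\<lambda>n. LINT t|lebesgue_on {0..1}. (norm (u (linepath a b t) - h (linepath a b t)))\<^sup>2) \<longlonglongrightarrow> 0" by simp
qed (use assms sob_W12 in auto)

end

section \<open>The domain\<close>

locale wors_domain =
  fixes \<rho> \<epsilon> :: real
  assumes rho: "0 < \<rho>" "\<rho> < 1" and eps: "0 < \<epsilon>" "\<epsilon> < min (1 / 2) (1 - \<rho>)"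
begin

abbreviation "\<Omega> \<equiv> Omega \<rho> \<epsilon>"

lemma Omega_iff: "p \<in> \<Omega> \<longleftrightarrow> \<bar>fst p\<bar> < 1 - \<epsilon> \<and> \<bar>snd p\<bar> < 1 - \<epsilon> \<and> \<rho> < \<bar>fst p\<bar> + \<bar>snd p\<bar> \<and> \<bar>fst p\<bar> + \<bar>snd p\<bar> < 1"
  unfolding Omega_def max_abs_add_diff by (cases p) auto

lemma open_Omega: "open \<Omega>"
proof -
  have "\<Omega> = {p. \<bar>fst p\<bar> < 1 - \<epsilon> \<and> \<bar>snd p\<bar> < 1 - \<epsilon> \<and> \<rho> < \<bar>fst p\<bar> + \<bar>snd p\<bar> \<and> \<bar>fst p\<bar> + \<bar>snd p\<bar> < 1}"
    using Omega_iff by blast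
  then show ?thesis by (simp only:) (intro open_Collect_conj open_Collect_less continuous_intros)
qed

lemma bounded_Omega: "bounded \<Omega>"
proof -
  have "norm p \<le> 1" if "p \<in> \<Omega>" for p
    using that norm_Pair_le[of "fst p" "snd p"] by (auto simp: Omega_iff)
  then show ?thesis by (rule boundedI)
qed

sublocale bounded_domain \<Omega>
  by unfold_locales (rule open_Omega bounded_Omega)+

sublocale rx: reflection \<Omega> "-1" 1
  by unfold_locales (auto simp: refl_def Omega_iff)

sublocale ry: reflection \<Omega> 1 "-1"
  by unfold_locales (auto simp: refl_def Omega_iff)

lemma swap_Omega: "prod.swap ` \<Omega> = \<Omega>"
proof -
  have "prod.swap p \<in> \<Omega> \<longleftrightarrow> p \<in> \<Omega>" for p by (auto simp: Omega_iff)
  then have "prod.swap ` \<Omega> \<subseteq> \<Omega>" by blast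
  moreover have "p \<in> prod.swap ` \<Omega>" if "p \<in> \<Omega>" for p
    by (rule image_eqI[of _ _ "prod.swap p"]) (use that \<open>\<And>p. prod.swap p \<in> \<Omega> \<longleftrightarrow> p \<in> \<Omega>\<close> in simp_all)
  ultimately show ?thesis by blast
qed

text \<open>Two kinds of horizontal chords occur. For |y| > \<rho> a chord passes above or below the
  hole and reaches at least \<epsilon> to both sides. Otherwise it runs beside the hole, where the
  gap to the outer boundary has length at least 1 - \<epsilon> - \<rho>, and half of this survives
  the thickening to a rectangle.\<close>

definition "width = min (2 * \<epsilon>) ((1 - \<epsilon> - \<rho>) / 2)"

lemma width_pos: "0 < width" using eps by (simp add: width_def)

lemma wide_Omega: "wide \<Omega> width 2"
  unfolding wide_def
proof
  fix p assume p: "p \<in> \<Omega>"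
  obtain x y where xy: "p = (x, y)" by (cases p)
  have O: "\<bar>x\<bar> < 1 - \<epsilon>" "\<bar>y\<bar> < 1 - \<epsilon>" "\<rho> < \<bar>x\<bar> + \<bar>y\<bar>" "\<bar>x\<bar> + \<bar>y\<bar> < 1"
    using p by (auto simp: xy Omega_iff)
  show "\<exists>a b c d. p \<in> {a<..<b} \<times> {c<..<d} \<and> {a<..<b} \<times> {c<..<d} \<subseteq> \<Omega> \<and> width \<le> b - a \<and> b - a \<le> 2"
  proof (cases "\<rho> < \<bar>y\<bar>")
    case True
    \<comment> \<open>The half-height of the rectangle is limited by the distances to the hole, to
      the short horizontal edge and to the slanted edge; halving the last one keeps |x| strictly
      below \<open>A\<close>.\<close>
    define \<delta> where "\<delta> = min (\<bar>y\<bar> - \<rho>) (min (1 - \<epsilon> - \<bar>y\<bar>) ((1 - \<bar>x\<bar> - \<bar>y\<bar>) / 2))"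
    have d: "0 < \<delta>" "\<delta> \<le> \<bar>y\<bar> - \<rho>" "\<delta> \<le> 1 - \<epsilon> - \<bar>y\<bar>" "\<delta> \<le> (1 - \<bar>x\<bar> - \<bar>y\<bar>) / 2"
      using True O unfolding \<delta>_def min_def by (auto split: if_splits)
    define A where "A = min (1 - \<epsilon>) (1 - \<bar>y\<bar> - \<delta>)"
    have A: "A \<le> 1 - \<epsilon>" "A \<le> 1 - \<bar>y\<bar> - \<delta>" "\<bar>x\<bar> < A" "\<epsilon> \<le> A"
      unfolding A_def using d O eps by auto
    have "{-A<..<A} \<times> {y - \<delta><..<y + \<delta>} \<subseteq> \<Omega>"
    proof
      fix q assume q: "q \<in> {-A<..<A} \<times> {y - \<delta><..<y + \<delta>}"
      then have "\<bar>fst q\<bar> < A" "\<bar>snd q - y\<bar> < \<delta>" by (auto simp: abs_less_iff)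
      then show "q \<in> \<Omega>" unfolding Omega_iff using A d by linarith
    qed
    moreover have "p \<in> {-A<..<A} \<times> {y - \<delta><..<y + \<delta>}" using A(3) d(1) by (auto simp: xy)
    moreover have "width \<le> A - (-A)" "A - (-A) \<le> 2" using A eps by (auto simp: width_def)
    ultimately show ?thesis by blast
  next
    case False
    \<comment> \<open>The first bound keeps the chord from \<open>\<alpha>\<close> to
      \<open>\<beta>\<close> long although \<delta> is taken off at its ends.\<close>
    define \<delta> where "\<delta> = min ((1 - \<epsilon> - \<rho>) / 4) (min ((\<bar>x\<bar> + \<bar>y\<bar> - \<rho>) / 2) (min (1 - \<epsilon> - \<bar>y\<bar>) ((1 - \<bar>x\<bar> - \<bar>y\<bar>) / 2)))"
    have d: "0 < \<delta>" "\<delta> \<le> (1 - \<epsilon> - \<rho>) / 4" "\<delta> \<le> (\<bar>x\<bar> + \<bar>y\<bar> - \<rho>) / 2" "\<delta> \<le> 1 - \<epsilon> - \<bar>y\<bar>" "\<delta> \<le> (1 - \<bar>x\<bar> - \<bar>y\<bar>) / 2"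
      using O eps unfolding \<delta>_def min_def by (auto split: if_splits)
    define \<alpha> \<beta> where "\<alpha> = \<rho> - \<bar>y\<bar> + \<delta>" and "\<beta> = min (1 - \<epsilon>) (1 - \<bar>y\<bar> - \<delta>)"
    have ab: "0 < \<alpha>" "\<alpha> < \<bar>x\<bar>" "\<bar>x\<bar> < \<beta>" "\<beta> \<le> 1 - \<epsilon>" "\<beta> \<le> 1 - \<bar>y\<bar> - \<delta>"
      using False d O by (auto simp: \<alpha>_def \<beta>_def)
    have len: "(1 - \<epsilon> - \<rho>) / 2 \<le> \<beta> - \<alpha>"
    proof -
      have "\<epsilon> < 1 - \<rho>" using eps(2) by simp
      then have "(1 - \<epsilon> - \<rho>) / 2 \<le> (1 - \<epsilon>) - \<alpha>" "(1 - \<epsilon> - \<rho>) / 2 \<le> (1 - \<bar>y\<bar> - \<delta>) - \<alpha>"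
        using d(1,2) eps(1) abs_ge_zero[of y] unfolding \<alpha>_def by argo+
      then show ?thesis unfolding \<beta>_def min_def by (simp only: split: if_split) blast
    qed
    have sub: "q \<in> \<Omega>" if "\<alpha> < \<bar>fst q\<bar>" "\<bar>fst q\<bar> < \<beta>" "\<bar>snd q - y\<bar> < \<delta>" for q
      unfolding Omega_iff using that ab d unfolding \<alpha>_def by linarith
    have w: "width \<le> \<beta> - \<alpha>" unfolding width_def by (rule order_trans[OF min.cobounded2 len])
    have w2: "\<beta> - \<alpha> \<le> 2" using ab(1,4) eps(1) by linarith
    note w = w w2
    show ?thesis
    proof (cases "x > 0")
      case True
      have "{\<alpha><..<\<beta>} \<times> {y - \<delta><..<y + \<delta>} \<subseteq> \<Omega>" using sub ab(1) by (auto simp: abs_less_iff)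
      moreover have "p \<in> {\<alpha><..<\<beta>} \<times> {y - \<delta><..<y + \<delta>}" using ab d(1) True by (auto simp: xy)
      ultimately show ?thesis using w by blast
    next
      case neg: False
      have "{-\<beta><..<-\<alpha>} \<times> {y - \<delta><..<y + \<delta>} \<subseteq> \<Omega>" using sub ab(1) by (auto simp: abs_less_iff)
      moreover have "p \<in> {-\<beta><..<-\<alpha>} \<times> {y - \<delta><..<y + \<delta>}" using ab d(1) neg by (auto simp: xy)
      moreover have "-\<alpha> - (-\<beta>) = \<beta> - \<alpha>" by simp
      ultimately show ?thesis using w by metis
    qed
  qed
qed

lemma sob_Omega_L4:
  "sob \<Omega> u v w \<Longrightarrow> integrable M\<Omega> (\<lambda>p. (u p :: real) ^ 4)"
  by (rule sob_L4[of u v w width 2]) (simp_all add: swap_Omega wide_Omega width_pos)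

definition boundary_edges :: "(R2 \<times> R2) set" where
  "boundary_edges =
     {((0, \<rho>), (\<rho>, 0)), ((- \<rho>, 0), (0, \<rho>)), ((- \<rho>, 0), (0, - \<rho>)), ((0, - \<rho>), (\<rho>, 0)),
      ((\<epsilon>, 1 - \<epsilon>), (1 - \<epsilon>, \<epsilon>)), ((- (1 - \<epsilon>), \<epsilon>), (- \<epsilon>, 1 - \<epsilon>)),
      ((- (1 - \<epsilon>), - \<epsilon>), (- \<epsilon>, - (1 - \<epsilon>))), ((\<epsilon>, - (1 - \<epsilon>)), (1 - \<epsilon>, - \<epsilon>)),
      ((1 - \<epsilon>, - \<epsilon>), (1 - \<epsilon>, \<epsilon>)), ((- \<epsilon>, 1 - \<epsilon>), (\<epsilon>, 1 - \<epsilon>)),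
      ((- (1 - \<epsilon>), - \<epsilon>), (- (1 - \<epsilon>), \<epsilon>)), ((- \<epsilon>, - (1 - \<epsilon>)), (\<epsilon>, - (1 - \<epsilon>)))}"

text \<open>Turns edges that are graphs over the x axis into linear conditions. The endpoints in
  \<open>boundary_edges\<close> are ordered from left to right for this purpose; the two vertical
  edges, ordered upwards, are treated separately.\<close>

lemma mem_graph_segment:
  fixes x0 x1 m k :: real
  assumes "x0 < x1" "y0 = m * x0 + k" "y1 = m * x1 + k"
  shows "(x, y) \<in> closed_segment (x0, y0) (x1, y1) \<longleftrightarrow> x0 \<le> x \<and> x \<le> x1 \<and> y = m * x + k"
proof
  assume "(x, y) \<in> closed_segment (x0, y0) (x1, y1)"
  then obtain u where u: "0 \<le> u" "u \<le> 1" "x = (1 - u) * x0 + u * x1" "y = (1 - u) * y0 + u * y1"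
    by (auto simp: in_segment)
  have "x = x0 + u * (x1 - x0)" "x = x1 - (1 - u) * (x1 - x0)" using u by (simp_all add: algebra_simps)
  moreover have "0 \<le> u * (x1 - x0)" "0 \<le> (1 - u) * (x1 - x0)" using u assms by simp_all
  moreover have "y = m * x + k" unfolding u(3,4) assms(2,3) by (simp add: algebra_simps)
  ultimately show "x0 \<le> x \<and> x \<le> x1 \<and> y = m * x + k" by simp
next
  assume h: "x0 \<le> x \<and> x \<le> x1 \<and> y = m * x + k"
  define u where "u = (x - x0) / (x1 - x0)"
  have u: "0 \<le> u" "u \<le> 1" "u * (x1 - x0) = x - x0" using h assms by (auto simp: u_def)
  then have x: "x = (1 - u) * x0 + u * x1" by (simp add: algebra_simps)
  have "y = (1 - u) * y0 + u * y1" using h assms unfolding x by (simp add: algebra_simps)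
  then show "(x, y) \<in> closed_segment (x0, y0) (x1, y1)" using u x by (auto simp: in_segment)
qed

lemma mem_vertical_segment:
  fixes x0 y0 y1 :: real
  assumes "y0 < y1"
  shows "(x, y) \<in> closed_segment (x0, y0) (x0, y1) \<longleftrightarrow> x = x0 \<and> y0 \<le> y \<and> y \<le> y1"
proof
  assume "(x, y) \<in> closed_segment (x0, y0) (x0, y1)"
  then obtain u where u: "0 \<le> u" "u \<le> 1" "x = (1 - u) * x0 + u * x0" "y = (1 - u) * y0 + u * y1"
    by (auto simp: in_segment)
  have "y = y0 + u * (y1 - y0)" "y = y1 - (1 - u) * (y1 - y0)" using u by (simp_all add: algebra_simps)
  moreover have "0 \<le> u * (y1 - y0)" "0 \<le> (1 - u) * (y1 - y0)" using u assms by simp_all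
  ultimately show "x = x0 \<and> y0 \<le> y \<and> y \<le> y1" using u by (auto simp: algebra_simps)
next
  assume h: "x = x0 \<and> y0 \<le> y \<and> y \<le> y1"
  define u where "u = (y - y0) / (y1 - y0)"
  have u: "0 \<le> u" "u \<le> 1" "u * (y1 - y0) = y - y0" using h assms by (auto simp: u_def)
  then have "y = (1 - u) * y0 + u * y1" by (simp add: algebra_simps)
  moreover have "x = (1 - u) * x0 + u * x0" using h by (simp add: algebra_simps)
  ultimately show "(x, y) \<in> closed_segment (x0, y0) (x0, y1)" using u by (auto simp: in_segment)
qed

lemma edge_parameters: "\<epsilon> < 1 - \<epsilon>" "- (1 - \<epsilon>) < - \<epsilon>" "- \<epsilon> < \<epsilon>" "0 < \<rho>" "- \<rho> < 0"
  using eps rho by auto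

lemma boundary_edges_props:
  "finite boundary_edges" "(c, d) \<in> boundary_edges \<Longrightarrow> c \<noteq> d"
proof -
  show "finite boundary_edges" unfolding boundary_edges_def by (intro finite.intros)
  show "c \<noteq> d" if "(c, d) \<in> boundary_edges"
    using that edge_parameters unfolding boundary_edges_def insert_iff empty_iff prod.inject
    by (elim disjE conjE) auto
qed

lemma edge_segments:
  "C1 \<epsilon> = closed_segment (\<epsilon>, 1 - \<epsilon>) (1 - \<epsilon>, \<epsilon>)"
  "C2 \<epsilon> = closed_segment (- (1 - \<epsilon>), \<epsilon>) (- \<epsilon>, 1 - \<epsilon>)"
  "C3 \<epsilon> = closed_segment (- (1 - \<epsilon>), - \<epsilon>) (- \<epsilon>, - (1 - \<epsilon>))"
  "C4 \<epsilon> = closed_segment (\<epsilon>, - (1 - \<epsilon>)) (1 - \<epsilon>, - \<epsilon>)"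
  "S1 \<epsilon> = closed_segment (1 - \<epsilon>, - \<epsilon>) (1 - \<epsilon>, \<epsilon>)"
  "S2 \<epsilon> = closed_segment (- \<epsilon>, 1 - \<epsilon>) (\<epsilon>, 1 - \<epsilon>)"
  "S3 \<epsilon> = closed_segment (- (1 - \<epsilon>), - \<epsilon>) (- (1 - \<epsilon>), \<epsilon>)"
  "S4 \<epsilon> = closed_segment (- \<epsilon>, - (1 - \<epsilon>)) (\<epsilon>, - (1 - \<epsilon>))"
proof -
  have eqI: "A = B" if "\<And>x y. (x, y) \<in> A \<longleftrightarrow> (x, y) \<in> B" for A B :: "R2 set"
    using that by auto
  show "C1 \<epsilon> = closed_segment (\<epsilon>, 1 - \<epsilon>) (1 - \<epsilon>, \<epsilon>)"
    by (rule eqI, subst mem_graph_segment[where m = "- 1" and k = "1"])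
      (use edge_parameters in \<open>auto simp: C1_def\<close>)
  show "C2 \<epsilon> = closed_segment (- (1 - \<epsilon>), \<epsilon>) (- \<epsilon>, 1 - \<epsilon>)"
    by (rule eqI, subst mem_graph_segment[where m = "1" and k = "1"])
      (use edge_parameters in \<open>auto simp: C2_def\<close>)
  show "C3 \<epsilon> = closed_segment (- (1 - \<epsilon>), - \<epsilon>) (- \<epsilon>, - (1 - \<epsilon>))"
    by (rule eqI, subst mem_graph_segment[where m = "- 1" and k = "- 1"])
      (use edge_parameters in \<open>auto simp: C3_def\<close>)
  show "C4 \<epsilon> = closed_segment (\<epsilon>, - (1 - \<epsilon>)) (1 - \<epsilon>, - \<epsilon>)"
    by (rule eqI, subst mem_graph_segment[where m = "1" and k = "- 1"])
      (use edge_parameters in \<open>auto simp: C4_def\<close>)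
  show "S1 \<epsilon> = closed_segment (1 - \<epsilon>, - \<epsilon>) (1 - \<epsilon>, \<epsilon>)"
    by (rule eqI, subst mem_vertical_segment[OF edge_parameters(3)]) (auto simp: S1_def)
  show "S2 \<epsilon> = closed_segment (- \<epsilon>, 1 - \<epsilon>) (\<epsilon>, 1 - \<epsilon>)"
    by (rule eqI, subst mem_graph_segment[where m = "0" and k = "1 - \<epsilon>"])
      (use edge_parameters in \<open>auto simp: S2_def\<close>)
  show "S3 \<epsilon> = closed_segment (- (1 - \<epsilon>), - \<epsilon>) (- (1 - \<epsilon>), \<epsilon>)"
    by (rule eqI, subst mem_vertical_segment[OF edge_parameters(3)]) (auto simp: S3_def)
  show "S4 \<epsilon> = closed_segment (- \<epsilon>, - (1 - \<epsilon>)) (\<epsilon>, - (1 - \<epsilon>))"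
    by (rule eqI, subst mem_graph_segment[where m = "0" and k = "- (1 - \<epsilon>)"])
      (use edge_parameters in \<open>auto simp: S4_def\<close>)
qed

lemma Gamma_in_segments:
  "Gamma_in \<rho> = closed_segment (0, \<rho>) (\<rho>, 0) \<union> closed_segment (- \<rho>, 0) (0, \<rho>) \<union>
     closed_segment (- \<rho>, 0) (0, - \<rho>) \<union> closed_segment (0, - \<rho>) (\<rho>, 0)"
proof (intro set_eqI)
  fix p :: R2
  obtain x y where p: "p = (x, y)" by (cases p)
  have "(x, y) \<in> closed_segment (0, \<rho>) (\<rho>, 0) \<longleftrightarrow> 0 \<le> x \<and> x \<le> \<rho> \<and> y = -1 * x + \<rho>"
    "(x, y) \<in> closed_segment (- \<rho>, 0) (0, \<rho>) \<longleftrightarrow> -\<rho> \<le> x \<and> x \<le> 0 \<and> y = 1 * x + \<rho>"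
    "(x, y) \<in> closed_segment (- \<rho>, 0) (0, - \<rho>) \<longleftrightarrow> -\<rho> \<le> x \<and> x \<le> 0 \<and> y = -1 * x + -\<rho>"
    "(x, y) \<in> closed_segment (0, - \<rho>) (\<rho>, 0) \<longleftrightarrow> 0 \<le> x \<and> x \<le> \<rho> \<and> y = 1 * x + -\<rho>"
    by (rule mem_graph_segment; use rho in simp)+
  moreover have "p \<in> Gamma_in \<rho> \<longleftrightarrow> \<bar>x\<bar> + \<bar>y\<bar> = \<rho>" by (simp add: p Gamma_in_def max_abs_add_diff)
  moreover have "\<bar>x\<bar> + \<bar>y\<bar> = \<rho> \<longleftrightarrow> (0 \<le> x \<and> x \<le> \<rho> \<and> y = -1 * x + \<rho>) \<or> (-\<rho> \<le> x \<and> x \<le> 0 \<and> y = 1 * x + \<rho>) \<or>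
     (-\<rho> \<le> x \<and> x \<le> 0 \<and> y = -1 * x + -\<rho>) \<or> (0 \<le> x \<and> x \<le> \<rho> \<and> y = 1 * x + -\<rho>)"
    using rho(1) by linarith
  ultimately show "p \<in> Gamma_in \<rho> \<longleftrightarrow> p \<in> closed_segment (0, \<rho>) (\<rho>, 0) \<union> closed_segment (- \<rho>, 0) (0, \<rho>) \<union>
     closed_segment (- \<rho>, 0) (0, - \<rho>) \<union> closed_segment (0, - \<rho>) (\<rho>, 0)"
    unfolding Un_iff p by blast
qed

lemma frontier_edges: "frontier \<Omega> = (\<Union>(c, d)\<in>boundary_edges. closed_segment c d)"
  unfolding frontier_Omega[OF rho eps] Gamma_out_def edge_segments Gamma_in_segments boundary_edges_def
  by (simp only: UN_insert UN_empty prod.case) (simp only: Un_assoc Un_empty_right)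

end

section \<open>An extension of the boundary data\<close>

locale wors_data = wors_domain +
  fixes s :: real and g :: "real \<Rightarrow> real"
  assumes s: "0 < s" and g: "boundary_profile s \<epsilon> g"
begin

text \<open>Clamping the argument continues \<open>g\<close> by its end values \<plusminus>s / 2, so
  the result is continuous and odd on the whole line.\<close>

definition gext :: "real \<Rightarrow> real" where "gext t = g (max (- \<epsilon>) (min \<epsilon> t))"

text \<open>Meant as a function of |x| + |y|. It vanishes on the inner boundary and is 1 from 1 -
  \<epsilon> on, a range that contains the outer boundary, where |x| + |y| lies between 1 -
  \<epsilon> and 1.\<close>

definition cutoff :: "real \<Rightarrow> real" where "cutoff r = min 1 ((r - \<rho>) / (1 - \<epsilon> - \<rho>))"

definition cutoff' :: "real \<Rightarrow> real" where "cutoff' r = (if r < 1 - \<epsilon> then 1 / (1 - \<epsilon> - \<rho>) else 0)"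

lemma width': "0 < 1 - \<epsilon> - \<rho>" using eps by simp

lemma g_range: "\<bar>x\<bar> \<le> \<epsilon> \<Longrightarrow> \<bar>g x\<bar> \<le> s / 2"
proof -
  assume "\<bar>x\<bar> \<le> \<epsilon>"
  then have "x \<in> {-\<epsilon>..\<epsilon>}" by auto
  moreover have "g ` {-\<epsilon>..\<epsilon>} \<subseteq> {- s / 2..s / 2}" using g by (simp add: boundary_profile_def)
  ultimately have "g x \<in> {- s / 2..s / 2}" by blast
  then show ?thesis by auto
qed

lemma g_odd: "\<bar>x\<bar> \<le> \<epsilon> \<Longrightarrow> g (- x) = - g x"
  using g unfolding boundary_profile_def by (auto simp: abs_le_iff)

lemma g_eps: "g \<epsilon> = s / 2" "g (- \<epsilon>) = - (s / 2)"
  using g g_odd[of \<epsilon>] eps by (auto simp: boundary_profile_def)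

lemma gext_inside: "\<bar>t\<bar> \<le> \<epsilon> \<Longrightarrow> gext t = g t" by (auto simp: gext_def abs_le_iff min_def max_def)
lemma gext_right: "\<epsilon> \<le> t \<Longrightarrow> gext t = s / 2" using eps g_eps by (auto simp: gext_def)
lemma gext_left: "t \<le> - \<epsilon> \<Longrightarrow> gext t = - (s / 2)" using eps g_eps by (auto simp: gext_def)

lemma gext_odd: "gext (- t) = - gext t"
proof -
  consider "\<bar>t\<bar> \<le> \<epsilon>" | "\<epsilon> \<le> t" | "t \<le> - \<epsilon>" by linarith
  then show ?thesis by cases (simp_all add: gext_inside g_odd gext_right gext_left)
qed

lemma gext_bound: "\<bar>gext t\<bar> \<le> s / 2"
  unfolding gext_def using eps by (intro g_range) (auto simp: abs_le_iff min_def max_def)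

lemma gext_continuous: "continuous_on S gext"
proof -
  obtain g' where "\<forall>x\<in>{-\<epsilon>..\<epsilon>}. (g has_real_derivative g' x) (at x within {-\<epsilon>..\<epsilon>})"
    using g by (auto simp: boundary_profile_def)
  then have "continuous_on {-\<epsilon>..\<epsilon>} g"
    unfolding continuous_on_eq_continuous_within by (meson DERIV_continuous)
  then show ?thesis
    unfolding gext_def by (rule continuous_on_compose2) (use eps in \<open>auto intro!: continuous_intros\<close>)
qed

lemma gext_deriv:
  obtains gd where "gd \<in> borel_measurable borel" "\<exists>K. \<forall>t. \<bar>gd t\<bar> \<le> K"
    "\<And>t. t \<notin> {-\<epsilon>, \<epsilon>} \<Longrightarrow> (gext has_real_derivative gd t) (at t)"
proof -
  obtain g' where g': "continuous_on {-\<epsilon>..\<epsilon>} g'"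
    "\<And>x. x \<in> {-\<epsilon>..\<epsilon>} \<Longrightarrow> (g has_real_derivative g' x) (at x within {-\<epsilon>..\<epsilon>})"
    using g by (auto simp: boundary_profile_def)
  have "compact (g' ` {-\<epsilon>..\<epsilon>})" by (rule compact_continuous_image[OF g'(1) compact_Icc])
  then obtain K where K: "\<And>y. y \<in> g' ` {-\<epsilon>..\<epsilon>} \<Longrightarrow> norm y \<le> K" using compact_imp_bounded bounded_iff by metis
  define gd where "gd t = (if t \<in> {-\<epsilon><..<\<epsilon>} then g' t else 0)" for t
  show ?thesis
  proof (rule that[of gd])
    show "gd \<in> borel_measurable borel"
      unfolding gd_def
      using borel_measurable_continuous_on_if[of "{-\<epsilon><..<\<epsilon>}" g' "\<lambda>_. 0"] continuous_on_subset[OF g'(1)]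
      by (auto simp: subset_iff)
    have "\<bar>gd t\<bar> \<le> max 0 K" for t
      using K[of "g' t"] by (auto simp: gd_def le_max_iff_disj)
    then show "\<exists>K. \<forall>t. \<bar>gd t\<bar> \<le> K" by blast
    show "(gext has_real_derivative gd t) (at t)" if t: "t \<notin> {-\<epsilon>, \<epsilon>}" for t
    proof -
      consider "- \<epsilon> < t \<and> t < \<epsilon>" | "\<epsilon> < t" | "t < - \<epsilon>" using t by force
      then show ?thesis
      proof cases
        case 1
        then have "(g has_real_derivative g' t) (at t within {-\<epsilon><..<\<epsilon>})"
          by (intro has_field_derivative_subset[OF g'(2)]) auto
        then have "(g has_real_derivative g' t) (at t)" using 1 by (simp add: at_within_open[of t "{-\<epsilon><..<\<epsilon>}"])
        then have "(gext has_real_derivative g' t) (at t)"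
          by (rule has_field_derivative_transform_within_open[of _ _ _ "{-\<epsilon><..<\<epsilon>}"]) (use 1 in \<open>auto simp: gext_inside abs_le_iff\<close>)
        then show ?thesis using 1 by (simp add: gd_def)
      next
        case 2
        have "((\<lambda>_. s / 2) has_real_derivative 0) (at t)" by simp
        then have "(gext has_real_derivative 0) (at t)"
          by (rule has_field_derivative_transform_within_open[of _ _ _ "{\<epsilon><..}"]) (use 2 in \<open>auto simp: gext_right\<close>)
        then show ?thesis using 2 by (simp add: gd_def)
      next
        case 3
        have "((\<lambda>_. - (s / 2)) has_real_derivative 0) (at t)" by simp
        then have "(gext has_real_derivative 0) (at t)"
          by (rule has_field_derivative_transform_within_open[of _ _ _ "{..<-\<epsilon>}"]) (use 3 in \<open>auto simp: gext_left\<close>)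
        then show ?thesis using 3 by (simp add: gd_def)
      qed
    qed
  qed
qed

lemma cutoff_continuous: "continuous_on S cutoff"
  unfolding cutoff_def using width' by (auto intro!: continuous_intros)

lemma cutoff_values: "cutoff \<rho> = 0" "1 - \<epsilon> \<le> r \<Longrightarrow> cutoff r = 1"
  using width' by (auto simp: cutoff_def min_def field_simps)

lemma cutoff_bound: "0 \<le> r \<Longrightarrow> \<bar>cutoff r\<bar> \<le> 1 + \<rho> / (1 - \<epsilon> - \<rho>)"
proof -
  assume r: "0 \<le> r"
  have "- (\<rho> / (1 - \<epsilon> - \<rho>)) \<le> (r - \<rho>) / (1 - \<epsilon> - \<rho>)"
    using r width' by (simp add: field_simps)
  moreover have "0 \<le> \<rho> / (1 - \<epsilon> - \<rho>)" using rho width' by simp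
  ultimately show ?thesis unfolding cutoff_def by (auto simp: min_def abs_le_iff)
qed

lemma cutoff_deriv: "r \<noteq> 1 - \<epsilon> \<Longrightarrow> (cutoff has_real_derivative cutoff' r) (at r)"
proof -
  assume "r \<noteq> 1 - \<epsilon>"
  then consider "r < 1 - \<epsilon>" | "r > 1 - \<epsilon>" by linarith
  then show ?thesis
  proof cases
    case 1
    have "((\<lambda>r. (r - \<rho>) / (1 - \<epsilon> - \<rho>)) has_real_derivative 1 / (1 - \<epsilon> - \<rho>)) (at r)"
      using width' by (auto intro!: derivative_eq_intros)
    then have "(cutoff has_real_derivative 1 / (1 - \<epsilon> - \<rho>)) (at r)"
      by (rule has_field_derivative_transform_within_open[of _ _ _ "{..<1 - \<epsilon>}"])
         (use 1 width' in \<open>auto simp: cutoff_def min_def field_simps\<close>)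
    then show ?thesis using 1 by (simp add: cutoff'_def)
  next
    case 2
    have "((\<lambda>r. 1) has_real_derivative 0) (at r)" by simp
    then have "(cutoff has_real_derivative 0) (at r)"
      by (rule has_field_derivative_transform_within_open[of _ _ _ "{1 - \<epsilon><..}"])
         (use 2 width' in \<open>auto simp: cutoff_values\<close>)
    then show ?thesis using 2 by (simp add: cutoff'_def)
  qed
qed

lemma cutoff'_bound: "\<bar>cutoff' r\<bar> \<le> 1 / (1 - \<epsilon> - \<rho>)"
  using width' by (simp add: cutoff'_def)

text \<open>The excluded points are the kink of the modulus and the points of the row where |x| +
  |y| reaches 1 - \<epsilon>, the kink of \<open>cutoff\<close>.\<close>

lemma radial_deriv:
  assumes "x \<notin> {0, 1 - \<epsilon> - \<bar>y\<bar>, - (1 - \<epsilon> - \<bar>y\<bar>)}"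
  shows "((\<lambda>x. cutoff (\<bar>x\<bar> + \<bar>y\<bar>)) has_real_derivative cutoff' (\<bar>x\<bar> + \<bar>y\<bar>) * sgn x) (at x)"
proof -
  have "(abs has_real_derivative sgn x) (at x)"
  proof (cases "x > 0")
    case True
    have "((\<lambda>x. x) has_real_derivative 1) (at x)" by simp
    then have "(abs has_real_derivative 1) (at x)"
      by (rule has_field_derivative_transform_within_open[of _ _ _ "{0<..}"]) (use True in auto)
    then show ?thesis using True by simp
  next
    case False
    then have "x < 0" using assms by auto
    have "((\<lambda>x. - x) has_real_derivative - 1) (at x)" by (auto intro!: derivative_eq_intros)
    then have "(abs has_real_derivative - 1) (at x)"
      by (rule has_field_derivative_transform_within_open[of _ _ _ "{..<0}"]) (use \<open>x < 0\<close> in auto)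
    then show ?thesis using \<open>x < 0\<close> by simp
  qed
  then have "((\<lambda>x. \<bar>x\<bar> + \<bar>y\<bar>) has_real_derivative sgn x) (at x)"
    by (auto intro!: derivative_eq_intros)
  moreover have "\<bar>x\<bar> + \<bar>y\<bar> \<noteq> 1 - \<epsilon>" using assms by auto
  ultimately show ?thesis by (intro DERIV_chain2[OF cutoff_deriv])
qed

text \<open>On every outer edge one of the two factors \<open>gext\<close> is \<open>\<plusminus> s / 2\<close>, so the product with \<open>2 / s\<close>
  reproduces the boundary data, including its signs.\<close>

definition lift1 :: "R2 \<Rightarrow> real" where
  "lift1 p = 2 / s * (gext (fst p) * gext (snd p) * cutoff (\<bar>fst p\<bar> + \<bar>snd p\<bar>))"

definition lift3 :: "R2 \<Rightarrow> real" where
  "lift3 p = - (s / 6) * cutoff (\<bar>fst p\<bar> + \<bar>snd p\<bar>)"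

lemma lift_continuous: "continuous_on S lift1" "continuous_on S lift3"
  unfolding lift1_def lift3_def
  by (intro continuous_intros continuous_on_compose2[OF gext_continuous[of UNIV]] continuous_on_compose2[OF cutoff_continuous[of UNIV]]; simp)+

lemma radial_measurable [measurable]:
  "(\<lambda>p::R2. cutoff (\<bar>fst p\<bar> + \<bar>snd p\<bar>)) \<in> borel_measurable borel"
  "(\<lambda>p::R2. cutoff' (\<bar>fst p\<bar> + \<bar>snd p\<bar>)) \<in> borel_measurable borel"
proof -
  have "(\<lambda>p::R2. \<bar>fst p\<bar> + \<bar>snd p\<bar>) \<in> borel_measurable borel"
    by (intro borel_measurable_continuous_onI continuous_intros)
  moreover have "cutoff \<in> borel_measurable borel" by (rule borel_measurable_continuous_onI[OF cutoff_continuous])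
  moreover have "cutoff' \<in> borel_measurable borel" unfolding cutoff'_def by measurable
  ultimately show "(\<lambda>p::R2. cutoff (\<bar>fst p\<bar> + \<bar>snd p\<bar>)) \<in> borel_measurable borel"
    "(\<lambda>p::R2. cutoff' (\<bar>fst p\<bar> + \<bar>snd p\<bar>)) \<in> borel_measurable borel"
    by (auto intro: measurable_compose)
qed

lemma sgn_measurable: "(sgn :: real \<Rightarrow> real) \<in> borel_measurable borel"
  unfolding sgn_if by measurable

text \<open>The lift is symmetric in x and y, so its second partial derivative is the first one with
  the coordinates swapped; \<open>lift1\<close> is treated in the same way.\<close>

lemma sob_lift3: "\<exists>v w. sob \<Omega> lift3 v w"
proof -
  define v where "v p = - (s / 6) * (cutoff' (\<bar>fst p\<bar> + \<bar>snd p\<bar>) * sgn (fst p))" for p :: R2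
  have v[measurable]: "v \<in> borel_measurable borel"
    unfolding v_def by (intro borel_measurable_times borel_measurable_const radial_measurable measurable_comp_fst sgn_measurable)
  have v': "(\<lambda>p. v (prod.swap p)) \<in> borel_measurable borel" by measurable
  have b: "\<bar>v p\<bar> \<le> s / 6 * (1 / (1 - \<epsilon> - \<rho>))" for p
  proof -
    have "\<bar>v p\<bar> = s / 6 * (\<bar>cutoff' (\<bar>fst p\<bar> + \<bar>snd p\<bar>)\<bar> * \<bar>sgn (fst p)\<bar>)" using s by (simp add: v_def abs_mult)
    also have "\<dots> \<le> s / 6 * (1 / (1 - \<epsilon> - \<rho>) * 1)"
      using s width' cutoff'_bound by (intro mult_left_mono mult_mono) (auto simp: sgn_if)
    finally show ?thesis by simp
  qed
  define F where "F y = {0, 1 - \<epsilon> - \<bar>y\<bar>, - (1 - \<epsilon> - \<bar>y\<bar>)}" for y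
  have d: "((\<lambda>x. lift3 (x, y)) has_real_derivative v (x, y)) (at x)" if "x \<notin> F y" for x y
    unfolding lift3_def v_def fst_conv snd_conv
    by (intro DERIV_cmult radial_deriv) (use that in \<open>simp add: F_def\<close>)
  have "sob \<Omega> lift3 v (\<lambda>p. v (prod.swap p))"
  proof (rule sob_piecewise_differentiable[OF lift_continuous(2) v v' b b, of F])
    show "((\<lambda>y. lift3 (x, y)) has_real_derivative v (prod.swap (x, y))) (at y)" if "y \<notin> F x" for x y
      using d[OF that] by (simp add: lift3_def add.commute)
  qed (use d in \<open>auto simp: F_def\<close>)
  then show ?thesis by blast
qed

lemma sob_lift1: "\<exists>v w. sob \<Omega> lift1 v w"
proof -
  obtain gd K where gd: "gd \<in> borel_measurable borel" and K: "\<And>t. \<bar>gd t\<bar> \<le> K"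
    and gd': "\<And>t. t \<notin> {-\<epsilon>, \<epsilon>} \<Longrightarrow> (gext has_real_derivative gd t) (at t)"
    by (rule gext_deriv) blast
  have gm: "gext \<in> borel_measurable borel" by (rule borel_measurable_continuous_onI[OF gext_continuous])
  define v where "v p = 2 / s * (gd (fst p) * gext (snd p) * cutoff (\<bar>fst p\<bar> + \<bar>snd p\<bar>) +
      gext (fst p) * gext (snd p) * (cutoff' (\<bar>fst p\<bar> + \<bar>snd p\<bar>) * sgn (fst p)))" for p :: R2
  have v[measurable]: "v \<in> borel_measurable borel"
    unfolding v_def
    by (intro borel_measurable_times borel_measurable_add borel_measurable_const radial_measurable
        measurable_comp_fst measurable_comp_snd sgn_measurable gd gm)
  have v': "(\<lambda>p. v (prod.swap p)) \<in> borel_measurable borel" by measurable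
  have K0: "0 \<le> K" using K[of 0] by linarith
  define B where "B = 2 / s * (K * (s / 2) * (1 + \<rho> / (1 - \<epsilon> - \<rho>)) + s / 2 * (s / 2) * (1 / (1 - \<epsilon> - \<rho>) * 1))"
  have b: "\<bar>v p\<bar> \<le> B" for p
  proof -
    have "\<bar>v p\<bar> = 2 / s * \<bar>gd (fst p) * gext (snd p) * cutoff (\<bar>fst p\<bar> + \<bar>snd p\<bar>) +
      gext (fst p) * gext (snd p) * (cutoff' (\<bar>fst p\<bar> + \<bar>snd p\<bar>) * sgn (fst p))\<bar>"
      unfolding v_def by (subst abs_mult) (use s in simp)
    also have "\<dots> \<le> 2 / s * (\<bar>gd (fst p)\<bar> * \<bar>gext (snd p)\<bar> * \<bar>cutoff (\<bar>fst p\<bar> + \<bar>snd p\<bar>)\<bar> +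
      \<bar>gext (fst p)\<bar> * \<bar>gext (snd p)\<bar> * (\<bar>cutoff' (\<bar>fst p\<bar> + \<bar>snd p\<bar>)\<bar> * \<bar>sgn (fst p)\<bar>))"
      using s by (intro mult_left_mono order_trans[OF abs_triangle_ineq]) (auto simp: abs_mult)
    also have "\<dots> \<le> B"
      unfolding B_def using s width' rho K0
      by (intro mult_left_mono add_mono mult_mono K gext_bound cutoff_bound cutoff'_bound)
         (auto simp: sgn_if)
    finally show ?thesis .
  qed
  \<comment> \<open>The kinks of \<open>gext\<close> at \<plusminus>\<epsilon> join the radial
    ones.\<close>
  define F where "F y = {-\<epsilon>, \<epsilon>, 0, 1 - \<epsilon> - \<bar>y\<bar>, - (1 - \<epsilon> - \<bar>y\<bar>)}" for y
  have d: "((\<lambda>x. lift1 (x, y)) has_real_derivative v (x, y)) (at x)" if "x \<notin> F y" for x y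
  proof -
    have 1: "(gext has_real_derivative gd x) (at x)" using gd' that by (simp add: F_def)
    have 2: "((\<lambda>x. cutoff (\<bar>x\<bar> + \<bar>y\<bar>)) has_real_derivative cutoff' (\<bar>x\<bar> + \<bar>y\<bar>) * sgn x) (at x)"
      by (rule radial_deriv) (use that in \<open>simp add: F_def\<close>)
    show ?thesis
      unfolding lift1_def v_def fst_conv snd_conv
      by (rule DERIV_cmult, rule DERIV_cong[OF DERIV_mult[OF DERIV_cmult_right[OF 1] 2]]) (simp add: algebra_simps)
  qed
  have "sob \<Omega> lift1 v (\<lambda>p. v (prod.swap p))"
  proof (rule sob_piecewise_differentiable[OF lift_continuous(1) v v' b b, of F])
    show "((\<lambda>y. lift1 (x, y)) has_real_derivative v (prod.swap (x, y))) (at y)" if "y \<notin> F x" for x y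
    proof -
      have "lift1 (x, y) = lift1 (y, x)" for y by (simp add: lift1_def add.commute mult.commute)
      then show ?thesis using d[OF that] by simp
    qed
  qed (use d in \<open>auto simp: F_def\<close>)
  then show ?thesis by blast
qed

lemma lift_boundary:
  assumes "p \<in> frontier \<Omega>"
  shows "lift1 p = q1b s \<rho> \<epsilon> g p" "lift3 p = q3b s \<rho> \<epsilon> p"
proof -
  obtain x y where p: "p = (x, y)" by (cases p)
  have fr: "p \<in> Gamma_in \<rho> \<or> p \<in> Gamma_out \<epsilon>" using assms by (simp add: frontier_Omega[OF rho eps])
  have G: "p \<in> Gamma_in \<rho> \<longleftrightarrow> \<bar>x\<bar> + \<bar>y\<bar> = \<rho>" by (simp add: p Gamma_in_def max_abs_add_diff)
  have out: "1 - \<epsilon> \<le> \<bar>x\<bar> + \<bar>y\<bar>" if "p \<in> Gamma_out \<epsilon>"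
    using that eps by (auto simp: p Gamma_out_def C1_def C2_def C3_def C4_def S1_def S2_def S3_def S4_def)
  have disj: "p \<notin> Gamma_in \<rho>" if "p \<in> Gamma_out \<epsilon>" using out[OF that] eps by (auto simp: G)
  show "lift3 p = q3b s \<rho> \<epsilon> p"
  proof (cases "p \<in> Gamma_in \<rho>")
    case True
    then have "\<bar>fst p\<bar> + \<bar>snd p\<bar> = \<rho>" using G by (simp add: p)
    then show ?thesis using True by (simp add: q3b_def lift3_def cutoff_values)
  next
    case False
    then have po: "p \<in> Gamma_out \<epsilon>" using fr by blast
    have "cutoff (\<bar>fst p\<bar> + \<bar>snd p\<bar>) = 1" using cutoff_values(2)[OF out[OF po]] by (simp add: p)
    then show ?thesis using False po by (simp add: q3b_def lift3_def)
  qed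
  show "lift1 p = q1b s \<rho> \<epsilon> g p"
  proof (cases "p \<in> Gamma_in \<rho>")
    case True
    then show ?thesis using G by (simp add: q1b_def lift1_def p cutoff_values)
  next
    case False
    then have po: "p \<in> Gamma_out \<epsilon>" using fr by blast
    have c: "lift1 p = 2 / s * (gext x * gext y)" using cutoff_values(2)[OF out[OF po]] by (simp add: lift1_def p)
    have e: "\<epsilon> \<le> 1 - \<epsilon>" using eps by simp
    \<comment> \<open>The cases follow the nested conditions of \<open>q1b\<close>. In each of them
      some coordinate has modulus at least \<epsilon>, so its \<open>gext\<close> is \<plusminus>s /
      2 and cancels against 2 / s up to sign.\<close>
    consider "p \<in> C1 \<epsilon> \<union> C3 \<epsilon>" | "p \<notin> C1 \<epsilon> \<union> C3 \<epsilon>" "p \<in> C2 \<epsilon> \<union> C4 \<epsilon>" |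
      "p \<notin> C1 \<epsilon> \<union> C3 \<epsilon>" "p \<notin> C2 \<epsilon> \<union> C4 \<epsilon>" "p \<in> S1 \<epsilon>" |
      "p \<notin> C1 \<epsilon> \<union> C3 \<epsilon>" "p \<notin> C2 \<epsilon> \<union> C4 \<epsilon>" "p \<notin> S1 \<epsilon>" "p \<in> S3 \<epsilon>" |
      "p \<notin> C1 \<epsilon> \<union> C3 \<epsilon>" "p \<notin> C2 \<epsilon> \<union> C4 \<epsilon>" "p \<notin> S1 \<epsilon>" "p \<notin> S3 \<epsilon>" "p \<in> S2 \<epsilon>" |
      "p \<notin> C1 \<epsilon> \<union> C3 \<epsilon>" "p \<notin> C2 \<epsilon> \<union> C4 \<epsilon>" "p \<notin> S1 \<epsilon>" "p \<notin> S3 \<epsilon>" "p \<notin> S2 \<epsilon>" "p \<in> S4 \<epsilon>"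
      using po unfolding Gamma_out_def Un_iff by blast
    then show ?thesis
    proof cases
      case 1
      then have q: "q1b s \<rho> \<epsilon> g p = s / 2" using False by (simp add: q1b_def)
      from 1 have "(\<epsilon> \<le> x \<and> \<epsilon> \<le> y) \<or> (x \<le> - \<epsilon> \<and> y \<le> - \<epsilon>)" by (auto simp: p C1_def C3_def)
      then show ?thesis using s unfolding c q by (auto simp: gext_right gext_left)
    next
      case 2
      then have q: "q1b s \<rho> \<epsilon> g p = - s / 2" using False by (simp add: q1b_def)
      from 2 have "(x \<le> - \<epsilon> \<and> \<epsilon> \<le> y) \<or> (\<epsilon> \<le> x \<and> y \<le> - \<epsilon>)" by (auto simp: p C2_def C4_def)
      then show ?thesis using s unfolding c q by (auto simp: gext_right gext_left)
    next
      case 3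
      then have q: "q1b s \<rho> \<epsilon> g p = g y" using False by (simp add: q1b_def p)
      from 3 have "\<epsilon> \<le> x" "\<bar>y\<bar> \<le> \<epsilon>" using e by (auto simp: p S1_def)
      then show ?thesis using s unfolding c q by (simp add: gext_right gext_inside)
    next
      case 4
      then have q: "q1b s \<rho> \<epsilon> g p = - g y" using False by (simp add: q1b_def p)
      from 4 have "x \<le> - \<epsilon>" "\<bar>y\<bar> \<le> \<epsilon>" using e by (auto simp: p S3_def)
      then show ?thesis using s unfolding c q by (simp add: gext_left gext_inside)
    next
      case 5
      then have q: "q1b s \<rho> \<epsilon> g p = g x" using False by (simp add: q1b_def p)
      from 5 have "\<epsilon> \<le> y" "\<bar>x\<bar> \<le> \<epsilon>" using e by (auto simp: p S2_def)
      then show ?thesis using s unfolding c q by (simp add: gext_right gext_inside)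
    next
      case 6
      then have q: "q1b s \<rho> \<epsilon> g p = - g x" using False by (simp add: q1b_def p)
      from 6 have "y \<le> - \<epsilon>" "\<bar>x\<bar> \<le> \<epsilon>" using e by (auto simp: p S4_def)
      then show ?thesis using s unfolding c q by (simp add: gext_left gext_inside)
    qed
  qed
qed

definition lift :: "R2 \<Rightarrow> real \<times> real" where "lift p = (lift1 p, lift3 p)"

definition bdata :: "R2 \<Rightarrow> real \<times> real" where "bdata p = (q1b s \<rho> \<epsilon> g p, q3b s \<rho> \<epsilon> p)"

lemma lift_trace: "has_trace \<Omega> lift (frontier \<Omega>) bdata"
proof -
  obtain v w v' w' where "sob \<Omega> lift1 v w" "sob \<Omega> lift3 v' w'" using sob_lift1 sob_lift3 by blast
  from sob_Pair[OF this] have "sob \<Omega> lift (\<lambda>p. (v p, v' p)) (\<lambda>p. (w p, w' p))" by (simp add: lift_def[abs_def])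
  then show ?thesis
    by (rule has_trace_eq) (auto simp: lift_def[abs_def] bdata_def lift_boundary intro!: continuous_intros lift_continuous)
qed

definition flip :: "real \<times> real \<Rightarrow> real \<times> real" where "flip q = (- fst q, snd q)"

lemma lift_symmetric: "lift (refl (- 1) 1 p) = flip (lift p)" "lift (refl 1 (- 1) p) = flip (lift p)"
  by (simp_all add: lift_def lift1_def lift3_def flip_def refl_def gext_odd)

end

section \<open>Energies along lines\<close>

context bounded_domain
begin

lemma energy_integrand_AE:
  fixes u ux uy :: "R2 \<Rightarrow> 'b::euclidean_space"
  assumes "sob \<Omega> u ux uy"
  shows "AE p in M\<Omega>. energy_integrand \<Omega> f u p = f (u p) (ux p) (uy p)"
  using sob_weak_deriv[OF assms] by eventually_elim (simp add: energy_integrand_def)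

lemma energy_integrand_eq:
  fixes u ux uy :: "R2 \<Rightarrow> 'b::euclidean_space"
  assumes s: "sob \<Omega> u ux uy" and eq: "AE p in M\<Omega>. f (u p) (ux p) (uy p) = h p" and h: "h \<in> borel_measurable M\<Omega>"
  shows "integrable M\<Omega> (energy_integrand \<Omega> f u) \<longleftrightarrow> integrable M\<Omega> h" "energy \<Omega> f u = (LINT p|M\<Omega>. h p)"
proof -
  have e: "AE p in M\<Omega>. energy_integrand \<Omega> f u p = h p"
    using energy_integrand_AE[OF s, of f] eq by eventually_elim simp
  then have "AE p in M\<Omega>. h p = energy_integrand \<Omega> f u p" by eventually_elim simp
  then have m: "energy_integrand \<Omega> f u \<in> borel_measurable M\<Omega>" by (rule borel_measurable_lebesgue_on_AE[OF open_\<Omega> h])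
  show "integrable M\<Omega> (energy_integrand \<Omega> f u) \<longleftrightarrow> integrable M\<Omega> h" by (rule integrable_cong_AE[OF m h e])
  show "energy \<Omega> f u = (LINT p|M\<Omega>. h p)" unfolding energy_def by (rule integral_cong_AE[OF m h e])
qed

text \<open>The density along the line is a polynomial in \<open>t\<close> with integrable
  coefficients, so the energy is a polynomial too and its derivative at 0 is the integral of the
  linear coefficient. No differentiation under the integral sign occurs.\<close>

lemma energy_polynomial:
  fixes u ux uy \<phi> \<phi>x \<phi>y :: "R2 \<Rightarrow> 'b::euclidean_space"
  assumes s: "sob \<Omega> u ux uy" "sob \<Omega> \<phi> \<phi>x \<phi>y"
    and c: "integrable M\<Omega> c0" "integrable M\<Omega> c1" "integrable M\<Omega> c2" "integrable M\<Omega> c3" "integrable M\<Omega> c4"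
    and ex: "AE p in M\<Omega>. \<forall>t. f (u p + t *\<^sub>R \<phi> p) (ux p + t *\<^sub>R \<phi>x p) (uy p + t *\<^sub>R \<phi>y p) =
      c0 p + t * c1 p + t\<^sup>2 * c2 p + t ^ 3 * c3 p + t ^ 4 * c4 p"
  shows "integrable M\<Omega> (energy_integrand \<Omega> f (\<lambda>p. u p + t *\<^sub>R \<phi> p))"
    and "((\<lambda>t. energy \<Omega> f (\<lambda>p. u p + t *\<^sub>R \<phi> p)) has_real_derivative (LINT p|M\<Omega>. c1 p)) (at 0)"
proof -
  define h where "h t p = c0 p + t * c1 p + t\<^sup>2 * c2 p + t ^ 3 * c3 p + t ^ 4 * c4 p" for t p
  have h: "integrable M\<Omega> (h t)" for t unfolding h_def using c by simp
  have st: "sob \<Omega> (\<lambda>p. u p + t *\<^sub>R \<phi> p) (\<lambda>p. ux p + t *\<^sub>R \<phi>x p) (\<lambda>p. uy p + t *\<^sub>R \<phi>y p)" for t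
    by (rule sob_add[OF s(1) sob_scaleR[OF s(2)]])
  have eq: "AE p in M\<Omega>. f (u p + t *\<^sub>R \<phi> p) (ux p + t *\<^sub>R \<phi>x p) (uy p + t *\<^sub>R \<phi>y p) = h t p" for t
    using ex by eventually_elim (simp add: h_def)
  note e = energy_integrand_eq[OF st eq borel_measurable_integrable[OF h]]
  show "integrable M\<Omega> (energy_integrand \<Omega> f (\<lambda>p. u p + t *\<^sub>R \<phi> p))" using e(1) h by blast
  have "energy \<Omega> f (\<lambda>p. u p + t *\<^sub>R \<phi> p) = (LINT p|M\<Omega>. c0 p) + t * (LINT p|M\<Omega>. c1 p) + t\<^sup>2 * (LINT p|M\<Omega>. c2 p) +
      t ^ 3 * (LINT p|M\<Omega>. c3 p) + t ^ 4 * (LINT p|M\<Omega>. c4 p)" for t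
    unfolding e(2) unfolding h_def using c by simp
  then show "((\<lambda>t. energy \<Omega> f (\<lambda>p. u p + t *\<^sub>R \<phi> p)) has_real_derivative (LINT p|M\<Omega>. c1 p)) (at 0)"
    by (auto intro!: derivative_eq_intros)
qed

text \<open>Degree bookkeeping for polynomial integrands. The weight \<open>m\<close> will be 1 +
  |u| + |\<phi>|, which is at least 1 and has an integrable fourth power, so everything of order up
  to 4 is integrable.\<close>

definition dominated :: "(R2 \<Rightarrow> real) \<Rightarrow> nat \<Rightarrow> (R2 \<Rightarrow> real) \<Rightarrow> bool" where
  "dominated m n f \<longleftrightarrow> f \<in> borel_measurable M\<Omega> \<and> (\<exists>K\<ge>0. \<forall>p. \<bar>f p\<bar> \<le> K * m p ^ n)"

lemma dominated_add:
  assumes "dominated m n f" "dominated m n g"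
  shows "dominated m n (\<lambda>p. f p + g p)"
proof -
  obtain K K' where K: "K \<ge> 0" "\<And>p. \<bar>f p\<bar> \<le> K * m p ^ n" "K' \<ge> 0" "\<And>p. \<bar>g p\<bar> \<le> K' * m p ^ n"
    using assms by (auto simp: dominated_def)
  have "\<bar>f p + g p\<bar> \<le> (K + K') * m p ^ n" for p
    using abs_triangle_ineq[of "f p" "g p"] K(2)[of p] K(4)[of p] by (simp add: distrib_right)
  then show ?thesis using assms K(1,3) unfolding dominated_def by (intro conjI exI[of _ "K + K'"]) auto
qed

lemma dominated_mult:
  assumes "dominated m n f" "dominated m n' g"
  shows "dominated m (n + n') (\<lambda>p. f p * g p)"
proof -
  obtain K K' where K: "K \<ge> 0" "\<And>p. \<bar>f p\<bar> \<le> K * m p ^ n" "K' \<ge> 0" "\<And>p. \<bar>g p\<bar> \<le> K' * m p ^ n'"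
    using assms by (auto simp: dominated_def)
  have "\<bar>f p * g p\<bar> \<le> (K * K') * m p ^ (n + n')" for p
    using mult_mono[OF K(2)[of p] K(4)[of p] order_trans[OF abs_ge_zero K(2)] abs_ge_zero] by (simp add: abs_mult power_add mult_ac)
  then show ?thesis using assms K(1,3) unfolding dominated_def by (intro conjI exI[of _ "K * K'"]) auto
qed

lemma dominated_cmult: "dominated m n f \<Longrightarrow> dominated m n (\<lambda>p. c * f p)"
proof -
  have "dominated m 0 (\<lambda>_. c)" by (auto simp: dominated_def intro!: exI[of _ "\<bar>c\<bar>"])
  then show "dominated m n f \<Longrightarrow> dominated m n (\<lambda>p. c * f p)" using dominated_mult[of m 0 "\<lambda>_. c" n f] by simp
qed

lemma dominated_base: "f \<in> borel_measurable M\<Omega> \<Longrightarrow> (\<And>p. \<bar>f p\<bar> \<le> m p) \<Longrightarrow> dominated m 1 f"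
  unfolding dominated_def by (intro conjI exI[of _ 1]) auto

lemma dominated_diff: "dominated m n f \<Longrightarrow> dominated m n g \<Longrightarrow> dominated m n (\<lambda>p. f p - g p)"
  using dominated_add[OF _ dominated_cmult[of m n g "-1"], of f] by simp

lemma dominated_le:
  assumes "dominated m n f" "n \<le> n'" and "\<And>p. 1 \<le> m p"
  shows "dominated m n' f"
proof -
  obtain K where K: "K \<ge> 0" "\<And>p. \<bar>f p\<bar> \<le> K * m p ^ n" using assms by (auto simp: dominated_def)
  have "\<bar>f p\<bar> \<le> K * m p ^ n'" for p
    by (rule order_trans[OF K(2) mult_left_mono[OF power_increasing[OF assms(2,3)] K(1)]])
  then show ?thesis using assms K(1) by (auto simp: dominated_def)
qed

lemma dominated_integrable:
  assumes "dominated m n f" "n \<le> 4" and m: "\<And>p. 1 \<le> m p" "integrable M\<Omega> (\<lambda>p. m p ^ 4)"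
  shows "integrable M\<Omega> f"
proof -
  obtain K where K: "f \<in> borel_measurable M\<Omega>" "\<And>p. \<bar>f p\<bar> \<le> K * m p ^ 4"
    using dominated_le[OF assms(1,2) m(1)] by (auto simp: dominated_def)
  show ?thesis
    by (rule Bochner_Integration.integrable_bound[of _ "\<lambda>p. K * m p ^ 4"])
       (use K m(2) in \<open>auto intro!: AE_I2 order_trans[OF K(2)]\<close>)
qed

lemma power4_add: "(x + y) ^ 4 \<le> 8 * x ^ 4 + 8 * y ^ 4" for x y :: real
proof -
  have "(x + y)\<^sup>2 \<le> 2 * x\<^sup>2 + 2 * y\<^sup>2" using zero_le_power2[of "x - y"] by (simp add: power2_eq_square algebra_simps)
  then have "((x + y)\<^sup>2)\<^sup>2 \<le> (2 * x\<^sup>2 + 2 * y\<^sup>2)\<^sup>2" by (intro power_mono) auto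
  also have "\<dots> \<le> 8 * (x\<^sup>2)\<^sup>2 + 8 * (y\<^sup>2)\<^sup>2" using zero_le_power2[of "x\<^sup>2 - y\<^sup>2"] by (simp add: power2_eq_square algebra_simps)
  finally show ?thesis by simp
qed

lemma integrable_power4_add:
  fixes f g :: "R2 \<Rightarrow> real"
  assumes [measurable]: "f \<in> borel_measurable M\<Omega>" "g \<in> borel_measurable M\<Omega>"
    and "integrable M\<Omega> (\<lambda>p. f p ^ 4)" "integrable M\<Omega> (\<lambda>p. g p ^ 4)"
  shows "integrable M\<Omega> (\<lambda>p. (f p + g p) ^ 4)"
  by (rule Bochner_Integration.integrable_bound[of _ "\<lambda>p. 8 * f p ^ 4 + 8 * g p ^ 4"])
     (use assms power4_add in auto)

lemma integrable_product_L2: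
  fixes f g :: "R2 \<Rightarrow> real"
  shows "L2 M\<Omega> f \<Longrightarrow> L2 M\<Omega> g \<Longrightarrow> integrable M\<Omega> (\<lambda>p. f p * g p)"
  by (rule integral_Cauchy_Schwarz(1)) (auto simp: L2_def)

end

context wors_domain
begin

text \<open>The norm is at most the sum of the moduli of the coordinates, and each coordinate has an
  integrable fourth power by the scalar embedding; the induction adds the coordinates one at a
  time.\<close>

lemma sob_norm_L4:
  fixes u ux uy :: "R2 \<Rightarrow> 'b::euclidean_space"
  assumes s: "sob \<Omega> u ux uy"
  shows "integrable M\<Omega> (\<lambda>p. (norm (u p)) ^ 4)"
proof -
  have [measurable]: "u \<in> borel_measurable M\<Omega>" using s by (auto simp: sob_def L2_def)
  have i: "integrable M\<Omega> (\<lambda>p. \<bar>u p \<bullet> i\<bar> ^ 4)" for i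
    using sob_Omega_L4[OF sob_bounded_linear[OF bounded_linear_inner_left s, of i]] by (simp add: power_even_abs)
  have "integrable M\<Omega> (\<lambda>p. (\<Sum>i\<in>I. \<bar>u p \<bullet> i\<bar>) ^ 4)" if "finite I" for I :: "'b set"
    using that
  proof induction
    case (insert j I)
    have "integrable M\<Omega> (\<lambda>p. (\<bar>u p \<bullet> j\<bar> + (\<Sum>i\<in>I. \<bar>u p \<bullet> i\<bar>)) ^ 4)"
      by (rule integrable_power4_add[OF _ _ i insert.IH]) auto
    then show ?case using insert.hyps by simp
  qed simp
  from this[OF finite_Basis] show ?thesis
    by (rule Bochner_Integration.integrable_bound) (auto intro!: AE_I2 power_mono norm_le_l1 simp: power_even_abs sum_nonneg)
qed

lemma weight_integrable:
  fixes u ux uy \<phi> \<phi>x \<phi>y :: "R2 \<Rightarrow> 'b::euclidean_space"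
  assumes s: "sob \<Omega> u ux uy" "sob \<Omega> \<phi> \<phi>x \<phi>y"
  shows "integrable M\<Omega> (\<lambda>p. (1 + norm (u p) + norm (\<phi> p)) ^ 4)"
proof -
  have [measurable]: "u \<in> borel_measurable M\<Omega>" "\<phi> \<in> borel_measurable M\<Omega>" using s by (auto simp: sob_def L2_def)
  show ?thesis
    by (intro integrable_power4_add sob_norm_L4[OF s(1)] sob_norm_L4[OF s(2)]) auto
qed

end

section \<open>The first functional along a line\<close>

lemma F_pot_expand:
  "F_pot A B C (a + t * \<alpha>) (b + t * \<beta>) =
     F_pot A B C a b
     + t * (2 * A * (a * \<alpha> + 3 * (b * \<beta>)) + 2 * B * (\<beta> * (a * a - b * b) + 2 * b * (a * \<alpha> - b * \<beta>))
        + 4 * C * ((a * a + 3 * (b * b)) * (a * \<alpha> + 3 * (b * \<beta>))))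
     + t\<^sup>2 * (A * (\<alpha> * \<alpha> + 3 * (\<beta> * \<beta>)) + 2 * B * (2 * \<beta> * (a * \<alpha> - b * \<beta>) + b * (\<alpha> * \<alpha> - \<beta> * \<beta>))
        + C * (4 * ((a * \<alpha> + 3 * (b * \<beta>)) * (a * \<alpha> + 3 * (b * \<beta>))) + 2 * ((a * a + 3 * (b * b)) * (\<alpha> * \<alpha> + 3 * (\<beta> * \<beta>)))))
     + t ^ 3 * (2 * B * (\<beta> * (\<alpha> * \<alpha> - \<beta> * \<beta>)) + 4 * C * ((a * \<alpha> + 3 * (b * \<beta>)) * (\<alpha> * \<alpha> + 3 * (\<beta> * \<beta>))))
     + t ^ 4 * (C * ((\<alpha> * \<alpha> + 3 * (\<beta> * \<beta>)) * (\<alpha> * \<alpha> + 3 * (\<beta> * \<beta>))))"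
  unfolding F_pot_def by algebra

text \<open>The coefficient of \<open>t\<close> in \<open>J_density\<close> along the line through
  \<open>q\<close> in direction \<open>\<phi>\<close>, that is, the integrand of the first
  variation.\<close>

definition J_first ::
    "real \<Rightarrow> real \<Rightarrow> real \<Rightarrow> real \<Rightarrow> real \<Rightarrow> real \<times> real \<Rightarrow> real \<times> real \<Rightarrow> real \<times> real \<Rightarrow> real \<times> real \<Rightarrow> real \<times> real \<Rightarrow> real \<times> real \<Rightarrow> real" where
  "J_first A B C L lam q qx qy \<phi> \<phi>x \<phi>y =
     2 * (fst qx * fst \<phi>x + fst qy * fst \<phi>y) + 6 * (snd qx * snd \<phi>x + snd qy * snd \<phi>y)
     + lam\<^sup>2 / L * (2 * A * (fst q * fst \<phi> + 3 * (snd q * snd \<phi>))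
        + 2 * B * (snd \<phi> * (fst q * fst q - snd q * snd q) + 2 * snd q * (fst q * fst \<phi> - snd q * snd \<phi>))
        + 4 * C * ((fst q * fst q + 3 * (snd q * snd q)) * (fst q * fst \<phi> + 3 * (snd q * snd \<phi>))))"

lemma J_first_add:
  "J_first A B C L lam q qx qy (\<phi> + \<psi>) (\<phi>x + \<psi>x) (\<phi>y + \<psi>y) =
   J_first A B C L lam q qx qy \<phi> \<phi>x \<phi>y + J_first A B C L lam q qx qy \<psi> \<psi>x \<psi>y"
proof -
  have "K * (2 * A * (a * (x + x') + 3 * (b * (y + y'))) + 2 * B * ((y + y') * D + 2 * b * (a * (x + x') - b * (y + y'))) + 4 * C * (N * (a * (x + x') + 3 * (b * (y + y'))))) =
    K * (2 * A * (a * x + 3 * (b * y)) + 2 * B * (y * D + 2 * b * (a * x - b * y)) + 4 * C * (N * (a * x + 3 * (b * y)))) +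
    K * (2 * A * (a * x' + 3 * (b * y')) + 2 * B * (y' * D + 2 * b * (a * x' - b * y')) + 4 * C * (N * (a * x' + 3 * (b * y'))))"
    for K D N a b x y x' y' :: real by algebra
  then show ?thesis by (simp add: J_first_def algebra_simps)
qed

context wors_domain
begin

text \<open>Each coefficient of the expansion consists of monomials of degree at most 4 in the
  values, dominated by the weight \<open>m\<close>, and of products of two derivatives in
  L2.\<close>

lemma J_line:
  fixes A B C L lam :: real and u ux uy \<phi> \<phi>x \<phi>y :: "R2 \<Rightarrow> real \<times> real"
  assumes s: "sob \<Omega> u ux uy" "sob \<Omega> \<phi> \<phi>x \<phi>y"
  defines "j1 \<equiv> \<lambda>p. J_first A B C L lam (u p) (ux p) (uy p) (\<phi> p) (\<phi>x p) (\<phi>y p)"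
  shows "integrable M\<Omega> j1"
    and "integrable M\<Omega> (energy_integrand \<Omega> (J_density A B C L lam) (\<lambda>p. u p + t *\<^sub>R \<phi> p))"
    and "((\<lambda>t. energy \<Omega> (J_density A B C L lam) (\<lambda>p. u p + t *\<^sub>R \<phi> p)) has_real_derivative (LINT p|M\<Omega>. j1 p)) (at 0)"
proof -
  define m where "m p = 1 + norm (u p) + norm (\<phi> p)" for p
  have m1: "1 \<le> m p" for p by (simp add: m_def)
  have m4: "integrable M\<Omega> (\<lambda>p. m p ^ 4)" unfolding m_def by (rule weight_integrable[OF s])
  define a b \<alpha> \<beta> where "a p = fst (u p)" and "b p = snd (u p)" and "\<alpha> p = fst (\<phi> p)" and "\<beta> p = snd (\<phi> p)" for p
  have L2s: "L2 M\<Omega> (\<lambda>p. fst (h p))" "L2 M\<Omega> (\<lambda>p. snd (h p))" if "L2 M\<Omega> h" for h :: "R2 \<Rightarrow> real \<times> real"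
    using L2_bounded_linear[OF bounded_linear_fst that] L2_bounded_linear[OF bounded_linear_snd that] .
  have L: "L2 M\<Omega> u" "L2 M\<Omega> ux" "L2 M\<Omega> uy" "L2 M\<Omega> \<phi>" "L2 M\<Omega> \<phi>x" "L2 M\<Omega> \<phi>y" using s by (auto simp: sob_def)
  have le: "\<bar>fst q\<bar> \<le> norm q" "\<bar>snd q\<bar> \<le> norm q" for q :: "real \<times> real"
    using norm_fst_le[of "fst q" "snd q"] norm_snd_le[of "snd q" "fst q"] by auto
  have d1: "dominated m 1 a" "dominated m 1 b" "dominated m 1 \<alpha>" "dominated m 1 \<beta>"
  proof -
    have "\<bar>a p\<bar> \<le> m p" "\<bar>b p\<bar> \<le> m p" "\<bar>\<alpha> p\<bar> \<le> m p" "\<bar>\<beta> p\<bar> \<le> m p" for p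
      using le[of "u p"] le[of "\<phi> p"] norm_ge_zero[of "u p"] norm_ge_zero[of "\<phi> p"]
      unfolding a_def b_def \<alpha>_def \<beta>_def m_def by linarith+
    moreover have "a \<in> borel_measurable M\<Omega>" "b \<in> borel_measurable M\<Omega>" "\<alpha> \<in> borel_measurable M\<Omega>" "\<beta> \<in> borel_measurable M\<Omega>"
      unfolding a_def[abs_def] b_def[abs_def] \<alpha>_def[abs_def] \<beta>_def[abs_def]
      using L2s[OF L(1)] L2s[OF L(4)] by (auto simp: L2_def)
    ultimately show "dominated m 1 a" "dominated m 1 b" "dominated m 1 \<alpha>" "dominated m 1 \<beta>" by (blast intro: dominated_base)+
  qed
  have dm: "dominated m 2 (\<lambda>p. f p * g p)" if "dominated m 1 f" "dominated m 1 g" for f g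
    using dominated_mult[OF that] by (simp add: numeral_2_eq_2)
  have dm3: "dominated m 3 (\<lambda>p. f p * g p)" if "dominated m 1 f" "dominated m 2 g" for f g
    using dominated_mult[OF that] by (simp add: numeral_3_eq_3)
  have dm4: "dominated m 4 (\<lambda>p. f p * g p)" if "dominated m 2 f" "dominated m 2 g" for f g
    using dominated_mult[OF that] by simp
  have up: "dominated m 4 f" if "dominated m n f" "n \<le> 4" for f n by (rule dominated_le[OF that m1])
  \<comment> \<open>\<open>N\<close>, \<open>P\<close>, \<open>R\<close> belong to the form x^2 + 3
    y^2 and \<open>D\<close>, \<open>E\<close>, \<open>G\<close> to the form x^2 - y^2: on
    \<open>u\<close>, polarised between \<open>u\<close> and \<open>\<phi>\<close>, and on
    \<open>\<phi>\<close>.\<close>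
  define N P R D E G where "N p = a p * a p + 3 * (b p * b p)" and "P p = a p * \<alpha> p + 3 * (b p * \<beta> p)"
    and "R p = \<alpha> p * \<alpha> p + 3 * (\<beta> p * \<beta> p)" and "D p = a p * a p - b p * b p"
    and "E p = a p * \<alpha> p - b p * \<beta> p" and "G p = \<alpha> p * \<alpha> p - \<beta> p * \<beta> p" for p
  have d2: "dominated m 2 N" "dominated m 2 P" "dominated m 2 R" "dominated m 2 D" "dominated m 2 E" "dominated m 2 G"
    unfolding N_def[abs_def] P_def[abs_def] R_def[abs_def] D_def[abs_def] E_def[abs_def] G_def[abs_def]
    by (intro dominated_add dominated_diff dominated_cmult dm d1)+
  have d3: "dominated m 4 (\<lambda>p. f p * g p)" if "dominated m 1 f" "dominated m 2 g" for f g
    by (rule up[OF dm3[OF that]]) simp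
  have d24: "dominated m 4 f" if "dominated m 2 f" for f by (rule up[OF that]) simp
  have di: "integrable M\<Omega> f" if "dominated m 4 f" for f by (rule dominated_integrable[OF that _ m1 m4]) simp
  define e0 e1 e2 e3 e4 where "e0 p = A * N p + 2 * B * (b p * D p) + C * (N p * N p) - F_min A B C"
    and "e1 p = 2 * A * P p + (2 * B * (\<beta> p * D p) + 4 * B * (b p * E p)) + 4 * C * (N p * P p)"
    and "e2 p = A * R p + (4 * B * (\<beta> p * E p) + 2 * B * (b p * G p)) + (4 * C * (P p * P p) + 2 * C * (N p * R p))"
    and "e3 p = 2 * B * (\<beta> p * G p) + 4 * C * (P p * R p)" and "e4 p = C * (R p * R p)" for p
  have e: "integrable M\<Omega> e0" "integrable M\<Omega> e1" "integrable M\<Omega> e2" "integrable M\<Omega> e3" "integrable M\<Omega> e4"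
    unfolding e0_def e1_def e2_def e3_def e4_def
    by (intro Bochner_Integration.integrable_diff di dominated_add dominated_cmult d3 dm4 d24 d1 d2 integrable_const)+
  define g0 g1 g2 where
    "g0 p = (fst (ux p) * fst (ux p) + fst (uy p) * fst (uy p)) + 3 * (snd (ux p) * snd (ux p) + snd (uy p) * snd (uy p))" and
    "g1 p = 2 * (fst (ux p) * fst (\<phi>x p) + fst (uy p) * fst (\<phi>y p)) + 6 * (snd (ux p) * snd (\<phi>x p) + snd (uy p) * snd (\<phi>y p))" and
    "g2 p = (fst (\<phi>x p) * fst (\<phi>x p) + fst (\<phi>y p) * fst (\<phi>y p)) + 3 * (snd (\<phi>x p) * snd (\<phi>x p) + snd (\<phi>y p) * snd (\<phi>y p))" for p
  have g: "integrable M\<Omega> g0" "integrable M\<Omega> g1" "integrable M\<Omega> g2"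
    unfolding g0_def g1_def g2_def
    by (intro Bochner_Integration.integrable_add integrable_mult_right integrable_product_L2 L2s L)+
  define \<kappa> where "\<kappa> = lam\<^sup>2 / L"
  have j1: "j1 p = g1 p + \<kappa> * e1 p" for p
    unfolding j1_def J_first_def g1_def e1_def \<kappa>_def N_def P_def D_def E_def a_def b_def \<alpha>_def \<beta>_def
    by (simp add: algebra_simps)
  show j1i: "integrable M\<Omega> j1" unfolding j1[abs_def] using g e by simp
  have i: "integrable M\<Omega> (\<lambda>p. g0 p + \<kappa> * e0 p)" "integrable M\<Omega> (\<lambda>p. g2 p + \<kappa> * e2 p)" "integrable M\<Omega> (\<lambda>p. \<kappa> * e3 p)" "integrable M\<Omega> (\<lambda>p. \<kappa> * e4 p)"
    using g e by simp_all
  have ex: "AE p in M\<Omega>. \<forall>t. J_density A B C L lam (u p + t *\<^sub>R \<phi> p) (ux p + t *\<^sub>R \<phi>x p) (uy p + t *\<^sub>R \<phi>y p) =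
      (g0 p + \<kappa> * e0 p) + t * j1 p + t\<^sup>2 * (g2 p + \<kappa> * e2 p) + t ^ 3 * (\<kappa> * e3 p) + t ^ 4 * (\<kappa> * e4 p)"
  proof (intro AE_I2 allI)
    fix p t
    have F: "F_pot A B C (fst (u p) + t * fst (\<phi> p)) (snd (u p) + t * snd (\<phi> p)) = e0 p + t * e1 p + t\<^sup>2 * e2 p + t ^ 3 * e3 p + t ^ 4 * e4 p"
      unfolding F_pot_expand
      unfolding e0_def e1_def e2_def e3_def e4_def N_def P_def R_def D_def E_def G_def a_def[symmetric] b_def[symmetric] \<alpha>_def[symmetric] \<beta>_def[symmetric] F_pot_def
      by algebra
    have Gr: "((x1 + t * y1)\<^sup>2 + (x2 + t * y2)\<^sup>2) + 3 * ((x3 + t * y3)\<^sup>2 + (x4 + t * y4)\<^sup>2) =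
      ((x1 * x1 + x2 * x2) + 3 * (x3 * x3 + x4 * x4)) + t * (2 * (x1 * y1 + x2 * y2) + 6 * (x3 * y3 + x4 * y4))
      + t\<^sup>2 * ((y1 * y1 + y2 * y2) + 3 * (y3 * y3 + y4 * y4))" for x1 x2 x3 x4 y1 y2 y3 y4 :: real by algebra
    show "J_density A B C L lam (u p + t *\<^sub>R \<phi> p) (ux p + t *\<^sub>R \<phi>x p) (uy p + t *\<^sub>R \<phi>y p) =
      (g0 p + \<kappa> * e0 p) + t * j1 p + t\<^sup>2 * (g2 p + \<kappa> * e2 p) + t ^ 3 * (\<kappa> * e3 p) + t ^ 4 * (\<kappa> * e4 p)"
      unfolding J_density_def F \<kappa>_def[symmetric] fst_add snd_add fst_scaleR snd_scaleR real_scaleR_def Gr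
        g0_def[symmetric] g1_def[symmetric] g2_def[symmetric] j1 by algebra
  qed
  from energy_polynomial[OF s i(1) j1i i(2) i(3) i(4) ex]
  show "integrable M\<Omega> (energy_integrand \<Omega> (J_density A B C L lam) (\<lambda>p. u p + t *\<^sub>R \<phi> p))"
    "((\<lambda>t. energy \<Omega> (J_density A B C L lam) (\<lambda>p. u p + t *\<^sub>R \<phi> p)) has_real_derivative (LINT p|M\<Omega>. j1 p)) (at 0)"
    by blast+
qed

end

section \<open>Existence of a symmetric minimiser\<close>

text \<open>With n = a^2 + 3 b^2 the quartic term is C n^2. One quarter of it absorbs the cubic term
  by Young's inequality at the price of a multiple of n, another quarter absorbs all terms linear in
  n, collected in \<open>T\<close>, and the remaining half is the claimed growth.\<close>

lemma F_pot_lower: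
  assumes C: "0 < C"
  obtains K where "\<And>a b. C / 2 * (a\<^sup>2 + b\<^sup>2)\<^sup>2 - K \<le> F_pot A B C a b"
proof -
  define T where "T = \<bar>A\<bar> + 4 * B\<^sup>2 / C"
  have "C / 2 * (a\<^sup>2 + b\<^sup>2)\<^sup>2 - (T\<^sup>2 / C + F_min A B C) \<le> F_pot A B C a b" for a b
  proof -
    define n where "n = a\<^sup>2 + 3 * b\<^sup>2"
    have n: "0 \<le> n" "a\<^sup>2 + b\<^sup>2 \<le> n" "b\<^sup>2 \<le> n" "\<bar>a\<^sup>2 - b\<^sup>2\<bar> \<le> n" by (auto simp: n_def abs_le_iff)
    have "2 * \<bar>B\<bar> * \<bar>b\<bar> * n \<le> C / 4 * n\<^sup>2 + 4 * B\<^sup>2 / C * b\<^sup>2"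
    proof -
      have "0 \<le> C * (n / 2 - 2 * \<bar>B\<bar> * \<bar>b\<bar> / C)\<^sup>2" using C by simp
      also have "\<dots> = C / 4 * n\<^sup>2 + 4 * B\<^sup>2 / C * b\<^sup>2 - 2 * \<bar>B\<bar> * \<bar>b\<bar> * n"
        using C by (simp add: power2_diff power_mult_distrib power_divide field_simps) (simp add: power2_eq_square)
      finally show ?thesis by simp
    qed
    also have "4 * B\<^sup>2 / C * b\<^sup>2 \<le> 4 * B\<^sup>2 / C * n" using C n by (intro mult_left_mono) auto
    finally have 1: "2 * \<bar>B\<bar> * \<bar>b\<bar> * n \<le> C / 4 * n\<^sup>2 + 4 * B\<^sup>2 / C * n" by simp
    have 2: "\<bar>2 * B * b * (a\<^sup>2 - b\<^sup>2)\<bar> \<le> 2 * \<bar>B\<bar> * \<bar>b\<bar> * n"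
      unfolding abs_mult using n(4) by (simp add: mult_left_mono)
    have 3: "T * n \<le> C / 4 * n\<^sup>2 + T\<^sup>2 / C"
    proof -
      have "0 \<le> C * (n / 2 - T / C)\<^sup>2" using C by simp
      also have "\<dots> = C / 4 * n\<^sup>2 + T\<^sup>2 / C - T * n"
        using C by (simp add: power2_diff power_divide field_simps) (simp add: power2_eq_square)
      finally show ?thesis by simp
    qed
    have 4: "- (\<bar>A\<bar> * n) \<le> A * n" using n(1) mult_right_mono[of "- \<bar>A\<bar>" A n] by simp
    have 5: "C / 2 * (a\<^sup>2 + b\<^sup>2)\<^sup>2 \<le> C / 2 * n\<^sup>2" using C n by (intro mult_left_mono power_mono) auto
    have F: "F_pot A B C a b = A * n + 2 * B * b * (a\<^sup>2 - b\<^sup>2) + C * n\<^sup>2 - F_min A B C"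
      by (simp add: F_pot_def n_def)
    have "T * n = \<bar>A\<bar> * n + 4 * B\<^sup>2 / C * n" by (simp add: T_def distrib_right)
    moreover have "C * n\<^sup>2 = C / 4 * n\<^sup>2 + C / 4 * n\<^sup>2 + C / 2 * n\<^sup>2" by simp
    moreover have "- (2 * \<bar>B\<bar> * \<bar>b\<bar> * n) \<le> 2 * B * b * (a\<^sup>2 - b\<^sup>2)" using 2 by linarith
    ultimately show ?thesis unfolding F using 1 3 4 5 by argo
  qed
  then show ?thesis using that by blast
qed

text \<open>Only the quadratic and the cubic term can violate convexity. The second difference of
  the cubic one grows linearly in (a, b); Young's inequality splits it into 2 C N R, which the
  quartic term provides, and a constant multiple of R. Hence \<open>K\<close> = |A| + B^2 /
  C.\<close>

lemma F_pot_semiconvex: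
  assumes C: "0 < C"
  obtains K where "0 \<le> K" "\<And>a b a' b'. F_pot A B C ((a + a') / 2) ((b + b') / 2) \<le>
    (F_pot A B C a b + F_pot A B C a' b') / 2 + K * ((a - a')\<^sup>2 + (b - b')\<^sup>2)"
proof -
  define K where "K = \<bar>A\<bar> + B\<^sup>2 / C"
  have K: "0 \<le> K" using C by (simp add: K_def)
  have mid: "F_pot A B C a b \<le> (F_pot A B C (a + \<alpha>) (b + \<beta>) + F_pot A B C (a - \<alpha>) (b - \<beta>)) / 2 + K * (\<alpha>\<^sup>2 + 3 * \<beta>\<^sup>2)" for a b \<alpha> \<beta>
  proof -
    define R where "R = \<alpha>\<^sup>2 + 3 * \<beta>\<^sup>2"
    define N where "N = a\<^sup>2 + 3 * b\<^sup>2"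
    define P where "P = a * \<alpha> + 3 * (b * \<beta>)"
    define X where "X = 2 * a * \<alpha> * \<beta> + b * (\<alpha>\<^sup>2 - 3 * \<beta>\<^sup>2)"
    \<comment> \<open>In the average the odd orders in \<alpha>, \<beta> cancel; \<open>X\<close> is
      the part of the cubic term that is quadratic in them.\<close>
    have eq: "(F_pot A B C (a + \<alpha>) (b + \<beta>) + F_pot A B C (a - \<alpha>) (b - \<beta>)) / 2 =
      F_pot A B C a b + A * R + 2 * B * X + 4 * C * P\<^sup>2 + 2 * C * N * R + C * R\<^sup>2"
      unfolding F_pot_def R_def N_def P_def X_def by (simp add: field_simps) algebra
    have R: "0 \<le> R" by (simp add: R_def)
    have X: "\<bar>X\<bar> \<le> (\<bar>a\<bar> + \<bar>b\<bar>) * R"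
    proof -
      have "2 * \<bar>\<alpha>\<bar> * \<bar>\<beta>\<bar> \<le> \<alpha>\<^sup>2 + \<beta>\<^sup>2" using zero_le_power2[of "\<bar>\<alpha>\<bar> - \<bar>\<beta>\<bar>"] by (simp add: power2_diff)
      then have 1: "2 * \<bar>\<alpha>\<bar> * \<bar>\<beta>\<bar> \<le> R" unfolding R_def using zero_le_power2[of \<beta>] by linarith
      have 2: "\<bar>\<alpha>\<^sup>2 - 3 * \<beta>\<^sup>2\<bar> \<le> R" by (simp add: R_def abs_le_iff)
      have "\<bar>X\<bar> \<le> \<bar>2 * a * \<alpha> * \<beta>\<bar> + \<bar>b * (\<alpha>\<^sup>2 - 3 * \<beta>\<^sup>2)\<bar>" unfolding X_def by (rule abs_triangle_ineq)
      also have "\<dots> = \<bar>a\<bar> * (2 * \<bar>\<alpha>\<bar> * \<bar>\<beta>\<bar>) + \<bar>b\<bar> * \<bar>\<alpha>\<^sup>2 - 3 * \<beta>\<^sup>2\<bar>" by (simp add: abs_mult)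
      also have "\<dots> \<le> \<bar>a\<bar> * R + \<bar>b\<bar> * R" using 1 2 by (intro add_mono mult_left_mono) auto
      finally show ?thesis by (simp add: distrib_right)
    qed
    have Y: "2 * \<bar>B\<bar> * (\<bar>a\<bar> + \<bar>b\<bar>) \<le> 2 * C * N + B\<^sup>2 / C"
    proof -
      have "2 * \<bar>B\<bar> * z \<le> 2 * C * z\<^sup>2 + B\<^sup>2 / (2 * C)" for z
      proof -
        have "0 \<le> 2 * C * (z - \<bar>B\<bar> / (2 * C))\<^sup>2" using C by simp
        also have "\<dots> = 2 * C * z\<^sup>2 + B\<^sup>2 / (2 * C) - 2 * \<bar>B\<bar> * z"
          using C by (simp add: power2_diff power_divide field_simps) (simp add: power2_eq_square)
        finally show ?thesis by simp
      qed
      from this[of "\<bar>a\<bar>"] this[of "\<bar>b\<bar>"]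
      have "2 * \<bar>B\<bar> * \<bar>a\<bar> + 2 * \<bar>B\<bar> * \<bar>b\<bar> \<le> 2 * C * a\<^sup>2 + 2 * C * b\<^sup>2 + B\<^sup>2 / C" by simp
      moreover have "2 * C * a\<^sup>2 + 2 * C * b\<^sup>2 \<le> 2 * C * N" using C by (simp add: N_def flip: distrib_left)
      ultimately show ?thesis by (simp add: distrib_left)
    qed
    have "\<bar>2 * B * X\<bar> \<le> 2 * \<bar>B\<bar> * ((\<bar>a\<bar> + \<bar>b\<bar>) * R)"
      unfolding abs_mult using X by (simp add: mult_left_mono)
    also have "\<dots> \<le> (2 * C * N + B\<^sup>2 / C) * R" using mult_right_mono[OF Y R] by (simp add: mult.assoc)
    finally have 1: "- ((2 * C * N + B\<^sup>2 / C) * R) \<le> 2 * B * X" by linarith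
    have 2: "- (\<bar>A\<bar> * R) \<le> A * R" using R mult_right_mono[of "- \<bar>A\<bar>" A R] by simp
    have 3: "0 \<le> 4 * C * P\<^sup>2" "0 \<le> C * R\<^sup>2" using C by simp_all
    have "K * R = \<bar>A\<bar> * R + B\<^sup>2 / C * R" by (simp add: K_def distrib_right)
    moreover have "(2 * C * N + B\<^sup>2 / C) * R = 2 * C * N * R + B\<^sup>2 / C * R" by (simp add: distrib_right)
    ultimately show ?thesis unfolding eq R_def[symmetric] using 1 2 3 by argo
  qed
  show ?thesis
  proof (rule that[OF K])
    fix a b a' b' :: real
    define \<alpha> \<beta> where "\<alpha> = (a - a') / 2" and "\<beta> = (b - b') / 2"
    have e: "(a + a') / 2 + \<alpha> = a" "(a + a') / 2 - \<alpha> = a'" "(b + b') / 2 + \<beta> = b" "(b + b') / 2 - \<beta> = b'"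
      by (simp_all add: \<alpha>_def \<beta>_def field_simps)
    have "\<alpha>\<^sup>2 = (a - a')\<^sup>2 / 4" "\<beta>\<^sup>2 = (b - b')\<^sup>2 / 4" by (simp_all add: \<alpha>_def \<beta>_def power_divide)
    then have "\<alpha>\<^sup>2 + 3 * \<beta>\<^sup>2 \<le> (a - a')\<^sup>2 + (b - b')\<^sup>2"
      using zero_le_power2[of "a - a'"] zero_le_power2[of "b - b'"] by linarith
    then show "F_pot A B C ((a + a') / 2) ((b + b') / 2) \<le> (F_pot A B C a b + F_pot A B C a' b') / 2 + K * ((a - a')\<^sup>2 + (b - b')\<^sup>2)"
      using mid[of "(a + a') / 2" "(b + b') / 2" \<alpha> \<beta>] mult_left_mono[OF _ K] unfolding e by (meson add_left_mono order_trans)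
  qed
qed

lemma norm_pair_sq: "(norm q)\<^sup>2 = (fst q)\<^sup>2 + (snd q)\<^sup>2" for q :: "real \<times> real"
  by (cases q) (simp add: norm_Pair)

text \<open>The parallelogram identity gives a quarter of the squared gradient difference as a gain,
  and semiconvexity of the potential limits the loss to the function values. The gain is what makes
  minimising sequences Cauchy in the gradient.\<close>

lemma J_density_midpoint:
  assumes C: "0 < C" and L: "0 < L"
  obtains K where "0 \<le> K" "\<And>q q' qx qx' qy qy'. J_density A B C L lam ((1 / 2) *\<^sub>R (q + q')) ((1 / 2) *\<^sub>R (qx + qx')) ((1 / 2) *\<^sub>R (qy + qy')) \<le>
    (J_density A B C L lam q qx qy + J_density A B C L lam q' qx' qy') / 2
    - ((norm (qx - qx'))\<^sup>2 + (norm (qy - qy'))\<^sup>2) / 4 + K * (norm (q - q'))\<^sup>2"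
proof -
  obtain K where K: "0 \<le> K" "\<And>a b a' b'. F_pot A B C ((a + a') / 2) ((b + b') / 2) \<le>
    (F_pot A B C a b + F_pot A B C a' b') / 2 + K * ((a - a')\<^sup>2 + (b - b')\<^sup>2)"
    by (rule F_pot_semiconvex[OF C, of A B]) blast
  define \<kappa> where "\<kappa> = lam\<^sup>2 / L"
  have \<kappa>: "0 \<le> \<kappa>" using L by (simp add: \<kappa>_def)
  show ?thesis
  proof (rule that[of "\<kappa> * K"])
    show "0 \<le> \<kappa> * K" using K \<kappa> by simp
    fix q q' qx qx' qy qy' :: "real \<times> real"
    have par: "((1 / 2) * (x + y))\<^sup>2 = (x\<^sup>2 + y\<^sup>2) / 2 - (x - y)\<^sup>2 / 4" for x y :: real
      by (simp add: power2_eq_square field_simps)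
    have F: "\<kappa> * F_pot A B C (1 / 2 * (fst q + fst q')) (1 / 2 * (snd q + snd q')) \<le>
      \<kappa> * ((F_pot A B C (fst q) (snd q) + F_pot A B C (fst q') (snd q')) / 2 + K * ((fst q - fst q')\<^sup>2 + (snd q - snd q')\<^sup>2))"
      using K(2)[of "fst q" "fst q'" "snd q" "snd q'"] \<kappa> by (intro mult_left_mono) simp_all
    also have "\<dots> = (\<kappa> * F_pot A B C (fst q) (snd q) + \<kappa> * F_pot A B C (fst q') (snd q')) / 2
        + \<kappa> * K * ((fst q - fst q')\<^sup>2 + (snd q - snd q')\<^sup>2)"
      by (simp add: distrib_left)
    finally have F: "\<kappa> * F_pot A B C (1 / 2 * (fst q + fst q')) (1 / 2 * (snd q + snd q')) \<le> \<dots>" .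
    have sq: "0 \<le> (snd qx - snd qx')\<^sup>2" "0 \<le> (snd qy - snd qy')\<^sup>2" by simp_all
    show "J_density A B C L lam ((1 / 2) *\<^sub>R (q + q')) ((1 / 2) *\<^sub>R (qx + qx')) ((1 / 2) *\<^sub>R (qy + qy')) \<le>
    (J_density A B C L lam q qx qy + J_density A B C L lam q' qx' qy') / 2
    - ((norm (qx - qx'))\<^sup>2 + (norm (qy - qy'))\<^sup>2) / 4 + \<kappa> * K * (norm (q - q'))\<^sup>2"
      using F sq unfolding J_density_def norm_pair_sq fst_scaleR snd_scaleR fst_add snd_add fst_diff snd_diff
        real_scaleR_def par \<kappa>_def[symmetric] by argo
  qed
qed

section \<open>Admissible pairs and the minimiser\<close>

locale wors_energy = wors_data +
  fixes A B C L lam :: real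
  assumes C: "0 < C" and L: "0 < L" and lam: "0 < lam"
begin

abbreviation "f \<equiv> J_density A B C L lam"

text \<open>Symmetry is required almost everywhere, the form in which it is inherited by limits of
  almost everywhere convergent sequences. \<open>flip\<close> on the values reproduces the effect of
  either reflection on the boundary data.\<close>

definition sym :: "(R2 \<Rightarrow> real \<times> real) \<Rightarrow> bool" where
  "sym u \<longleftrightarrow> (AE p in M\<Omega>. u (refl (- 1) 1 p) = flip (u p)) \<and> (AE p in M\<Omega>. u (refl 1 (- 1) p) = flip (u p))"

definition adm :: "(R2 \<Rightarrow> real \<times> real) \<Rightarrow> bool" where
  "adm u \<longleftrightarrow> has_trace \<Omega> u (frontier \<Omega>) bdata \<and> sym u"

lemma adm_W12: "adm u \<Longrightarrow> W12 \<Omega> u" by (simp add: adm_def has_trace_def)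

lemma flip_linear: "bounded_linear flip"
  unfolding flip_def by (intro bounded_linear_Pair bounded_linear_minus bounded_linear_fst bounded_linear_snd)

lemma sym_add: "sym u \<Longrightarrow> sym v \<Longrightarrow> sym (\<lambda>p. u p + v p)"
  unfolding sym_def by (auto simp: linear_add[OF bounded_linear.linear[OF flip_linear]] elim!: eventually_elim2)

lemma sym_scaleR: "sym u \<Longrightarrow> sym (\<lambda>p. c *\<^sub>R u p)"
  unfolding sym_def by (auto simp: linear_scale[OF bounded_linear.linear[OF flip_linear]] elim!: eventually_mono)

lemma adm_midpoint:
  assumes "adm u" "adm v"
  shows "adm (\<lambda>p. (1 / 2) *\<^sub>R (u p + v p))"
proof -
  have "has_trace \<Omega> (\<lambda>p. (1 / 2) *\<^sub>R (u p + v p)) (frontier \<Omega>) (\<lambda>p. (1 / 2) *\<^sub>R (bdata p + bdata p))"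
    using assms by (intro has_trace_scaleR has_trace_add) (auto simp: adm_def)
  moreover have "(1 / 2) *\<^sub>R (bdata p + bdata p) = bdata p" for p
    by (simp add: scaleR_2[symmetric])
  ultimately show ?thesis using assms by (simp add: adm_def sym_add sym_scaleR)
qed

text \<open>Makes the set of energies over which the infimum is taken nonempty.\<close>

lemma adm_lift: "adm lift"
  using lift_trace lift_symmetric by (simp add: adm_def sym_def)

text \<open>Lets the energy be computed with any explicit derivatives instead of those picked by
  \<open>weak_deriv\<close>. Integrability is that of \<open>J_line\<close> at parameter 0.\<close>

lemma energy_density:
  assumes s: "sob \<Omega> u ux uy"
  shows "integrable M\<Omega> (\<lambda>p. f (u p) (ux p) (uy p))" "energy \<Omega> f u = (LINT p|M\<Omega>. f (u p) (ux p) (uy p))"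
proof -
  have i: "integrable M\<Omega> (energy_integrand \<Omega> f u)" using J_line(2)[OF s s, of A B C L lam 0] by simp
  have m: "(\<lambda>p. f (u p) (ux p) (uy p)) \<in> borel_measurable M\<Omega>"
    by (rule borel_measurable_lebesgue_on_AE[OF open_\<Omega> borel_measurable_integrable[OF i] energy_integrand_AE[OF s]])
  show "integrable M\<Omega> (\<lambda>p. f (u p) (ux p) (uy p))" "energy \<Omega> f u = (LINT p|M\<Omega>. f (u p) (ux p) (uy p))"
    using energy_integrand_eq[OF s AE_I2 m] i by auto
qed

text \<open>The direct method with strong convergence: coercivity bounds the sequence, compactness
  yields convergence in L2 along a subsequence, and the midpoint inequality upgrades this to the
  gradients. The trace passes to the limit by \<open>has_trace_limit\<close>, the symmetry by almost
  everywhere convergence, the energy by Fatou.\<close>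

lemma minimiser_exists:
  obtains u where "adm u" "\<And>v. adm v \<Longrightarrow> energy \<Omega> f u \<le> energy \<Omega> f v"
proof -
  define \<kappa> where "\<kappa> = lam\<^sup>2 / L"
  have \<kappa>: "0 < \<kappa>" using L lam by (simp add: \<kappa>_def)
  obtain K0 where K0: "\<And>a b. C / 2 * (a\<^sup>2 + b\<^sup>2)\<^sup>2 - K0 \<le> F_pot A B C a b"
    by (rule F_pot_lower[OF C, of A B]) blast
  \<comment> \<open>Adding \<open>b0\<close> makes the density nonnegative, which both the lower
    bound for the energy and Fatou's lemma use.\<close>
  define b0 where "b0 = \<kappa> * K0"
  have low: "\<kappa> * (C / 2) * (norm q) ^ 4 + (norm qx)\<^sup>2 + (norm qy)\<^sup>2 \<le> f q qx qy + b0" for q qx qy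
  proof -
    have "(norm q) ^ 4 = ((fst q)\<^sup>2 + (snd q)\<^sup>2)\<^sup>2" by (simp flip: norm_pair_sq)
    then have "\<kappa> * (C / 2 * (norm q) ^ 4 - K0) \<le> \<kappa> * F_pot A B C (fst q) (snd q)"
      using K0[of "fst q" "snd q"] \<kappa> by (intro mult_left_mono) auto
    moreover have "(norm qx)\<^sup>2 + (norm qy)\<^sup>2 \<le> ((fst qx)\<^sup>2 + (fst qy)\<^sup>2) + 3 * ((snd qx)\<^sup>2 + (snd qy)\<^sup>2)"
      by (simp add: norm_pair_sq)
    ultimately show ?thesis by (simp add: J_density_def b0_def \<kappa>_def[symmetric] algebra_simps)
  qed
  have low0: "0 \<le> f q qx qy + b0" for q qx qy
  proof -
    have "0 \<le> \<kappa> * (C / 2) * (norm q) ^ 4 + (norm qx)\<^sup>2 + (norm qy)\<^sup>2" using \<kappa> C by simp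
    then show ?thesis using low by (rule order_trans)
  qed
  define \<mu> where "\<mu> = measure M\<Omega> (space M\<Omega>)"
  have Jlow: "- b0 * \<mu> \<le> energy \<Omega> f u" if "adm u" for u
  proof -
    note s = W12_sob[OF adm_W12[OF that]]
    have "0 \<le> (LINT p|M\<Omega>. f (u p) (weak_deriv \<Omega> (1, 0) u p) (weak_deriv \<Omega> (0, 1) u p) + b0)"
      using low0 by (intro integral_nonneg_AE AE_I2)
    also have "\<dots> = energy \<Omega> f u + b0 * \<mu>" using energy_density[OF s] by (simp add: \<mu>_def)
    finally show ?thesis by simp
  qed
  define \<iota> where "\<iota> = Inf (energy \<Omega> f ` Collect adm)"
  have bdd: "bdd_below (energy \<Omega> f ` Collect adm)" using Jlow by (intro bdd_belowI[of _ "- b0 * \<mu>"]) auto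
  have \<iota>: "\<iota> \<le> energy \<Omega> f u" if "adm u" for u
    unfolding \<iota>_def by (rule cInf_lower[OF _ bdd]) (use that in auto)
  have "\<exists>u. adm u \<and> energy \<Omega> f u < \<iota> + 1 / Suc n" for n
  proof -
    have "Inf (energy \<Omega> f ` Collect adm) < \<iota> + 1 / Suc n" by (simp add: \<iota>_def)
    then show ?thesis using cInf_less_iff[OF _ bdd] adm_lift by auto
  qed
  then obtain u where u: "\<And>n. adm (u n)" "\<And>n. energy \<Omega> f (u n) < \<iota> + 1 / Suc n" by metis
  define ux uy where "ux n = weak_deriv \<Omega> (1, 0) (u n)" and "uy n = weak_deriv \<Omega> (0, 1) (u n)" for n
  have s: "sob \<Omega> (u n) (ux n) (uy n)" for n unfolding ux_def uy_def by (rule W12_sob[OF adm_W12[OF u(1)]])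
  have L2s: "L2 M\<Omega> (u n)" "L2 M\<Omega> (ux n)" "L2 M\<Omega> (uy n)" for n using s[of n] by (auto simp: sob_def)
  have int: "integrable M\<Omega> (\<lambda>p. (norm (u n p))\<^sup>2)" "integrable M\<Omega> (\<lambda>p. (norm (ux n p))\<^sup>2)"
    "integrable M\<Omega> (\<lambda>p. (norm (uy n p))\<^sup>2)" "integrable M\<Omega> (\<lambda>p. (norm (u n p)) ^ 4)" for n
    using L2s[of n] sob_norm_L4[OF s[of n]] by (auto simp: L2_def)
  define T where "T = \<iota> + 1 + b0 * \<mu>"
  have le: "\<kappa> * (C / 2) * (LINT p|M\<Omega>. (norm (u n p)) ^ 4) + (LINT p|M\<Omega>. (norm (ux n p))\<^sup>2) + (LINT p|M\<Omega>. (norm (uy n p))\<^sup>2) \<le> T" for n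
  proof -
    have "(LINT p|M\<Omega>. \<kappa> * (C / 2) * (norm (u n p)) ^ 4 + (norm (ux n p))\<^sup>2 + (norm (uy n p))\<^sup>2) \<le>
       (LINT p|M\<Omega>. f (u n p) (ux n p) (uy n p) + b0)"
      using energy_density(1)[OF s[of n]] int[of n] low by (intro integral_mono) auto
    also have "\<dots> = energy \<Omega> f (u n) + b0 * \<mu>" using energy_density[OF s[of n]] by (simp add: \<mu>_def)
    also have "\<dots> \<le> T"
    proof -
      have "1 / real (Suc n) \<le> 1" by simp
      then show ?thesis using u(2)[of n] unfolding T_def by linarith
    qed
    finally show ?thesis using int[of n] by simp
  qed
  define c where "c = \<kappa> * (C / 2)"
  have c: "0 < c" using \<kappa> C by (simp add: c_def)
  have nn: "0 \<le> (LINT p|M\<Omega>. (norm (u n p)) ^ 4)" "0 \<le> (LINT p|M\<Omega>. (norm (ux n p))\<^sup>2)" "0 \<le> (LINT p|M\<Omega>. (norm (uy n p))\<^sup>2)" for n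
    by simp_all
  have b4: "(LINT p|M\<Omega>. (norm (u n p)) ^ 4) \<le> T / c" for n
  proof -
    have "c * (LINT p|M\<Omega>. (norm (u n p)) ^ 4) \<le> T" using le[of n] nn[of n] unfolding c_def[symmetric] by linarith
    then show ?thesis using c by (simp add: field_simps)
  qed
  have bv: "(LINT p|M\<Omega>. (norm (ux n p))\<^sup>2) + (LINT p|M\<Omega>. (norm (uy n p))\<^sup>2) \<le> T" for n
    using le[of n] nn[of n] mult_nonneg_nonneg[OF less_imp_le[OF c] nn(1)[of n]] unfolding c_def[symmetric] by linarith
  have b2: "(LINT p|M\<Omega>. (norm (u n p))\<^sup>2) \<le> \<mu> + T / c" for n
  proof -
    have "x\<^sup>2 \<le> 1 + x ^ 4" for x :: real
      using zero_le_power2[of "x\<^sup>2 - 1/2"] by (simp add: power2_diff power_divide)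
    then have "(LINT p|M\<Omega>. (norm (u n p))\<^sup>2) \<le> (LINT p|M\<Omega>. 1 + (norm (u n p)) ^ 4)"
      using int[of n] by (intro integral_mono) auto
    also have "\<dots> = \<mu> + (LINT p|M\<Omega>. (norm (u n p)) ^ 4)" using int[of n] by (simp add: \<mu>_def)
    finally show ?thesis using b4[of n] by simp
  qed
  define K where "K = max T (max (T / c) (\<mu> + T / c))"
  \<comment> \<open>Compactness is available for scalar functions. It is applied to the first
    component and then, along the subsequence found, to the second; \<open>q\<close> is the
    subsequence already chosen.\<close>
  have sub: "\<exists>r :: nat \<Rightarrow> nat. strict_mono r \<and> (\<forall>e>0. \<exists>N. \<forall>i\<ge>N. \<forall>j\<ge>N. (LINT p|M\<Omega>. (\<pi> (u (q (r i)) p) - \<pi> (u (q (r j)) p))\<^sup>2) < e)"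
    if \<pi>: "bounded_linear \<pi>" "\<And>x. \<bar>\<pi> x\<bar> \<le> norm x" for \<pi> :: "real \<times> real \<Rightarrow> real" and q :: "nat \<Rightarrow> nat"
  proof -
    have sp: "sob \<Omega> (\<lambda>p. \<pi> (u n p)) (\<lambda>p. \<pi> (ux n p)) (\<lambda>p. \<pi> (uy n p))" for n by (rule sob_bounded_linear[OF \<pi>(1) s])
    have p2: "(\<pi> x)\<^sup>2 \<le> (norm x)\<^sup>2" "(\<pi> x) ^ 4 \<le> (norm x) ^ 4" for x
      using power_mono[OF \<pi>(2) abs_ge_zero, of x 2] power_mono[OF \<pi>(2) abs_ge_zero, of x 4] by (simp_all add: power_even_abs)
    have i: "integrable M\<Omega> (\<lambda>p. (\<pi> (u n p))\<^sup>2)" "integrable M\<Omega> (\<lambda>p. (\<pi> (ux n p))\<^sup>2)" "integrable M\<Omega> (\<lambda>p. (\<pi> (uy n p))\<^sup>2)" for n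
      using sp[of n] by (auto simp: sob_def L2_def)
    have i4: "integrable M\<Omega> (\<lambda>p. (\<pi> (u n p)) ^ 4)" for n by (rule sob_Omega_L4[OF sp])
    have B2: "(LINT p|M\<Omega>. (\<pi> (u n p))\<^sup>2) \<le> K" for n
      by (rule order_trans[OF integral_mono[OF i(1) int(1) p2(1)] order_trans[OF b2]]) (simp add: K_def)
    have B4: "(LINT p|M\<Omega>. (\<pi> (u n p)) ^ 4) \<le> K" for n
      by (rule order_trans[OF integral_mono[OF i4 int(4) p2(2)] order_trans[OF b4]]) (simp add: K_def)
    have Bv: "(LINT p|M\<Omega>. (\<pi> (ux n p))\<^sup>2 + (\<pi> (uy n p))\<^sup>2) \<le> K" for n
    proof -
      have "(LINT p|M\<Omega>. (\<pi> (ux n p))\<^sup>2 + (\<pi> (uy n p))\<^sup>2) \<le> (LINT p|M\<Omega>. (norm (ux n p))\<^sup>2 + (norm (uy n p))\<^sup>2)"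
        using i int by (intro integral_mono add_mono p2) auto
      also have "\<dots> \<le> T" using int[of n] bv[of n] by simp
      finally show ?thesis by (simp add: K_def)
    qed
    obtain r :: "nat \<Rightarrow> nat" where "strict_mono r" "\<And>e. e > 0 \<Longrightarrow> \<exists>N. \<forall>i\<ge>N. \<forall>j\<ge>N. (LINT p|M\<Omega>. (\<pi> (u (q (r i)) p) - \<pi> (u (q (r j)) p))\<^sup>2) < e"
      by (rule Rellich[of "\<lambda>n p. \<pi> (u (q n) p)", OF sp i4 B2 Bv B4]) blast
    then show ?thesis by blast
  qed
  have fb: "\<bar>fst x\<bar> \<le> norm x" "\<bar>snd x\<bar> \<le> norm x" for x :: "real \<times> real"
    using norm_fst_le[of "fst x" "snd x"] norm_snd_le[of "snd x" "fst x"] by auto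
  obtain r1 :: "nat \<Rightarrow> nat" where r1: "strict_mono r1"
    "\<And>e. e > 0 \<Longrightarrow> \<exists>N. \<forall>i\<ge>N. \<forall>j\<ge>N. (LINT p|M\<Omega>. (fst (u (r1 i) p) - fst (u (r1 j) p))\<^sup>2) < e"
    using sub[OF bounded_linear_fst fb(1), of "\<lambda>n. n"] by auto
  obtain r2 :: "nat \<Rightarrow> nat" where r2: "strict_mono r2"
    "\<And>e. e > 0 \<Longrightarrow> \<exists>N. \<forall>i\<ge>N. \<forall>j\<ge>N. (LINT p|M\<Omega>. (snd (u (r1 (r2 i)) p) - snd (u (r1 (r2 j)) p))\<^sup>2) < e"
    using sub[OF bounded_linear_snd fb(2), of r1] by auto
  define r where "r n = r1 (r2 n)" for n
  have r: "n \<le> r n" for n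
    unfolding r_def by (rule order_trans[OF seq_suble[OF r2(1)] seq_suble[OF r1(1)]])
  have Cauchy2: "\<exists>N. \<forall>i\<ge>N. \<forall>j\<ge>N. (LINT p|M\<Omega>. (norm (u (r i) p - u (r j) p))\<^sup>2) < e" if e: "e > 0" for e
  proof -
    obtain N1 where N1: "\<And>i j. i \<ge> N1 \<Longrightarrow> j \<ge> N1 \<Longrightarrow> (LINT p|M\<Omega>. (fst (u (r1 i) p) - fst (u (r1 j) p))\<^sup>2) < e / 2"
      using r1(2)[of "e / 2"] e by auto
    obtain N2 where N2: "\<And>i j. i \<ge> N2 \<Longrightarrow> j \<ge> N2 \<Longrightarrow> (LINT p|M\<Omega>. (snd (u (r i) p) - snd (u (r j) p))\<^sup>2) < e / 2"
      using r2(2)[of "e / 2"] e unfolding r_def by auto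
    have "(LINT p|M\<Omega>. (norm (u (r i) p - u (r j) p))\<^sup>2) < e" if "i \<ge> max N1 N2" "j \<ge> max N1 N2" for i j
    proof -
      have d: "L2 M\<Omega> (\<lambda>p. u (r i) p - u (r j) p)" by (rule L2_diff[OF L2s(1) L2s(1)])
      have "integrable M\<Omega> (\<lambda>p. (fst (u (r i) p) - fst (u (r j) p))\<^sup>2)" "integrable M\<Omega> (\<lambda>p. (snd (u (r i) p) - snd (u (r j) p))\<^sup>2)"
        using L2_bounded_linear[OF bounded_linear_fst d] L2_bounded_linear[OF bounded_linear_snd d] by (auto simp: L2_def)
      then have "(LINT p|M\<Omega>. (norm (u (r i) p - u (r j) p))\<^sup>2) =
        (LINT p|M\<Omega>. (fst (u (r i) p) - fst (u (r j) p))\<^sup>2) + (LINT p|M\<Omega>. (snd (u (r i) p) - snd (u (r j) p))\<^sup>2)"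
        unfolding norm_pair_sq by simp
      moreover have "r2 i \<ge> N1" "r2 j \<ge> N1" using that seq_suble[OF r2(1), of i] seq_suble[OF r2(1), of j] by linarith+
      ultimately show ?thesis using N1[of "r2 i" "r2 j"] N2[of i j] that by (simp add: r_def)
    qed
    then show ?thesis by blast
  qed
  obtain Km where Km: "0 \<le> Km" "\<And>q q' qx qx' qy qy'. f ((1 / 2) *\<^sub>R (q + q')) ((1 / 2) *\<^sub>R (qx + qx')) ((1 / 2) *\<^sub>R (qy + qy')) \<le>
    (f q qx qy + f q' qx' qy') / 2 - ((norm (qx - qx'))\<^sup>2 + (norm (qy - qy'))\<^sup>2) / 4 + Km * (norm (q - q'))\<^sup>2"
    by (rule J_density_midpoint[OF C L, of A B lam]) blast
  \<comment> \<open>The midpoint of \<open>u i\<close> and \<open>u j\<close> is admissible, so its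
    energy is at least \<open>\<iota>\<close>, while the two energies exceed \<open>\<iota>\<close>
    by less than 1/(i+1) and 1/(j+1). The gain in the midpoint inequality is therefore bounded by
    these excesses and the L2 distance.\<close>
  have par: "(LINT p|M\<Omega>. (norm (ux i p - ux j p))\<^sup>2) + (LINT p|M\<Omega>. (norm (uy i p - uy j p))\<^sup>2) \<le>
     2 * (1 / Suc i) + 2 * (1 / Suc j) + 4 * Km * (LINT p|M\<Omega>. (norm (u i p - u j p))\<^sup>2)" for i j
  proof -
    note sm = sob_scaleR[OF sob_add[OF s[of i] s[of j]], of "1 / 2"]
    have d: "integrable M\<Omega> (\<lambda>p. (norm (u i p - u j p))\<^sup>2)" "integrable M\<Omega> (\<lambda>p. (norm (ux i p - ux j p))\<^sup>2)"
      "integrable M\<Omega> (\<lambda>p. (norm (uy i p - uy j p))\<^sup>2)"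
      using sob_diff[OF s[of i] s[of j]] by (auto simp: sob_def L2_def)
    have "\<iota> \<le> energy \<Omega> f (\<lambda>p. (1 / 2) *\<^sub>R (u i p + u j p))" by (rule \<iota>[OF adm_midpoint[OF u(1) u(1)]])
    also have "\<dots> = (LINT p|M\<Omega>. f ((1 / 2) *\<^sub>R (u i p + u j p)) ((1 / 2) *\<^sub>R (ux i p + ux j p)) ((1 / 2) *\<^sub>R (uy i p + uy j p)))"
      by (rule energy_density(2)[OF sm])
    also have "\<dots> \<le> (LINT p|M\<Omega>. (f (u i p) (ux i p) (uy i p) + f (u j p) (ux j p) (uy j p)) / 2
        - ((norm (ux i p - ux j p))\<^sup>2 + (norm (uy i p - uy j p))\<^sup>2) / 4 + Km * (norm (u i p - u j p))\<^sup>2)"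
      by (rule integral_mono[OF energy_density(1)[OF sm]])
         (use energy_density(1)[OF s[of i]] energy_density(1)[OF s[of j]] d Km(2) in auto)
    also have "\<dots> = (energy \<Omega> f (u i) + energy \<Omega> f (u j)) / 2
       - ((LINT p|M\<Omega>. (norm (ux i p - ux j p))\<^sup>2) + (LINT p|M\<Omega>. (norm (uy i p - uy j p))\<^sup>2)) / 4
       + Km * (LINT p|M\<Omega>. (norm (u i p - u j p))\<^sup>2)"
      using energy_density[OF s[of i]] energy_density[OF s[of j]] d by simp
    finally show ?thesis using u(2)[of i] u(2)[of j] by argo
  qed
  have inv0: "(\<lambda>n. 1 / real (Suc n)) \<longlonglongrightarrow> 0" using LIMSEQ_inverse_real_of_nat by (simp add: inverse_eq_divide)
  have Cauchy: "\<exists>N. \<forall>i\<ge>N. \<forall>j\<ge>N. sob_sq (\<lambda>p. u (r i) p - u (r j) p) (\<lambda>p. ux (r i) p - ux (r j) p) (\<lambda>p. uy (r i) p - uy (r j) p) < e"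
    if e: "e > 0" for e
  proof -
    \<comment> \<open>With excesses below e / 8 and the L2 distance below e / 2 / (1 + 4 Km),
      \<open>par\<close> adds up to less than e / 2 + e / 2; the summand 1 accounts for the function
      values contained in \<open>sob_sq\<close>.\<close>
    have K1: "0 < 1 + 4 * Km" using Km(1) by simp
    obtain N1 where N1: "\<And>i j. i \<ge> N1 \<Longrightarrow> j \<ge> N1 \<Longrightarrow> (LINT p|M\<Omega>. (norm (u (r i) p - u (r j) p))\<^sup>2) < e / 2 / (1 + 4 * Km)"
      using Cauchy2[of "e / 2 / (1 + 4 * Km)"] e K1 by auto
    have "eventually (\<lambda>n. 1 / real (Suc n) < e / 8) sequentially" by (rule order_tendstoD(2)[OF inv0]) (use e in simp)
    then obtain N2 where N2: "\<And>n. n \<ge> N2 \<Longrightarrow> 1 / real (Suc n) < e / 8" by (auto simp: eventually_sequentially)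
    have "sob_sq (\<lambda>p. u (r i) p - u (r j) p) (\<lambda>p. ux (r i) p - ux (r j) p) (\<lambda>p. uy (r i) p - uy (r j) p) < e"
      if "i \<ge> max N1 N2" "j \<ge> max N1 N2" for i j
    proof -
      have "(LINT p|M\<Omega>. (norm (u (r i) p - u (r j) p))\<^sup>2) * (1 + 4 * Km) < e / 2"
        by (rule iffD1[OF pos_less_divide_eq[OF K1] N1]) (use that in auto)
      moreover have "1 / real (Suc (r i)) < e / 8" "1 / real (Suc (r j)) < e / 8"
        using N2[of "r i"] N2[of "r j"] r[of i] r[of j] that by simp_all
      moreover have "4 * Km * (LINT p|M\<Omega>. (norm (u (r i) p - u (r j) p))\<^sup>2) + (LINT p|M\<Omega>. (norm (u (r i) p - u (r j) p))\<^sup>2)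
         = (LINT p|M\<Omega>. (norm (u (r i) p - u (r j) p))\<^sup>2) * (1 + 4 * Km)" by (simp add: algebra_simps)
      ultimately show ?thesis
        unfolding sob_sq_split[OF sob_diff[OF s s]] using par[of "r i" "r j"] by argo
    qed
    then show ?thesis by blast
  qed
  obtain u' v' w' where sl: "sob \<Omega> u' v' w'"
    and lim: "(\<lambda>n. LINT p|M\<Omega>. (norm (u (r n) p - u' p))\<^sup>2) \<longlonglongrightarrow> 0"
    "(\<lambda>n. LINT p|M\<Omega>. (norm (ux (r n) p - v' p))\<^sup>2) \<longlonglongrightarrow> 0"
    "(\<lambda>n. LINT p|M\<Omega>. (norm (uy (r n) p - w' p))\<^sup>2) \<longlonglongrightarrow> 0"
    by (rule sob_complete[of "\<lambda>n. u (r n)" "\<lambda>n. ux (r n)" "\<lambda>n. uy (r n)", OF s Cauchy])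
  have sd: "sob \<Omega> (\<lambda>p. u (r n) p - u' p) (\<lambda>p. ux (r n) p - v' p) (\<lambda>p. uy (r n) p - w' p)" for n
    by (rule sob_diff[OF s sl])
  have di: "integrable M\<Omega> (\<lambda>p. (norm (u (r n) p - u' p))\<^sup>2)" "integrable M\<Omega> (\<lambda>p. (norm (ux (r n) p - v' p))\<^sup>2)"
    "integrable M\<Omega> (\<lambda>p. (norm (uy (r n) p - w' p))\<^sup>2)" for n
    using sd[of n] by (auto simp: sob_def L2_def)
  have lim_sum: "(\<lambda>n. (LINT p|M\<Omega>. (norm (u (r n) p - u' p))\<^sup>2) + (LINT p|M\<Omega>. (norm (ux (r n) p - v' p))\<^sup>2)
     + (LINT p|M\<Omega>. (norm (uy (r n) p - w' p))\<^sup>2)) \<longlonglongrightarrow> 0"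
    using tendsto_add[OF tendsto_add[OF lim(1,2)] lim(3)] by simp
  have tr: "has_trace \<Omega> u' (frontier \<Omega>) bdata"
  proof (rule has_trace_limit[OF boundary_edges_props frontier_edges])
    show "has_trace \<Omega> (u (r n)) (frontier \<Omega>) bdata" for n using u(1) by (simp add: adm_def)
    show "W12 \<Omega> u'" by (rule sob_W12[OF sl])
    have "(\<lambda>n. (W12_norm \<Omega> (\<lambda>p. u (r n) p - u' p))\<^sup>2) \<longlonglongrightarrow> 0"
      unfolding W12_norm_sq[OF sd] by (rule lim_sum)
    then show "(\<lambda>n. W12_norm \<Omega> (\<lambda>p. u (r n) p - u' p)) \<longlonglongrightarrow> 0" by (simp add: tendsto_zero_square_iff)
  qed
  \<comment> \<open>A further subsequence along which values and derivatives converge almost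
    everywhere, for the symmetry and for Fatou.\<close>
  have "\<exists>t :: nat \<Rightarrow> nat. strict_mono t \<and> (AE p in M\<Omega>. (\<lambda>n. (norm (u (r (t n)) p - u' p))\<^sup>2 + (norm (ux (r (t n)) p - v' p))\<^sup>2
     + (norm (uy (r (t n)) p - w' p))\<^sup>2) \<longlonglongrightarrow> 0)"
    by (rule tendsto_L1_AE_subseq) (use di lim_sum in \<open>simp_all add: add_nonneg_nonneg\<close>)
  then obtain t :: "nat \<Rightarrow> nat" where t: "strict_mono t" "AE p in M\<Omega>. (\<lambda>n. (norm (u (r (t n)) p - u' p))\<^sup>2 + (norm (ux (r (t n)) p - v' p))\<^sup>2
     + (norm (uy (r (t n)) p - w' p))\<^sup>2) \<longlonglongrightarrow> 0" by blast
  have AElim: "AE p in M\<Omega>. (\<lambda>n. u (r (t n)) p) \<longlonglongrightarrow> u' p \<and> (\<lambda>n. ux (r (t n)) p) \<longlonglongrightarrow> v' p \<and> (\<lambda>n. uy (r (t n)) p) \<longlonglongrightarrow> w' p"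
    using t(2)
  proof eventually_elim
    case (elim p)
    have aux: "h \<longlonglongrightarrow> l" if "\<And>n. (norm (h n - l))\<^sup>2 \<le> (norm (u (r (t n)) p - u' p))\<^sup>2 + (norm (ux (r (t n)) p - v' p))\<^sup>2
     + (norm (uy (r (t n)) p - w' p))\<^sup>2" for h :: "nat \<Rightarrow> real \<times> real" and l
    proof -
      have "(\<lambda>n. (norm (h n - l))\<^sup>2) \<longlonglongrightarrow> 0"
        by (rule tendsto_sandwich[OF always_eventually always_eventually tendsto_const elim]) (use that in auto)
      then have "(\<lambda>n. norm (h n - l)) \<longlonglongrightarrow> 0" by (simp only: tendsto_zero_square_iff)
      then show ?thesis by (simp add: tendsto_norm_zero_iff LIM_zero_iff)
    qed
    show ?case by (intro conjI aux) simp_all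
  qed
  have symu: "sym u'"
  proof -
    have flc: "(\<lambda>n. flip (h n)) \<longlonglongrightarrow> flip l" if "h \<longlonglongrightarrow> l" for h :: "nat \<Rightarrow> real \<times> real" and l
      unfolding flip_def by (intro tendsto_intros that)
    have su: "AE p in M\<Omega>. \<forall>n. u (r (t n)) (refl (- 1) 1 p) = flip (u (r (t n)) p)"
      "AE p in M\<Omega>. \<forall>n. u (r (t n)) (refl 1 (- 1) p) = flip (u (r (t n)) p)"
      using u(1) unfolding AE_all_countable by (auto simp: adm_def sym_def)
    have "AE p in M\<Omega>. u' (refl (- 1) 1 p) = flip (u' p)"
      using su(1) AElim rx.AE_R[OF AElim]
    proof eventually_elim
      case (elim p)
      then have "(\<lambda>n. flip (u (r (t n)) p)) \<longlonglongrightarrow> u' (refl (- 1) 1 p)" by simp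
      then show ?case using LIMSEQ_unique flc elim(2) by blast
    qed
    moreover have "AE p in M\<Omega>. u' (refl 1 (- 1) p) = flip (u' p)"
      using su(2) AElim ry.AE_R[OF AElim]
    proof eventually_elim
      case (elim p)
      then have "(\<lambda>n. flip (u (r (t n)) p)) \<longlonglongrightarrow> u' (refl 1 (- 1) p)" by simp
      then show ?case using LIMSEQ_unique flc elim(2) by blast
    qed
    ultimately show ?thesis by (simp add: sym_def)
  qed
  have "energy \<Omega> f u' \<le> \<iota> + e" if e: "e > 0" for e
  proof -
    have lims: "AE p in M\<Omega>. (\<lambda>n. f (u (r (t n)) p) (ux (r (t n)) p) (uy (r (t n)) p) + b0) \<longlonglongrightarrow> f (u' p) (v' p) (w' p) + b0"
      using AElim unfolding J_density_def F_pot_def by eventually_elim (use L in \<open>auto intro!: tendsto_intros\<close>)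
    have ev: "\<forall>\<^sub>F n in sequentially. (LINT p|M\<Omega>. f (u (r (t n)) p) (ux (r (t n)) p) (uy (r (t n)) p) + b0) \<le> \<iota> + e + b0 * \<mu>"
      using order_tendstoD(2)[OF inv0 e]
    proof eventually_elim
      case (elim n)
      have "1 / real (Suc (r (t n))) \<le> 1 / real (Suc n)"
        using r[of "t n"] seq_suble[OF t(1), of n] by (intro divide_left_mono) auto
      then have "energy \<Omega> f (u (r (t n))) \<le> \<iota> + e" using u(2)[of "r (t n)"] elim by linarith
      then show ?case using energy_density[OF s[of "r (t n)"]] by (simp add: \<mu>_def)
    qed
    have i: "integrable M\<Omega> (\<lambda>p. f (u (r (t n)) p) (ux (r (t n)) p) (uy (r (t n)) p) + b0)" for n
      using energy_density(1)[OF s[of "r (t n)"]] by simp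
    have i': "integrable M\<Omega> (\<lambda>p. f (u' p) (v' p) (w' p) + b0)" using energy_density(1)[OF sl] by simp
    have "(LINT p|M\<Omega>. f (u' p) (v' p) (w' p) + b0) \<le> \<iota> + e + b0 * \<mu>"
      by (rule nn_integral_Fatou_bound(2)[OF borel_measurable_integrable[OF i] borel_measurable_integrable[OF i'] low0 i lims ev])
    then show ?thesis using energy_density[OF sl] by (simp add: \<mu>_def)
  qed
  then have "energy \<Omega> f u' \<le> \<iota>" by (rule field_le_epsilon)
  then show ?thesis using that[of u'] tr symu \<iota> by (meson adm_def order_trans)
qed

end

section \<open>Symmetric criticality\<close>

context reflection
begin

lemma R_frontier: "R p \<in> frontier \<Omega> \<longleftrightarrow> p \<in> frontier \<Omega>"
  by (simp add: frontier_def interior_open[OF open_\<Omega>] R_closure sym)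

text \<open>Antisymmetrising an approximating sequence makes it vanish on the axis of reflection.\<close>

lemma has_trace_axis:
  fixes q :: "R2 \<Rightarrow> real"
  assumes tr: "has_trace \<Omega> q S' h" and odd: "AE p in M\<Omega>. q (R p) = - q p" and S: "\<And>p. p \<in> S \<Longrightarrow> R p = p"
  shows "has_trace \<Omega> q S (\<lambda>_. 0)"
proof -
  have W: "W12 \<Omega> q" using tr by (simp add: has_trace_def)
  obtain v where v: "\<And>n. W12 \<Omega> (v n)" "\<And>n. continuous_on (closure \<Omega>) (v n)"
    "(\<lambda>n. W12_norm \<Omega> (\<lambda>p. v n p - q p)) \<longlonglongrightarrow> 0"
    using tr unfolding has_trace_def by blast
  define w where "w n p = (v n p - v n (R p)) / 2" for n p
  have WR: "W12 \<Omega> (\<lambda>p. f (R p))" if "W12 \<Omega> f" for f :: "R2 \<Rightarrow> real"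
    by (rule sob_W12[OF sob_R[OF W12_sob[OF that]]])
  have half: "bounded_linear (\<lambda>x::real. x / 2)" by (rule bounded_linear_divide)
  have Ww: "W12 \<Omega> (w n)" for n
    unfolding w_def by (rule W12_bounded_linear[OF half W12_diff[OF v(1) WR[OF v(1)]]])
  have "continuous_on (closure \<Omega>) (w n)" for n
    unfolding w_def
    by (intro continuous_intros v(2) continuous_on_compose2[OF v(2) R_continuous]) (auto simp: R_closure)
  moreover have "w n p = 0" if "p \<in> S" for n p using S[OF that] by (simp add: w_def)
  ultimately have tw: "has_trace \<Omega> (w n) S (\<lambda>_. 0)" for n
    by (intro has_trace_eq[OF W12_sob[OF Ww]]) auto
  have seg: "(\<forall>n. L2 (lebesgue_on {0..1}) (\<lambda>t. w n (linepath a b t) - 0)) \<and>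
     (\<lambda>n. LINT t|lebesgue_on {0..1}. (norm (w n (linepath a b t) - 0))\<^sup>2) \<longlonglongrightarrow> 0"
    if ab: "a \<noteq> b \<and> closed_segment a b \<subseteq> S" for a b
  proof -
    have 0: "w n (linepath a b t) = 0" if "t \<in> {0..1}" for n t
    proof -
      have "linepath a b t \<in> closed_segment a b" using that linepath_image_01[of a b] by blast
      then have "R (linepath a b t) = linepath a b t" using S ab by blast
      then show ?thesis by (simp add: w_def)
    qed
    have m: "(\<lambda>t. w n (linepath a b t)) \<in> borel_measurable (lebesgue_on {0..1})" for n
      by (subst measurable_cong[of _ _ "\<lambda>_. 0"]) (use 0 in auto)
    have i: "integrable (lebesgue_on {0..1}) (\<lambda>t. (norm (w n (linepath a b t)))\<^sup>2)" for n
      by (subst Bochner_Integration.integrable_cong[OF HOL.refl, of _ _ "\<lambda>_. 0"]) (use 0 in auto)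
    have "(LINT t|lebesgue_on {0..1}. (norm (w n (linepath a b t)))\<^sup>2) = (LINT t|lebesgue_on {0..1::real}. 0)" for n
      by (rule Bochner_Integration.integral_cong) (use 0 in auto)
    then show ?thesis using m i by (simp add: L2_def)
  qed
  have le: "(W12_norm \<Omega> (\<lambda>p. w n p - q p))\<^sup>2 \<le> (W12_norm \<Omega> (\<lambda>p. v n p - q p))\<^sup>2" for n
  proof -
    define d where "d p = v n p - q p" for p
    have Wd: "W12 \<Omega> d" unfolding d_def by (rule W12_diff[OF v(1) W])
    define e where "e p = d p / 2 + - (d (R p) / 2)" for p
    have half': "bounded_linear (\<lambda>x::real. - (x / 2))" by (intro bounded_linear_minus half)
    note W1 = W12_bounded_linear[OF half Wd] and W2 = W12_bounded_linear[OF half' WR[OF Wd]]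
    have We: "W12 \<Omega> e" unfolding e_def by (rule W12_add[OF W1 W2])
    have "(W12_norm \<Omega> e)\<^sup>2 \<le> 2 * (W12_norm \<Omega> (\<lambda>p. d p / 2))\<^sup>2 + 2 * (W12_norm \<Omega> (\<lambda>p. - (d (R p) / 2)))\<^sup>2"
      unfolding e_def by (rule W12_norm_add[OF W1 W2])
    also have "\<dots> \<le> 2 * ((1 / 2)\<^sup>2 * (W12_norm \<Omega> d)\<^sup>2) + 2 * ((1 / 2)\<^sup>2 * (W12_norm \<Omega> (\<lambda>p. d (R p)))\<^sup>2)"
      by (intro add_mono mult_left_mono W12_norm_bounded_linear half half' Wd WR) auto
    also have "\<dots> = (W12_norm \<Omega> d)\<^sup>2" unfolding W12_norm_R[OF Wd] by (simp add: power_divide)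
    finally have 1: "(W12_norm \<Omega> e)\<^sup>2 \<le> (W12_norm \<Omega> d)\<^sup>2" .
    \<comment> \<open>Oddness of \<open>q\<close> identifies w n - q with the antisymmetrisation
      \<open>e\<close> of v n - q, and antisymmetrising does not increase the norm.\<close>
    have eq: "AE p in M\<Omega>. e p = w n p - q p"
      using odd by eventually_elim (simp add: e_def d_def w_def field_simps)
    note s = W12_sob[OF We]
    have s': "sob \<Omega> (\<lambda>p. w n p - q p) (weak_deriv \<Omega> (1, 0) e) (weak_deriv \<Omega> (0, 1) e)"
      by (rule sob_cong[OF s eq]) auto
    have "(LINT p|M\<Omega>. (norm (w n p - q p))\<^sup>2) = (LINT p|M\<Omega>. (norm (e p))\<^sup>2)"
      by (rule integral_cong_AE) (use s s' eq in \<open>auto simp: sob_def L2_def\<close>)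
    then have "(W12_norm \<Omega> (\<lambda>p. w n p - q p))\<^sup>2 = (W12_norm \<Omega> e)\<^sup>2"
      unfolding W12_norm_sq[OF s] W12_norm_sq[OF s'] by simp
    then show ?thesis using 1 by (simp add: d_def[abs_def])
  qed
  have v0: "(\<lambda>n. (W12_norm \<Omega> (\<lambda>p. v n p - q p))\<^sup>2) \<longlonglongrightarrow> 0"
    using tendsto_power[OF v(3), of 2] by simp
  have "(\<lambda>n. (W12_norm \<Omega> (\<lambda>p. w n p - q p))\<^sup>2) \<longlonglongrightarrow> 0"
    by (rule tendsto_zero_le[OF v0 v0, of _ 1 0]) (use le in auto)
  then have "(\<lambda>n. W12_norm \<Omega> (\<lambda>p. w n p - q p)) \<longlonglongrightarrow> 0" by (simp only: tendsto_zero_square_iff)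
  then show ?thesis
    unfolding has_trace_def using W Ww tw seg \<open>\<And>n. continuous_on (closure \<Omega>) (w n)\<close> by (intro conjI exI[of _ w]) blast+
qed

end

context wors_energy
begin

lemma flip_simps: "flip (flip q) = q" "flip (a + b) = flip a + flip b" "flip (r *\<^sub>R a) = r *\<^sub>R flip a" "flip 0 = 0"
  by (simp_all add: flip_def prod_eq_iff)

lemma energy_cong_AE:
  assumes s: "sob \<Omega> v vx vy" and eq: "AE p in M\<Omega>. v p = v' p"
  shows "energy \<Omega> f v' = energy \<Omega> f v"
proof -
  have s': "sob \<Omega> v' vx vy" by (rule sob_cong[OF s eq]) auto
  have "(LINT p|M\<Omega>. f (v' p) (vx p) (vy p)) = (LINT p|M\<Omega>. f (v p) (vx p) (vy p))"
    by (rule integral_cong_AE[OF borel_measurable_integrable[OF energy_density(1)[OF s']]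
        borel_measurable_integrable[OF energy_density(1)[OF s]]]) (use eq in \<open>eventually_elim, simp\<close>)
  then show ?thesis by (simp add: energy_density(2)[OF s] energy_density(2)[OF s'])
qed

text \<open>A reflection changes derivatives by signs and \<open>flip\<close> changes the sign of
  the first component. The density contains derivatives only squared and the first component only in
  even powers, and the domain is invariant.\<close>

lemma energy_reflect:
  assumes "reflection \<Omega> c1 c2" and s: "sob \<Omega> v vx vy"
  shows "energy \<Omega> f (\<lambda>p. flip (v (refl c1 c2 p))) = energy \<Omega> f v"
proof -
  interpret R: reflection \<Omega> c1 c2 by fact
  have s': "sob \<Omega> (\<lambda>p. flip (v (refl c1 c2 p))) (\<lambda>p. flip (c1 *\<^sub>R vx (refl c1 c2 p))) (\<lambda>p. flip (c2 *\<^sub>R vy (refl c1 c2 p)))"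
    by (rule sob_bounded_linear[OF flip_linear R.sob_R[OF s]])
  have c: "c1\<^sup>2 = 1" "c2\<^sup>2 = 1" using R.c by (simp_all add: power2_eq_square)
  have f: "f (flip q) (flip (c1 *\<^sub>R a)) (flip (c2 *\<^sub>R b)) = f q a b" for q a b
    by (simp add: J_density_def F_pot_def flip_def power_mult_distrib c)
  show ?thesis
    unfolding energy_density(2)[OF s'] energy_density(2)[OF s] f
    by (rule R.integral_R(3)[OF borel_measurable_integrable[OF energy_density(1)[OF s]]])
qed

text \<open>Since \<open>u\<close> is invariant, the energies along the two lines agree for every
  \<open>t\<close>, and so do their derivatives at 0. No computation with \<open>J_first\<close> is
  involved.\<close>

lemma first_variation_reflect:
  assumes R: "reflection \<Omega> c1 c2" and s: "sob \<Omega> u ux uy" "sob \<Omega> \<phi> \<phi>x \<phi>y"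
    and "sob \<Omega> (\<lambda>p. flip (\<phi> (refl c1 c2 p))) \<psi>x \<psi>y"
    and sym: "AE p in M\<Omega>. u (refl c1 c2 p) = flip (u p)"
  shows "(LINT p|M\<Omega>. J_first A B C L lam (u p) (ux p) (uy p) (flip (\<phi> (refl c1 c2 p))) (\<psi>x p) (\<psi>y p)) =
    (LINT p|M\<Omega>. J_first A B C L lam (u p) (ux p) (uy p) (\<phi> p) (\<phi>x p) (\<phi>y p))"
proof (rule DERIV_unique[OF J_line(3)[OF s(1) assms(4)]])
  interpret R: reflection \<Omega> c1 c2 by fact
  have "energy \<Omega> f (\<lambda>p. u p + t *\<^sub>R flip (\<phi> (refl c1 c2 p))) = energy \<Omega> f (\<lambda>p. u p + t *\<^sub>R \<phi> p)" for t
  proof -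
    note st = sob_add[OF s(1) sob_scaleR[OF s(2), of t]]
    have "energy \<Omega> f (\<lambda>p. u p + t *\<^sub>R flip (\<phi> (refl c1 c2 p))) =
      energy \<Omega> f (\<lambda>p. flip (u (refl c1 c2 p) + t *\<^sub>R \<phi> (refl c1 c2 p)))"
      by (rule energy_cong_AE[OF sob_bounded_linear[OF flip_linear R.sob_R[OF st]]])
         (use sym in \<open>eventually_elim, simp add: flip_simps\<close>)
    also have "\<dots> = energy \<Omega> f (\<lambda>p. u p + t *\<^sub>R \<phi> p)" by (rule energy_reflect[OF R st])
    finally show ?thesis .
  qed
  then show "((\<lambda>t. energy \<Omega> f (\<lambda>p. u p + t *\<^sub>R flip (\<phi> (refl c1 c2 p)))) has_real_derivative
     (LINT p|M\<Omega>. J_first A B C L lam (u p) (ux p) (uy p) (\<phi> p) (\<phi>x p) (\<phi>y p))) (at 0)"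
    using J_line(3)[OF s, of A B C L lam] by simp
qed

text \<open>Adding to a direction its flipped reflection doubles the first variation. Doing this
  with both reflections leads to \<open>\<zeta>\<close>, the sum of the four images of
  \<open>\<phi>\<close>, which is symmetric because the reflections commute. Hence four times the
  first variation in direction \<open>\<phi>\<close> is 0.\<close>

lemma first_variation_zero:
  assumes u: "adm u" "\<And>v. adm v \<Longrightarrow> energy \<Omega> f u \<le> energy \<Omega> f v" and s: "sob \<Omega> u ux uy"
    and \<phi>: "has_trace \<Omega> \<phi> (frontier \<Omega>) (\<lambda>_. 0)" "sob \<Omega> \<phi> \<phi>x \<phi>y"
  shows "(LINT p|M\<Omega>. J_first A B C L lam (u p) (ux p) (uy p) (\<phi> p) (\<phi>x p) (\<phi>y p)) = 0"
proof -
  define j where "j \<phi> \<phi>x \<phi>y p = J_first A B C L lam (u p) (ux p) (uy p) (\<phi> p) (\<phi>x p) (\<phi>y p)" for \<phi> \<phi>x \<phi>y p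
  \<comment> \<open>A line in a symmetric direction of zero trace stays admissible, so the energy
    along it is minimal at t = 0.\<close>
  have symmetric_case: "(LINT p|M\<Omega>. j \<phi> \<phi>x \<phi>y p) = 0"
    if \<phi>: "has_trace \<Omega> \<phi> (frontier \<Omega>) (\<lambda>_. 0)" "sym \<phi>" "sob \<Omega> \<phi> \<phi>x \<phi>y" for \<phi> \<phi>x \<phi>y
  proof (rule DERIV_local_min[OF J_line(3)[OF s \<phi>(3), of A B C L lam, folded j_def], of 1], simp, intro allI impI)
    fix t :: real
    have "has_trace \<Omega> (\<lambda>p. u p + t *\<^sub>R \<phi> p) (frontier \<Omega>) (\<lambda>p. bdata p + t *\<^sub>R 0)"
      by (intro has_trace_add has_trace_scaleR \<phi>(1)) (use u in \<open>simp add: adm_def\<close>)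
    then have "adm (\<lambda>p. u p + t *\<^sub>R \<phi> p)"
      using u(1) \<phi>(2) by (simp add: adm_def sym_add sym_scaleR)
    then show "energy \<Omega> f (\<lambda>p. u p + 0 *\<^sub>R \<phi> p) \<le> energy \<Omega> f (\<lambda>p. u p + t *\<^sub>R \<phi> p)" using u(2) by simp
  qed
  have ji: "integrable M\<Omega> (j \<phi> \<phi>x \<phi>y)" if "sob \<Omega> \<phi> \<phi>x \<phi>y" for \<phi> \<phi>x \<phi>y
    unfolding j_def by (rule J_line(1)[OF s that])
  have step: "\<exists>\<psi>x \<psi>y. sob \<Omega> \<psi> \<psi>x \<psi>y \<and> has_trace \<Omega> \<psi> (frontier \<Omega>) (\<lambda>_. 0) \<and>
      (LINT p|M\<Omega>. j \<psi> \<psi>x \<psi>y p) = 2 * (LINT p|M\<Omega>. j \<phi> \<phi>x \<phi>y p)"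
    if R: "reflection \<Omega> c1 c2" and ur: "AE p in M\<Omega>. u (refl c1 c2 p) = flip (u p)"
      and \<phi>: "has_trace \<Omega> \<phi> (frontier \<Omega>) (\<lambda>_. 0)" "sob \<Omega> \<phi> \<phi>x \<phi>y"
      and \<psi>: "\<psi> = (\<lambda>p. \<phi> p + flip (\<phi> (refl c1 c2 p)))"
    for c1 c2 \<phi> \<phi>x \<phi>y \<psi>
  proof -
    interpret R: reflection \<Omega> c1 c2 by fact
    define \<sigma>x \<sigma>y where "\<sigma>x p = flip (c1 *\<^sub>R \<phi>x (refl c1 c2 p))" and "\<sigma>y p = flip (c2 *\<^sub>R \<phi>y (refl c1 c2 p))" for p
    have s\<sigma>: "sob \<Omega> (\<lambda>p. flip (\<phi> (refl c1 c2 p))) \<sigma>x \<sigma>y"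
      unfolding \<sigma>x_def \<sigma>y_def by (rule sob_bounded_linear[OF flip_linear R.sob_R[OF \<phi>(2)]])
    have "has_trace \<Omega> (\<lambda>p. \<phi> p + flip (\<phi> (refl c1 c2 p))) (frontier \<Omega>) (\<lambda>p. 0 + flip 0)"
      by (intro has_trace_add \<phi>(1) has_trace_bounded_linear[OF flip_linear] R.has_trace_R R.R_frontier)
    then have tr: "has_trace \<Omega> \<psi> (frontier \<Omega>) (\<lambda>_. 0)" by (simp add: \<psi> flip_simps)
    have "(LINT p|M\<Omega>. j \<psi> (\<lambda>p. \<phi>x p + \<sigma>x p) (\<lambda>p. \<phi>y p + \<sigma>y p) p) =
      (LINT p|M\<Omega>. j \<phi> \<phi>x \<phi>y p + j (\<lambda>p. flip (\<phi> (refl c1 c2 p))) \<sigma>x \<sigma>y p)"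
      unfolding \<psi> j_def J_first_add ..
    also have "\<dots> = (LINT p|M\<Omega>. j \<phi> \<phi>x \<phi>y p) + (LINT p|M\<Omega>. j (\<lambda>p. flip (\<phi> (refl c1 c2 p))) \<sigma>x \<sigma>y p)"
      by (rule Bochner_Integration.integral_add[OF ji[OF \<phi>(2)] ji[OF s\<sigma>]])
    also have "(LINT p|M\<Omega>. j (\<lambda>p. flip (\<phi> (refl c1 c2 p))) \<sigma>x \<sigma>y p) = (LINT p|M\<Omega>. j \<phi> \<phi>x \<phi>y p)"
      unfolding j_def by (rule first_variation_reflect[OF R s \<phi>(2) s\<sigma> ur])
    finally have "(LINT p|M\<Omega>. j \<psi> (\<lambda>p. \<phi>x p + \<sigma>x p) (\<lambda>p. \<phi>y p + \<sigma>y p) p) = 2 * (LINT p|M\<Omega>. j \<phi> \<phi>x \<phi>y p)"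
      by simp
    moreover have "sob \<Omega> \<psi> (\<lambda>p. \<phi>x p + \<sigma>x p) (\<lambda>p. \<phi>y p + \<sigma>y p)" unfolding \<psi> by (rule sob_add[OF \<phi>(2) s\<sigma>])
    ultimately show ?thesis using tr by blast
  qed
  define \<psi> where "\<psi> p = \<phi> p + flip (\<phi> (refl (- 1) 1 p))" for p
  define \<zeta> where "\<zeta> p = \<psi> p + flip (\<psi> (refl 1 (- 1) p))" for p
  have us: "AE p in M\<Omega>. u (refl (- 1) 1 p) = flip (u p)" "AE p in M\<Omega>. u (refl 1 (- 1) p) = flip (u p)"
    using u(1) by (auto simp: adm_def sym_def)
  have "\<exists>\<psi>x \<psi>y. sob \<Omega> \<psi> \<psi>x \<psi>y \<and> has_trace \<Omega> \<psi> (frontier \<Omega>) (\<lambda>_. 0) \<and>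
    (LINT p|M\<Omega>. j \<psi> \<psi>x \<psi>y p) = 2 * (LINT p|M\<Omega>. j \<phi> \<phi>x \<phi>y p)"
    by (rule step[OF rx.reflection_axioms us(1) \<phi>]) (rule ext, rule \<psi>_def)
  then obtain \<psi>x \<psi>y where "sob \<Omega> \<psi> \<psi>x \<psi>y \<and> has_trace \<Omega> \<psi> (frontier \<Omega>) (\<lambda>_. 0) \<and>
    (LINT p|M\<Omega>. j \<psi> \<psi>x \<psi>y p) = 2 * (LINT p|M\<Omega>. j \<phi> \<phi>x \<phi>y p)"
    by (elim exE) (erule that)
  then have \<psi>: "sob \<Omega> \<psi> \<psi>x \<psi>y" "has_trace \<Omega> \<psi> (frontier \<Omega>) (\<lambda>_. 0)"
    "(LINT p|M\<Omega>. j \<psi> \<psi>x \<psi>y p) = 2 * (LINT p|M\<Omega>. j \<phi> \<phi>x \<phi>y p)" by simp_all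
  have "\<exists>\<zeta>x \<zeta>y. sob \<Omega> \<zeta> \<zeta>x \<zeta>y \<and> has_trace \<Omega> \<zeta> (frontier \<Omega>) (\<lambda>_. 0) \<and>
    (LINT p|M\<Omega>. j \<zeta> \<zeta>x \<zeta>y p) = 2 * (LINT p|M\<Omega>. j \<psi> \<psi>x \<psi>y p)"
    by (rule step[OF ry.reflection_axioms us(2) \<psi>(2,1)]) (rule ext, rule \<zeta>_def)
  then obtain \<zeta>x \<zeta>y where "sob \<Omega> \<zeta> \<zeta>x \<zeta>y \<and> has_trace \<Omega> \<zeta> (frontier \<Omega>) (\<lambda>_. 0) \<and>
    (LINT p|M\<Omega>. j \<zeta> \<zeta>x \<zeta>y p) = 2 * (LINT p|M\<Omega>. j \<psi> \<psi>x \<psi>y p)"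
    by (elim exE) (erule that)
  then have \<zeta>: "sob \<Omega> \<zeta> \<zeta>x \<zeta>y" "has_trace \<Omega> \<zeta> (frontier \<Omega>) (\<lambda>_. 0)"
    "(LINT p|M\<Omega>. j \<zeta> \<zeta>x \<zeta>y p) = 2 * (LINT p|M\<Omega>. j \<psi> \<psi>x \<psi>y p)" by simp_all
  have rr: "refl a b (refl a' b' p) = refl (a * a') (b * b') p" for a b a' b' p by (simp add: refl_def)
  have r1: "refl 1 1 p = p" for p by (simp add: refl_def)
  have "sym \<zeta>" unfolding sym_def by (intro conjI AE_I2) (simp_all add: \<zeta>_def \<psi>_def rr r1 flip_simps add_ac)
  then have "(LINT p|M\<Omega>. j \<zeta> \<zeta>x \<zeta>y p) = 0" using symmetric_case \<zeta> by blast
  then have "(LINT p|M\<Omega>. j \<phi> \<phi>x \<phi>y p) = 0" using \<zeta>(3) \<psi>(3) by simp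
  then show ?thesis by (simp add: j_def)
qed

lemma bdata_critical:
  assumes u: "adm u" "\<And>v. adm v \<Longrightarrow> energy \<Omega> f u \<le> energy \<Omega> f v"
  shows "critical_point \<Omega> UNIV bdata f u"
  unfolding critical_point_def
proof (intro conjI ballI)
  show "u \<in> dirichlet_class \<Omega> UNIV bdata" using u(1) adm_W12 by (simp add: dirichlet_class_def adm_def)
  note s = W12_sob[OF adm_W12[OF u(1)]]
  fix \<phi> :: "R2 \<Rightarrow> real \<times> real" assume "\<phi> \<in> dirichlet_class \<Omega> UNIV (\<lambda>_. 0)"
  then have \<phi>: "W12 \<Omega> \<phi>" "has_trace \<Omega> \<phi> (frontier \<Omega>) (\<lambda>_. 0)" by (auto simp: dirichlet_class_def)
  note s\<phi> = W12_sob[OF \<phi>(1)]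
  show "\<forall>t. integrable M\<Omega> (energy_integrand \<Omega> f (\<lambda>p. u p + t *\<^sub>R \<phi> p))" using J_line(2)[OF s s\<phi>] by blast
  show "((\<lambda>t. energy \<Omega> f (\<lambda>p. u p + t *\<^sub>R \<phi> p)) has_real_derivative 0) (at 0)"
    using J_line(3)[OF s s\<phi>, of A B C L lam] first_variation_zero[OF u s \<phi>(2) s\<phi>] by simp
qed

lemma axis_traces:
  assumes "adm u"
  shows "has_trace \<Omega> (\<lambda>p. fst (u p)) (\<Omega> \<inter> {(x, y). x = 0}) (\<lambda>_. 0)"
    "has_trace \<Omega> (\<lambda>p. fst (u p)) (\<Omega> \<inter> {(x, y). y = 0}) (\<lambda>_. 0)"
proof -
  have tr: "has_trace \<Omega> (\<lambda>p. fst (u p)) (frontier \<Omega>) (\<lambda>p. fst (bdata p))"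
    using assms by (intro has_trace_bounded_linear[OF bounded_linear_fst]) (simp add: adm_def)
  have "AE p in M\<Omega>. u (refl (- 1) 1 p) = flip (u p)" "AE p in M\<Omega>. u (refl 1 (- 1) p) = flip (u p)"
    using assms by (auto simp: adm_def sym_def)
  then have odd: "AE p in M\<Omega>. fst (u (refl (- 1) 1 p)) = - fst (u p)" "AE p in M\<Omega>. fst (u (refl 1 (- 1) p)) = - fst (u p)"
    by (eventually_elim, simp add: flip_def)+
  show "has_trace \<Omega> (\<lambda>p. fst (u p)) (\<Omega> \<inter> {(x, y). x = 0}) (\<lambda>_. 0)"
    by (rule rx.has_trace_axis[OF tr odd(1)]) (auto simp: refl_def)
  show "has_trace \<Omega> (\<lambda>p. fst (u p)) (\<Omega> \<inter> {(x, y). y = 0}) (\<lambda>_. 0)"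
    by (rule ry.has_trace_axis[OF tr odd(2)]) (auto simp: refl_def)
qed

end

section \<open>The Landau-de Gennes energy\<close>

lemma trace_mult_3: "trace (X ** Y) = (\<Sum>i\<in>UNIV. \<Sum>j\<in>UNIV. X $ i $ j * Y $ j $ i)" for X Y :: "real^3^3"
  by (simp add: trace_def matrix_matrix_mult_def)

lemma trace_mult_commute: "trace (X ** Y) = trace (Y ** X)" for X Y :: "real^3^3"
  unfolding trace_mult_3 by (subst sum.swap) (simp add: mult.commute)

lemma matrix_add_rdistrib3: "(X + Y) ** Z = X ** Z + Y ** Z" for X Y Z :: "real^3^3"
  by (simp add: vec_eq_iff matrix_matrix_mult_def sum.distrib distrib_right)

lemma scaleR_matrix_mult: "(t *\<^sub>R X) ** Y = t *\<^sub>R (X ** Y)" "X ** (t *\<^sub>R Y) = t *\<^sub>R (X ** Y)" for X Y :: "real^3^3"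
  by (simp_all add: vec_eq_iff matrix_matrix_mult_def sum_distrib_left mult_ac)

lemma trace_linear: "trace (X + Y) = trace X + trace Y" "trace (t *\<^sub>R X) = t * trace X" for X Y :: "real^3^3"
  by (simp_all add: trace_def sum.distrib sum_distrib_left)

lemma trace_square_expand:
  "trace ((X + t *\<^sub>R Y) ** (X + t *\<^sub>R Y)) = trace (X ** X) + t * (2 * trace (X ** Y)) + t\<^sup>2 * trace (Y ** Y)"
  for X Y :: "real^3^3"
  using trace_mult_commute[of Y X]
  by (simp add: matrix_add_ldistrib matrix_add_rdistrib3 scaleR_matrix_mult trace_linear power2_eq_square algebra_simps)

text \<open>Matrices do not commute, but the trace is cyclic, so the three mixed products of each
  order have the same trace; this is the origin of the coefficients 3.\<close>

lemma trace_cube_expand: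
  "trace ((X + t *\<^sub>R Y) ** (X + t *\<^sub>R Y) ** (X + t *\<^sub>R Y)) =
     trace (X ** X ** X) + t * (3 * trace (X ** X ** Y)) + t\<^sup>2 * (3 * trace (X ** Y ** Y)) + t ^ 3 * trace (Y ** Y ** Y)"
  for X Y :: "real^3^3"
proof -
  have c: "trace (X ** Y ** Z) = trace (Y ** Z ** X)" for X Y Z :: "real^3^3"
    using trace_mult_commute[of X "Y ** Z"] by (simp add: matrix_mul_assoc)
  have "trace (X ** Y ** X) = trace (X ** X ** Y)" "trace (Y ** X ** X) = trace (X ** X ** Y)"
    "trace (Y ** X ** Y) = trace (X ** Y ** Y)" "trace (Y ** Y ** X) = trace (X ** Y ** Y)"
    using c[of X Y X] c[of Y X X] c[of Y X Y] c[of Y Y X] by simp_all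
  then show ?thesis
    by (simp add: matrix_add_ldistrib matrix_add_rdistrib3 scaleR_matrix_mult trace_linear power2_eq_square power3_eq_cube algebra_simps)
qed

lemma bounded_linear_entry: "bounded_linear (\<lambda>X :: real^3^3. X $ i $ j)"
  unfolding linear_conv_bounded_linear[symmetric] by (rule linearI) simp_all

lemma norm_entry_le: "\<bar>X $ i $ j\<bar> \<le> norm X" for X :: "real^3^3"
  using order_trans[OF component_le_norm_cart Finite_Cartesian_Product.norm_nth_le, of X i j] by simp

text \<open>The coefficient of \<open>t\<close> in \<open>I_density\<close> along a line. The
  factors 1/2, 1/3 and 1/4 of the density cancel against the degrees.\<close>

definition I_first ::
    "real \<Rightarrow> real \<Rightarrow> real \<Rightarrow> real \<Rightarrow> real \<Rightarrow> real^3^3 \<Rightarrow> real^3^3 \<Rightarrow> real^3^3 \<Rightarrow> real^3^3 \<Rightarrow> real^3^3 \<Rightarrow> real^3^3 \<Rightarrow> real" where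
  "I_first A B C L lam Q Qx Qy \<phi> \<phi>x \<phi>y =
     (trace (Qx ** \<phi>x) + trace (Qy ** \<phi>y)) + lam\<^sup>2 / L * (A * trace (Q ** \<phi>) - B * trace (Q ** Q ** \<phi>)
       + C * (trace (Q ** Q) * trace (Q ** \<phi>)))"

context wors_domain
begin

text \<open>Parallel to \<open>J_line\<close>, with domination of matrix-valued functions understood
  entry by entry (\<open>mdom\<close>), so that products and traces of matrices obey the same degree
  count.\<close>

lemma I_line:
  fixes A B C L lam :: real and Q Qx Qy \<phi> \<phi>x \<phi>y :: "R2 \<Rightarrow> real^3^3"
  assumes s: "sob \<Omega> Q Qx Qy" "sob \<Omega> \<phi> \<phi>x \<phi>y"
  shows "integrable M\<Omega> (energy_integrand \<Omega> (I_density A B C L lam) (\<lambda>p. Q p + t *\<^sub>R \<phi> p))"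
    and "((\<lambda>t. energy \<Omega> (I_density A B C L lam) (\<lambda>p. Q p + t *\<^sub>R \<phi> p)) has_real_derivative
      (LINT p|M\<Omega>. I_first A B C L lam (Q p) (Qx p) (Qy p) (\<phi> p) (\<phi>x p) (\<phi>y p))) (at 0)"
proof -
  define m where "m p = 1 + norm (Q p) + norm (\<phi> p)" for p
  have m1: "1 \<le> m p" for p by (simp add: m_def)
  have m4: "integrable M\<Omega> (\<lambda>p. m p ^ 4)" unfolding m_def by (rule weight_integrable[OF s])
  have L: "L2 M\<Omega> Q" "L2 M\<Omega> Qx" "L2 M\<Omega> Qy" "L2 M\<Omega> \<phi>" "L2 M\<Omega> \<phi>x" "L2 M\<Omega> \<phi>y" using s by (auto simp: sob_def)
  have Le: "L2 M\<Omega> (\<lambda>p. X p $ i $ j)" if "L2 M\<Omega> X" for X :: "R2 \<Rightarrow> real^3^3" and i j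
    by (rule L2_bounded_linear[OF bounded_linear_entry that])
  define mdom where "mdom n X \<longleftrightarrow> (\<forall>i j. dominated m n (\<lambda>p. X p $ i $ j))" for n and X :: "R2 \<Rightarrow> real^3^3"
  have md: "mdom 1 Q" "mdom 1 \<phi>"
  proof -
    have "\<bar>Q p $ i $ j\<bar> \<le> m p" "\<bar>\<phi> p $ i $ j\<bar> \<le> m p" for p i j
      using norm_entry_le[of "Q p" i j] norm_entry_le[of "\<phi> p" i j] norm_ge_zero[of "Q p"] norm_ge_zero[of "\<phi> p"]
      unfolding m_def by linarith+
    moreover have "(\<lambda>p. Q p $ i $ j) \<in> borel_measurable M\<Omega>" "(\<lambda>p. \<phi> p $ i $ j) \<in> borel_measurable M\<Omega>" for i j
      using Le[OF L(1), of i j] Le[OF L(4), of i j] by (simp_all add: L2_def)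
    ultimately show "mdom 1 Q" "mdom 1 \<phi>" unfolding mdom_def by (blast intro: dominated_base)+
  qed
  have mm: "mdom (k + n) (\<lambda>p. X p ** Y p)" if "mdom k X" "mdom n Y" for k n X Y
    using that unfolding mdom_def matrix_matrix_mult_def vec_lambda_beta sum_3
    by (intro allI dominated_add dominated_mult) simp_all
  have mt: "dominated m n (\<lambda>p. trace (X p))" if "mdom n X" for n X
    using that unfolding mdom_def trace_def sum_3 by (intro dominated_add) simp_all
  define a b c where "a p = trace (Q p ** Q p)" and "b p = trace (Q p ** \<phi> p)" and "c p = trace (\<phi> p ** \<phi> p)" for p
  define d0 d1 d2 d3 where "d0 p = trace (Q p ** Q p ** Q p)" and "d1 p = trace (Q p ** Q p ** \<phi> p)"
    and "d2 p = trace (Q p ** \<phi> p ** \<phi> p)" and "d3 p = trace (\<phi> p ** \<phi> p ** \<phi> p)" for p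
  have dabc: "dominated m 2 a" "dominated m 2 b" "dominated m 2 c"
    unfolding a_def[abs_def] b_def[abs_def] c_def[abs_def]
    using mt[OF mm[OF md(1) md(1)]] mt[OF mm[OF md(1) md(2)]] mt[OF mm[OF md(2) md(2)]] by (simp_all add: numeral_2_eq_2)
  have dd: "dominated m 3 d0" "dominated m 3 d1" "dominated m 3 d2" "dominated m 3 d3"
    unfolding d0_def[abs_def] d1_def[abs_def] d2_def[abs_def] d3_def[abs_def]
    using mt[OF mm[OF mm[OF md(1) md(1)] md(1)]] mt[OF mm[OF mm[OF md(1) md(1)] md(2)]]
      mt[OF mm[OF mm[OF md(1) md(2)] md(2)]] mt[OF mm[OF mm[OF md(2) md(2)] md(2)]] by (simp_all add: numeral_3_eq_3)
  have d4: "dominated m 4 (\<lambda>p. f p * g p)" if "dominated m 2 f" "dominated m 2 g" for f g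
    using dominated_mult[OF that] by simp
  have up: "dominated m 4 f" if "dominated m 2 f \<or> dominated m 3 f" for f
    using that dominated_le[of m 2 f 4] dominated_le[of m 3 f 4] m1 by auto
  have di: "integrable M\<Omega> f" if "dominated m 4 f" for f by (rule dominated_integrable[OF that _ m1 m4]) simp
  have i2: "integrable M\<Omega> a" "integrable M\<Omega> b" "integrable M\<Omega> c" "integrable M\<Omega> d0" "integrable M\<Omega> d1" "integrable M\<Omega> d2" "integrable M\<Omega> d3"
    by (rule di[OF up], use dabc dd in blast)+
  have i4: "integrable M\<Omega> (\<lambda>p. a p * a p)" "integrable M\<Omega> (\<lambda>p. a p * b p)" "integrable M\<Omega> (\<lambda>p. b p * b p)"
    "integrable M\<Omega> (\<lambda>p. a p * c p)" "integrable M\<Omega> (\<lambda>p. b p * c p)" "integrable M\<Omega> (\<lambda>p. c p * c p)"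
    by (rule di[OF d4], use dabc in blast, use dabc in blast)+
  have ig: "integrable M\<Omega> (\<lambda>p. trace (X p ** Y p))" if "L2 M\<Omega> X" "L2 M\<Omega> Y" for X Y :: "R2 \<Rightarrow> real^3^3"
    unfolding trace_mult_3
    by (intro Bochner_Integration.integrable_sum integrable_product_L2 Le that)
  define \<kappa> where "\<kappa> = lam\<^sup>2 / L"
  define ga gb gc where "ga p = trace (Qx p ** Qx p) + trace (Qy p ** Qy p)"
    and "gb p = trace (Qx p ** \<phi>x p) + trace (Qy p ** \<phi>y p)"
    and "gc p = trace (\<phi>x p ** \<phi>x p) + trace (\<phi>y p ** \<phi>y p)" for p
  have g: "integrable M\<Omega> ga" "integrable M\<Omega> gb" "integrable M\<Omega> gc"
    unfolding ga_def gb_def gc_def by (intro Bochner_Integration.integrable_add ig L)+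
  define c0 c1 c2 c3 c4 where "c0 p = 1 / 2 * ga p + \<kappa> * (A / 2 * a p - B / 3 * d0 p + C / 4 * (a p * a p))"
    and "c1 p = gb p + \<kappa> * (A * b p - B * d1 p + C * (a p * b p))"
    and "c2 p = 1 / 2 * gc p + \<kappa> * (A / 2 * c p - B * d2 p + (C * (b p * b p) + C / 2 * (a p * c p)))"
    and "c3 p = \<kappa> * (C * (b p * c p) - B / 3 * d3 p)" and "c4 p = \<kappa> * (C / 4 * (c p * c p))" for p
  have i: "integrable M\<Omega> c0" "integrable M\<Omega> c1" "integrable M\<Omega> c2" "integrable M\<Omega> c3" "integrable M\<Omega> c4"
    unfolding c0_def c1_def c2_def c3_def c4_def
    by (intro Bochner_Integration.integrable_add Bochner_Integration.integrable_diff integrable_mult_right g i2 i4)+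
  have ex: "AE p in M\<Omega>. \<forall>t. I_density A B C L lam (Q p + t *\<^sub>R \<phi> p) (Qx p + t *\<^sub>R \<phi>x p) (Qy p + t *\<^sub>R \<phi>y p) =
      c0 p + t * c1 p + t\<^sup>2 * c2 p + t ^ 3 * c3 p + t ^ 4 * c4 p"
  proof (intro AE_I2 allI)
    fix p t
    have "1 / 2 * ((x0 + t * (2 * x1) + t\<^sup>2 * x2) + (y0 + t * (2 * y1) + t\<^sup>2 * y2)) +
        k * (A / 2 * (a' + t * (2 * b') + t\<^sup>2 * c') - B / 3 * (e0 + t * (3 * e1) + t\<^sup>2 * (3 * e2) + t ^ 3 * e3)
          + C / 4 * (a' + t * (2 * b') + t\<^sup>2 * c')\<^sup>2) =
      (1 / 2 * (x0 + y0) + k * (A / 2 * a' - B / 3 * e0 + C / 4 * (a' * a')))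
      + t * ((x1 + y1) + k * (A * b' - B * e1 + C * (a' * b')))
      + t\<^sup>2 * (1 / 2 * (x2 + y2) + k * (A / 2 * c' - B * e2 + (C * (b' * b') + C / 2 * (a' * c'))))
      + t ^ 3 * (k * (C * (b' * c') - B / 3 * e3)) + t ^ 4 * (k * (C / 4 * (c' * c')))"
      for x0 x1 x2 y0 y1 y2 a' b' c' e0 e1 e2 e3 k :: real
      by (simp add: field_simps) algebra
    then show "I_density A B C L lam (Q p + t *\<^sub>R \<phi> p) (Qx p + t *\<^sub>R \<phi>x p) (Qy p + t *\<^sub>R \<phi>y p) =
      c0 p + t * c1 p + t\<^sup>2 * c2 p + t ^ 3 * c3 p + t ^ 4 * c4 p"
      unfolding I_density_def trace_square_expand trace_cube_expand \<kappa>_def[symmetric] c0_def c1_def c2_def c3_def c4_def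
        ga_def gb_def gc_def a_def b_def c_def d0_def d1_def d2_def d3_def .
  qed
  have c1: "c1 = (\<lambda>p. I_first A B C L lam (Q p) (Qx p) (Qy p) (\<phi> p) (\<phi>x p) (\<phi>y p))"
    by (simp add: fun_eq_iff c1_def I_first_def gb_def a_def b_def d1_def \<kappa>_def)
  note e = energy_polynomial[OF s i ex]
  show "integrable M\<Omega> (energy_integrand \<Omega> (I_density A B C L lam) (\<lambda>p. Q p + t *\<^sub>R \<phi> p))"
    by (rule e(1))
  show "((\<lambda>t. energy \<Omega> (I_density A B C L lam) (\<lambda>p. Q p + t *\<^sub>R \<phi> p)) has_real_derivative
      (LINT p|M\<Omega>. I_first A B C L lam (Q p) (Qx p) (Qy p) (\<phi> p) (\<phi>x p) (\<phi>y p))) (at 0)"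
    using e(2) unfolding c1 .
qed

end

section \<open>The matrices in the range of \<open>Q_of\<close> and the reduction to the first
  functional\<close>

lemma Q_of_entries:
  "Q_of a b $ 1 $ 1 = - b" "Q_of a b $ 1 $ 2 = - a" "Q_of a b $ 1 $ 3 = 0"
  "Q_of a b $ 2 $ 1 = - a" "Q_of a b $ 2 $ 2 = - b" "Q_of a b $ 2 $ 3 = 0"
  "Q_of a b $ 3 $ 1 = 0" "Q_of a b $ 3 $ 2 = 0" "Q_of a b $ 3 $ 3 = 2 * b"
  by (simp_all add: Q_of_def tensor_def n1_def n2_def zhat_def)

lemma Q_of_S0: "Q_of a b \<in> S0"
  by (simp add: S0_def transpose_def trace_def vec_eq_iff forall_3 sum_3 Q_of_entries)

lemma Q_of_linear: "bounded_linear (\<lambda>q. Q_of (fst q) (snd q))"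
  unfolding linear_conv_bounded_linear[symmetric]
  by (rule linearI) (simp_all add: Q_of_def scaleR_add_left algebra_simps)

text \<open>The coordinates of the orthogonal projection onto the range of \<open>Q_of\<close>.\<close>

definition proj :: "real^3^3 \<Rightarrow> real \<times> real" where
  "proj X = (- (X $ 1 $ 2 + X $ 2 $ 1) / 2, (2 * X $ 3 $ 3 - X $ 1 $ 1 - X $ 2 $ 2) / 6)"

lemma proj_linear: "bounded_linear proj"
  unfolding linear_conv_bounded_linear[symmetric]
  by (rule linearI) (simp_all add: proj_def field_simps)

text \<open>The two matrices spanning the range of \<open>Q_of\<close> are orthogonal with squared
  norms 2 and 6, and \<open>proj\<close> gives coordinates with respect to them.\<close>

lemma trace_Q_of_mult: "trace (Q_of a b ** X) = 2 * a * fst (proj X) + 6 * b * snd (proj X)"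
  unfolding trace_mult_3 by (simp add: sum_3 Q_of_entries proj_def field_simps)

lemma trace_Q_of_square: "trace (Q_of a b ** Q_of a b) = 2 * (a * a + 3 * (b * b))"
  unfolding trace_mult_3 by (simp add: sum_3 Q_of_entries)

text \<open>The square of a matrix in the range of \<open>Q_of\<close> is again in that range up to
  a multiple of the identity, and the identity pairs to 0 with a traceless \<open>X\<close>. This is
  why the cubic term of the energy exerts no force in directions orthogonal to the range.\<close>

lemma trace_Q_of_square_mult:
  assumes "trace X = 0"
  shows "trace (Q_of a b ** Q_of a b ** X) =
    - (2 * (snd (proj X) * (a * a - b * b) + 2 * b * (a * fst (proj X) - b * snd (proj X))))"
proof -
  have X: "X $ 1 $ 1 = - X $ 2 $ 2 - X $ 3 $ 3" using assms by (simp add: trace_def sum_3)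
  have "trace (Q_of a b ** Q_of a b ** X) =
    (a * a + b * b) * (X $ 1 $ 1 + X $ 2 $ 2) + 2 * a * b * (X $ 1 $ 2 + X $ 2 $ 1) + 4 * b * b * X $ 3 $ 3"
    unfolding trace_mult_3 by (simp add: matrix_matrix_mult_def sum_3 Q_of_entries algebra_simps)
  also have "\<dots> = - (2 * (snd (proj X) * (a * a - b * b) + 2 * b * (a * fst (proj X) - b * snd (proj X))))"
    unfolding proj_def X by (simp add: field_simps)
  finally show ?thesis .
qed

text \<open>On the range of \<open>Q_of\<close> the two densities differ only by the constant coming
  from \<open>F_min\<close>, and components of the direction outside the range pair to 0 with every
  term. So the normalisations match and no factor is left over.\<close>

lemma I_first_Q_of:
  assumes "trace \<phi> = 0"
  shows "I_first A B C L lam (Q_of (fst q) (snd q)) (Q_of (fst qx) (snd qx)) (Q_of (fst qy) (snd qy)) \<phi> \<phi>x \<phi>y =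
    J_first A B C L lam q qx qy (proj \<phi>) (proj \<phi>x) (proj \<phi>y)"
proof -
  have "(2 * x1 * y1 + 6 * x2 * y2) + (2 * x3 * y3 + 6 * x4 * y4) + k * (A * (2 * a * \<alpha> + 6 * b * \<beta>)
      - B * (- (2 * (\<beta> * D + 2 * b * E))) + C * (2 * N * (2 * a * \<alpha> + 6 * b * \<beta>))) =
    2 * (x1 * y1 + x3 * y3) + 6 * (x2 * y2 + x4 * y4) + k * (2 * A * (a * \<alpha> + 3 * (b * \<beta>)) + 2 * B * (\<beta> * D + 2 * b * E)
      + 4 * C * (N * (a * \<alpha> + 3 * (b * \<beta>))))"
    for x1 x2 x3 x4 y1 y2 y3 y4 a b \<alpha> \<beta> k D E N :: real by algebra
  then show ?thesis
    unfolding I_first_def J_first_def trace_Q_of_square trace_Q_of_square_mult[OF assms] unfolding trace_Q_of_mult .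
qed

context wors_energy
begin

text \<open>A direction lies in \<open>S0\<close> only almost everywhere, so the two first
  variations are compared through integrands that agree almost everywhere. Its projection is linear,
  hence again has zero trace and has the projected derivatives, and
  \<open>first_variation_zero\<close> applies to it.\<close>

lemma Q_of_critical:
  assumes u: "adm u" "\<And>v. adm v \<Longrightarrow> energy \<Omega> f u \<le> energy \<Omega> f v"
  shows "critical_point \<Omega> S0 (\<lambda>p. Q_of (fst (bdata p)) (snd (bdata p))) (I_density A B C L lam)
    (\<lambda>p. Q_of (fst (u p)) (snd (u p)))"
  unfolding critical_point_def
proof (intro conjI ballI)
  have tr: "has_trace \<Omega> u (frontier \<Omega>) bdata" using u(1) by (simp add: adm_def)
  show "(\<lambda>p. Q_of (fst (u p)) (snd (u p))) \<in> dirichlet_class \<Omega> S0 (\<lambda>p. Q_of (fst (bdata p)) (snd (bdata p)))"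
    unfolding dirichlet_class_def
    using has_trace_bounded_linear[OF Q_of_linear tr] W12_bounded_linear[OF Q_of_linear adm_W12[OF u(1)]]
    by (simp add: Q_of_S0)
  note s = W12_sob[OF adm_W12[OF u(1)]]
  note sQ = sob_bounded_linear[OF Q_of_linear s]
  fix \<phi> :: "R2 \<Rightarrow> real^3^3" assume "\<phi> \<in> dirichlet_class \<Omega> S0 (\<lambda>_. 0)"
  then have \<phi>: "W12 \<Omega> \<phi>" "AE p in M\<Omega>. \<phi> p \<in> S0" "has_trace \<Omega> \<phi> (frontier \<Omega>) (\<lambda>_. 0)"
    by (auto simp: dirichlet_class_def)
  note s\<phi> = W12_sob[OF \<phi>(1)]
  show "\<forall>t. integrable M\<Omega> (energy_integrand \<Omega> (I_density A B C L lam) (\<lambda>p. Q_of (fst (u p)) (snd (u p)) + t *\<^sub>R \<phi> p))"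
    using I_line(1)[OF sQ s\<phi>] by blast
  define \<phi>x \<phi>y where "\<phi>x = weak_deriv \<Omega> (1, 0) \<phi>" and "\<phi>y = weak_deriv \<Omega> (0, 1) \<phi>"
  define ux uy where "ux = weak_deriv \<Omega> (1, 0) u" and "uy = weak_deriv \<Omega> (0, 1) u"
  note s' = s[folded ux_def uy_def] and s\<phi>' = s\<phi>[folded \<phi>x_def \<phi>y_def]
  define J1 where "J1 p = J_first A B C L lam (u p) (ux p) (uy p) (proj (\<phi> p)) (proj (\<phi>x p)) (proj (\<phi>y p))" for p
  define I1 where "I1 p = I_first A B C L lam (Q_of (fst (u p)) (snd (u p))) (Q_of (fst (ux p)) (snd (ux p)))
    (Q_of (fst (uy p)) (snd (uy p))) (\<phi> p) (\<phi>x p) (\<phi>y p)" for p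
  note sP = sob_bounded_linear[OF proj_linear s\<phi>']
  have trP: "has_trace \<Omega> (\<lambda>p. proj (\<phi> p)) (frontier \<Omega>) (\<lambda>_. 0)"
    using has_trace_bounded_linear[OF proj_linear \<phi>(3)] by (simp add: linear_0[OF bounded_linear.linear[OF proj_linear]])
  have "(LINT p|M\<Omega>. J1 p) = 0"
    using first_variation_zero[OF u s' trP sP] unfolding J1_def .
  moreover have "(LINT p|M\<Omega>. I1 p) = (LINT p|M\<Omega>. J1 p)"
  proof -
    have eq: "AE p in M\<Omega>. J1 p = I1 p"
      using \<phi>(2) by eventually_elim (simp add: I1_def J1_def I_first_Q_of S0_def)
    have J: "J1 \<in> borel_measurable M\<Omega>"
      unfolding J1_def by (rule borel_measurable_integrable[OF J_line(1)[OF s' sP]])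
    show ?thesis
      by (rule integral_cong_AE[OF borel_measurable_lebesgue_on_AE[OF open_\<Omega> J eq] J]) (use eq in \<open>eventually_elim, simp\<close>)
  qed
  ultimately show "((\<lambda>t. energy \<Omega> (I_density A B C L lam) (\<lambda>p. Q_of (fst (u p)) (snd (u p)) + t *\<^sub>R \<phi> p)) has_real_derivative 0) (at 0)"
    using I_line(2)[OF sQ[folded ux_def uy_def] s\<phi>', of A B C L lam] by (simp add: I1_def[abs_def])
qed

end

theorem proposition3p1:
  fixes A B C L lam \<rho> \<epsilon> :: real and g :: "real \<Rightarrow> real"
  assumes "A < 0" and "B > 0" and "C > 0" and "L > 0" and "lam > 0"
    and "0 < \<rho>" and "\<rho> < 1"
    and "0 < \<epsilon>" and "\<epsilon> < min (1 / 2) (1 - \<rho>)"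
    and "boundary_profile (s_plus A B C) \<epsilon> g"
  shows "\<exists>q1 q3 :: R2 \<Rightarrow> real.
    critical_point (Omega \<rho> \<epsilon>) UNIV
      (\<lambda>p. (q1b (s_plus A B C) \<rho> \<epsilon> g p, q3b (s_plus A B C) \<rho> \<epsilon> p))
      (J_density A B C L lam) (\<lambda>p. (q1 p, q3 p)) \<and>
    has_trace (Omega \<rho> \<epsilon>) q1 (Omega \<rho> \<epsilon> \<inter> {(x, y). x = 0}) (\<lambda>_. 0) \<and>
    has_trace (Omega \<rho> \<epsilon>) q1 (Omega \<rho> \<epsilon> \<inter> {(x, y). y = 0}) (\<lambda>_. 0) \<and>
    critical_point (Omega \<rho> \<epsilon>) S0
      (\<lambda>p. Q_of (q1b (s_plus A B C) \<rho> \<epsilon> g p) (q3b (s_plus A B C) \<rho> \<epsilon> p))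
      (I_density A B C L lam) (\<lambda>p. Q_of (q1 p) (q3 p))"
proof -
  \<comment> \<open>The lift of the boundary data divides by this number.\<close>
  have "0 < s_plus A B C"
    unfolding s_plus_def using assms(2,3) by (intro divide_pos_pos add_pos_nonneg) simp_all
  then interpret wors_energy \<rho> \<epsilon> "s_plus A B C" g A B C L lam
    using assms by unfold_locales
  obtain u where u: "adm u" "\<And>v. adm v \<Longrightarrow> energy (Omega \<rho> \<epsilon>) f u \<le> energy (Omega \<rho> \<epsilon>) f v"
    by (rule minimiser_exists) blast
  show ?thesis
    by (rule exI[of _ "\<lambda>p. fst (u p)"], rule exI[of _ "\<lambda>p. snd (u p)"])
       (use bdata_critical[OF u] axis_traces[OF u(1)] Q_of_critical[OF u] in \<open>simp add: bdata_def[abs_def]\<close>)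
qed

end
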